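(* Let $k\in\mathbb{N}$. Suppose that $\psi_1(\tau),\ldots,\psi_k(\tau)\in L_2([t,T])$ and $\{\phi_j(x)\}_{j=0}^{\infty}$ is an arbitrary complete orthonormal system of functions in the space $L_2([t,T])$. Then the estimate $$\mathsf{M}\left\{\left(J[\psi^{(k)}]_{T,t}-J[\psi^{(k)}]_{T,t}^{p_1,\ldots,p_k}\right)^2\right\}\le k!\left(\int_{[t,T]^k}K^2(t_1,\ldots,t_k)\,dt_1\ldots dt_k-\sum_{j_1=0}^{p_1}\ldots\sum_{j_k=0}^{p_k}C_{j_k\ldots j_1}^2\right)$$ is valid in each of the following cases: 1. $i_1,\ldots,i_k=1,\ldots,m$ and $0<T-t<\infty$; 2. $i_1,\ldots,i_k=0,1,\ldots,m$, $i_1^2+\ldots+i_k^2>0$, and $0<T-t<1$. Here $$J[\psi^{(k)}]_{T,t}=\int_t^T\psi_k(t_k)\ldots\int_t^{t_2}\psi_1(t_1)\,d\mathbf{w}_{t_1}^{(i_1)}\ldots d\mathbf{w}_{t_k}^{(i_k)}$$ and $$J[\psi^{(k)}]_{T,t}^{p_1,\ldots,p_k}=\sum_{j_1=0}^{p_1}\ldots\sum_{j_k=0}^{p_k}C_{j_k\ldots j_1}\Biggl(\prod_{l=1}^k\zeta_{j_l}^{(i_l)}+\sum_{r=1}^{[k/2]}(-1)^r\sum_{(\{\{g_1,g_2\},\ldots,\{g_{2r-1},g_{2r}\}\},\{q_1,\ldots,q_{k-2r}\})}\ \prod_{s=1}^r\mathbf{1}_{\{i_{g_{2s-1}}=i_{g_{2s}}\ne0\}}\mathbf{1}_{\{j_{g_{2s-1}}=j_{g_{2s}}\}}\prod_{l=1}^{k-2r}\zeta_{j_{q_l}}^{(i_{q_l})}\Biggr),$$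 where the inner sum is over all partitions of $\{1,\ldots,k\}$ into $r$ unordered pairs and a remaining set of $k-2r$ elements.
   Context: Setting: $(\Omega,\mathrm{F},\mathsf{P})$ is a complete probability space with a nondecreasing right-continuous family $\{\mathrm{F}_s\}_{s\in[0,T]}$ of sub-$\sigma$-fields, and $\mathbf{f}_s=(\mathbf{f}_s^{(1)},\ldots,\mathbf{f}_s^{(m)})$ is a standard $m$-dimensional Wiener process, $\mathrm{F}_s$-measurable for every $s$, with independent components. $0\le t<T$. Put $\mathbf{w}_\tau^{(i)}=\mathbf{f}_\tau^{(i)}$ for $i=1,\ldots,m$ and $\mathbf{w}_\tau^{(0)}=\tau$. $\mathsf{M}$ denotes expectation; iterated stochastic integrals are Ito integrals; $\mathbf{1}_A$ is an indicator. Kernel and Fourier coefficients: $K(t_1,\ldots,t_k)=\psi_1(t_1)\cdots\psi_k(t_k)$ if $t_1<\ldots<t_k$ and $0$ otherwise ($K(t_1)=\psi_1(t_1)$ for $k=1$); $C_{j_k\ldots j_1}=\int_{[t,T]^k}K(t_1,\ldots,t_k)\prod_{l=1}^k\phi_{j_l}(t_l)\,dt_1\ldots dt_k$. Random variables: $\zeta_j^{(i)}=\int_t^T\phi_j(s)\,d\mathbf{w}_s^{(i)}$ ($i=0,1,\ldots,m$, $j=0,1,\ldots$). Pair sums: $[x]$ is the integer part of $x$. In the inner sum, $\{g_1,g_2\},\ldots,\{g_{2r-1},g_{2r}\}$ are $r$ disjoint unordered pairs, the order of the pairs being irrelevant, and $\{q_1,\ldots,q_{k-2r}\}$ is the remaining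 set, with $\{g_1,\ldots,g_{2r},q_1,\ldots,q_{k-2r}\}=\{1,\ldots,k\}$. Each such partition is counted once. Empty products equal $1$ and empty sums equal $0$. $p_1,\ldots,p_k$ are nonnegative integers. *)

theory Defs
  imports "HOL-Probability.Probability"
begin

subsection \<open>The space $L_2([a,b])$\<close>

text \<open>Elements are represented by Lebesgue measurable functions; values outside the interval
  are irrelevant.\<close>

definition L2_on :: "real \<Rightarrow> real \<Rightarrow> (real \<Rightarrow> real) \<Rightarrow> bool" where
  "L2_on a b g \<longleftrightarrow>
     g \<in> borel_measurable (lebesgue_on {a..b}) \<and>
     integrable (lebesgue_on {a..b}) (\<lambda>x. (g x)\<^sup>2)"

definition complete_orthonormal_system :: "real \<Rightarrow> real \<Rightarrow> (nat \<Rightarrow> real \<Rightarrow> real) \<Rightarrow> bool" where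
  "complete_orthonormal_system a b \<phi> \<longleftrightarrow>
     (\<forall>j. L2_on a b (\<phi> j)) \<and>
     (\<forall>i j. (LINT x|lebesgue_on {a..b}. \<phi> i x * \<phi> j x) = (if i = j then 1 else 0)) \<and>
     (\<forall>g. L2_on a b g \<longrightarrow> (\<forall>j. (LINT x|lebesgue_on {a..b}. g x * \<phi> j x) = 0) \<longrightarrow>
        (AE x in lebesgue_on {a..b}. g x = 0))"

subsection \<open>Filtrations and Wiener processes on $[0,T]$\<close>

definition right_continuous_filtration :: "'a measure \<Rightarrow> real \<Rightarrow> (real \<Rightarrow> 'a measure) \<Rightarrow> bool" where
  "right_continuous_filtration M T F \<longleftrightarrow>
     (\<forall>s\<in>{0..T}. subalgebra M (F s)) \<and>
     (\<forall>s\<in>{0..T}. \<forall>u\<in>{s..T}. sets (F s) \<subseteq> sets (F u)) \<and>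
     (\<forall>s\<in>{0..<T}. sets (F s) = (\<Inter>u\<in>{s<..T}. sets (F u)))"

text \<open>A standard \<open>m\<close>-dimensional Wiener process with respect to the filtration \<open>F\<close>, with
  components indexed by \<open>{1..m}\<close>.  Besides adaptedness, the increments of the vector process
  after time \<open>s\<close> are independent of \<open>F s\<close>, which is what makes Ito integrals of
  \<open>F\<close>-adapted integrands meaningful.  The last condition is the independence of the components,
  as processes.\<close>

definition wiener_process ::
  "'a measure \<Rightarrow> (real \<Rightarrow> 'a measure) \<Rightarrow> real \<Rightarrow> nat \<Rightarrow> (nat \<Rightarrow> real \<Rightarrow> 'a \<Rightarrow> real) \<Rightarrow> bool" where
  "wiener_process M F T m f \<longleftrightarrow>
     (\<forall>i\<in>{1..m}. \<forall>s\<in>{0..T}. f i s \<in> borel_measurable (F s)) \<and>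
     (\<forall>i\<in>{1..m}. AE \<omega> in M. f i 0 \<omega> = 0) \<and>
     (\<forall>i\<in>{1..m}. AE \<omega> in M. continuous_on {0..T} (\<lambda>s. f i s \<omega>)) \<and>
     (\<forall>i\<in>{1..m}. \<forall>s\<in>{0..T}. \<forall>u\<in>{s<..T}.
        distributed M lborel (\<lambda>\<omega>. f i u \<omega> - f i s \<omega>)
          (\<lambda>x. ennreal (normal_density 0 (sqrt (u - s)) x))) \<and>
     (\<forall>s\<in>{0..T}. \<forall>u\<in>{s<..T}.
        prob_space.indep_set M (sets (F s))
          (sets (vimage_algebra (space M) (\<lambda>\<omega>. \<lambda>i\<in>{1..m}. f i u \<omega> - f i s \<omega>)
             (Pi\<^sub>M {1..m} (\<lambda>_. borel))))) \<and>
     prob_space.indep_vars M (\<lambda>_. Pi\<^sub>M {0..T} (\<lambda>_. borel))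
       (\<lambda>i \<omega>. \<lambda>s\<in>{0..T}. f i s \<omega>) {1..m}"

subsection \<open>The Ito integral\<close>

text \<open>A step process on \<open>[a,b]\<close> takes the value \<open>\<eta> j\<close> on \<open>[\<tau> j, \<tau> (j+1))\<close>, where
  \<open>a = \<tau> 0 < \<dots> < \<tau> N = b\<close>, and \<open>\<eta> j\<close> is square integrable and \<open>F (\<tau> j)\<close>-measurable.\<close>

definition adapted_step ::
  "'a measure \<Rightarrow> (real \<Rightarrow> 'a measure) \<Rightarrow> real \<Rightarrow> real \<Rightarrow> nat \<Rightarrow> (nat \<Rightarrow> real) \<Rightarrow> (nat \<Rightarrow> 'a \<Rightarrow> real) \<Rightarrow> bool"
  where
  "adapted_step M F a b N \<tau> \<eta> \<longleftrightarrow>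
     \<tau> 0 = a \<and> \<tau> N = b \<and> (\<forall>j<N. \<tau> j < \<tau> (Suc j)) \<and>
     (\<forall>j<N. \<eta> j \<in> borel_measurable (F (\<tau> j)) \<and> integrable M (\<lambda>\<omega>. (\<eta> j \<omega>)\<^sup>2))"

definition step_process ::
  "nat \<Rightarrow> (nat \<Rightarrow> real) \<Rightarrow> (nat \<Rightarrow> 'a \<Rightarrow> real) \<Rightarrow> real \<Rightarrow> 'a \<Rightarrow> real" where
  "step_process N \<tau> \<eta> u \<omega> = (\<Sum>j<N. \<eta> j \<omega> * indicator {\<tau> j..<\<tau> (Suc j)} u)"

definition step_integral ::
  "(real \<Rightarrow> 'a \<Rightarrow> real) \<Rightarrow> nat \<Rightarrow> (nat \<Rightarrow> real) \<Rightarrow> (nat \<Rightarrow> 'a \<Rightarrow> real) \<Rightarrow> 'a \<Rightarrow> real" where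
  "step_integral W N \<tau> \<eta> \<omega> = (\<Sum>j<N. \<eta> j \<omega> * (W (\<tau> (Suc j)) \<omega> - W (\<tau> j) \<omega>))"

text \<open>\<open>X\<close> is (a version of) the Ito integral of \<open>\<xi>\<close> over \<open>[a,b]\<close>: the mean-square limit of the
  integrals of adapted step processes that converge to \<open>\<xi>\<close> in the mean-square sense on
  \<open>[a,b] \<times> \<Omega>\<close>.  By the Ito isometry \<open>X\<close> is unique almost surely.  The existence of the
  approximating sequence replaces the adaptedness of \<open>\<xi>\<close>; it is insensitive to changing \<open>\<xi>\<close>
  on a null set, so that no completeness of the individual \<open>F s\<close> is needed.\<close>

definition is_ito_integral ::
  "'a measure \<Rightarrow> (real \<Rightarrow> 'a measure) \<Rightarrow> (real \<Rightarrow> 'a \<Rightarrow> real) \<Rightarrow> real \<Rightarrow> real \<Rightarrow>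
   (real \<Rightarrow> 'a \<Rightarrow> real) \<Rightarrow> ('a \<Rightarrow> real) \<Rightarrow> bool" where
  "is_ito_integral M F W a b \<xi> X \<longleftrightarrow>
     (\<lambda>(u, \<omega>). \<xi> u \<omega>) \<in> borel_measurable (lebesgue_on {a..b} \<Otimes>\<^sub>M M) \<and>
     X \<in> borel_measurable M \<and>
     (\<exists>N \<tau> \<eta>.
        (\<forall>n. adapted_step M F a b (N n) (\<tau> n) (\<eta> n)) \<and>
        (\<lambda>n. \<integral>\<^sup>+u. (\<integral>\<^sup>+\<omega>. ennreal ((step_process (N n) (\<tau> n) (\<eta> n) u \<omega> - \<xi> u \<omega>)\<^sup>2) \<partial>M)
           \<partial>(lebesgue_on {a..b})) \<longlonglongrightarrow> 0 \<and>
        (\<lambda>n. \<integral>\<^sup>+\<omega>. ennreal ((step_integral W (N n) (\<tau> n) (\<eta> n) \<omega> - X \<omega>)\<^sup>2) \<partial>M) \<longlonglongrightarrow> 0)"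

text \<open>The integral as a function of its upper limit \<open>s \<in> [a,b]\<close>.  The versions for the different
  \<open>s\<close> are chosen jointly measurable in \<open>(s, \<omega>)\<close>, so that the process can serve as an integrand
  again; any two such choices agree almost surely for every \<open>s\<close>.\<close>

definition ito_integral ::
  "'a measure \<Rightarrow> (real \<Rightarrow> 'a measure) \<Rightarrow> (real \<Rightarrow> 'a \<Rightarrow> real) \<Rightarrow> real \<Rightarrow> real \<Rightarrow>
   (real \<Rightarrow> 'a \<Rightarrow> real) \<Rightarrow> real \<Rightarrow> 'a \<Rightarrow> real" where
  "ito_integral M F W a b \<xi> =
     (SOME X. (\<lambda>(s, \<omega>). X s \<omega>) \<in> borel_measurable (lebesgue_on {a..b} \<Otimes>\<^sub>M M) \<and>
              (\<forall>s\<in>{a..b}. is_ito_integral M F W a s \<xi> (X s)))"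

text \<open>The process \<open>\<lambda>s. \<integral>\<^sub>a\<^sup>s \<xi> dw\<^sup>(\<^sup>i\<^sup>)\<close> for \<open>s \<in> [a,b]\<close>, where \<open>w\<^sup>(\<^sup>0\<^sup>)\<close> is time and
  \<open>w\<^sup>(\<^sup>i\<^sup>) = f i\<close> for \<open>i \<ge> 1\<close>.\<close>

definition w_integral ::
  "'a measure \<Rightarrow> (real \<Rightarrow> 'a measure) \<Rightarrow> (nat \<Rightarrow> real \<Rightarrow> 'a \<Rightarrow> real) \<Rightarrow> real \<Rightarrow> real \<Rightarrow> nat \<Rightarrow>
   (real \<Rightarrow> 'a \<Rightarrow> real) \<Rightarrow> real \<Rightarrow> 'a \<Rightarrow> real" where
  "w_integral M F f a b i \<xi> =
     (if i = 0 then (\<lambda>s \<omega>. LINT u|lebesgue_on {a..s}. \<xi> u \<omega>)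
      else ito_integral M F (f i) a b \<xi>)"

text \<open>The \<open>l\<close>-fold iterated integral with upper limit \<open>s\<close>; the innermost differential is that
  of \<open>w\<^sup>(\<^sup>i\<^sup> \<^sup>1\<^sup>)\<close>.\<close>

primrec iterated_integral ::
  "'a measure \<Rightarrow> (real \<Rightarrow> 'a measure) \<Rightarrow> (nat \<Rightarrow> real \<Rightarrow> 'a \<Rightarrow> real) \<Rightarrow> real \<Rightarrow> real \<Rightarrow>
   (nat \<Rightarrow> real \<Rightarrow> real) \<Rightarrow> (nat \<Rightarrow> nat) \<Rightarrow> nat \<Rightarrow> real \<Rightarrow> 'a \<Rightarrow> real" where
  "iterated_integral M F f a b \<psi> i 0 = (\<lambda>s \<omega>. 1)"
| "iterated_integral M F f a b \<psi> i (Suc l) =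
     w_integral M F f a b (i (Suc l))
       (\<lambda>u \<omega>. \<psi> (Suc l) u * iterated_integral M F f a b \<psi> i l u \<omega>)"

subsection \<open>Kernel, Fourier coefficients and the approximation\<close>

definition simplex_kernel :: "nat \<Rightarrow> (nat \<Rightarrow> real \<Rightarrow> real) \<Rightarrow> (nat \<Rightarrow> real) \<Rightarrow> real" where
  "simplex_kernel k \<psi> x = (if \<forall>l\<in>{1..<k}. x l < x (Suc l) then \<Prod>l=1..k. \<psi> l (x l) else 0)"

abbreviation cube :: "real \<Rightarrow> real \<Rightarrow> nat \<Rightarrow> (nat \<Rightarrow> real) measure" where
  "cube t T k \<equiv> Pi\<^sub>M {1..k} (\<lambda>_. lebesgue_on {t..T})"

definition fourier_coeff ::
  "real \<Rightarrow> real \<Rightarrow> nat \<Rightarrow> (nat \<Rightarrow> real \<Rightarrow> real) \<Rightarrow> (nat \<Rightarrow> real \<Rightarrow> real) \<Rightarrow> (nat \<Rightarrow> nat) \<Rightarrow> real" where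
  "fourier_coeff t T k \<psi> \<phi> j = (LINT x|cube t T k. simplex_kernel k \<psi> x * (\<Prod>l=1..k. \<phi> (j l) (x l)))"

definition zeta ::
  "'a measure \<Rightarrow> (real \<Rightarrow> 'a measure) \<Rightarrow> (nat \<Rightarrow> real \<Rightarrow> 'a \<Rightarrow> real) \<Rightarrow> real \<Rightarrow> real \<Rightarrow>
   (nat \<Rightarrow> real \<Rightarrow> real) \<Rightarrow> nat \<Rightarrow> nat \<Rightarrow> 'a \<Rightarrow> real" where
  "zeta M F f t T \<phi> i j = w_integral M F f t T i (\<lambda>u \<omega>. \<phi> j u) T"

text \<open>A partition of \<open>{1..k}\<close> into \<open>r\<close> unordered pairs and a remaining set is determined by the
  set \<open>P\<close> of its pairs; the remaining set is \<open>{1..k} - \<Union>P\<close>.\<close>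

definition pair_partitions :: "nat \<Rightarrow> nat \<Rightarrow> nat set set set" where
  "pair_partitions k r =
     {P. (\<forall>A\<in>P. A \<subseteq> {1..k} \<and> card A = 2) \<and> disjoint P \<and> card P = r}"

text \<open>The two elements of a pair \<open>A\<close> are \<open>Min A\<close> and \<open>Max A\<close>.\<close>

definition approximation_sum ::
  "'a measure \<Rightarrow> (real \<Rightarrow> 'a measure) \<Rightarrow> (nat \<Rightarrow> real \<Rightarrow> 'a \<Rightarrow> real) \<Rightarrow> real \<Rightarrow> real \<Rightarrow> nat \<Rightarrow>
   (nat \<Rightarrow> real \<Rightarrow> real) \<Rightarrow> (nat \<Rightarrow> real \<Rightarrow> real) \<Rightarrow> (nat \<Rightarrow> nat) \<Rightarrow> (nat \<Rightarrow> nat) \<Rightarrow> 'a \<Rightarrow> real" where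
  "approximation_sum M F f t T k \<psi> \<phi> i p \<omega> =
     (\<Sum>j\<in>(\<Pi>\<^sub>E l\<in>{1..k}. {0..p l}).
        fourier_coeff t T k \<psi> \<phi> j *
        ((\<Prod>l=1..k. zeta M F f t T \<phi> (i l) (j l) \<omega>) +
         (\<Sum>r=1..k div 2. (-1) ^ r *
            (\<Sum>P\<in>pair_partitions k r.
               (\<Prod>A\<in>P. of_bool (i (Min A) = i (Max A) \<and> i (Min A) \<noteq> 0) *
                        of_bool (j (Min A) = j (Max A))) *
               (\<Prod>q\<in>{1..k} - \<Union>P. zeta M F f t T \<phi> (i q) (j q) \<omega>)))))"

end

theory Submission
  imports Defs
begin

text \<open>
The proof reads everything off the transform \<open>E[X exp (G h)]\<close> of a random variable \<open>X\<close>. Here \<open>h\<close> is a step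
function on \<open>[t,T]\<close> with values in \<open>\<real>\<^sup>m\<close>, and \<open>G h\<close> is its Wiener integral, a finite sum of
increments.  Put \<open>h\<^sub>0 = 1\<close>.  The iterated integral and its approximation have transforms of the form

  \<open>E[X exp (G h)] = exp (|h|\<^sup>2 / 2) \<integral> \<Phi>(x) h\<^bsub>i(1)\<^esub>(x\<^sub>1) \<dots> h\<^bsub>i(k)\<^esub>(x\<^sub>k) dx\<close>.

For the iterated integral \<open>\<Phi>\<close> is the kernel \<open>K\<close> (\<open>iterated_integral_transform\<close>): an integration
becomes an integration against \<open>h\<close>, first for elementary processes and then in the limit.  For the
approximation \<open>\<Phi>\<close> is the partial Fourier sum of \<open>K\<close>: integration by parts gives a recursion for
the moments of the \<open>zeta\<close> variables under \<open>exp (G h)\<close> (\<open>zeta_recursion\<close>), and the alternating sum over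
pairings inverts this recursion (\<open>alternating_pairing_sum\<close>), so that the transform factorizes
(\<open>wick_transform\<close>).  Hence the error has as \<open>\<Phi>\<close> the residual of the Fourier expansion, whose square
integral is \<open>\<integral> K\<^sup>2\<close> minus the sum of the squared coefficients (\<open>orthonormal_residual\<close>).

The transform controls the second moment: \<open>E X\<^sup>2 \<le> k! \<integral> \<Phi>\<^sup>2\<close> (\<open>transform_bound\<close>), provided that \<open>X\<close> lies in
the closed span of the exponentials.  Indeed, let \<open>Y = \<Sum> b\<^sub>n exp (G h\<^sub>n - |h\<^sub>n|\<^sup>2 / 2)\<close>.  By the
Cauchy-Schwarz inequality on the cube, \<open>(E XY)\<^sup>2\<close> is at most \<open>\<integral> \<Phi>\<^sup>2\<close> times a quadratic form in the \<open>b\<^sub>n\<close>;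
if \<open>r\<close> of the indices differ from \<open>0\<close>, that form is at most \<open>(T - t)\<^bsup>k-r\<^esup>\<close> times the form with entries
\<open>\<langle>h\<^sub>n, h\<^sub>l\<rangle>\<^sup>r\<close>.  On the other hand \<open>E Y\<^sup>2\<close> is the form with entries \<open>exp \<langle>h\<^sub>n, h\<^sub>l\<rangle>\<close>.  All power forms are
nonnegative, so the exponential form dominates \<open>1/r!\<close> times the one of order \<open>r\<close>.  This gives
the constant \<open>r! (T - t)\<^bsup>k-r\<^esup>\<close>, and it is at most \<open>k!\<close> when \<open>r = k\<close> or \<open>T - t < 1\<close>.

Membership in the closed span and the existence of the integrals come from one class of
integrands, the uniform mean-square limits of polynomials in past increments (\<open>approximable\<close>).
Products of such polynomials with exponentials are derivatives of exponentials
(\<open>exp_multiplier_mult\<close>), and the class is closed under integration (\<open>approximable_w_integral\<close>).  Whichever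
version of an Ito integral is chosen, the isometry keeps it close to the integrals of the elementary
processes near the integrand (\<open>is_ito_integral_close\<close>).
\<close>

section \<open>Square integrable functions\<close>

definition square_integrable :: "'a measure \<Rightarrow> ('a \<Rightarrow> real) \<Rightarrow> bool" where
  "square_integrable N f \<longleftrightarrow> f \<in> borel_measurable N \<and> integrable N (\<lambda>x. (f x)\<^sup>2)"

text \<open>Valued in the extended reals, so that estimates and limits can be stated before square
  integrability is known.\<close>

definition nsq :: "'a measure \<Rightarrow> ('a \<Rightarrow> real) \<Rightarrow> ennreal" where
  "nsq N f = (\<integral>\<^sup>+x. ennreal ((f x)\<^sup>2) \<partial>N)"

lemma square_integrable_measurable [measurable_dest]:
  "square_integrable N f \<Longrightarrow> f \<in> borel_measurable N"
  by (simp add: square_integrable_def)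

lemma square_integrable_sq: "square_integrable N f \<Longrightarrow> integrable N (\<lambda>x. (f x)\<^sup>2)"
  by (simp add: square_integrable_def)

lemma square_integrable_iff_nsq:
  assumes "f \<in> borel_measurable N"
  shows "square_integrable N f \<longleftrightarrow> nsq N f < \<infinity>"
proof -
  have "(\<lambda>x. (f x)\<^sup>2) \<in> borel_measurable N" using assms by measurable
  then show ?thesis
    unfolding square_integrable_def nsq_def integrable_iff_bounded using assms by simp
qed

lemma nsq_eq_integral: "square_integrable N f \<Longrightarrow> nsq N f = ennreal (\<integral>x. (f x)\<^sup>2 \<partial>N)"
  unfolding nsq_def square_integrable_def by (intro nn_integral_eq_integral) auto

lemma square_integrable_mult:
  assumes "square_integrable N f" "square_integrable N g"
  shows "integrable N (\<lambda>x. f x * g x)"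
proof (rule Bochner_Integration.integrable_bound)
  show "integrable N (\<lambda>x. (f x)\<^sup>2 + (g x)\<^sup>2)"
    using assms by (auto simp: square_integrable_def)
  show "(\<lambda>x. f x * g x) \<in> borel_measurable N"
    using assms by (auto simp: square_integrable_def)
  have "\<bar>a * b\<bar> \<le> a\<^sup>2 + b\<^sup>2" for a b :: real
  proof -
    have "2 * \<bar>a * b\<bar> \<le> a\<^sup>2 + b\<^sup>2"
      using zero_le_power2[of "\<bar>a\<bar> - \<bar>b\<bar>"] by (simp add: power2_diff abs_mult)
    then show ?thesis using abs_ge_zero[of "a * b"] by linarith
  qed
  then show "AE x in N. norm (f x * g x) \<le> norm ((f x)\<^sup>2 + (g x)\<^sup>2)"
    by auto
qed

lemma square_integrable_cmult [intro]:
  "square_integrable N f \<Longrightarrow> square_integrable N (\<lambda>x. c * f x)"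
  by (auto simp: square_integrable_def power_mult_distrib)

lemma sq_add_le: "(a + b)\<^sup>2 \<le> 2 * a\<^sup>2 + 2 * (b::real)\<^sup>2"
  using zero_le_power2[of "a - b"] by (simp add: power2_eq_square algebra_simps)

lemma square_integrable_add [intro]:
  assumes "square_integrable N f" "square_integrable N g"
  shows "square_integrable N (\<lambda>x. f x + g x)"
  unfolding square_integrable_def
proof
  show m: "(\<lambda>x. f x + g x) \<in> borel_measurable N"
    using assms by (auto simp: square_integrable_def)
  show "integrable N (\<lambda>x. (f x + g x)\<^sup>2)"
  proof (rule Bochner_Integration.integrable_bound)
    show "integrable N (\<lambda>x. 2 * (f x)\<^sup>2 + 2 * (g x)\<^sup>2)"
      using assms by (auto simp: square_integrable_def)
    show "(\<lambda>x. (f x + g x)\<^sup>2) \<in> borel_measurable N" using m by measurable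
  qed (use sq_add_le in auto)
qed

lemma square_integrable_diff [intro]:
  assumes "square_integrable N f" "square_integrable N g"
  shows "square_integrable N (\<lambda>x. f x - g x)"
  using square_integrable_add[OF assms(1) square_integrable_cmult[OF assms(2), of "-1"]] by simp

lemma square_integrable_zero [simp]: "square_integrable N (\<lambda>x. 0)"
  by (simp add: square_integrable_def)

lemma square_integrable_sum [intro]:
  assumes "\<And>i. i \<in> I \<Longrightarrow> square_integrable N (f i)"
  shows "square_integrable N (\<lambda>x. \<Sum>i\<in>I. f i x)"
  using assms by (induction I rule: infinite_finite_induct) auto

lemma square_integrable_sum_list:
  assumes "\<And>i. i \<in> set xs \<Longrightarrow> square_integrable N (f i)"
  shows "square_integrable N (\<lambda>x. \<Sum>i\<leftarrow>xs. f i x)"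
  using assms by (induction xs) auto

lemma integral_Cauchy_Schwarz:
  assumes f: "square_integrable N f" and g: "square_integrable N g"
  shows "(\<integral>x. f x * g x \<partial>N)\<^sup>2 \<le> (\<integral>x. (f x)\<^sup>2 \<partial>N) * (\<integral>x. (g x)\<^sup>2 \<partial>N)"
proof -
  define A B C where "A = (\<integral>x. (f x)\<^sup>2 \<partial>N)" and "B = (\<integral>x. f x * g x \<partial>N)"
    and "C = (\<integral>x. (g x)\<^sup>2 \<partial>N)"
  have pos: "0 \<le> A - 2 * c * B + c\<^sup>2 * C" for c
  proof -
    have "0 \<le> (\<integral>x. (f x - c * g x)\<^sup>2 \<partial>N)" by simp
    also have "\<dots> = (\<integral>x. (f x)\<^sup>2 - (2 * c) * (f x * g x) + c\<^sup>2 * (g x)\<^sup>2 \<partial>N)"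
      by (intro Bochner_Integration.integral_cong) (auto simp: power2_eq_square algebra_simps)
    also have "\<dots> = A - 2 * c * B + c\<^sup>2 * C"
      using f g square_integrable_mult[OF f g] unfolding A_def B_def C_def square_integrable_def by simp
    finally show ?thesis .
  qed
  have C: "0 \<le> C" by (simp add: C_def)
  have A: "0 \<le> A" by (simp add: A_def)
  show ?thesis
  proof (cases "C = 0")
    case True
    have "B = 0"
    proof (rule ccontr)
      assume "B \<noteq> 0"
      then have "A - 2 * ((A + 1) / (2 * B)) * B + ((A + 1) / (2 * B))\<^sup>2 * C = -1"
        using True by (simp add: field_simps)
      then show False using pos[of "(A + 1) / (2 * B)"] by simp
    qed
    then show ?thesis using A C by (simp flip: A_def B_def C_def)
  next
    case False
    then have "A - 2 * (B / C) * B + (B / C)\<^sup>2 * C = A - B\<^sup>2 / C"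
      by (simp add: field_simps power2_eq_square)
    then have "B\<^sup>2 / C \<le> A" using pos[of "B / C"] by simp
    then show ?thesis using False C by (simp add: field_simps flip: A_def B_def C_def)
  qed
qed

lemma integral_Cauchy_Schwarz_abs:
  assumes f: "square_integrable N f" and g: "square_integrable N g"
  shows "\<bar>\<integral>x. f x * g x \<partial>N\<bar> \<le> sqrt (\<integral>x. (f x)\<^sup>2 \<partial>N) * sqrt (\<integral>x. (g x)\<^sup>2 \<partial>N)"
  using real_sqrt_le_mono[OF integral_Cauchy_Schwarz[OF assms]] by (simp add: real_sqrt_mult)

lemma nsq_add_le:
  assumes [measurable]: "f \<in> borel_measurable N" "g \<in> borel_measurable N"
  shows "nsq N (\<lambda>x. f x + g x) \<le> 2 * nsq N f + 2 * nsq N g"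
proof -
  have "nsq N (\<lambda>x. f x + g x) \<le> (\<integral>\<^sup>+x. 2 * ennreal ((f x)\<^sup>2) + 2 * ennreal ((g x)\<^sup>2) \<partial>N)"
    unfolding nsq_def
  proof (intro nn_integral_mono)
    fix x
    have "ennreal ((f x + g x)\<^sup>2) \<le> ennreal (2 * (f x)\<^sup>2 + 2 * (g x)\<^sup>2)"
      by (intro ennreal_leI sq_add_le)
    then show "ennreal ((f x + g x)\<^sup>2) \<le> 2 * ennreal ((f x)\<^sup>2) + 2 * ennreal ((g x)\<^sup>2)"
      by (simp add: ennreal_plus ennreal_mult)
  qed
  also have "\<dots> = 2 * nsq N f + 2 * nsq N g"
    unfolding nsq_def by (simp add: nn_integral_add nn_integral_cmult)
  finally show ?thesis .
qed

lemma nsq_diff_le: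
  assumes "f \<in> borel_measurable N" "g \<in> borel_measurable N" "h \<in> borel_measurable N"
  shows "nsq N (\<lambda>x. f x - h x) \<le> 2 * nsq N (\<lambda>x. f x - g x) + 2 * nsq N (\<lambda>x. g x - h x)"
  using nsq_add_le[of "\<lambda>x. f x - g x" N "\<lambda>x. g x - h x"] assms by simp

lemma nsq_commute: "nsq N (\<lambda>x. f x - g x) = nsq N (\<lambda>x. g x - f x)"
  by (simp add: nsq_def power2_commute)

lemma nsq_cong_AE: "(AE x in N. f x = g x) \<Longrightarrow> nsq N f = nsq N g"
  unfolding nsq_def by (intro nn_integral_cong_AE) auto

lemma square_integrable_if_close:
  assumes f: "square_integrable N f" and g: "g \<in> borel_measurable N"
    and "nsq N (\<lambda>x. f x - g x) < \<infinity>"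
  shows "square_integrable N g"
proof -
  have fm: "f \<in> borel_measurable N" using f by measurable
  have "nsq N (\<lambda>x. g x - 0) \<le> 2 * nsq N (\<lambda>x. g x - f x) + 2 * nsq N (\<lambda>x. f x - 0)"
    by (rule nsq_diff_le) (use fm g in auto)
  also have "\<dots> < \<infinity>"
    using assms(3) f fm nsq_commute[of N g f]
    by (simp add: ennreal_mult_less_top square_integrable_iff_nsq)
  finally show ?thesis using g by (simp add: square_integrable_iff_nsq)
qed

lemma eventually_less_top:
  assumes "X \<longlonglongrightarrow> (0::ennreal)" shows "eventually (\<lambda>n. X n < \<infinity>) sequentially"
  using order_tendstoD(2)[OF assms, of \<infinity>] by simp

lemma square_integrable_limit:
  assumes f: "\<And>n. square_integrable N (f n)" and g: "g \<in> borel_measurable N"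
    and lim: "(\<lambda>n. nsq N (\<lambda>x. f n x - g x)) \<longlonglongrightarrow> 0"
  shows "square_integrable N g"
proof -
  from eventually_less_top[OF lim] obtain n where "nsq N (\<lambda>x. f n x - g x) < \<infinity>"
    by (meson eventually_sequentially order_refl)
  then show ?thesis by (rule square_integrable_if_close[OF f g])
qed

lemma nsq_limit_integral:
  assumes f: "\<And>n. square_integrable N (f n)" and g: "g \<in> borel_measurable N"
    and lim: "(\<lambda>n. nsq N (\<lambda>x. f n x - g x)) \<longlonglongrightarrow> 0"
  shows "(\<lambda>n. \<integral>x. (f n x - g x)\<^sup>2 \<partial>N) \<longlonglongrightarrow> 0"
proof -
  have "square_integrable N (\<lambda>x. f n x - g x)" for n
    by (intro square_integrable_diff f square_integrable_limit[OF assms])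
  then have "(\<lambda>n. ennreal (\<integral>x. (f n x - g x)\<^sup>2 \<partial>N)) \<longlonglongrightarrow> ennreal 0"
    using lim by (simp add: nsq_eq_integral)
  then show ?thesis by (rule tendsto_ennrealD) auto
qed

lemma integral_mult_limit:
  assumes f: "\<And>n. square_integrable N (f n)" and g: "g \<in> borel_measurable N"
    and lim: "(\<lambda>n. nsq N (\<lambda>x. f n x - g x)) \<longlonglongrightarrow> 0" and h: "square_integrable N h"
  shows "(\<lambda>n. \<integral>x. f n x * h x \<partial>N) \<longlonglongrightarrow> (\<integral>x. g x * h x \<partial>N)"
proof -
  have sg: "square_integrable N g" by (rule square_integrable_limit[OF f g lim])
  have d: "square_integrable N (\<lambda>x. f n x - g x)" for n by (intro square_integrable_diff f sg)
  have eq: "(\<integral>x. f n x * h x \<partial>N) - (\<integral>x. g x * h x \<partial>N) = (\<integral>x. (f n x - g x) * h x \<partial>N)" for n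
    using square_integrable_mult[OF f h] square_integrable_mult[OF sg h]
    by (simp add: left_diff_distrib)
  have "(\<lambda>n. sqrt (\<integral>x. (f n x - g x)\<^sup>2 \<partial>N) * sqrt (\<integral>x. (h x)\<^sup>2 \<partial>N)) \<longlonglongrightarrow> sqrt 0 * sqrt (\<integral>x. (h x)\<^sup>2 \<partial>N)"
    by (intro tendsto_intros nsq_limit_integral[OF f g lim])
  then have "(\<lambda>n. sqrt (\<integral>x. (f n x - g x)\<^sup>2 \<partial>N) * sqrt (\<integral>x. (h x)\<^sup>2 \<partial>N)) \<longlonglongrightarrow> 0"
    by simp
  then have "(\<lambda>n. (\<integral>x. f n x * h x \<partial>N) - (\<integral>x. g x * h x \<partial>N)) \<longlonglongrightarrow> 0"
    unfolding eq
  proof (rule Lim_null_comparison[rotated], intro always_eventually allI)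
    show "norm (\<integral>x. (f n x - g x) * h x \<partial>N) \<le> sqrt (\<integral>x. (f n x - g x)\<^sup>2 \<partial>N) * sqrt (\<integral>x. (h x)\<^sup>2 \<partial>N)" for n
      unfolding real_norm_def by (rule integral_Cauchy_Schwarz_abs[OF d h])
  qed
  then show ?thesis by (simp add: LIM_zero_iff)
qed

lemma integral_sq_limit:
  assumes f: "\<And>n. square_integrable N (f n)" and g: "g \<in> borel_measurable N"
    and lim: "(\<lambda>n. nsq N (\<lambda>x. f n x - g x)) \<longlonglongrightarrow> 0"
  shows "(\<lambda>n. \<integral>x. (f n x)\<^sup>2 \<partial>N) \<longlonglongrightarrow> (\<integral>x. (g x)\<^sup>2 \<partial>N)"
proof -
  have sg: "square_integrable N g" by (rule square_integrable_limit[OF f g lim])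
  have d: "square_integrable N (\<lambda>x. f n x - g x)" for n by (intro square_integrable_diff f sg)
  have eq: "(\<integral>x. (f n x)\<^sup>2 \<partial>N) = (\<integral>x. (f n x - g x)\<^sup>2 \<partial>N) + 2 * (\<integral>x. f n x * g x \<partial>N) - (\<integral>x. (g x)\<^sup>2 \<partial>N)" for n
  proof -
    have "(\<integral>x. (f n x)\<^sup>2 \<partial>N) = (\<integral>x. ((f n x - g x)\<^sup>2 + 2 * (f n x * g x)) - (g x)\<^sup>2 \<partial>N)"
      by (intro Bochner_Integration.integral_cong) (auto simp: power2_eq_square algebra_simps)
    then show ?thesis
      using square_integrable_mult[OF f sg] square_integrable_sq[OF d] square_integrable_sq[OF sg] by simp
  qed
  have "(\<lambda>n. (\<integral>x. (f n x - g x)\<^sup>2 \<partial>N) + 2 * (\<integral>x. f n x * g x \<partial>N) - (\<integral>x. (g x)\<^sup>2 \<partial>N))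
     \<longlonglongrightarrow> 0 + 2 * (\<integral>x. g x * g x \<partial>N) - (\<integral>x. (g x)\<^sup>2 \<partial>N)"
    by (intro tendsto_intros nsq_limit_integral[OF f g lim] integral_mult_limit[OF f g lim sg])
  then show ?thesis unfolding eq by (simp add: power2_eq_square)
qed

lemma nsq_Fatou_liminf:
  assumes [measurable]: "\<And>n. f n \<in> borel_measurable N" "g \<in> borel_measurable N"
    and conv: "AE x in N. (\<lambda>n. f n x) \<longlonglongrightarrow> g x"
  shows "nsq N g \<le> liminf (\<lambda>n. nsq N (f n))"
proof -
  have "nsq N g = (\<integral>\<^sup>+x. liminf (\<lambda>n. ennreal ((f n x)\<^sup>2)) \<partial>N)"
    unfolding nsq_def
  proof (rule nn_integral_cong_AE, use conv in eventually_elim)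
    case (elim x)
    then have "(\<lambda>n. ennreal ((f n x)\<^sup>2)) \<longlonglongrightarrow> ennreal ((g x)\<^sup>2)"
      by (intro tendsto_ennrealI tendsto_intros)
    then show ?case by (intro lim_imp_Liminf[symmetric]) auto
  qed
  also have "\<dots> \<le> liminf (\<lambda>n. nsq N (f n))"
    unfolding nsq_def by (rule nn_integral_liminf) measurable
  finally show ?thesis .
qed

lemma nsq_Fatou:
  assumes "\<And>n. f n \<in> borel_measurable N" "g \<in> borel_measurable N"
    and "AE x in N. (\<lambda>n. f n x) \<longlonglongrightarrow> g x"
    and le: "\<And>n. n \<ge> n0 \<Longrightarrow> nsq N (f n) \<le> c"
  shows "nsq N g \<le> c"
proof -
  have "nsq N g \<le> liminf (\<lambda>n. nsq N (f n))"
    by (rule nsq_Fatou_liminf[OF assms(1-3)])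
  also have "\<dots> \<le> liminf (\<lambda>n. c)"
    by (intro Liminf_mono) (auto simp: eventually_sequentially intro!: exI[of _ n0] le)
  finally show ?thesis by (simp add: Liminf_const)
qed

lemma nsq_Fatou_lim:
  assumes "\<And>n. f n \<in> borel_measurable N" "g \<in> borel_measurable N"
    and "AE x in N. (\<lambda>n. f n x) \<longlonglongrightarrow> g x"
    and lim: "(\<lambda>n. nsq N (f n)) \<longlonglongrightarrow> c"
  shows "nsq N g \<le> c"
  using nsq_Fatou_liminf[OF assms(1-3)] lim_imp_Liminf[OF _ lim] by simp

text \<open>The inequality $|d| \le 2^n d^2 + 2^{-n}$ trades square integrals that decay like $4^{-n}$
  for first moments that decay like $2^{-n}$.\<close>

lemma (in prob_space) AE_summable_fast:
  assumes [measurable]: "\<And>n. d n \<in> borel_measurable M"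
    and le: "\<And>n. nsq M (d n) \<le> ennreal (C * (1/4)^n)" and C: "0 \<le> C"
  shows "AE x in M. summable (\<lambda>n. \<bar>d n x\<bar>)"
proof -
  have n: "(\<integral>\<^sup>+x. ennreal \<bar>d n x\<bar> \<partial>M) \<le> ennreal ((C + 1) * (1/2)^n)" for n
  proof -
    have "(\<integral>\<^sup>+x. ennreal \<bar>d n x\<bar> \<partial>M) \<le> (\<integral>\<^sup>+x. ennreal (2^n) * ennreal ((d n x)\<^sup>2) + ennreal ((1/2)^n) \<partial>M)"
    proof (rule nn_integral_mono)
      fix x
      have "0 \<le> (2^n * \<bar>d n x\<bar> - 1)\<^sup>2" by simp
      then have "2 * 2^n * \<bar>d n x\<bar> \<le> 2^n * 2^n * (d n x)\<^sup>2 + 1"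
        by (simp add: power2_eq_square algebra_simps)
      then have "2 * \<bar>d n x\<bar> \<le> 2^n * (d n x)\<^sup>2 + (1/2)^n"
        by (simp add: field_simps)
      then have "\<bar>d n x\<bar> \<le> 2^n * (d n x)\<^sup>2 + (1/2)^n" by linarith
      then have "ennreal \<bar>d n x\<bar> \<le> ennreal (2^n * (d n x)\<^sup>2 + (1/2)^n)" by (rule ennreal_leI)
      then show "ennreal \<bar>d n x\<bar> \<le> ennreal (2^n) * ennreal ((d n x)\<^sup>2) + ennreal ((1/2)^n)"
        by (simp add: ennreal_plus ennreal_mult)
    qed
    also have "\<dots> = ennreal (2^n) * nsq M (d n) + ennreal ((1/2)^n)"
      by (simp add: nn_integral_add nn_integral_cmult nsq_def emeasure_space_1)
    also have "\<dots> \<le> ennreal (2^n) * ennreal (C * (1/4)^n) + ennreal ((1/2)^n)"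
      by (intro add_mono mult_left_mono le) auto
    also have "\<dots> = ennreal (2^n * (C * (1/4)^n) + (1/2)^n)"
      using C by (simp add: ennreal_plus ennreal_mult)
    also have "2^n * (C * (1/4)^n) + (1/2)^n = (C + 1) * (1/2)^n"
    proof -
      have "(2::real)^n * (1/4)^n = (1/2)^n" by (simp flip: power_mult_distrib)
      then show ?thesis by (simp add: algebra_simps)
    qed
    finally show ?thesis .
  qed
  have "(\<integral>\<^sup>+x. (\<Sum>n. ennreal \<bar>d n x\<bar>) \<partial>M) = (\<Sum>n. \<integral>\<^sup>+x. ennreal \<bar>d n x\<bar> \<partial>M)"
    by (intro nn_integral_suminf) auto
  also have "\<dots> \<le> (\<Sum>n. ennreal ((C + 1) * (1/2)^n))"
    by (intro suminf_le n) auto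
  also have "\<dots> < \<infinity>"
  proof -
    have "summable (\<lambda>n. (C + 1) * (1/2::real)^n)" by (intro summable_mult summable_geometric) simp
    then show ?thesis using C by (subst suminf_ennreal2) auto
  qed
  finally have "(\<integral>\<^sup>+x. (\<Sum>n. ennreal \<bar>d n x\<bar>) \<partial>M) \<noteq> \<infinity>" by simp
  then have "AE x in M. (\<Sum>n. ennreal \<bar>d n x\<bar>) \<noteq> \<infinity>"
    by (intro nn_integral_noteq_infinite) auto
  then show ?thesis
    by eventually_elim (auto intro!: summable_suminf_not_top)
qed

lemma (in prob_space) AE_tendsto_fast:
  assumes "\<And>n. f n \<in> borel_measurable M" "g \<in> borel_measurable M"
    and "\<And>n. nsq M (\<lambda>x. f n x - g x) \<le> ennreal (C * (1/4)^n)" and "0 \<le> C"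
  shows "AE x in M. (\<lambda>n. f n x) \<longlonglongrightarrow> g x"
proof -
  have "AE x in M. summable (\<lambda>n. \<bar>f n x - g x\<bar>)"
    by (rule AE_summable_fast[OF _ assms(3,4)]) (use assms(1,2) in auto)
  then show ?thesis
    by eventually_elim (auto dest!: summable_LIMSEQ_zero simp: tendsto_rabs_zero_iff LIM_zero_iff)
qed

lemma (in prob_space) AE_convergent_fast:
  assumes "\<And>n. f n \<in> borel_measurable M"
    and "\<And>n. nsq M (\<lambda>x. f (Suc n) x - f n x) \<le> ennreal (C * (1/4)^n)" and "0 \<le> C"
  shows "AE x in M. convergent (\<lambda>n. f n x)"
proof -
  have "AE x in M. summable (\<lambda>n. \<bar>f (Suc n) x - f n x\<bar>)"
    by (rule AE_summable_fast[OF _ assms(2,3)]) (use assms(1) in auto)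
  then show ?thesis
  proof eventually_elim
    case (elim x)
    then have "summable (\<lambda>n. f (Suc n) x - f n x)" by (rule summable_rabs_cancel)
    then have "convergent (\<lambda>n. \<Sum>i<n. f (Suc i) x - f i x)" by (simp add: summable_iff_convergent)
    then have "convergent (\<lambda>n. f n x - f 0 x)" by (simp add: sum_lessThan_telescope[where f = "\<lambda>n. f n x"])
    then show ?case using convergent_diff_const_right_iff by blast
  qed
qed

lemma L2_on_iff: "L2_on a b g \<longleftrightarrow> square_integrable (lebesgue_on {a..b}) g"
  by (simp add: L2_on_def square_integrable_def)

lemma finite_measure_lebesgue_on_Icc: "finite_measure (lebesgue_on {a..b::real})"
  by (intro finite_measureI) (simp add: emeasure_restrict_space space_restrict_space emeasure_lborel_Icc_eq)

lemma nsq_dominated_convergence: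
  assumes [measurable]: "\<And>n. f n \<in> borel_measurable N" "g \<in> borel_measurable N"
    and conv: "AE x in N. (\<lambda>n. f n x) \<longlonglongrightarrow> g x"
    and le: "\<And>n. AE x in N. \<bar>f n x - g x\<bar> \<le> \<bar>h x\<bar>" and h: "square_integrable N h"
  shows "(\<lambda>n. nsq N (\<lambda>x. f n x - g x)) \<longlonglongrightarrow> 0"
proof -
  have [measurable]: "h \<in> borel_measurable N" using h by measurable
  have "(\<lambda>n. nsq N (\<lambda>x. f n x - g x)) \<longlonglongrightarrow> (\<integral>\<^sup>+x. 0 \<partial>N)"
    unfolding nsq_def
  proof (rule nn_integral_dominated_convergence[where w = "\<lambda>x. ennreal ((h x)\<^sup>2)"])
    show "AE x in N. ennreal ((f n x - g x)\<^sup>2) \<le> ennreal ((h x)\<^sup>2)" for n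
      using le[of n] by eventually_elim (auto intro!: ennreal_leI simp: abs_le_square_iff)
    show "(\<integral>\<^sup>+x. ennreal ((h x)\<^sup>2) \<partial>N) < \<infinity>"
      using h by (simp add: square_integrable_iff_nsq flip: nsq_def)
    show "AE x in N. (\<lambda>n. ennreal ((f n x - g x)\<^sup>2)) \<longlonglongrightarrow> 0"
      using conv
    proof eventually_elim
      case (elim x)
      then have "(\<lambda>n. ennreal ((f n x - g x)\<^sup>2)) \<longlonglongrightarrow> ennreal ((g x - g x)\<^sup>2)"
        by (intro tendsto_ennrealI tendsto_intros)
      then show ?case by simp
    qed
  qed measurable
  then show ?thesis by simp
qed

text \<open>A square integrable function is truncated first; a bounded measurable function is an almost
  everywhere limit of continuous ones, which may be clamped to the same bound.\<close>

lemma continuous_dense_L2: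
  assumes psi: "L2_on a b \<psi>" and e: "0 < e"
  shows "\<exists>\<gamma>. continuous_on UNIV \<gamma> \<and> nsq (lebesgue_on {a..b}) (\<lambda>x. \<gamma> x - \<psi> x) \<le> ennreal e"
proof -
  let ?L = "lebesgue_on {a..b}"
  interpret finite_measure ?L by (rule finite_measure_lebesgue_on_Icc)
  have sq: "square_integrable ?L \<psi>" and [measurable]: "\<psi> \<in> borel_measurable ?L"
    using psi by (auto simp: L2_on_iff square_integrable_def)
  define tr where "tr c x = max (- real c) (min (real c) x)" for c x
  have "(\<lambda>c. nsq ?L (\<lambda>x. tr c (\<psi> x) - \<psi> x)) \<longlonglongrightarrow> 0"
  proof (rule nsq_dominated_convergence[OF _ _ _ _ sq])
    show "AE x in ?L. (\<lambda>c. tr c (\<psi> x)) \<longlonglongrightarrow> \<psi> x"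
    proof (rule AE_I2)
      fix x
      obtain n where n: "\<bar>\<psi> x\<bar> \<le> real n" using real_arch_simple by blast
      have "eventually (\<lambda>c. tr c (\<psi> x) = \<psi> x) sequentially"
        using n by (auto simp: eventually_sequentially tr_def max_def min_def intro!: exI[of _ n])
      then show "(\<lambda>c. tr c (\<psi> x)) \<longlonglongrightarrow> \<psi> x" by (rule tendsto_eventually)
    qed
    show "AE x in ?L. \<bar>tr c (\<psi> x) - \<psi> x\<bar> \<le> \<bar>\<psi> x\<bar>" for c
      by (rule AE_I2) (auto simp: tr_def max_def min_def)
  qed (auto simp: tr_def)
  then have "eventually (\<lambda>c. nsq ?L (\<lambda>x. tr c (\<psi> x) - \<psi> x) < ennreal (e / 4)) sequentially"
    using e by (intro order_tendstoD(2)) auto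
  then obtain c where c: "nsq ?L (\<lambda>x. tr c (\<psi> x) - \<psi> x) < ennreal (e / 4)"
    by (auto simp: eventually_sequentially)
  define g where "g x = tr c (\<psi> x)" for x
  have gm [measurable]: "g \<in> borel_measurable ?L" unfolding g_def tr_def by measurable
  then have "g measurable_on {a..b}" by (subst measurable_on_iff_borel_measurable) auto
  then obtain N h where N: "negligible N" and h: "\<And>n. continuous_on UNIV (h n)"
    and lim: "\<And>x. x \<notin> N \<Longrightarrow> (\<lambda>n. h n x) \<longlonglongrightarrow> (if x \<in> {a..b} then g x else 0)"
    unfolding measurable_on_def by metis
  define h' where "h' n x = tr c (h n x)" for n x
  have hc: "continuous_on UNIV (h' n)" for n
    unfolding h'_def tr_def by (intro continuous_intros h)
  have [measurable]: "h' n \<in> borel_measurable ?L" for n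
    using borel_measurable_continuous_onI[OF hc]
    by (intro measurable_restrict_space1 measurable_completion) simp
  have "(\<lambda>n. nsq ?L (\<lambda>x. h' n x - g x)) \<longlonglongrightarrow> 0"
  proof (rule nsq_dominated_convergence)
    have "AE x in lebesgue. x \<notin> N" using N by (simp add: negligible_iff_null_sets AE_not_in)
    then have "AE x in ?L. x \<notin> N" by (subst AE_restrict_space_iff) auto
    then show "AE x in ?L. (\<lambda>n. h' n x) \<longlonglongrightarrow> g x"
    proof (rule AE_mp, intro AE_I2 impI)
      fix x assume "x \<in> space ?L" "x \<notin> N"
      then have "(\<lambda>n. h n x) \<longlonglongrightarrow> g x" using lim[of x] by (simp add: space_restrict_space)
      then have "(\<lambda>n. h' n x) \<longlonglongrightarrow> tr c (g x)"
        unfolding h'_def tr_def by (intro tendsto_intros)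
      then show "(\<lambda>n. h' n x) \<longlonglongrightarrow> g x" by (simp add: g_def tr_def)
    qed
    show "square_integrable ?L (\<lambda>x. 2 * real c)" by (simp add: square_integrable_def)
    show "AE x in ?L. \<bar>h' n x - g x\<bar> \<le> \<bar>2 * real c\<bar>" for n
      by (rule AE_I2) (auto simp: h'_def g_def tr_def)
  qed auto
  then have "eventually (\<lambda>n. nsq ?L (\<lambda>x. h' n x - g x) < ennreal (e / 4)) sequentially"
    using e by (intro order_tendstoD(2)) auto
  then obtain n where n: "nsq ?L (\<lambda>x. h' n x - g x) < ennreal (e / 4)"
    by (auto simp: eventually_sequentially)
  have "nsq ?L (\<lambda>x. h' n x - \<psi> x) \<le> 2 * nsq ?L (\<lambda>x. h' n x - g x) + 2 * nsq ?L (\<lambda>x. g x - \<psi> x)"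
    by (rule nsq_diff_le) auto
  also have "\<dots> \<le> 2 * ennreal (e / 4) + 2 * ennreal (e / 4)"
    using n c unfolding g_def by (intro add_mono mult_left_mono) auto
  also have "\<dots> = ennreal e"
    using e by (simp add: mult_2 flip: ennreal_plus)
  finally show ?thesis using hc by (intro exI[of _ "h' n"]) simp
qed

section \<open>Gaussian increments\<close>

locale wiener_setting = prob_space M for M :: "'a measure" +
  fixes F :: "real \<Rightarrow> 'a measure" and f :: "nat \<Rightarrow> real \<Rightarrow> 'a \<Rightarrow> real"
    and t T :: real and m :: nat
  assumes filtration: "right_continuous_filtration M T F"
    and wiener: "wiener_process M F T m f"
    and t_nonneg: "0 \<le> t" and t_less: "t < T"
begin

lemma F_subalgebra: "s \<in> {0..T} \<Longrightarrow> subalgebra M (F s)"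
  using filtration by (auto simp: right_continuous_filtration_def)

lemma F_measurable: "s \<in> {0..T} \<Longrightarrow> \<eta> \<in> borel_measurable (F s) \<Longrightarrow> \<eta> \<in> borel_measurable M"
  using F_subalgebra measurable_from_subalg by blast

lemma F_mono:
  assumes "0 \<le> s" "s \<le> u" "u \<le> T" "\<eta> \<in> borel_measurable (F s)"
  shows "\<eta> \<in> borel_measurable (F u)"
proof -
  have "subalgebra (F u) (F s)"
    using F_subalgebra[of s] F_subalgebra[of u] filtration assms
    by (auto simp: right_continuous_filtration_def subalgebra_def)
  then show ?thesis using assms(4) measurable_from_subalg by blast
qed

lemma f_adapted: "i \<in> {1..m} \<Longrightarrow> 0 \<le> s \<Longrightarrow> s \<le> u \<Longrightarrow> u \<le> T \<Longrightarrow> f i s \<in> borel_measurable (F u)"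
  using wiener by (intro F_mono[of s u]) (auto simp: wiener_process_def)

lemma f_measurable: "i \<in> {1..m} \<Longrightarrow> 0 \<le> s \<Longrightarrow> s \<le> T \<Longrightarrow> f i s \<in> borel_measurable M"
  by (rule F_measurable[OF _ f_adapted[of i s s]]) auto

lemma increment_indep:
  assumes "0 \<le> s" "s < u" "u \<le> T" and eta: "\<eta> \<in> borel_measurable (F s)"
    and Y: "Y \<in> borel_measurable (Pi\<^sub>M {1..m} (\<lambda>_. borel))"
  shows "indep_var borel \<eta> borel (\<lambda>\<omega>. Y (\<lambda>i\<in>{1..m}. f i u \<omega> - f i s \<omega>) :: real)"
proof -
  let ?V = "\<lambda>\<omega>. \<lambda>i\<in>{1..m}. f i u \<omega> - f i s \<omega>"
  let ?P = "Pi\<^sub>M {1..m} (\<lambda>_. borel) :: (nat \<Rightarrow> real) measure"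
  have sp: "space (F s) = space M"
    using F_subalgebra[of s] assms by (auto simp: subalgebra_def)
  have V: "?V \<in> M \<rightarrow>\<^sub>M ?P"
    using assms by (intro measurable_restrict borel_measurable_diff f_measurable) auto
  have ind: "indep_set (sets (F s)) (sets (vimage_algebra (space M) ?V ?P))"
    using wiener assms by (auto simp: wiener_process_def)
  have 1: "sigma_sets (space M) {\<eta> -` A \<inter> space M |A. A \<in> sets borel} \<subseteq> sets (F s)"
    using measurable_sets[OF eta] sp
    by (subst sp[symmetric], intro sets.sigma_sets_subset) auto
  have 2: "sigma_sets (space M) {(\<lambda>\<omega>. Y (?V \<omega>)) -` A \<inter> space M |A. A \<in> sets borel}
      \<subseteq> sets (vimage_algebra (space M) ?V ?P)"
  proof -
    have "(\<lambda>\<omega>. Y (?V \<omega>)) \<in> borel_measurable (vimage_algebra (space M) ?V ?P)"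
    proof (rule measurable_compose[OF _ Y])
      show "?V \<in> vimage_algebra (space M) ?V ?P \<rightarrow>\<^sub>M ?P"
        by (rule measurable_vimage_algebra1) (use measurable_space[OF V] in auto)
    qed
    from measurable_sets[OF this]
    have "{(\<lambda>\<omega>. Y (?V \<omega>)) -` A \<inter> space M |A. A \<in> sets borel} \<subseteq> sets (vimage_algebra (space M) ?V ?P)"
      by (auto simp only: space_vimage_algebra)
    from sets.sigma_sets_subset[OF this] show ?thesis by (simp only: space_vimage_algebra)
  qed
  have rv: "\<eta> \<in> borel_measurable M" "(\<lambda>\<omega>. Y (?V \<omega>)) \<in> borel_measurable M"
    using F_measurable[OF _ eta] assms measurable_compose[OF V Y] by auto
  show ?thesis
    unfolding indep_var_eq
  proof (intro conjI rv)
    show "indep_set (sigma_sets (space M) {\<eta> -` A \<inter> space M |A. A \<in> sets borel})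
       (sigma_sets (space M) {(\<lambda>\<omega>. Y (?V \<omega>)) -` A \<inter> space M |A. A \<in> sets borel})"
      using ind 1 2 unfolding indep_sets2_eq by blast
  qed
qed

lemma increment_distributed:
  assumes "i \<in> {1..m}" "0 \<le> s" "s < u" "u \<le> T"
  shows "distributed M lborel (\<lambda>\<omega>. f i u \<omega> - f i s \<omega>) (normal_density 0 (sqrt (u - s)))"
  using wiener assms by (auto simp: wiener_process_def)

text \<open>Completing the square turns the exponentially tilted density into a shifted one.\<close>

lemma exp_normal:
  assumes D: "distributed M lborel X (normal_density 0 \<sigma>)" and s: "0 < \<sigma>"
  shows "integrable M (\<lambda>\<omega>. exp (c * X \<omega>))" "expectation (\<lambda>\<omega>. exp (c * X \<omega>)) = exp (c\<^sup>2 * \<sigma>\<^sup>2 / 2)"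
proof -
  have eq: "normal_density 0 \<sigma> x * exp (c * x) = exp (c\<^sup>2 * \<sigma>\<^sup>2 / 2) * normal_density (c * \<sigma>\<^sup>2) \<sigma> x" for x
  proof -
    have "c * x - x\<^sup>2 / (2 * \<sigma>\<^sup>2) = c\<^sup>2 * \<sigma>\<^sup>2 / 2 - (x - c * \<sigma>\<^sup>2)\<^sup>2 / (2 * \<sigma>\<^sup>2)"
    proof -
      define q where "q = \<sigma>\<^sup>2"
      have q: "\<sigma>\<^sup>2 = q" "q > 0" using zero_less_power[OF s, of 2] by (simp_all only: q_def)
      have "(x - c * q)\<^sup>2 = x\<^sup>2 - 2 * c * q * x + c\<^sup>2 * q * q"
        by (simp add: power2_eq_square algebra_simps)
      then have "(x - c * q)\<^sup>2 / (2 * q) = x\<^sup>2 / (2 * q) - c * x + c\<^sup>2 * q / 2"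
        using q(2) by (simp add: add_divide_distrib diff_divide_distrib)
      then show ?thesis unfolding q(1) by simp
    qed
    then have "exp (c * x) * exp (- x\<^sup>2 / (2 * \<sigma>\<^sup>2)) = exp (c\<^sup>2 * \<sigma>\<^sup>2 / 2) * exp (- (x - c * \<sigma>\<^sup>2)\<^sup>2 / (2 * \<sigma>\<^sup>2))"
      by (simp flip: exp_add)
    then show ?thesis by (simp add: normal_density_def field_simps)
  qed
  have "integrable lborel (\<lambda>x. normal_density 0 \<sigma> x * exp (c * x))"
    unfolding eq using s by (intro integrable_mult_right integrable_normal_density)
  then show "integrable M (\<lambda>\<omega>. exp (c * X \<omega>))"
    using distributed_integrable[OF D, of "\<lambda>x. exp (c * x)"] by simp
  have "(\<integral>x. normal_density 0 \<sigma> x * exp (c * x) \<partial>lborel) = exp (c\<^sup>2 * \<sigma>\<^sup>2 / 2)"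
    unfolding eq using s by simp
  then show "expectation (\<lambda>\<omega>. exp (c * X \<omega>)) = exp (c\<^sup>2 * \<sigma>\<^sup>2 / 2)"
    using distributed_integral[OF D, of "\<lambda>x. exp (c * x)"] by simp
qed

lemma increment_exp_component:
  assumes "i \<in> {1..m}" "0 \<le> s" "s \<le> u" "u \<le> T"
  shows "integrable M (\<lambda>\<omega>. exp (c * (f i u \<omega> - f i s \<omega>)))"
    "expectation (\<lambda>\<omega>. exp (c * (f i u \<omega> - f i s \<omega>))) = exp (c\<^sup>2 * (u - s) / 2)"
  using exp_normal[OF increment_distributed, of i s u c] assms by (cases "s = u"; simp add: prob_space)+

lemma increment_exp:
  assumes "0 \<le> s" "s \<le> u" "u \<le> T"
  shows "integrable M (\<lambda>\<omega>. exp (\<Sum>i\<in>{1..m}. C i * (f i u \<omega> - f i s \<omega>)))"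
    "expectation (\<lambda>\<omega>. exp (\<Sum>i\<in>{1..m}. C i * (f i u \<omega> - f i s \<omega>))) = exp (\<Sum>i\<in>{1..m}. (C i)\<^sup>2 * (u - s) / 2)"
proof -
  let ?X = "\<lambda>i \<omega>. exp (C i * (f i u \<omega> - f i s \<omega>))"
  have "indep_vars (\<lambda>_. Pi\<^sub>M {0..T} (\<lambda>_. borel)) (\<lambda>i \<omega>. \<lambda>s\<in>{0..T}. f i s \<omega>) {1..m}"
    using wiener by (simp add: wiener_process_def)
  then have "indep_vars (\<lambda>_. borel) (\<lambda>i \<omega>. exp (C i * ((\<lambda>s\<in>{0..T}. f i s \<omega>) u - (\<lambda>s\<in>{0..T}. f i s \<omega>) s))) {1..m}"
  proof (rule indep_vars_compose2[where Y = "\<lambda>i x. exp (C i * (x u - x s))"])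
    have [measurable]: "(\<lambda>x. x u) \<in> borel_measurable (Pi\<^sub>M {0..T} (\<lambda>_. borel :: real measure))"
      "(\<lambda>x. x s) \<in> borel_measurable (Pi\<^sub>M {0..T} (\<lambda>_. borel :: real measure))"
      using assms by (auto intro!: measurable_component_singleton)
    show "(\<lambda>x. exp (C i * (x u - x s))) \<in> borel_measurable (Pi\<^sub>M {0..T} (\<lambda>_. borel))" for i
      by measurable
  qed
  then have ind: "indep_vars (\<lambda>_. borel) ?X {1..m}" using assms by simp
  have int: "integrable M (?X i)" if "i \<in> {1..m}" for i
    using increment_exp_component(1)[OF that assms] .
  show "integrable M (\<lambda>\<omega>. exp (\<Sum>i\<in>{1..m}. C i * (f i u \<omega> - f i s \<omega>)))"
    using indep_vars_integrable[OF _ ind int] by (simp add: exp_sum)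
  have "expectation (\<lambda>\<omega>. exp (\<Sum>i\<in>{1..m}. C i * (f i u \<omega> - f i s \<omega>))) = (\<Prod>i\<in>{1..m}. expectation (?X i))"
    using indep_vars_lebesgue_integral[OF _ ind int] by (simp add: exp_sum)
  also have "\<dots> = (\<Prod>i\<in>{1..m}. exp ((C i)\<^sup>2 * (u - s) / 2))"
    by (intro prod.cong refl increment_exp_component(2) assms)
  finally show "expectation (\<lambda>\<omega>. exp (\<Sum>i\<in>{1..m}. C i * (f i u \<omega> - f i s \<omega>))) = exp (\<Sum>i\<in>{1..m}. (C i)\<^sup>2 * (u - s) / 2)"
    by (simp add: exp_sum)
qed

lemma increment_exp_past:
  assumes su: "0 \<le> s" "s \<le> u" "u \<le> T" and eta: "\<eta> \<in> borel_measurable (F s)" "integrable M \<eta>"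
  shows "integrable M (\<lambda>\<omega>. \<eta> \<omega> * exp (\<Sum>i\<in>{1..m}. C i * (f i u \<omega> - f i s \<omega>)))"
    "expectation (\<lambda>\<omega>. \<eta> \<omega> * exp (\<Sum>i\<in>{1..m}. C i * (f i u \<omega> - f i s \<omega>)))
      = expectation \<eta> * exp (\<Sum>i\<in>{1..m}. (C i)\<^sup>2 * (u - s) / 2)"
proof -
  let ?E = "\<lambda>\<omega>. exp (\<Sum>i\<in>{1..m}. C i * (f i u \<omega> - f i s \<omega>))"
  have "integrable M (\<lambda>\<omega>. \<eta> \<omega> * ?E \<omega>) \<and>
    expectation (\<lambda>\<omega>. \<eta> \<omega> * ?E \<omega>) = expectation \<eta> * exp (\<Sum>i\<in>{1..m}. (C i)\<^sup>2 * (u - s) / 2)"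
  proof (cases "s = u")
    case False
    have "(\<lambda>x. exp (\<Sum>i\<in>{1..m}. C i * x i) :: real) \<in> borel_measurable (Pi\<^sub>M {1..m} (\<lambda>_. borel))" by measurable
    from increment_indep[OF _ _ _ eta(1) this, of u] False su
    have ind: "indep_var borel \<eta> borel ?E" by simp
    show ?thesis
      using indep_var_integrable[OF ind eta(2) increment_exp(1)[OF su]]
        indep_var_lebesgue_integral[OF ind eta(2) increment_exp(1)[OF su]] increment_exp(2)[OF su] by simp
  qed (use eta in simp)
  then show "integrable M (\<lambda>\<omega>. \<eta> \<omega> * ?E \<omega>)"
    "expectation (\<lambda>\<omega>. \<eta> \<omega> * ?E \<omega>) = expectation \<eta> * exp (\<Sum>i\<in>{1..m}. (C i)\<^sup>2 * (u - s) / 2)" by blast+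
qed

lemma increment_moments_past:
  assumes i: "i \<in> {1..m}" and su: "0 \<le> s" "s \<le> u" "u \<le> T"
    and eta: "\<eta> \<in> borel_measurable (F s)" "integrable M \<eta>"
  shows "integrable M (\<lambda>\<omega>. \<eta> \<omega> * (f i u \<omega> - f i s \<omega>))"
    "expectation (\<lambda>\<omega>. \<eta> \<omega> * (f i u \<omega> - f i s \<omega>)) = 0"
    "integrable M (\<lambda>\<omega>. \<eta> \<omega> * (f i u \<omega> - f i s \<omega>)\<^sup>2)"
    "expectation (\<lambda>\<omega>. \<eta> \<omega> * (f i u \<omega> - f i s \<omega>)\<^sup>2) = expectation \<eta> * (u - s)"
proof -
  let ?D = "\<lambda>\<omega>. f i u \<omega> - f i s \<omega>"
  have *: "integrable M (\<lambda>\<omega>. \<eta> \<omega> * ?D \<omega>) \<and> expectation (\<lambda>\<omega>. \<eta> \<omega> * ?D \<omega>) = 0 \<and>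
    integrable M (\<lambda>\<omega>. \<eta> \<omega> * (?D \<omega>)\<^sup>2) \<and> expectation (\<lambda>\<omega>. \<eta> \<omega> * (?D \<omega>)\<^sup>2) = expectation \<eta> * (u - s)"
  proof (cases "s = u")
    case False
    then have lt: "s < u" and pos: "0 < sqrt (u - s)" using su(2) by auto
    note D = increment_distributed[OF i su(1) lt su(3)]
    have 1: "integrable M ?D"
      using distributed_integrable[OF D, of "\<lambda>x. x"] integrable_normal_moment_nz_1[OF pos, of 0] by simp
    have 2: "expectation ?D = 0" using normal_distributed_expectation[OF pos D] .
    have 3: "integrable M (\<lambda>\<omega>. (?D \<omega>)\<^sup>2)"
      using distributed_integrable[OF D, of "\<lambda>x. x\<^sup>2"] integrable_normal_moment[OF pos, of 0 2] by simp
    have 4: "expectation (\<lambda>\<omega>. (?D \<omega>)\<^sup>2) = u - s"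
      using normal_distributed_variance[OF pos D] lt 2 by simp
    have Y: "(\<lambda>x. x i) \<in> borel_measurable (Pi\<^sub>M {1..m} (\<lambda>_. borel :: real measure))"
      "(\<lambda>x. (x i)\<^sup>2) \<in> borel_measurable (Pi\<^sub>M {1..m} (\<lambda>_. borel :: real measure))"
      using i by measurable
    have ind1: "indep_var borel \<eta> borel ?D" and ind2: "indep_var borel \<eta> borel (\<lambda>\<omega>. (?D \<omega>)\<^sup>2)"
      using increment_indep[OF su(1) lt su(3) eta(1) Y(1)] increment_indep[OF su(1) lt su(3) eta(1) Y(2)] i by simp_all
    show ?thesis
      using indep_var_integrable[OF ind1 eta(2) 1] indep_var_lebesgue_integral[OF ind1 eta(2) 1]
        indep_var_integrable[OF ind2 eta(2) 3] indep_var_lebesgue_integral[OF ind2 eta(2) 3] 2 4 by simp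
  qed simp
  then show "integrable M (\<lambda>\<omega>. \<eta> \<omega> * (f i u \<omega> - f i s \<omega>))"
    "expectation (\<lambda>\<omega>. \<eta> \<omega> * (f i u \<omega> - f i s \<omega>)) = 0"
    "integrable M (\<lambda>\<omega>. \<eta> \<omega> * (f i u \<omega> - f i s \<omega>)\<^sup>2)"
    "expectation (\<lambda>\<omega>. \<eta> \<omega> * (f i u \<omega> - f i s \<omega>)\<^sup>2) = expectation \<eta> * (u - s)" by blast+
qed

text \<open>Induction on the number of increments.  Up to the earliest end point \<open>v0\<close> all of them run in
  parallel and form a vector independent of the past; after \<open>v0\<close> one increment has ended and the
  remaining ones restart at \<open>v0\<close>.\<close>

lemma moment_generating_family:
  fixes c :: "'b \<Rightarrow> real" and k :: "'b \<Rightarrow> nat" and v :: "'b \<Rightarrow> real"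
  assumes "finite A" "0 \<le> s" "\<eta> \<in> borel_measurable (F s)" "integrable M \<eta>" "s \<le> T"
    and "\<And>a. a \<in> A \<Longrightarrow> k a \<in> {1..m} \<and> s \<le> v a \<and> v a \<le> T"
  shows "integrable M (\<lambda>\<omega>. \<eta> \<omega> * exp (\<Sum>a\<in>A. c a * (f (k a) (v a) \<omega> - f (k a) s \<omega>))) \<and>
    expectation (\<lambda>\<omega>. \<eta> \<omega> * exp (\<Sum>a\<in>A. c a * (f (k a) (v a) \<omega> - f (k a) s \<omega>))) =
    expectation \<eta> * exp ((\<Sum>a\<in>A. \<Sum>b\<in>A. c a * c b * of_bool (k a = k b) * (min (v a) (v b) - s)) / 2)"
  using assms
proof (induction "card A" arbitrary: A s \<eta>)
  case 0
  then show ?case by simp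
next
  case (Suc n)
  note fin = Suc.prems(1)
  from Suc.hyps(2) have ne: "A \<noteq> {}" by auto
  define v0 where "v0 = Min (v ` A)"
  have "v0 \<in> v ` A" unfolding v0_def using ne fin by (intro Min_in) auto
  then obtain a0 where a0: "a0 \<in> A" "v a0 = v0" by auto
  have le: "v0 \<le> v a" if "a \<in> A" for a unfolding v0_def using that fin by auto
  have v0: "s \<le> v0" "v0 \<le> T" using Suc.prems(6)[OF a0(1)] a0 by auto
  define A' where "A' = A - {a0}"
  have A': "finite A'" "a0 \<notin> A'" "A = insert a0 A'" "card A' = n"
    using a0 fin Suc.hyps(2) by (auto simp: A'_def)
  define C where "C i = (\<Sum>a\<in>A. c a * of_bool (k a = i))" for i
  define \<eta>' where "\<eta>' \<omega> = \<eta> \<omega> * exp (\<Sum>i\<in>{1..m}. C i * (f i v0 \<omega> - f i s \<omega>))" for \<omega>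
  have split_k: "(\<Sum>i\<in>{1..m}. of_bool (k a = i) * g i) = (g (k a) :: real)" if "a \<in> A" for a and g :: "nat \<Rightarrow> real"
  proof -
    have "(\<Sum>i\<in>{1..m}. of_bool (k a = i) * g i) = (\<Sum>i\<in>{1..m}. if k a = i then g i else 0)"
      by (intro sum.cong) auto
    then show ?thesis using Suc.prems(6)[OF that] by simp
  qed
  have "(\<Sum>i\<in>{1..m}. C i * g i) = (\<Sum>a\<in>A. c a * g (k a))" for g :: "nat \<Rightarrow> real"
  proof -
    have "(\<Sum>i\<in>{1..m}. C i * g i) = (\<Sum>i\<in>{1..m}. \<Sum>a\<in>A. c a * (of_bool (k a = i) * g i))"
      unfolding C_def by (simp add: sum_distrib_right mult.assoc)
    also have "\<dots> = (\<Sum>a\<in>A. c a * (\<Sum>i\<in>{1..m}. of_bool (k a = i) * g i))"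
      unfolding sum_distrib_left by (rule sum.swap)
    finally show ?thesis using split_k by simp
  qed
  note C_sum = this
  have Csq: "(\<Sum>i\<in>{1..m}. (C i)\<^sup>2) = (\<Sum>a\<in>A. \<Sum>b\<in>A. c a * c b * of_bool (k a = k b))"
  proof -
    have "(\<Sum>i\<in>{1..m}. (C i)\<^sup>2) = (\<Sum>a\<in>A. c a * C (k a))"
      using C_sum[of C] by (simp add: power2_eq_square)
    then show ?thesis unfolding C_def
      by (simp add: sum_distrib_left mult.assoc eq_commute[of "k _" "k _"])
  qed
  have eta': "\<eta>' \<in> borel_measurable (F v0)"
    unfolding \<eta>'_def
    using Suc.prems v0
    by (intro borel_measurable_times borel_measurable_exp[THEN measurable_compose[rotated]] borel_measurable_sum
        borel_measurable_diff f_adapted F_mono[OF _ _ _ Suc.prems(3)] borel_measurable_const) auto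
  have eta'_int: "integrable M \<eta>'" and eta'_E: "expectation \<eta>' = expectation \<eta> * exp ((\<Sum>i\<in>{1..m}. (C i)\<^sup>2) * (v0 - s) / 2)"
    using increment_exp_past[OF Suc.prems(2) v0 Suc.prems(3,4), of C]
    unfolding \<eta>'_def by (simp_all add: sum_distrib_right sum_divide_distrib)
  have IH: "integrable M (\<lambda>\<omega>. \<eta>' \<omega> * exp (\<Sum>a\<in>A'. c a * (f (k a) (v a) \<omega> - f (k a) v0 \<omega>))) \<and>
    expectation (\<lambda>\<omega>. \<eta>' \<omega> * exp (\<Sum>a\<in>A'. c a * (f (k a) (v a) \<omega> - f (k a) v0 \<omega>))) =
    expectation \<eta>' * exp ((\<Sum>a\<in>A'. \<Sum>b\<in>A'. c a * c b * of_bool (k a = k b) * (min (v a) (v b) - v0)) / 2)"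
    using Suc.prems v0 A' le by (intro Suc.hyps(1) eta' eta'_int) auto
  have exponent: "(\<Sum>a\<in>A. c a * (f (k a) (v a) \<omega> - f (k a) s \<omega>)) =
    (\<Sum>i\<in>{1..m}. C i * (f i v0 \<omega> - f i s \<omega>)) + (\<Sum>a\<in>A'. c a * (f (k a) (v a) \<omega> - f (k a) v0 \<omega>))" for \<omega>
  proof -
    have "(\<Sum>a\<in>A. c a * (f (k a) (v a) \<omega> - f (k a) s \<omega>)) =
      (\<Sum>a\<in>A. c a * (f (k a) v0 \<omega> - f (k a) s \<omega>)) + (\<Sum>a\<in>A. c a * (f (k a) (v a) \<omega> - f (k a) v0 \<omega>))"
      by (simp add: algebra_simps flip: sum.distrib)
    then show ?thesis using C_sum A' a0 by simp
  qed
  have variance: "(\<Sum>a\<in>A. \<Sum>b\<in>A. c a * c b * of_bool (k a = k b) * (min (v a) (v b) - s)) =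
    (\<Sum>i\<in>{1..m}. (C i)\<^sup>2) * (v0 - s) + (\<Sum>a\<in>A'. \<Sum>b\<in>A'. c a * c b * of_bool (k a = k b) * (min (v a) (v b) - v0))"
  proof -
    have "(\<Sum>a\<in>A. \<Sum>b\<in>A. c a * c b * of_bool (k a = k b) * (min (v a) (v b) - s)) =
      (\<Sum>a\<in>A. \<Sum>b\<in>A. c a * c b * of_bool (k a = k b)) * (v0 - s)
      + (\<Sum>a\<in>A. \<Sum>b\<in>A. c a * c b * of_bool (k a = k b) * (min (v a) (v b) - v0))"
      unfolding sum_distrib_right sum.distrib[symmetric]
      by (intro sum.cong refl) (simp add: algebra_simps)
    also have "(\<Sum>a\<in>A. \<Sum>b\<in>A. c a * c b * of_bool (k a = k b) * (min (v a) (v b) - v0)) =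
      (\<Sum>a\<in>A'. \<Sum>b\<in>A'. c a * c b * of_bool (k a = k b) * (min (v a) (v b) - v0))"
      using A' a0 le by (simp add: min_absorb1 min_absorb2)
    finally show ?thesis by (simp only: Csq)
  qed
  have rew: "\<eta> \<omega> * exp (\<Sum>a\<in>A. c a * (f (k a) (v a) \<omega> - f (k a) s \<omega>)) =
    \<eta>' \<omega> * exp (\<Sum>a\<in>A'. c a * (f (k a) (v a) \<omega> - f (k a) v0 \<omega>))" for \<omega>
    unfolding exponent \<eta>'_def by (simp add: exp_add)
  show ?case
    unfolding rew variance using IH by (simp add: eta'_E exp_add add_divide_distrib)
qed

subsection \<open>Linear functionals of the Wiener process\<close>

text \<open>A list of triples \<open>(c, i, v)\<close> stands for the step function with value in \<open>\<real>\<^sup>m\<close> that is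
  the sum of the jumps \<open>c e\<^sub>i 1\<^bsub>[s,v)\<^esub>\<close>; concatenation of lists is addition.\<close>

definition valid_from :: "real \<Rightarrow> (real \<times> nat \<times> real) list \<Rightarrow> bool" where
  "valid_from s h \<longleftrightarrow> (\<forall>(c, i, v)\<in>set h. i \<in> {1..m} \<and> s \<le> v \<and> v \<le> T)"

abbreviation valid :: "(real \<times> nat \<times> real) list \<Rightarrow> bool" where
  "valid \<equiv> valid_from t"

definition gsum :: "real \<Rightarrow> (real \<times> nat \<times> real) list \<Rightarrow> 'a \<Rightarrow> real" where
  "gsum s h \<omega> = (\<Sum>(c, i, v)\<leftarrow>h. c * (f i v \<omega> - f i s \<omega>))"

abbreviation G :: "(real \<times> nat \<times> real) list \<Rightarrow> 'a \<Rightarrow> real" where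
  "G \<equiv> gsum t"

definition covariance :: "real \<Rightarrow> (real \<times> nat \<times> real) list \<Rightarrow> (real \<times> nat \<times> real) list \<Rightarrow> real" where
  "covariance s h h' = (\<Sum>(c, i, v)\<leftarrow>h. \<Sum>(c', i', v')\<leftarrow>h'. c * c' * of_bool (i = i') * (min v v' - s))"

definition scale :: "real \<Rightarrow> (real \<times> nat \<times> real) list \<Rightarrow> (real \<times> nat \<times> real) list" where
  "scale r h = map (\<lambda>(c, i, v). (r * c, i, v)) h"

lemma valid_simps [simp]:
  "valid_from s []" "valid_from s (a # h) \<longleftrightarrow> fst (snd a) \<in> {1..m} \<and> s \<le> snd (snd a) \<and> snd (snd a) \<le> T \<and> valid_from s h"
  "valid_from s (h @ h') \<longleftrightarrow> valid_from s h \<and> valid_from s h'"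
  "valid_from s h \<Longrightarrow> valid_from s (scale r h)"
proof -
  show "valid_from s (h @ h') \<longleftrightarrow> valid_from s h \<and> valid_from s h'"
    unfolding valid_from_def set_append ball_Un by (rule refl)
  show "valid_from s (a # h) \<longleftrightarrow> fst (snd a) \<in> {1..m} \<and> s \<le> snd (snd a) \<and> snd (snd a) \<le> T \<and> valid_from s h"
    unfolding valid_from_def by (cases a) simp
  show "valid_from s h \<Longrightarrow> valid_from s (scale r h)"
    unfolding valid_from_def scale_def by (simp add: case_prod_unfold)
qed (simp add: valid_from_def)

lemma gsum_simps [simp]:
  "gsum s [] \<omega> = 0" "gsum s ((c, i, v) # h) \<omega> = c * (f i v \<omega> - f i s \<omega>) + gsum s h \<omega>"
  "gsum s (h @ h') \<omega> = gsum s h \<omega> + gsum s h' \<omega>"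
  by (simp_all add: gsum_def)

lemma gsum_scale [simp]: "gsum s (scale r h) \<omega> = r * gsum s h \<omega>"
  by (induction h) (auto simp: scale_def algebra_simps)

lemma covariance_simps [simp]:
  "covariance s [] h = 0" "covariance s h [] = 0"
  "covariance s (h @ h') g = covariance s h g + covariance s h' g"
  "covariance s g (h @ h') = covariance s g h + covariance s g h'"
  by (simp_all add: covariance_def case_prod_unfold sum_list_addf)

lemma covariance_Cons:
  "covariance s (a # h) g = covariance s [a] g + covariance s h g"
  "covariance s g (a # h) = covariance s g [a] + covariance s g h"
  using covariance_simps(3)[of s "[a]" h g] covariance_simps(4)[of s g "[a]" h] by simp_all

lemma covariance_commute: "covariance s g h = covariance s h g"
proof -
  have *: "covariance s [a] h = covariance s h [a]" for a
  proof (induction h)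
    case (Cons b h)
    have "covariance s [a] [b] = covariance s [b] [a]"
      by (auto simp: covariance_def case_prod_unfold mult.commute min.commute)
    then show ?case
      using Cons covariance_Cons(1)[of s b h "[a]"] covariance_Cons(2)[of s "[a]" b h] by simp
  qed simp
  show ?thesis
  proof (induction g)
    case (Cons a g)
    then show ?case
      using * covariance_Cons(1)[of s a g h] covariance_Cons(2)[of s h a g] by simp
  qed simp
qed

lemma gsum_adapted:
  assumes "valid_from s h" "0 \<le> s" "s \<le> T"
  shows "gsum s h \<in> borel_measurable M"
  using assms(1)
proof (induction h)
  case (Cons a h)
  obtain c i v where a: "a = (c, i, v)" by (cases a) auto
  have "f i v \<in> borel_measurable M" "f i s \<in> borel_measurable M" "gsum s h \<in> borel_measurable M"
    using Cons assms(2,3) f_measurable[of i v] f_measurable[of i s] by (auto simp: a)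
  then have "(\<lambda>\<omega>. c * (f i v \<omega> - f i s \<omega>) + gsum s h \<omega>) \<in> borel_measurable M" by measurable
  then show ?case by (simp add: a cong: measurable_cong)
qed (simp cong: measurable_cong)

lemma G_measurable: "valid h \<Longrightarrow> G h \<in> borel_measurable M"
  using gsum_adapted t_nonneg t_less by simp

lemma sum_list_map_nth: "sum_list (map g xs) = (\<Sum>a<length xs. g (xs ! a))"
  by (simp add: sum_list_sum_nth atLeast0LessThan)

lemma moment_generating:
  assumes "0 \<le> s" "s \<le> T" "valid_from s h" "\<eta> \<in> borel_measurable (F s)" "integrable M \<eta>"
  shows "integrable M (\<lambda>\<omega>. \<eta> \<omega> * exp (gsum s h \<omega>))"
    "expectation (\<lambda>\<omega>. \<eta> \<omega> * exp (gsum s h \<omega>)) = expectation \<eta> * exp (covariance s h h / 2)"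
proof -
  have val: "fst (snd (h ! a)) \<in> {1..m} \<and> s \<le> snd (snd (h ! a)) \<and> snd (snd (h ! a)) \<le> T" if "a \<in> {..<length h}" for a
  proof -
    have "h ! a \<in> set h" using that by simp
    then show ?thesis using assms(3) by (force simp: valid_from_def case_prod_unfold)
  qed
  have *: "integrable M (\<lambda>\<omega>. \<eta> \<omega> * exp (\<Sum>a<length h. fst (h ! a) * (f (fst (snd (h ! a))) (snd (snd (h ! a))) \<omega> - f (fst (snd (h ! a))) s \<omega>))) \<and>
    expectation (\<lambda>\<omega>. \<eta> \<omega> * exp (\<Sum>a<length h. fst (h ! a) * (f (fst (snd (h ! a))) (snd (snd (h ! a))) \<omega> - f (fst (snd (h ! a))) s \<omega>))) =
    expectation \<eta> * exp ((\<Sum>a<length h. \<Sum>b<length h. fst (h ! a) * fst (h ! b) * of_bool (fst (snd (h ! a)) = fst (snd (h ! b))) * (min (snd (snd (h ! a))) (snd (snd (h ! b))) - s)) / 2)"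
    by (rule moment_generating_family[OF _ assms(1,4,5,2)]) (use val in auto)
  then show "integrable M (\<lambda>\<omega>. \<eta> \<omega> * exp (gsum s h \<omega>))"
    "expectation (\<lambda>\<omega>. \<eta> \<omega> * exp (gsum s h \<omega>)) = expectation \<eta> * exp (covariance s h h / 2)"
    by (simp_all add: gsum_def covariance_def case_prod_unfold sum_list_map_nth)
qed

end

section \<open>Gaussian variables and their exponentials\<close>

lemma sequential_derivative:
  fixes g :: "real \<Rightarrow> real"
  assumes "(g has_real_derivative D) (at 0)"
  shows "(\<lambda>n. real (Suc n) * (g (1 / real (Suc n)) - g 0)) \<longlonglongrightarrow> D"
proof -
  have *: "((\<lambda>h. (g h - g 0) / h) \<longlongrightarrow> D) (at 0)"
    using assms by (simp add: DERIV_def)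
  have "filterlim (\<lambda>n. 1 / real (Suc n)) (at 0) sequentially"
    using LIMSEQ_inverse_real_of_nat by (intro filterlim_atI) (auto simp: inverse_eq_divide)
  from filterlim_compose[OF * this] show ?thesis by (simp add: mult.commute)
qed

lemma ennreal_squeeze:
  fixes a b :: "nat \<Rightarrow> ennreal"
  assumes "\<And>n. a n \<le> b n" "b \<longlonglongrightarrow> 0"
  shows "a \<longlonglongrightarrow> 0"
  by (rule tendsto_sandwich[OF _ _ tendsto_const assms(2)]) (use assms(1) in auto)

lemma exp_diff_sq: "(exp x - exp y)\<^sup>2 = exp (x + x) + exp (y + y) - 2 * exp (x + y :: real)"
  unfolding exp_add power2_eq_square by (simp add: algebra_simps)

lemma exp_difference_quotient_bound:
  assumes "1 \<le> N"
  shows "\<bar>N * (exp (y / N) - 1) - y\<bar> \<le> 2 * (exp (2 * y) + exp (- (2 * y :: real)))"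
proof -
  have abs1: "\<bar>exp z - 1\<bar> \<le> \<bar>z\<bar> * exp \<bar>z\<bar>" for z :: real
  proof (cases "0 \<le> z")
    case True
    have "1 - z \<le> exp (- z)" using exp_ge_add_one_self[of "- z"] by simp
    then have "exp z * (1 - z) \<le> exp z * exp (- z)" by (intro mult_left_mono) auto
    then have "exp z - 1 \<le> z * exp z" by (simp add: exp_minus field_simps)
    then show ?thesis using True by simp
  next
    case False
    then have "1 - exp z \<le> - z" using exp_ge_add_one_self[of z] by linarith
    also have "- z \<le> - z * exp \<bar>z\<bar>" using False by (simp add: mult_le_cancel_left1)
    finally show ?thesis using False by simp
  qed
  have N: "0 < N" using assms by simp
  have le: "\<bar>y\<bar> \<le> exp \<bar>y\<bar>" using exp_ge_add_one_self[of "\<bar>y\<bar>"] by linarith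
  have "\<bar>N * (exp (y / N) - 1)\<bar> = N * \<bar>exp (y / N) - 1\<bar>" using N by (simp add: abs_mult)
  also have "\<dots> \<le> N * (\<bar>y / N\<bar> * exp \<bar>y / N\<bar>)"
    by (rule mult_left_mono[OF abs1]) (use N in simp)
  also have "\<dots> = \<bar>y\<bar> * exp (\<bar>y\<bar> / N)" using N by simp
  also have "\<bar>y\<bar> / N \<le> \<bar>y\<bar>" using assms by (simp add: divide_le_eq mult_le_cancel_left1)
  then have "\<bar>y\<bar> * exp (\<bar>y\<bar> / N) \<le> exp \<bar>y\<bar> * exp \<bar>y\<bar>"
    using le by (intro mult_mono) auto
  finally have 1: "\<bar>N * (exp (y / N) - 1)\<bar> \<le> exp \<bar>y\<bar> * exp \<bar>y\<bar>" .
  have "\<bar>y\<bar> \<le> exp \<bar>y\<bar> * 1" using le by simp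
  also have "\<dots> \<le> exp \<bar>y\<bar> * exp \<bar>y\<bar>" by (intro mult_left_mono) auto
  finally have "\<bar>N * (exp (y / N) - 1) - y\<bar> \<le> 2 * (exp \<bar>y\<bar> * exp \<bar>y\<bar>)"
    using 1 by linarith
  also have "exp \<bar>y\<bar> * exp \<bar>y\<bar> = exp (2 * \<bar>y\<bar>)" by (simp flip: exp_add)
  also have "exp (2 * \<bar>y\<bar>) \<le> exp (2 * y) + exp (- (2 * y))"
    by (cases "0 \<le> y") (simp_all add: abs_if)
  finally show ?thesis by simp
qed

lemma ennreal_quarters: "0 \<le> e \<Longrightarrow> 2 * ennreal (e / 4) + 2 * ennreal (e / 4) = ennreal e"
  by (simp add: mult_2 flip: ennreal_plus)

lemma nsq_cmult:
  assumes "u \<in> borel_measurable N"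
  shows "nsq N (\<lambda>x. c * u x) = ennreal (c\<^sup>2) * nsq N u"
proof -
  have "nsq N (\<lambda>x. c * u x) = (\<integral>\<^sup>+x. ennreal (c\<^sup>2) * ennreal ((u x)\<^sup>2) \<partial>N)"
    unfolding nsq_def by (intro nn_integral_cong) (simp add: power_mult_distrib ennreal_mult)
  also have "\<dots> = ennreal (c\<^sup>2) * nsq N u"
    unfolding nsq_def by (intro nn_integral_cmult) (use assms in measurable)
  finally show ?thesis .
qed

lemma nsq_cmult_diff_le:
  assumes le: "nsq N (\<lambda>x. u x - v x) \<le> ennreal (e / (c\<^sup>2 + 1))"
    and m: "u \<in> borel_measurable N" "v \<in> borel_measurable N" and e: "0 < e"
  shows "nsq N (\<lambda>x. c * u x - c * v x) \<le> ennreal e"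
proof -
  have c1: "0 < c\<^sup>2 + 1" using zero_le_power2[of c] by linarith
  have "nsq N (\<lambda>x. c * u x - c * v x) = ennreal (c\<^sup>2) * nsq N (\<lambda>x. u x - v x)"
    unfolding right_diff_distrib[symmetric] by (rule nsq_cmult) (use m in simp)
  also have "\<dots> \<le> ennreal (c\<^sup>2) * ennreal (e / (c\<^sup>2 + 1))" by (intro mult_left_mono le) simp
  also have "\<dots> = ennreal (c\<^sup>2 * (e / (c\<^sup>2 + 1)))" using e c1 by (intro ennreal_mult[symmetric]) auto
  also have "c\<^sup>2 * (e / (c\<^sup>2 + 1)) \<le> (c\<^sup>2 + 1) * (e / (c\<^sup>2 + 1))"
    using e c1 by (intro mult_right_mono) auto
  also have "(c\<^sup>2 + 1) * (e / (c\<^sup>2 + 1)) = e" using c1 by simp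
  finally show ?thesis by (simp add: ennreal_leI)
qed

lemma nsq_add_diff_le:
  assumes "f \<in> borel_measurable N" "g \<in> borel_measurable N" "f' \<in> borel_measurable N" "g' \<in> borel_measurable N"
    and "nsq N (\<lambda>x. f x - f' x) \<le> ennreal (e / 4)" "nsq N (\<lambda>x. g x - g' x) \<le> ennreal (e / 4)" and e: "0 < e"
  shows "nsq N (\<lambda>x. (f x + g x) - (f' x + g' x)) \<le> ennreal e"
proof -
  have "nsq N (\<lambda>x. (f x + g x) - (f' x + g' x)) = nsq N (\<lambda>x. (f x - f' x) + (g x - g' x))"
    by (simp add: algebra_simps)
  also have "\<dots> \<le> 2 * nsq N (\<lambda>x. f x - f' x) + 2 * nsq N (\<lambda>x. g x - g' x)"
    by (rule nsq_add_le) (use assms in auto)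
  also have "\<dots> \<le> 2 * ennreal (e / 4) + 2 * ennreal (e / 4)"
    by (intro add_mono mult_left_mono assms) auto
  finally show ?thesis using ennreal_quarters[of e] e by simp
qed

context wiener_setting
begin

abbreviation L :: "real measure" where "L \<equiv> lebesgue_on {t..T}"

lemma finite_measure_L: "finite_measure L"
  by (rule finite_measure_lebesgue_on_Icc)

definition step_fun :: "(real \<times> nat \<times> real) list \<Rightarrow> nat \<Rightarrow> real \<Rightarrow> real" where
  "step_fun h i x = (\<Sum>(c, i', v)\<leftarrow>h. c * of_bool (i' = i) * indicator {..<v} x)"

lemma step_fun_simps [simp]:
  "step_fun [] i x = 0"
  "step_fun ((c, i', v) # h) i x = c * of_bool (i' = i) * indicator {..<v} x + step_fun h i x"
  "step_fun (h @ h') i x = step_fun h i x + step_fun h' i x"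
  by (simp_all add: step_fun_def)

lemma step_fun_Cons: "step_fun (b # h) = (\<lambda>i x. step_fun [b] i x + step_fun h i x)"
  by (cases b) (simp add: fun_eq_iff)

lemma step_fun_scale [simp]: "step_fun (scale r h) i x = r * step_fun h i x"
  by (induction h) (auto simp: scale_def algebra_simps)

lemma square_integrable_step_fun: "square_integrable L (step_fun h i)"
proof (induction h)
  case Nil
  have "step_fun [] i = (\<lambda>x. 0)" by (simp add: fun_eq_iff)
  then show ?case by simp
next
  case (Cons a h)
  interpret finite_measure L by (rule finite_measure_L)
  obtain c i' v where a: "a = (c, i', v)" by (cases a) auto
  have "square_integrable L (\<lambda>x. c * of_bool (i' = i) * indicator {..<v} x)"
    unfolding square_integrable_def
  proof
    show m: "(\<lambda>x. c * of_bool (i' = i) * indicator {..<v} x) \<in> borel_measurable L"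
      by (intro measurable_restrict_space1 borel_measurable_times borel_measurable_const borel_measurable_indicator) simp
    show "integrable L (\<lambda>x. (c * of_bool (i' = i) * indicator {..<v} x)\<^sup>2)"
      by (rule integrable_const_bound[where B = "c\<^sup>2"])
         (simp_all add: AE_I2 borel_measurable_power[OF m] split: split_indicator)
  qed
  from square_integrable_add[OF this Cons] show ?case unfolding a step_fun_simps[abs_def] .
qed

definition inner_K :: "(nat \<Rightarrow> real \<Rightarrow> real) \<Rightarrow> (nat \<Rightarrow> real \<Rightarrow> real) \<Rightarrow> real" where
  "inner_K H K = (\<Sum>i\<in>{1..m}. \<integral>x. H i x * K i x \<partial>L)"

lemma inner_K_commute: "inner_K H K = inner_K K H"
  by (simp add: inner_K_def mult.commute)

lemma inner_K_cmult: "inner_K (\<lambda>i x. c * H i x) K = c * inner_K H K"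
  by (simp add: inner_K_def sum_distrib_left mult.assoc)

lemma inner_K_add:
  assumes "\<And>i. i \<in> {1..m} \<Longrightarrow> square_integrable L (H i)" "\<And>i. i \<in> {1..m} \<Longrightarrow> square_integrable L (H' i)"
    "\<And>i. i \<in> {1..m} \<Longrightarrow> square_integrable L (K i)"
  shows "inner_K (\<lambda>i x. H i x + H' i x) K = inner_K H K + inner_K H' K"
proof -
  have "(\<integral>x. (H i x + H' i x) * K i x \<partial>L) = (\<integral>x. H i x * K i x \<partial>L) + (\<integral>x. H' i x * K i x \<partial>L)"
    if "i \<in> {1..m}" for i
    using square_integrable_mult[OF assms(1,3)[OF that]] square_integrable_mult[OF assms(2,3)[OF that]]
    by (simp add: distrib_right)
  then show ?thesis unfolding inner_K_def by (simp add: sum.distrib)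
qed

lemma covariance_eq_inner:
  assumes "valid h" "valid h'"
  shows "covariance t h h' = inner_K (step_fun h) (step_fun h')"
proof -
  have single: "covariance t [(c, k, v)] [(c', k', v')] = inner_K (step_fun [(c, k, v)]) (step_fun [(c', k', v')])"
    if v: "k \<in> {1..m}" "t \<le> v" "v \<le> T" "k' \<in> {1..m}" "t \<le> v'" "v' \<le> T" for c k v c' k' v'
  proof -
    have "(\<integral>x. indicator {..<v} x * indicator {..<v'} x \<partial>L) = min v v' - t"
    proof -
      have "(\<integral>x. indicator {..<v} x * indicator {..<v'} x \<partial>L) = (\<integral>x. (indicator {t..T} x * indicator {..<min v v'} x :: real) \<partial>lebesgue)"
        by (subst integral_restrict_space) (auto intro!: Bochner_Integration.integral_cong split: split_indicator)
      also have "\<dots> = (\<integral>x. indicator {t..<min v v'} x \<partial>lebesgue)"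
        using v by (intro Bochner_Integration.integral_cong refl) (auto split: split_indicator)
      also have "\<dots> = min v v' - t" using v by simp
      finally show ?thesis .
    qed
    note int = this
    have "(\<integral>x. step_fun [(c, k, v)] i x * step_fun [(c', k', v')] i x \<partial>L) =
        c * c' * of_bool (k = k') * (if k = i then min v v' - t else 0)" for i
    proof -
      have "(\<integral>x. step_fun [(c, k, v)] i x * step_fun [(c', k', v')] i x \<partial>L) =
        (\<integral>x. (c * c' * of_bool (k = i) * of_bool (k' = i)) * (indicator {..<v} x * indicator {..<v'} x) \<partial>L)"
        by (simp add: mult_ac)
      then show ?thesis unfolding integral_mult_right_zero int by auto
    qed
    then show ?thesis using v by (simp add: inner_K_def covariance_def flip: sum_distrib_left)
  qed
  have one: "covariance t [a] h' = inner_K (step_fun [a]) (step_fun h')" if "valid [a]" for a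
    using assms(2)
  proof (induction h')
    case (Cons b h')
    have "inner_K (step_fun [a]) (step_fun (b # h')) = inner_K (step_fun [a]) (step_fun [b]) + inner_K (step_fun [a]) (step_fun h')"
      unfolding step_fun_Cons[of b h'] inner_K_commute[of "step_fun [a]"]
      by (rule inner_K_add) (rule square_integrable_step_fun)+
    moreover have "covariance t [a] [b] = inner_K (step_fun [a]) (step_fun [b])"
      using that Cons.prems by (cases a; cases b) (simp only:, rule single, auto)
    ultimately show ?case using Cons covariance_Cons(2)[of t "[a]" b h'] by simp
  qed (simp add: inner_K_def)
  show ?thesis using assms(1)
  proof (induction h)
    case (Cons a h)
    have "inner_K (step_fun (a # h)) (step_fun h') = inner_K (step_fun [a]) (step_fun h') + inner_K (step_fun h) (step_fun h')"
      unfolding step_fun_Cons[of a h]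
      by (rule inner_K_add) (rule square_integrable_step_fun)+
    then show ?case using Cons one[of a] covariance_Cons(1)[of t a h h'] by simp
  qed (simp add: inner_K_def)
qed

lemma exp_G_expectation:
  assumes "valid h"
  shows "integrable M (\<lambda>\<omega>. exp (G h \<omega>))" "expectation (\<lambda>\<omega>. exp (G h \<omega>)) = exp (covariance t h h / 2)"
proof -
  have i: "integrable M (\<lambda>_. 1 :: real)" and e: "expectation (\<lambda>_. 1) = (1 :: real)" by (simp_all add: prob_space)
  note mg = moment_generating[OF t_nonneg less_imp_le[OF t_less] assms borel_measurable_const i]
  show "integrable M (\<lambda>\<omega>. exp (G h \<omega>))" using mg(1) by (simp only: mult_1)
  show "expectation (\<lambda>\<omega>. exp (G h \<omega>)) = exp (covariance t h h / 2)"
    using mg(2) unfolding e by (simp only: mult_1)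
qed

lemma exp_G_square_integrable: "valid h \<Longrightarrow> square_integrable M (\<lambda>\<omega>. exp (G h \<omega>))"
  using exp_G_expectation(1)[of "h @ h"] measurable_compose[OF G_measurable[of h] borel_measurable_exp]
  by (simp add: square_integrable_def power2_eq_square flip: exp_add)

text \<open>The closure, in mean square, of the pairs formed by the Gaussian variable of a step function
  and the step function itself.  It contains the Wiener integrals of all square integrable
  functions.\<close>

definition gauss :: "('a \<Rightarrow> real) \<Rightarrow> (nat \<Rightarrow> real \<Rightarrow> real) \<Rightarrow> bool" where
  "gauss X H \<longleftrightarrow> X \<in> borel_measurable M \<and> (\<forall>i\<in>{1..m}. square_integrable L (H i)) \<and>
     (\<forall>e>0. \<exists>h. valid h \<and> nsq M (\<lambda>\<omega>. G h \<omega> - X \<omega>) \<le> ennreal e \<and>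
        (\<forall>i\<in>{1..m}. nsq L (\<lambda>x. step_fun h i x - H i x) \<le> ennreal e))"

lemma gauss_measurable: "gauss X H \<Longrightarrow> X \<in> borel_measurable M"
  by (simp add: gauss_def)

lemma gauss_kernel: "gauss X H \<Longrightarrow> i \<in> {1..m} \<Longrightarrow> square_integrable L (H i)"
  by (simp add: gauss_def)

lemma gauss_G: "valid h \<Longrightarrow> gauss (G h) (step_fun h)"
  unfolding gauss_def using G_measurable square_integrable_step_fun
  by (auto simp: nsq_def intro!: exI[of _ h])

lemma gauss_zero: "gauss (\<lambda>_. 0) (\<lambda>_ _. 0)"
  unfolding gauss_def by (auto simp: nsq_def intro!: exI[of _ "[]"])

lemma gauss_cmult:
  assumes "gauss X H"
  shows "gauss (\<lambda>\<omega>. c * X \<omega>) (\<lambda>i x. c * H i x)"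
  unfolding gauss_def
proof (intro conjI ballI allI impI)
  show "(\<lambda>\<omega>. c * X \<omega>) \<in> borel_measurable M" using gauss_measurable[OF assms] by simp
  show "square_integrable L (\<lambda>x. c * H i x)" if "i \<in> {1..m}" for i
    by (intro square_integrable_cmult gauss_kernel[OF assms that])
  fix e :: real assume e: "0 < e"
  have "0 < e / (c\<^sup>2 + 1)" using e zero_le_power2[of c] by (intro divide_pos_pos) linarith+
  then obtain h where h: "valid h" "nsq M (\<lambda>\<omega>. G h \<omega> - X \<omega>) \<le> ennreal (e / (c\<^sup>2 + 1))"
    "\<And>i. i \<in> {1..m} \<Longrightarrow> nsq L (\<lambda>x. step_fun h i x - H i x) \<le> ennreal (e / (c\<^sup>2 + 1))"
    using assms unfolding gauss_def by blast
  show "\<exists>h. valid h \<and> nsq M (\<lambda>\<omega>. G h \<omega> - c * X \<omega>) \<le> ennreal e \<and>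
        (\<forall>i\<in>{1..m}. nsq L (\<lambda>x. step_fun h i x - c * H i x) \<le> ennreal e)"
  proof (intro exI[of _ "scale c h"] conjI ballI)
    show "nsq M (\<lambda>\<omega>. G (scale c h) \<omega> - c * X \<omega>) \<le> ennreal e"
      unfolding gsum_scale by (rule nsq_cmult_diff_le[OF h(2) G_measurable[OF h(1)] gauss_measurable[OF assms] e])
    show "nsq L (\<lambda>x. step_fun (scale c h) i x - c * H i x) \<le> ennreal e" if i: "i \<in> {1..m}" for i
      unfolding step_fun_scale
      by (rule nsq_cmult_diff_le[OF h(3)[OF i] square_integrable_measurable[OF square_integrable_step_fun]
            square_integrable_measurable[OF gauss_kernel[OF assms i]] e])
  qed (simp add: h)
qed

lemma gauss_add:
  assumes "gauss X H" "gauss Y K"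
  shows "gauss (\<lambda>\<omega>. X \<omega> + Y \<omega>) (\<lambda>i x. H i x + K i x)"
  unfolding gauss_def
proof (intro conjI ballI allI impI)
  note mX = gauss_measurable[OF assms(1)] and mY = gauss_measurable[OF assms(2)]
  show "(\<lambda>\<omega>. X \<omega> + Y \<omega>) \<in> borel_measurable M" using mX mY by simp
  show "square_integrable L (\<lambda>x. H i x + K i x)" if "i \<in> {1..m}" for i
    by (intro square_integrable_add gauss_kernel[OF assms(1) that] gauss_kernel[OF assms(2) that])
  fix e :: real assume e: "0 < e"
  then have e4: "0 < e / 4" by simp
  obtain h where h: "valid h" "nsq M (\<lambda>\<omega>. G h \<omega> - X \<omega>) \<le> ennreal (e / 4)"
    "\<And>i. i \<in> {1..m} \<Longrightarrow> nsq L (\<lambda>x. step_fun h i x - H i x) \<le> ennreal (e / 4)"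
    using assms(1) e4 unfolding gauss_def by blast
  obtain k where k: "valid k" "nsq M (\<lambda>\<omega>. G k \<omega> - Y \<omega>) \<le> ennreal (e / 4)"
    "\<And>i. i \<in> {1..m} \<Longrightarrow> nsq L (\<lambda>x. step_fun k i x - K i x) \<le> ennreal (e / 4)"
    using assms(2) e4 unfolding gauss_def by blast
  show "\<exists>h. valid h \<and> nsq M (\<lambda>\<omega>. G h \<omega> - (X \<omega> + Y \<omega>)) \<le> ennreal e \<and>
        (\<forall>i\<in>{1..m}. nsq L (\<lambda>x. step_fun h i x - (H i x + K i x)) \<le> ennreal e)"
  proof (intro exI[of _ "h @ k"] conjI ballI)
    show "nsq M (\<lambda>\<omega>. G (h @ k) \<omega> - (X \<omega> + Y \<omega>)) \<le> ennreal e"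
      unfolding gsum_simps by (rule nsq_add_diff_le[OF G_measurable[OF h(1)] G_measurable[OF k(1)] mX mY h(2) k(2) e])
    show "nsq L (\<lambda>x. step_fun (h @ k) i x - (H i x + K i x)) \<le> ennreal e" if i: "i \<in> {1..m}" for i
      unfolding step_fun_simps
      by (rule nsq_add_diff_le[OF _ _ _ _ h(3)[OF i] k(3)[OF i] e])
         (auto intro!: square_integrable_measurable square_integrable_step_fun gauss_kernel[OF assms(1) i] gauss_kernel[OF assms(2) i])
  qed (simp add: h k)
qed

lemma gauss_sequence:
  assumes "gauss X H"
  obtains h where "\<And>n. valid (h n)" "\<And>n. nsq M (\<lambda>\<omega>. G (h n) \<omega> - X \<omega>) \<le> ennreal (1 * (1/4)^n)"
    "\<And>i. i \<in> {1..m} \<Longrightarrow> (\<lambda>n. nsq L (\<lambda>x. step_fun (h n) i x - H i x)) \<longlonglongrightarrow> 0"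
proof -
  have "\<exists>h. valid h \<and> nsq M (\<lambda>\<omega>. G h \<omega> - X \<omega>) \<le> ennreal (1 * (1/4)^n) \<and>
        (\<forall>i\<in>{1..m}. nsq L (\<lambda>x. step_fun h i x - H i x) \<le> ennreal (1 * (1/4)^n))" for n :: nat
    using assms unfolding gauss_def by simp
  then obtain h where h: "\<And>n. valid (h n)" "\<And>n. nsq M (\<lambda>\<omega>. G (h n) \<omega> - X \<omega>) \<le> ennreal (1 * (1/4)^n)"
    "\<And>n i. i \<in> {1..m} \<Longrightarrow> nsq L (\<lambda>x. step_fun (h n) i x - H i x) \<le> ennreal (1 * (1/4)^n)"
    by metis
  have "(\<lambda>n. nsq L (\<lambda>x. step_fun (h n) i x - H i x)) \<longlonglongrightarrow> 0" if "i \<in> {1..m}" for i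
  proof (rule tendsto_sandwich[OF _ _ tendsto_const])
    have "(\<lambda>n. (1/4::real)^n) \<longlonglongrightarrow> 0" by (intro LIMSEQ_realpow_zero) auto
    then have "(\<lambda>n. ennreal (1 * (1/4)^n)) \<longlonglongrightarrow> ennreal 0" by (intro tendsto_ennrealI) simp
    then show "(\<lambda>n. ennreal (1 * (1/4)^n)) \<longlonglongrightarrow> 0" by simp
  qed (use h(3)[OF that] in auto)
  then show ?thesis using h that by blast
qed

lemma inner_K_limit:
  assumes "\<And>n i. i \<in> {1..m} \<Longrightarrow> square_integrable L (Hn n i)" "\<And>i. i \<in> {1..m} \<Longrightarrow> square_integrable L (H i)"
    "\<And>i. i \<in> {1..m} \<Longrightarrow> (\<lambda>n. nsq L (\<lambda>x. Hn n i x - H i x)) \<longlonglongrightarrow> 0"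
  shows "(\<And>i. i \<in> {1..m} \<Longrightarrow> square_integrable L (K i)) \<Longrightarrow> (\<lambda>n. inner_K (Hn n) K) \<longlonglongrightarrow> inner_K H K"
    "(\<lambda>n. inner_K (Hn n) (Hn n)) \<longlonglongrightarrow> inner_K H H"
  unfolding inner_K_def using assms
  by (auto intro!: tendsto_sum integral_mult_limit square_integrable_measurable
      integral_sq_limit[unfolded power2_eq_square])

text \<open>The exponentials of an approximating sequence form a Cauchy sequence in mean square, because
  their mutual distances are determined by the inner products of the step functions.  Fatou's
  lemma identifies the limit.\<close>

lemma gauss_exp_approx:
  assumes X: "gauss X H" and h: "\<And>n. valid (h n)" "\<And>n. nsq M (\<lambda>\<omega>. G (h n) \<omega> - X \<omega>) \<le> ennreal (1 * (1/4)^n)"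
    "\<And>i. i \<in> {1..m} \<Longrightarrow> (\<lambda>n. nsq L (\<lambda>x. step_fun (h n) i x - H i x)) \<longlonglongrightarrow> 0"
  shows "(\<lambda>n. nsq M (\<lambda>\<omega>. exp (G (h n) \<omega>) - exp (X \<omega>))) \<longlonglongrightarrow> 0"
proof -
  have mX [measurable]: "X \<in> borel_measurable M" by (rule gauss_measurable[OF X])
  have mG [measurable]: "G (h n) \<in> borel_measurable M" for n by (rule G_measurable[OF h(1)])
  define I where "I n l = covariance t (h n) (h l)" for n l
  define J where "J n = inner_K H (step_fun (h n))" for n
  define S where "S = inner_K H H"
  have conv: "AE \<omega> in M. (\<lambda>n. G (h n) \<omega>) \<longlonglongrightarrow> X \<omega>"
    by (rule AE_tendsto_fast[OF mG mX h(2)]) auto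
  have Inn: "(\<lambda>n. I n n) \<longlonglongrightarrow> S"
    unfolding I_def S_def covariance_eq_inner[OF h(1) h(1)]
    by (rule inner_K_limit(2)) (auto intro!: square_integrable_step_fun gauss_kernel[OF X] h(3))
  have Inl: "(\<lambda>l. I l n) \<longlonglongrightarrow> J n" for n
    unfolding I_def J_def covariance_eq_inner[OF h(1) h(1)]
    by (rule inner_K_limit(1)) (auto intro!: square_integrable_step_fun gauss_kernel[OF X] h(3))
  have J: "J \<longlonglongrightarrow> S"
  proof -
    have "(\<lambda>n. inner_K (step_fun (h n)) H) \<longlonglongrightarrow> inner_K H H"
      by (rule inner_K_limit(1)) (auto intro!: square_integrable_step_fun gauss_kernel[OF X] h(3))
    moreover have "J = (\<lambda>n. inner_K (step_fun (h n)) H)"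
      unfolding J_def by (intro ext inner_K_commute)
    ultimately show ?thesis unfolding S_def by simp
  qed
  define \<delta> where "\<delta> n l = exp (2 * I l l) + exp (2 * I n n) - 2 * exp ((I l l + I n n) / 2 + I l n)" for n l
  have dist: "nsq M (\<lambda>\<omega>. exp (G (h l) \<omega>) - exp (G (h n) \<omega>)) = ennreal (\<delta> n l)" for n l
  proof -
    have si: "square_integrable M (\<lambda>\<omega>. exp (G (h l) \<omega>) - exp (G (h n) \<omega>))"
      by (intro square_integrable_diff exp_G_square_integrable h(1))
    have "expectation (\<lambda>\<omega>. (exp (G (h l) \<omega>) - exp (G (h n) \<omega>))\<^sup>2) =
      expectation (\<lambda>\<omega>. exp (G (h l @ h l) \<omega>) + exp (G (h n @ h n) \<omega>) - 2 * exp (G (h l @ h n) \<omega>))"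
      by (simp only: gsum_simps exp_diff_sq)
    also have "\<dots> = exp (covariance t (h l @ h l) (h l @ h l) / 2) + exp (covariance t (h n @ h n) (h n @ h n) / 2)
       - 2 * exp (covariance t (h l @ h n) (h l @ h n) / 2)"
      using exp_G_expectation[of "h l @ h l"] exp_G_expectation[of "h n @ h n"] exp_G_expectation[of "h l @ h n"] h(1)
      by (simp del: gsum_simps covariance_simps)
    also have "\<dots> = \<delta> n l"
      unfolding \<delta>_def I_def by (simp add: covariance_commute[of t "h n" "h l"] add_divide_distrib)
    finally show ?thesis using nsq_eq_integral[OF si] by simp
  qed
  define \<epsilon> where "\<epsilon> n = exp (2 * S) + exp (2 * I n n) - 2 * exp ((S + I n n) / 2 + J n)" for n
  have bound: "nsq M (\<lambda>\<omega>. exp (G (h n) \<omega>) - exp (X \<omega>)) \<le> ennreal (\<epsilon> n)" for n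
    unfolding nsq_commute[of M "\<lambda>\<omega>. exp (G (h n) \<omega>)"]
  proof (rule nsq_Fatou_lim[where f = "\<lambda>l \<omega>. exp (G (h l) \<omega>) - exp (G (h n) \<omega>)"])
    show "AE \<omega> in M. (\<lambda>l. exp (G (h l) \<omega>) - exp (G (h n) \<omega>)) \<longlonglongrightarrow> exp (X \<omega>) - exp (G (h n) \<omega>)"
      using conv by eventually_elim (intro tendsto_intros)
    show "(\<lambda>l. nsq M (\<lambda>\<omega>. exp (G (h l) \<omega>) - exp (G (h n) \<omega>))) \<longlonglongrightarrow> ennreal (\<epsilon> n)"
      unfolding dist \<delta>_def \<epsilon>_def by (intro tendsto_ennrealI tendsto_intros Inn Inl) simp
  qed measurable
  have "\<epsilon> \<longlonglongrightarrow> exp (2 * S) + exp (2 * S) - 2 * exp ((S + S) / 2 + S)"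
    unfolding \<epsilon>_def by (intro tendsto_intros Inn J) simp
  moreover have "(S + S) / 2 + S = 2 * S" by simp
  then have "exp (2 * S) + exp (2 * S) - 2 * exp ((S + S) / 2 + S) = 0" by (simp only: mult_2 diff_self)
  ultimately have "\<epsilon> \<longlonglongrightarrow> 0" by (simp only:)
  from tendsto_ennrealI[OF this] have "(\<lambda>n. ennreal (\<epsilon> n)) \<longlonglongrightarrow> 0" by (simp only: ennreal_0)
  then show ?thesis by (rule ennreal_squeeze[OF bound])
qed

lemma gauss_exp:
  assumes X: "gauss X H"
  shows "square_integrable M (\<lambda>\<omega>. exp (X \<omega>))" "expectation (\<lambda>\<omega>. exp (X \<omega>)) = exp (inner_K H H / 2)"
proof -
  obtain h where h: "\<And>n. valid (h n)" "\<And>n. nsq M (\<lambda>\<omega>. G (h n) \<omega> - X \<omega>) \<le> ennreal (1 * (1/4)^n)"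
    "\<And>i. i \<in> {1..m} \<Longrightarrow> (\<lambda>n. nsq L (\<lambda>x. step_fun (h n) i x - H i x)) \<longlonglongrightarrow> 0"
    using gauss_sequence[OF X] by blast
  note lim = gauss_exp_approx[OF X h]
  have [measurable]: "X \<in> borel_measurable M" by (rule gauss_measurable[OF X])
  note si = exp_G_square_integrable[OF h(1)]
  show "square_integrable M (\<lambda>\<omega>. exp (X \<omega>))"
    by (rule square_integrable_limit[OF si _ lim]) measurable
  have "square_integrable M (\<lambda>_. 1)" by (simp add: square_integrable_def)
  from integral_mult_limit[OF si _ lim this]
  have "(\<lambda>n. expectation (\<lambda>\<omega>. exp (G (h n) \<omega>))) \<longlonglongrightarrow> expectation (\<lambda>\<omega>. exp (X \<omega>))" by simp
  moreover have "(\<lambda>n. expectation (\<lambda>\<omega>. exp (G (h n) \<omega>))) \<longlonglongrightarrow> exp (inner_K H H / 2)"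
    unfolding exp_G_expectation(2)[OF h(1)] covariance_eq_inner[OF h(1) h(1)]
    by (intro tendsto_intros inner_K_limit(2)) (auto intro!: square_integrable_step_fun gauss_kernel[OF X] h(3))
  ultimately show "expectation (\<lambda>\<omega>. exp (X \<omega>)) = exp (inner_K H H / 2)" by (rule LIMSEQ_unique)
qed

subsection \<open>The closed span of the exponentials\<close>

definition exp_sum :: "(real \<times> (real \<times> nat \<times> real) list) list \<Rightarrow> 'a \<Rightarrow> real" where
  "exp_sum l \<omega> = (\<Sum>(a, h)\<leftarrow>l. a * exp (G h \<omega>))"

definition exp_span :: "('a \<Rightarrow> real) \<Rightarrow> bool" where
  "exp_span X \<longleftrightarrow> X \<in> borel_measurable M \<and>
     (\<forall>e>0. \<exists>l. (\<forall>(a, h)\<in>set l. valid h) \<and> nsq M (\<lambda>\<omega>. exp_sum l \<omega> - X \<omega>) \<le> ennreal e)"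

lemma exp_sum_square_integrable:
  assumes "\<forall>(a, h)\<in>set l. valid h"
  shows "square_integrable M (exp_sum l)"
  unfolding exp_sum_def[abs_def]
  using assms by (intro square_integrable_sum_list) (auto intro!: square_integrable_cmult exp_G_square_integrable)

lemma exp_span_measurable: "exp_span X \<Longrightarrow> X \<in> borel_measurable M"
  by (simp add: exp_span_def)

lemma exp_span_limit:
  assumes X: "\<And>n::nat. exp_span (X n)" and Y: "Y \<in> borel_measurable M"
    and lim: "(\<lambda>n. nsq M (\<lambda>\<omega>. X n \<omega> - Y \<omega>)) \<longlonglongrightarrow> 0"
  shows "exp_span Y"
  unfolding exp_span_def
proof (intro conjI allI impI Y)
  fix e :: real assume e: "0 < e"
  then have e4: "0 < e / 4" by simp
  have "eventually (\<lambda>n. nsq M (\<lambda>\<omega>. X n \<omega> - Y \<omega>) < ennreal (e / 4)) sequentially"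
    using e by (intro order_tendstoD(2)[OF lim]) auto
  then obtain n where n: "nsq M (\<lambda>\<omega>. X n \<omega> - Y \<omega>) < ennreal (e / 4)"
    by (auto simp: eventually_sequentially)
  obtain l where l: "\<forall>(a, h)\<in>set l. valid h" "nsq M (\<lambda>\<omega>. exp_sum l \<omega> - X n \<omega>) \<le> ennreal (e / 4)"
    using X[of n] e4 unfolding exp_span_def by blast
  have "nsq M (\<lambda>\<omega>. exp_sum l \<omega> - Y \<omega>) \<le> 2 * nsq M (\<lambda>\<omega>. exp_sum l \<omega> - X n \<omega>) + 2 * nsq M (\<lambda>\<omega>. X n \<omega> - Y \<omega>)"
    by (rule nsq_diff_le[OF square_integrable_measurable[OF exp_sum_square_integrable[OF l(1)]] exp_span_measurable[OF X] Y])
  also have "\<dots> \<le> 2 * ennreal (e / 4) + 2 * ennreal (e / 4)"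
    using l n by (intro add_mono mult_left_mono) auto
  finally have "nsq M (\<lambda>\<omega>. exp_sum l \<omega> - Y \<omega>) \<le> ennreal e" using ennreal_quarters[of e] e by simp
  then show "\<exists>l. (\<forall>(a, h)\<in>set l. valid h) \<and> nsq M (\<lambda>\<omega>. exp_sum l \<omega> - Y \<omega>) \<le> ennreal e"
    using l by blast
qed

lemma exp_span_add:
  assumes "exp_span X" "exp_span Y"
  shows "exp_span (\<lambda>\<omega>. X \<omega> + Y \<omega>)"
  unfolding exp_span_def
proof (intro conjI allI impI)
  note m = exp_span_measurable[OF assms(1)] exp_span_measurable[OF assms(2)]
  show "(\<lambda>\<omega>. X \<omega> + Y \<omega>) \<in> borel_measurable M" using m by simp
  fix e :: real assume e: "0 < e"
  then have e4: "0 < e / 4" by simp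
  obtain l where l: "\<forall>(a, h)\<in>set l. valid h" "nsq M (\<lambda>\<omega>. exp_sum l \<omega> - X \<omega>) \<le> ennreal (e / 4)"
    using assms(1) e4 unfolding exp_span_def by blast
  obtain k where k: "\<forall>(a, h)\<in>set k. valid h" "nsq M (\<lambda>\<omega>. exp_sum k \<omega> - Y \<omega>) \<le> ennreal (e / 4)"
    using assms(2) e4 unfolding exp_span_def by blast
  have "nsq M (\<lambda>\<omega>. exp_sum (l @ k) \<omega> - (X \<omega> + Y \<omega>)) \<le> ennreal e"
    using nsq_add_diff_le[OF square_integrable_measurable[OF exp_sum_square_integrable[OF l(1)]]
        square_integrable_measurable[OF exp_sum_square_integrable[OF k(1)]] m l(2) k(2) e]
    by (simp add: exp_sum_def)
  then show "\<exists>l. (\<forall>(a, h)\<in>set l. valid h) \<and> nsq M (\<lambda>\<omega>. exp_sum l \<omega> - (X \<omega> + Y \<omega>)) \<le> ennreal e"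
    using l(1) k(1) by (intro exI[of _ "l @ k"]) auto
qed

end

section \<open>Pairings and Gaussian integration by parts\<close>

definition pairings :: "nat set \<Rightarrow> nat set set set" where
  "pairings A = {P. (\<forall>B\<in>P. B \<subseteq> A \<and> card B = 2) \<and> disjoint P}"

lemma finite_pairings: "finite A \<Longrightarrow> finite (pairings A)"
  by (rule finite_subset[of _ "Pow (Pow A)"]) (auto simp: pairings_def)

lemma finite_pairing: "finite A \<Longrightarrow> P \<in> pairings A \<Longrightarrow> finite P"
  by (rule finite_subset[of _ "Pow A"]) (auto simp: pairings_def)

lemma pairings_empty: "pairings {} = {{}}"
  by (auto simp: pairings_def)

lemma pairings_remove: "pairings (A - {q}) = {P \<in> pairings A. q \<notin> \<Union>P}"
  by (auto simp: pairings_def)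

text \<open>A new point is either left unpaired or paired with some \<open>q\<close>.\<close>

lemma pairings_insert:
  assumes x: "x \<notin> A"
  shows "pairings (insert x A) = pairings A \<union> (\<Union>q\<in>A. insert {x, q} ` pairings (A - {q}))"
proof (intro equalityI subsetI)
  fix P assume P: "P \<in> pairings (insert x A)"
  show "P \<in> pairings A \<union> (\<Union>q\<in>A. insert {x, q} ` pairings (A - {q}))"
  proof (cases "x \<in> \<Union>P")
    case False
    then show ?thesis using P by (auto simp: pairings_def)
  next
    case True
    then obtain B where B: "B \<in> P" "x \<in> B" by blast
    then have "card B = 2" "B \<subseteq> insert x A" using P by (auto simp: pairings_def)
    then obtain q where q: "B = {x, q}" "q \<noteq> x"
      using B(2) by (auto simp: card_2_iff)
    then have qA: "q \<in> A" using \<open>B \<subseteq> insert x A\<close> by auto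
    have disj: "C \<inter> B = {}" if "C \<in> P" "C \<noteq> B" for C
      using P B(1) that by (auto simp: pairings_def disjoint_def)
    have "P - {B} \<in> pairings (A - {q})"
    proof -
      have "C \<subseteq> A - {q} \<and> card C = 2" if "C \<in> P - {B}" for C
        using disj[of C] that P q by (auto simp: pairings_def)
      moreover have "disjoint (P - {B})" using P by (auto simp: pairings_def disjoint_def)
      ultimately show ?thesis unfolding pairings_def by blast
    qed
    moreover have "P = insert {x, q} (P - {B})" using B q by auto
    ultimately show ?thesis using qA by blast
  qed
next
  fix P assume "P \<in> pairings A \<union> (\<Union>q\<in>A. insert {x, q} ` pairings (A - {q}))"
  then consider "P \<in> pairings A" | q Q where "q \<in> A" "P = insert {x, q} Q" "Q \<in> pairings (A - {q})" by blast
  then show "P \<in> pairings (insert x A)"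
  proof cases
    case 1 then show ?thesis by (auto simp: pairings_def)
  next
    case 2
    have "x \<noteq> q" using 2(1) x by auto
    have dj: "{x, q} \<inter> C = {}" if "C \<in> Q" for C using 2(3) that x by (auto simp: pairings_def)
    have "disjoint Q" using 2(3) by (simp add: pairings_def)
    then have "disjoint (insert {x, q} Q)"
      using dj unfolding pairwise_insert disjnt_def by (metis Int_commute)
    moreover have "\<forall>B\<in>insert {x, q} Q. B \<subseteq> insert x A \<and> card B = 2"
      using 2 \<open>x \<noteq> q\<close> by (auto simp: pairings_def)
    ultimately show ?thesis unfolding pairings_def 2(2) by blast
  qed
qed

text \<open>If \<open>\<Phi> S\<close> obeys the recursion of Gaussian moments, in which a factor \<open>x\<close> contributes its mean
  \<open>b x\<close> or is contracted with another factor \<open>q\<close>, then the alternating sum over pairings removes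
  all contractions: those of the new point \<open>x\<close> cancel against the pairings that contain \<open>x\<close>.\<close>

lemma alternating_pairing_sum:
  fixes c :: "nat set \<Rightarrow> real" and b :: "nat \<Rightarrow> real" and \<Phi> :: "nat set \<Rightarrow> real"
  assumes "finite A"
    and "\<And>x S. x \<in> A \<Longrightarrow> S \<subseteq> A - {x} \<Longrightarrow> \<Phi> (insert x S) = b x * \<Phi> S + (\<Sum>q\<in>S. c {x, q} * \<Phi> (S - {q}))"
  shows "(\<Sum>P\<in>pairings A. (-1) ^ card P * (\<Prod>B\<in>P. c B) * \<Phi> (A - \<Union>P)) = (\<Prod>l\<in>A. b l) * \<Phi> {}"
  using assms
proof (induction A rule: finite_induct)
  case empty
  then show ?case by (simp add: pairings_empty)
next
  case (insert x A)
  define T where "T P = (-1) ^ card P * (\<Prod>B\<in>P. c B)" for P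
  note fin = finite_pairings[OF insert.hyps(1)]
  have IH: "(\<Sum>P\<in>pairings A. T P * \<Phi> (A - \<Union>P)) = (\<Prod>l\<in>A. b l) * \<Phi> {}"
    unfolding T_def using insert.hyps(2) by (intro insert.IH insert.prems) auto
  have unpaired: "\<Phi> (insert x A - \<Union>P) = b x * \<Phi> (A - \<Union>P) + (\<Sum>q\<in>A - \<Union>P. c {x, q} * \<Phi> (A - {q} - \<Union>P))"
    if "P \<in> pairings A" for P
  proof -
    have "x \<notin> \<Union>P" using that insert.hyps(2) by (auto simp: pairings_def)
    then have "insert x A - \<Union>P = insert x (A - \<Union>P)" by auto
    moreover have "A - \<Union>P - {q} = A - {q} - \<Union>P" for q by auto
    ultimately show ?thesis using insert.prems[of x "A - \<Union>P"] insert.hyps(2) by (auto simp: insert_Diff_if)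
  qed
  have paired: "T (insert {x, q} P) * \<Phi> (insert x A - \<Union>(insert {x, q} P)) = - (T P * (c {x, q} * \<Phi> (A - {q} - \<Union>P)))"
    if "q \<in> A" "P \<in> pairings (A - {q})" for q P
  proof -
    have "{x, q} \<notin> P" using that insert.hyps(2) by (auto simp: pairings_def)
    moreover have "finite P" using finite_pairing[OF _ that(2)] insert.hyps(1) by simp
    moreover have "insert x A - \<Union>(insert {x, q} P) = A - {q} - \<Union>P"
      using insert.hyps(2) by auto
    ultimately show ?thesis by (simp add: T_def)
  qed
  have swap: "(\<Sum>P\<in>pairings A. \<Sum>q\<in>A - \<Union>P. T P * (c {x, q} * \<Phi> (A - {q} - \<Union>P))) =
    (\<Sum>q\<in>A. \<Sum>P\<in>pairings (A - {q}). T P * (c {x, q} * \<Phi> (A - {q} - \<Union>P)))"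
  proof -
    have "A - \<Union>P = {q \<in> A. q \<notin> \<Union>P}" for P by auto
    then show ?thesis
      unfolding pairings_remove using sum.swap_restrict[OF fin insert.hyps(1)] by simp
  qed
  have disj1: "pairings A \<inter> (\<Union>q\<in>A. insert {x, q} ` pairings (A - {q})) = {}"
    using insert.hyps(2) by (auto simp: pairings_def)
  have disj2: "insert {x, q} ` pairings (A - {q}) \<inter> insert {x, q'} ` pairings (A - {q'}) = {}"
    if "q \<in> A" "q' \<in> A" "q \<noteq> q'" for q q'
  proof -
    have False if P: "P \<in> pairings (A - {q})" "P' \<in> pairings (A - {q'})" "insert {x, q} P = insert {x, q'} P'" for P P'
    proof -
      have "{x, q} \<in> insert {x, q'} P'" using P(3) by blast
      moreover have "{x, q} \<noteq> {x, q'}" using \<open>q \<noteq> q'\<close> by (auto simp: doubleton_eq_iff)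
      ultimately have "{x, q} \<in> P'" by blast
      then show False using P(2) insert.hyps(2) by (auto simp: pairings_def)
    qed
    then show ?thesis by blast
  qed
  have inj: "inj_on (insert {x, q}) (pairings (A - {q}))" if "q \<in> A" for q
  proof (rule inj_onI)
    fix P Q assume *: "P \<in> pairings (A - {q})" "Q \<in> pairings (A - {q})" "insert {x, q} P = insert {x, q} Q"
    have "{x, q} \<notin> P" "{x, q} \<notin> Q" using *(1,2) insert.hyps(2) by (auto simp: pairings_def)
    then show "P = Q" using *(3) by (rule insert_ident[THEN iffD1])
  qed
  have "(\<Sum>P\<in>pairings (insert x A). T P * \<Phi> (insert x A - \<Union>P)) =
    (\<Sum>P\<in>pairings A. T P * \<Phi> (insert x A - \<Union>P)) +
    (\<Sum>q\<in>A. \<Sum>P\<in>insert {x, q} ` pairings (A - {q}). T P * \<Phi> (insert x A - \<Union>P))"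
    unfolding pairings_insert[OF insert.hyps(2)]
  proof (subst sum.union_disjoint[OF fin _ disj1])
    have fin': "finite (insert {x, q} ` pairings (A - {q}))" for q
      using finite_pairings[of "A - {q}"] insert.hyps(1) by simp
    show "finite (\<Union>q\<in>A. insert {x, q} ` pairings (A - {q}))"
      using insert.hyps(1) fin' by blast
    have "(\<Sum>P\<in>(\<Union>q\<in>A. insert {x, q} ` pairings (A - {q})). T P * \<Phi> (insert x A - \<Union>P)) =
        (\<Sum>q\<in>A. \<Sum>P\<in>insert {x, q} ` pairings (A - {q}). T P * \<Phi> (insert x A - \<Union>P))"
      by (rule sum.UNION_disjoint[OF insert.hyps(1)]; intro ballI impI; (rule fin' | rule disj2, assumption+))
    then show "(\<Sum>P\<in>pairings A. T P * \<Phi> (insert x A - \<Union>P)) +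
        (\<Sum>P\<in>(\<Union>q\<in>A. insert {x, q} ` pairings (A - {q})). T P * \<Phi> (insert x A - \<Union>P)) =
      (\<Sum>P\<in>pairings A. T P * \<Phi> (insert x A - \<Union>P)) +
        (\<Sum>q\<in>A. \<Sum>P\<in>insert {x, q} ` pairings (A - {q}). T P * \<Phi> (insert x A - \<Union>P))"
      by (simp only:)
  qed
  also have "(\<Sum>q\<in>A. \<Sum>P\<in>insert {x, q} ` pairings (A - {q}). T P * \<Phi> (insert x A - \<Union>P)) =
    (\<Sum>q\<in>A. \<Sum>P\<in>pairings (A - {q}). - (T P * (c {x, q} * \<Phi> (A - {q} - \<Union>P))))"
  proof (rule sum.cong[OF refl])
    fix q assume q: "q \<in> A"
    show "(\<Sum>P\<in>insert {x, q} ` pairings (A - {q}). T P * \<Phi> (insert x A - \<Union>P)) =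
      (\<Sum>P\<in>pairings (A - {q}). - (T P * (c {x, q} * \<Phi> (A - {q} - \<Union>P))))"
      unfolding sum.reindex[OF inj[OF q]] comp_def by (rule sum.cong[OF refl paired[OF q]])
  qed
  also have "(\<Sum>P\<in>pairings A. T P * \<Phi> (insert x A - \<Union>P)) =
     b x * (\<Sum>P\<in>pairings A. T P * \<Phi> (A - \<Union>P)) +
     (\<Sum>P\<in>pairings A. \<Sum>q\<in>A - \<Union>P. T P * (c {x, q} * \<Phi> (A - {q} - \<Union>P)))"
    unfolding sum_distrib_left sum.distrib[symmetric]
    by (intro sum.cong refl) (simp add: unpaired sum_distrib_left algebra_simps)
  finally show ?case
    unfolding swap IH using insert.hyps by (simp add: T_def sum_negf)
qed

lemma tendsto_of_scaled_difference:
  fixes a :: "nat \<Rightarrow> real"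
  assumes "(\<lambda>n. real (Suc n) * (a n - b)) \<longlonglongrightarrow> D"
  shows "a \<longlonglongrightarrow> b"
proof -
  have "(\<lambda>n. inverse (real (Suc n)) * (real (Suc n) * (a n - b))) \<longlonglongrightarrow> 0 * D"
    by (intro tendsto_mult LIMSEQ_inverse_real_of_nat assms)
  then have "(\<lambda>n. a n - b) \<longlonglongrightarrow> 0" by (simp add: mult.assoc[symmetric] del: of_nat_Suc)
  then show ?thesis by (simp add: LIM_zero_iff)
qed

context wiener_setting
begin

lemma exp_span_cmult:
  assumes "exp_span X"
  shows "exp_span (\<lambda>\<omega>. c * X \<omega>)"
  unfolding exp_span_def
proof (intro conjI allI impI)
  note m = exp_span_measurable[OF assms]
  show "(\<lambda>\<omega>. c * X \<omega>) \<in> borel_measurable M" using m by simp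
  fix e :: real assume e: "0 < e"
  have "0 < e / (c\<^sup>2 + 1)" using e zero_le_power2[of c] by (intro divide_pos_pos) linarith+
  then obtain l where l: "\<forall>(a, h)\<in>set l. valid h" "nsq M (\<lambda>\<omega>. exp_sum l \<omega> - X \<omega>) \<le> ennreal (e / (c\<^sup>2 + 1))"
    using assms unfolding exp_span_def by blast
  define l' where "l' = map (\<lambda>(a, h). (c * a, h)) l"
  have eq: "exp_sum l' \<omega> = c * exp_sum l \<omega>" for \<omega>
    unfolding l'_def exp_sum_def by (induction l) (auto simp: algebra_simps)
  have "nsq M (\<lambda>\<omega>. exp_sum l' \<omega> - c * X \<omega>) \<le> ennreal e"
    unfolding eq
    by (rule nsq_cmult_diff_le[OF l(2) square_integrable_measurable[OF exp_sum_square_integrable[OF l(1)]] m e])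
  moreover have "\<forall>(a, h)\<in>set l'. valid h" using l(1) by (auto simp: l'_def)
  ultimately show "\<exists>l. (\<forall>(a, h)\<in>set l. valid h) \<and> nsq M (\<lambda>\<omega>. exp_sum l \<omega> - c * X \<omega>) \<le> ennreal e" by blast
qed

lemma exp_span_gauss_exp:
  assumes X: "gauss X H"
  shows "exp_span (\<lambda>\<omega>. exp (X \<omega>))"
proof -
  obtain h where h: "\<And>n. valid (h n)" "\<And>n. nsq M (\<lambda>\<omega>. G (h n) \<omega> - X \<omega>) \<le> ennreal (1 * (1/4)^n)"
    "\<And>i. i \<in> {1..m} \<Longrightarrow> (\<lambda>n. nsq L (\<lambda>x. step_fun (h n) i x - H i x)) \<longlonglongrightarrow> 0"
    using gauss_sequence[OF X] by blast
  have "exp_span (\<lambda>\<omega>. exp (G (h n) \<omega>))" for n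
    unfolding exp_span_def
    using square_integrable_measurable[OF exp_G_square_integrable[OF h(1)]] h(1)
    by (auto intro!: exI[of _ "[(1, h n)]"] simp: exp_sum_def nsq_def)
  then show ?thesis
    by (rule exp_span_limit[OF _ _ gauss_exp_approx[OF X h]])
       (rule square_integrable_measurable[OF gauss_exp(1)[OF X]])
qed

text \<open>Variables such as polynomials in Gaussian variables, whose products with exponentials stay
  in the closed span of the exponentials.\<close>

definition exp_multiplier :: "('a \<Rightarrow> real) \<Rightarrow> bool" where
  "exp_multiplier Z \<longleftrightarrow> (\<forall>X H. gauss X H \<longrightarrow>
     square_integrable M (\<lambda>\<omega>. Z \<omega> * exp (X \<omega>)) \<and> exp_span (\<lambda>\<omega>. Z \<omega> * exp (X \<omega>)))"

lemma exp_multiplierD: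
  assumes "exp_multiplier Z" "gauss X H"
  shows "square_integrable M (\<lambda>\<omega>. Z \<omega> * exp (X \<omega>))" "exp_span (\<lambda>\<omega>. Z \<omega> * exp (X \<omega>))"
  using assms unfolding exp_multiplier_def by blast+

lemma exp_multiplier_base:
  assumes "exp_multiplier Z"
  shows "square_integrable M Z" "exp_span Z"
  using exp_multiplierD[OF assms gauss_zero] by simp_all

lemma exp_multiplier_const: "exp_multiplier (\<lambda>_. c)"
  unfolding exp_multiplier_def
  using gauss_exp(1) exp_span_gauss_exp by (auto intro!: square_integrable_cmult exp_span_cmult)

lemma exp_multiplier_add: "exp_multiplier Y \<Longrightarrow> exp_multiplier Z \<Longrightarrow> exp_multiplier (\<lambda>\<omega>. Y \<omega> + Z \<omega>)"
  unfolding exp_multiplier_def distrib_right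
  by (intro allI impI conjI square_integrable_add exp_span_add; blast)

lemma exp_multiplier_cmult: "exp_multiplier Z \<Longrightarrow> exp_multiplier (\<lambda>\<omega>. c * Z \<omega>)"
  unfolding exp_multiplier_def mult.assoc
  by (intro allI impI conjI square_integrable_cmult exp_span_cmult; blast)

text \<open>The difference quotients of \<open>\<epsilon> \<mapsto> Z exp (X + \<epsilon> Y)\<close> at \<open>0\<close> stay in the closed span; they converge in
  mean square because \<open>Z exp (X + 2 Y)\<close> and \<open>Z exp (X - 2 Y)\<close> dominate their error.\<close>

lemma difference_quotient_convergence:
  assumes Z: "exp_multiplier Z" and X: "gauss X H" and Y: "gauss Y K"
  shows "square_integrable M (\<lambda>\<omega>. real (Suc n) * (Z \<omega> * exp (X \<omega> + 1 / real (Suc n) * Y \<omega>) - Z \<omega> * exp (X \<omega>)))"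
    "exp_span (\<lambda>\<omega>. real (Suc n) * (Z \<omega> * exp (X \<omega> + 1 / real (Suc n) * Y \<omega>) - Z \<omega> * exp (X \<omega>)))"
    "(\<lambda>\<omega>. Z \<omega> * Y \<omega> * exp (X \<omega>)) \<in> borel_measurable M"
    "(\<lambda>n. nsq M (\<lambda>\<omega>. real (Suc n) * (Z \<omega> * exp (X \<omega> + 1 / real (Suc n) * Y \<omega>) - Z \<omega> * exp (X \<omega>)) - Z \<omega> * Y \<omega> * exp (X \<omega>))) \<longlonglongrightarrow> 0"
proof -
  have g: "gauss (\<lambda>\<omega>. X \<omega> + c * Y \<omega>) (\<lambda>i x. H i x + c * K i x)" for c
    by (intro gauss_add gauss_cmult X Y)
  show si: "square_integrable M (\<lambda>\<omega>. real (Suc n) * (Z \<omega> * exp (X \<omega> + 1 / real (Suc n) * Y \<omega>) - Z \<omega> * exp (X \<omega>)))" for n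
    by (intro square_integrable_cmult square_integrable_diff exp_multiplierD(1)[OF Z g] exp_multiplierD(1)[OF Z X])
  have "exp_span (\<lambda>\<omega>. Z \<omega> * exp (X \<omega> + c * Y \<omega>) + (-1) * (Z \<omega> * exp (X \<omega>)))" for c
    by (intro exp_span_add exp_span_cmult exp_multiplierD(2)[OF Z g] exp_multiplierD(2)[OF Z X])
  then have "exp_span (\<lambda>\<omega>. Z \<omega> * exp (X \<omega> + c * Y \<omega>) - Z \<omega> * exp (X \<omega>))" for c by simp
  then show "exp_span (\<lambda>\<omega>. real (Suc n) * (Z \<omega> * exp (X \<omega> + 1 / real (Suc n) * Y \<omega>) - Z \<omega> * exp (X \<omega>)))"
    by (rule exp_span_cmult)
  have mZ: "Z \<in> borel_measurable M" by (rule square_integrable_measurable[OF exp_multiplier_base(1)[OF Z]])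
  note mX = gauss_measurable[OF X] and mY = gauss_measurable[OF Y]
  show m: "(\<lambda>\<omega>. Z \<omega> * Y \<omega> * exp (X \<omega>)) \<in> borel_measurable M"
    using mX mY mZ by measurable
  define B where "B \<omega> = 2 * (Z \<omega> * exp (X \<omega> + 2 * Y \<omega>) + Z \<omega> * exp (X \<omega> + (-2) * Y \<omega>))" for \<omega>
  have B: "square_integrable M B"
    unfolding B_def[abs_def] by (intro square_integrable_cmult square_integrable_add exp_multiplierD(1)[OF Z g])
  show "(\<lambda>n. nsq M (\<lambda>\<omega>. real (Suc n) * (Z \<omega> * exp (X \<omega> + 1 / real (Suc n) * Y \<omega>) - Z \<omega> * exp (X \<omega>)) - Z \<omega> * Y \<omega> * exp (X \<omega>))) \<longlonglongrightarrow> 0"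
  proof (rule nsq_dominated_convergence[OF square_integrable_measurable[OF si] m _ _ B])
    have fac: "real (Suc n) * (Z \<omega> * exp (X \<omega> + 1 / real (Suc n) * Y \<omega>) - Z \<omega> * exp (X \<omega>)) =
      Z \<omega> * exp (X \<omega>) * (real (Suc n) * (exp (Y \<omega> / real (Suc n)) - 1))" for n \<omega>
    proof -
      have "exp (X \<omega> + 1 / real (Suc n) * Y \<omega>) = exp (X \<omega>) * exp (Y \<omega> / real (Suc n))" by (simp add: exp_add)
      then show ?thesis by (simp only: right_diff_distrib mult_1_right mult_ac)
    qed
    show "AE \<omega> in M. (\<lambda>n. real (Suc n) * (Z \<omega> * exp (X \<omega> + 1 / real (Suc n) * Y \<omega>) - Z \<omega> * exp (X \<omega>))) \<longlonglongrightarrow> Z \<omega> * Y \<omega> * exp (X \<omega>)"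
    proof (rule AE_I2)
      fix \<omega>
      have "((\<lambda>h. exp (Y \<omega> * h)) has_real_derivative Y \<omega>) (at 0)"
        by (auto intro!: derivative_eq_intros)
      from sequential_derivative[OF this]
      have "(\<lambda>n. Z \<omega> * exp (X \<omega>) * (real (Suc n) * (exp (Y \<omega> / real (Suc n)) - 1))) \<longlonglongrightarrow> Z \<omega> * exp (X \<omega>) * Y \<omega>"
        by (intro tendsto_mult_left) simp
      then show "(\<lambda>n. real (Suc n) * (Z \<omega> * exp (X \<omega> + 1 / real (Suc n) * Y \<omega>) - Z \<omega> * exp (X \<omega>))) \<longlonglongrightarrow> Z \<omega> * Y \<omega> * exp (X \<omega>)"
        unfolding fac by (simp only: mult_ac)
    qed
    show "AE \<omega> in M. \<bar>real (Suc n) * (Z \<omega> * exp (X \<omega> + 1 / real (Suc n) * Y \<omega>) - Z \<omega> * exp (X \<omega>)) - Z \<omega> * Y \<omega> * exp (X \<omega>)\<bar> \<le> \<bar>B \<omega>\<bar>" for n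
    proof (rule AE_I2)
      fix \<omega>
      let ?q = "real (Suc n) * (exp (Y \<omega> / real (Suc n)) - 1) - Y \<omega>"
      let ?b = "2 * (exp (2 * Y \<omega>) + exp (- (2 * Y \<omega>)))"
      have "real (Suc n) * (Z \<omega> * exp (X \<omega> + 1 / real (Suc n) * Y \<omega>) - Z \<omega> * exp (X \<omega>)) - Z \<omega> * Y \<omega> * exp (X \<omega>)
        = Z \<omega> * exp (X \<omega>) * ?q"
        unfolding fac by (simp only: right_diff_distrib mult_ac)
      moreover have "B \<omega> = Z \<omega> * exp (X \<omega>) * ?b"
        unfolding B_def exp_add by (simp add: algebra_simps)
      moreover have "\<bar>?q\<bar> \<le> \<bar>?b\<bar>"
        using exp_difference_quotient_bound[of "real (Suc n)" "Y \<omega>"] by linarith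
      ultimately show "\<bar>real (Suc n) * (Z \<omega> * exp (X \<omega> + 1 / real (Suc n) * Y \<omega>) - Z \<omega> * exp (X \<omega>)) - Z \<omega> * Y \<omega> * exp (X \<omega>)\<bar> \<le> \<bar>B \<omega>\<bar>"
        by (metis abs_mult mult_left_mono abs_ge_zero)
    qed
  qed
qed

text \<open>Multiplication by a Gaussian variable \<open>Y\<close> is differentiation of the exponential along \<open>Y\<close>.\<close>

lemma exp_multiplier_mult:
  assumes Z: "exp_multiplier Z" and Y: "gauss Y K"
  shows "exp_multiplier (\<lambda>\<omega>. Z \<omega> * Y \<omega>)"
  unfolding exp_multiplier_def
proof (intro allI impI conjI)
  fix X H assume X: "gauss X H"
  note dq = difference_quotient_convergence[OF Z X Y]
  show "square_integrable M (\<lambda>\<omega>. Z \<omega> * Y \<omega> * exp (X \<omega>))"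
    by (rule square_integrable_limit[OF dq(1) dq(3) dq(4)])
  show "exp_span (\<lambda>\<omega>. Z \<omega> * Y \<omega> * exp (X \<omega>))"
    by (rule exp_span_limit[OF dq(2) dq(3) dq(4)])
qed

lemma exp_multiplier_prod:
  assumes "finite S" "\<And>q. q \<in> S \<Longrightarrow> gauss (Y q) (K q)"
  shows "exp_multiplier (\<lambda>\<omega>. \<Prod>q\<in>S. Y q \<omega>)"
  using assms
proof (induction S rule: finite_induct)
  case (insert x S)
  have "exp_multiplier (\<lambda>\<omega>. (\<Prod>q\<in>S. Y q \<omega>) * Y x \<omega>)"
    by (rule exp_multiplier_mult[OF insert.IH]) (use insert.prems in auto)
  then show ?case using insert.hyps by (simp add: mult.commute)
qed (simp add: exp_multiplier_const)

lemma multiplier_derivative: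
  assumes Z: "exp_multiplier Z" and X: "gauss X H" and Y: "gauss Y K" and \<eta>: "square_integrable M \<eta>"
  shows "(\<lambda>n. real (Suc n) * (expectation (\<lambda>\<omega>. \<eta> \<omega> * (Z \<omega> * exp (X \<omega> + 1 / real (Suc n) * Y \<omega>)))
       - expectation (\<lambda>\<omega>. \<eta> \<omega> * (Z \<omega> * exp (X \<omega>))))) \<longlonglongrightarrow> expectation (\<lambda>\<omega>. \<eta> \<omega> * (Z \<omega> * Y \<omega> * exp (X \<omega>)))"
proof -
  note dq = difference_quotient_convergence[OF Z X Y]
  have g: "gauss (\<lambda>\<omega>. X \<omega> + c * Y \<omega>) (\<lambda>i x. H i x + c * K i x)" for c
    by (intro gauss_add gauss_cmult X Y)
  have int: "integrable M (\<lambda>\<omega>. \<eta> \<omega> * (Z \<omega> * exp (X \<omega> + c * Y \<omega>)))" "integrable M (\<lambda>\<omega>. \<eta> \<omega> * (Z \<omega> * exp (X \<omega>)))" for c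
    by (intro square_integrable_mult \<eta> exp_multiplierD(1)[OF Z g] exp_multiplierD(1)[OF Z X])+
  have "expectation (\<lambda>\<omega>. real (Suc n) * (Z \<omega> * exp (X \<omega> + 1 / real (Suc n) * Y \<omega>) - Z \<omega> * exp (X \<omega>)) * \<eta> \<omega>)
    = real (Suc n) * (expectation (\<lambda>\<omega>. \<eta> \<omega> * (Z \<omega> * exp (X \<omega> + 1 / real (Suc n) * Y \<omega>)))
       - expectation (\<lambda>\<omega>. \<eta> \<omega> * (Z \<omega> * exp (X \<omega>))))" for n
  proof -
    have "(\<lambda>\<omega>. real (Suc n) * (Z \<omega> * exp (X \<omega> + 1 / real (Suc n) * Y \<omega>) - Z \<omega> * exp (X \<omega>)) * \<eta> \<omega>) =
      (\<lambda>\<omega>. real (Suc n) * (\<eta> \<omega> * (Z \<omega> * exp (X \<omega> + 1 / real (Suc n) * Y \<omega>)) - \<eta> \<omega> * (Z \<omega> * exp (X \<omega>))))"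
      by (simp only: right_diff_distrib left_diff_distrib mult_ac)
    then show ?thesis
      by (simp only: integral_mult_right_zero Bochner_Integration.integral_diff[OF int])
  qed
  then show ?thesis
    using integral_mult_limit[OF dq(1) dq(3) dq(4) \<eta>] by (simp only: mult.commute[of _ "\<eta> _"])
qed

lemma inner_K_add_right:
  assumes "\<And>i. i \<in> {1..m} \<Longrightarrow> square_integrable L (H i)" "\<And>i. i \<in> {1..m} \<Longrightarrow> square_integrable L (K i)"
    "\<And>i. i \<in> {1..m} \<Longrightarrow> square_integrable L (K' i)"
  shows "inner_K H (\<lambda>i x. K i x + c * K' i x) = inner_K H K + c * inner_K H K'"
  using inner_K_add[of K "\<lambda>i x. c * K' i x" H, OF assms(2) square_integrable_cmult[OF assms(3)] assms(1)]
  unfolding inner_K_commute[of H] inner_K_cmult .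

lemma square_integrable_const: "square_integrable M (\<lambda>_. c)"
  by (simp add: square_integrable_def)

text \<open>Gaussian integration by parts.  Both sides are differentiated in the direction of one more
  factor \<open>Y r\<close>, that is, \<open>X\<close> is replaced by \<open>X + \<epsilon> Y r\<close>.\<close>

lemma gauss_integration_by_parts:
  assumes "finite S" "\<And>q. q \<in> S \<Longrightarrow> gauss (Y q) (K q)" "gauss Y0 K0" "gauss X H"
  shows "expectation (\<lambda>\<omega>. (\<Prod>q\<in>S. Y q \<omega>) * Y0 \<omega> * exp (X \<omega>)) =
    inner_K K0 H * expectation (\<lambda>\<omega>. (\<Prod>q\<in>S. Y q \<omega>) * exp (X \<omega>)) +
    (\<Sum>q\<in>S. inner_K K0 (K q) * expectation (\<lambda>\<omega>. (\<Prod>q\<in>S - {q}. Y q \<omega>) * exp (X \<omega>)))"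
  using assms(1,2,4)
proof (induction S arbitrary: X H rule: finite_induct)
  case empty
  note X = empty(2) and Y0 = assms(3)
  have g: "gauss (\<lambda>\<omega>. X \<omega> + c * Y0 \<omega>) (\<lambda>i x. H i x + c * K0 i x)" for c
    by (intro gauss_add gauss_cmult X Y0)
  have gs: "expectation (\<lambda>\<omega>. exp (X \<omega> + c * Y0 \<omega>)) = exp ((inner_K H H + 2 * c * inner_K K0 H + c\<^sup>2 * inner_K K0 K0) / 2)" for c
  proof -
    have k: "\<And>i. i \<in> {1..m} \<Longrightarrow> square_integrable L (H i)" "\<And>i. i \<in> {1..m} \<Longrightarrow> square_integrable L (K0 i)"
      "\<And>i. i \<in> {1..m} \<Longrightarrow> square_integrable L (\<lambda>x. H i x + c * K0 i x)"
      using gauss_kernel[OF X] gauss_kernel[OF Y0] gauss_kernel[OF g] by auto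
    have "inner_K (\<lambda>i x. H i x + c * K0 i x) (\<lambda>i x. H i x + c * K0 i x) =
      inner_K H (\<lambda>i x. H i x + c * K0 i x) + c * inner_K K0 (\<lambda>i x. H i x + c * K0 i x)"
      using inner_K_add_right[OF k(3) k(1) k(2)]
      unfolding inner_K_commute[of H "\<lambda>i x. H i x + c * K0 i x"] inner_K_commute[of K0 "\<lambda>i x. H i x + c * K0 i x"] .
    also have "\<dots> = inner_K H H + 2 * c * inner_K K0 H + c\<^sup>2 * inner_K K0 K0"
    proof -
      have "inner_K H (\<lambda>i x. H i x + c * K0 i x) = inner_K H H + c * inner_K H K0"
        "inner_K K0 (\<lambda>i x. H i x + c * K0 i x) = inner_K K0 H + c * inner_K K0 K0"
        by (rule inner_K_add_right; (rule k(1) | rule k(2)); assumption)+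
      then show ?thesis unfolding inner_K_commute[of H K0] by (simp add: power2_eq_square algebra_simps)
    qed
    finally show ?thesis using gauss_exp(2)[OF g] by simp
  qed
  have "(\<lambda>n. real (Suc n) * (expectation (\<lambda>\<omega>. exp (X \<omega> + 1 / real (Suc n) * Y0 \<omega>)) - expectation (\<lambda>\<omega>. exp (X \<omega>))))
     \<longlonglongrightarrow> expectation (\<lambda>\<omega>. Y0 \<omega> * exp (X \<omega>))"
    using multiplier_derivative[OF exp_multiplier_const[of 1] X Y0 square_integrable_const[of 1]] by simp
  moreover have "(\<lambda>n. real (Suc n) * (expectation (\<lambda>\<omega>. exp (X \<omega> + 1 / real (Suc n) * Y0 \<omega>)) - expectation (\<lambda>\<omega>. exp (X \<omega>))))
     \<longlonglongrightarrow> inner_K K0 H * exp (inner_K H H / 2)"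
  proof -
    have "((\<lambda>c. exp ((inner_K H H + 2 * c * inner_K K0 H + c\<^sup>2 * inner_K K0 K0) / 2)) has_real_derivative
      inner_K K0 H * exp (inner_K H H / 2)) (at 0)"
      by (auto intro!: derivative_eq_intros)
    from sequential_derivative[OF this] show ?thesis
      unfolding gs[of "1 / real (Suc _)"] gs[of 0, simplified] by simp
  qed
  ultimately have "expectation (\<lambda>\<omega>. Y0 \<omega> * exp (X \<omega>)) = inner_K K0 H * exp (inner_K H H / 2)"
    by (rule LIMSEQ_unique)
  then show ?case using gauss_exp(2)[OF X] by simp
next
  case (insert r S)
  note X = insert.prems(2) and Y0 = assms(3)
  have Yr: "gauss (Y r) (K r)" and YS: "\<And>q. q \<in> S \<Longrightarrow> gauss (Y q) (K q)" using insert.prems by auto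
  define A where "A S X = expectation (\<lambda>\<omega>. (\<Prod>q\<in>S. Y q \<omega>) * exp (X \<omega> :: real))" for S X
  define B where "B X = expectation (\<lambda>\<omega>. (\<Prod>q\<in>S. Y q \<omega>) * Y0 \<omega> * exp (X \<omega> :: real))" for X
  define X' where "X' n \<omega> = X \<omega> + 1 / real (Suc n) * Y r \<omega>" for n \<omega>
  have g: "gauss (X' n) (\<lambda>i x. H i x + 1 / real (Suc n) * K r i x)" for n
    unfolding X'_def[abs_def] by (intro gauss_add gauss_cmult X Yr)
  have A_deriv: "(\<lambda>n. real (Suc n) * (A S' (X' n) - A S' X)) \<longlonglongrightarrow> A (insert r S') X" if "S' \<subseteq> S" for S'
  proof -
    have fin: "finite S'" "r \<notin> S'" using that insert.hyps by (auto intro: finite_subset)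
    have "exp_multiplier (\<lambda>\<omega>. \<Prod>q\<in>S'. Y q \<omega>)"
      by (rule exp_multiplier_prod[OF fin(1), where K = K]) (use that YS in auto)
    from multiplier_derivative[OF this X Yr square_integrable_const[of 1]] show ?thesis
      using fin unfolding A_def X'_def by (simp add: mult_ac)
  qed
  have B_deriv: "(\<lambda>n. real (Suc n) * (B (X' n) - B X)) \<longlonglongrightarrow> expectation (\<lambda>\<omega>. (\<Prod>q\<in>insert r S. Y q \<omega>) * Y0 \<omega> * exp (X \<omega>))"
  proof -
    have "exp_multiplier (\<lambda>\<omega>. (\<Prod>q\<in>S. Y q \<omega>) * Y0 \<omega>)"
      by (rule exp_multiplier_mult[OF exp_multiplier_prod[OF insert.hyps(1) YS] Y0])
    from multiplier_derivative[OF this X Yr square_integrable_const[of 1]] show ?thesis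
      using insert.hyps unfolding B_def X'_def by (simp add: mult_ac)
  qed
  have IH: "B X = inner_K K0 H * A S X + (\<Sum>q\<in>S. inner_K K0 (K q) * A (S - {q}) X)"
    unfolding A_def B_def by (rule insert.IH[OF YS X])
  have IH': "B (X' n) = (inner_K K0 H + 1 / real (Suc n) * inner_K K0 (K r)) * A S (X' n) + (\<Sum>q\<in>S. inner_K K0 (K q) * A (S - {q}) (X' n))" for n
  proof -
    have "inner_K K0 (\<lambda>i x. H i x + 1 / real (Suc n) * K r i x) = inner_K K0 H + 1 / real (Suc n) * inner_K K0 (K r)"
      by (rule inner_K_add_right; rule gauss_kernel[OF Y0] gauss_kernel[OF X] gauss_kernel[OF Yr]; assumption)
    moreover have "B (X' n) = inner_K K0 (\<lambda>i x. H i x + 1 / real (Suc n) * K r i x) * A S (X' n)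
        + (\<Sum>q\<in>S. inner_K K0 (K q) * A (S - {q}) (X' n))"
      unfolding A_def B_def by (rule insert.IH[OF YS g])
    ultimately show ?thesis by (simp only:)
  qed
  have eq: "real (Suc n) * (B (X' n) - B X) =
    inner_K K0 H * (real (Suc n) * (A S (X' n) - A S X)) + inner_K K0 (K r) * A S (X' n)
    + (\<Sum>q\<in>S. inner_K K0 (K q) * (real (Suc n) * (A (S - {q}) (X' n) - A (S - {q}) X)))" for n
  proof -
    define N where "N = real (Suc n)"
    have N: "N \<noteq> 0" by (simp add: N_def)
    have sums: "(\<Sum>q\<in>S. inner_K K0 (K q) * (N * (A (S - {q}) (X' n) - A (S - {q}) X))) =
      N * ((\<Sum>q\<in>S. inner_K K0 (K q) * A (S - {q}) (X' n)) - (\<Sum>q\<in>S. inner_K K0 (K q) * A (S - {q}) X))"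
      by (simp add: sum_distrib_left sum_subtractf algebra_simps)
    have "N * (((u + 1 / N * v) * y + z) - (u * y' + z')) = u * (N * (y - y')) + v * y + N * (z - z')" for u v y y' z z'
      using N by (simp add: algebra_simps)
    then show ?thesis unfolding IH IH' N_def[symmetric] sums .
  qed
  have A_lim: "(\<lambda>n. A S (X' n)) \<longlonglongrightarrow> A S X"
    by (rule tendsto_of_scaled_difference[OF A_deriv[OF order_refl]])
  have "(\<lambda>n. real (Suc n) * (B (X' n) - B X)) \<longlonglongrightarrow>
    inner_K K0 H * A (insert r S) X + inner_K K0 (K r) * A S X + (\<Sum>q\<in>S. inner_K K0 (K q) * A (insert r (S - {q})) X)"
    unfolding eq by (intro tendsto_intros tendsto_sum A_deriv A_lim) auto
  from LIMSEQ_unique[OF B_deriv this]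
  have *: "expectation (\<lambda>\<omega>. (\<Prod>q\<in>insert r S. Y q \<omega>) * Y0 \<omega> * exp (X \<omega>)) =
    inner_K K0 H * A (insert r S) X + inner_K K0 (K r) * A S X + (\<Sum>q\<in>S. inner_K K0 (K q) * A (insert r (S - {q})) X)" .
  have "(\<Sum>q\<in>insert r S. inner_K K0 (K q) * A (insert r S - {q}) X) =
    inner_K K0 (K r) * A S X + (\<Sum>q\<in>S. inner_K K0 (K q) * A (insert r (S - {q})) X)"
  proof -
    have "insert r S - {r} = S" "\<And>q. q \<in> S \<Longrightarrow> insert r S - {q} = insert r (S - {q})" using insert.hyps by auto
    then show ?thesis using insert.hyps by simp
  qed
  then show ?case unfolding * A_def[symmetric] by simp
qed

end

section \<open>The transform and the second moment\<close>

text \<open>In the exponential series only the term of order \<open>r\<close> is kept; the others are nonnegative.\<close>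

lemma positive_exponential_form:
  fixes b :: "nat \<Rightarrow> real" and c :: "nat \<Rightarrow> nat \<Rightarrow> real"
  assumes nonneg: "\<And>r. 0 \<le> (\<Sum>n<N. \<Sum>n'<N. b n * b n' * c n n' ^ r)"
  shows "(\<Sum>n<N. \<Sum>n'<N. b n * b n' * c n n' ^ r) \<le> fact r * (\<Sum>n<N. \<Sum>n'<N. b n * b n' * exp (c n n'))"
proof -
  define p where "p r = (\<Sum>n<N. \<Sum>n'<N. b n * b n' * c n n' ^ r) / fact r" for r
  have tm: "(\<lambda>r. b n * b n' * (c n n' ^ r / fact r)) sums (b n * b n' * exp (c n n'))" for n n'
    using exp_converges[of "c n n'"] by (intro sums_mult) (simp add: divide_inverse mult.commute)
  have "(\<lambda>r. \<Sum>n<N. \<Sum>n'<N. b n * b n' * (c n n' ^ r / fact r)) sums (\<Sum>n<N. \<Sum>n'<N. b n * b n' * exp (c n n'))"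
    by (intro sums_sum tm)
  moreover have "(\<lambda>r. \<Sum>n<N. \<Sum>n'<N. b n * b n' * (c n n' ^ r / fact r)) = p"
    by (simp add: p_def fun_eq_iff sum_divide_distrib)
  ultimately have p: "p sums (\<Sum>n<N. \<Sum>n'<N. b n * b n' * exp (c n n'))" by simp
  have "sum p {r} \<le> suminf p"
    by (rule sum_le_suminf[OF sums_summable[OF p]]) (auto simp: p_def nonneg)
  also have "suminf p = (\<Sum>n<N. \<Sum>n'<N. b n * b n' * exp (c n n'))" by (rule sums_unique[OF p, symmetric])
  finally show ?thesis by (simp add: p_def divide_le_eq mult.commute)
qed

lemma integral_double_sum:
  fixes b :: "nat \<Rightarrow> nat \<Rightarrow> real"
  assumes "\<And>n n'. n < N \<Longrightarrow> n' < N \<Longrightarrow> integrable Q (g n n')"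
  shows "(\<integral>x. (\<Sum>n<N. \<Sum>n'<N. b n n' * g n n' x) \<partial>Q) = (\<Sum>n<N. \<Sum>n'<N. b n n' * (\<integral>x. g n n' x \<partial>Q))"
proof -
  have int: "integrable Q (\<lambda>x. b n n' * g n n' x)" if "n \<in> {..<N}" "n' \<in> {..<N}" for n n'
    by (intro integrable_mult_right assms) (use that in simp_all)
  have "(\<integral>x. (\<Sum>n<N. \<Sum>n'<N. b n n' * g n n' x) \<partial>Q) = (\<Sum>n<N. \<integral>x. (\<Sum>n'<N. b n n' * g n n' x) \<partial>Q)"
    by (rule Bochner_Integration.integral_sum, rule Bochner_Integration.integrable_sum, rule int)
  also have "\<dots> = (\<Sum>n<N. \<Sum>n'<N. \<integral>x. b n n' * g n n' x \<partial>Q)"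
    by (rule sum.cong[OF refl], rule Bochner_Integration.integral_sum, rule int)
  finally show ?thesis by (simp only: integral_mult_right_zero)
qed

context wiener_setting
begin

lemma product_sigma_finite_L: "product_sigma_finite (\<lambda>_::nat. L)"
  unfolding product_sigma_finite_def using finite_measure.axioms(1)[OF finite_measure_L] by blast

lemma square_integrable_product_form:
  fixes S :: "nat set" and b :: "nat \<Rightarrow> real"
  assumes S: "finite S" and g: "\<And>n l. n < N \<Longrightarrow> l \<in> S \<Longrightarrow> square_integrable L (g n l)"
  shows "square_integrable (Pi\<^sub>M S (\<lambda>_. L)) (\<lambda>x. \<Sum>n<N. b n * (\<Prod>l\<in>S. g n l (x l)))"
    "(\<integral>x. (\<Sum>n<N. b n * (\<Prod>l\<in>S. g n l (x l)))\<^sup>2 \<partial>Pi\<^sub>M S (\<lambda>_. L)) =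
      (\<Sum>n<N. \<Sum>n'<N. b n * b n' * (\<Prod>l\<in>S. \<integral>x. g n l x * g n' l x \<partial>L))"
proof -
  interpret product_sigma_finite "\<lambda>_::nat. L" by (rule product_sigma_finite_L)
  let ?\<Psi> = "\<lambda>x. \<Sum>n<N. b n * (\<Prod>l\<in>S. g n l (x l))"
  have sq: "(?\<Psi> x)\<^sup>2 = (\<Sum>n<N. \<Sum>n'<N. b n * b n' * (\<Prod>l\<in>S. g n l (x l) * g n' l (x l)))" for x
    unfolding power2_eq_square sum_product prod.distrib by (intro sum.cong refl) (simp add: mult_ac)
  have int: "integrable (Pi\<^sub>M S (\<lambda>_. L)) (\<lambda>x. \<Prod>l\<in>S. g n l (x l) * g n' l (x l))" if "n < N" "n' < N" for n n'
    by (rule product_integrable_prod[OF S]) (rule square_integrable_mult[OF g[OF that(1)] g[OF that(2)]])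
  have meas: "?\<Psi> \<in> borel_measurable (Pi\<^sub>M S (\<lambda>_. L))"
  proof (intro borel_measurable_sum borel_measurable_times borel_measurable_const borel_measurable_prod)
    fix n l assume "n \<in> {..<N}" "l \<in> S"
    then show "(\<lambda>x. g n l (x l)) \<in> borel_measurable (Pi\<^sub>M S (\<lambda>_. L))"
      by (intro measurable_compose[OF measurable_component_singleton[of l S "\<lambda>_. L"] square_integrable_measurable[OF g]]) auto
  qed
  show "square_integrable (Pi\<^sub>M S (\<lambda>_. L)) ?\<Psi>"
    unfolding square_integrable_def sq
    by (intro conjI meas Bochner_Integration.integrable_sum integrable_mult_right int) auto
  have "(\<integral>x. (?\<Psi> x)\<^sup>2 \<partial>Pi\<^sub>M S (\<lambda>_. L)) = (\<Sum>n<N. \<Sum>n'<N. b n * b n' * (\<integral>x. (\<Prod>l\<in>S. g n l (x l) * g n' l (x l)) \<partial>Pi\<^sub>M S (\<lambda>_. L)))"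
    unfolding sq by (rule integral_double_sum[where b = "\<lambda>n n'. b n * b n'" and
          g = "\<lambda>n n' x. \<Prod>l\<in>S. g n l (x l) * g n' l (x l)"]) (rule int)
  also have "\<dots> = (\<Sum>n<N. \<Sum>n'<N. b n * b n' * (\<Prod>l\<in>S. \<integral>x. g n l x * g n' l x \<partial>L))"
    by (intro sum.cong refl arg_cong2[where f = "(*)"] product_integral_prod[OF S] square_integrable_mult g) auto
  finally show "(\<integral>x. (?\<Psi> x)\<^sup>2 \<partial>Pi\<^sub>M S (\<lambda>_. L)) = (\<Sum>n<N. \<Sum>n'<N. b n * b n' * (\<Prod>l\<in>S. \<integral>x. g n l x * g n' l x \<partial>L))" .
qed

text \<open>The component with index \<open>0\<close> is time, which every exponential sees with density \<open>1\<close>.\<close>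

definition kernel :: "(real \<times> nat \<times> real) list \<Rightarrow> nat \<Rightarrow> real \<Rightarrow> real" where
  "kernel h i x = (if i = 0 then 1 else step_fun h i x)"

lemma square_integrable_const_L: "square_integrable L (\<lambda>_. c)"
proof -
  interpret finite_measure L by (rule finite_measure_L)
  show ?thesis by (simp add: square_integrable_def)
qed

lemma square_integrable_kernel: "square_integrable L (kernel h i)"
  using square_integrable_step_fun square_integrable_const_L by (cases "i = 0") (simp_all add: kernel_def[abs_def])

lemma measure_L: "measure L {t..T} = T - t"
  by (simp add: measure_restrict_space space_restrict_space less_imp_le[OF t_less])

text \<open>Expanding \<open>\<langle>h\<^sub>n, h\<^sub>n'\<rangle>\<^sup>r\<close> over all index tuples writes the form as a sum of squared norms, one for
  each tuple \<open>\<iota>\<close>; in particular it dominates each single one of them.\<close>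

lemma covariance_power_form:
  fixes S :: "nat set" and b :: "nat \<Rightarrow> real"
  assumes h: "\<And>n. n < N \<Longrightarrow> valid (h n)" and S: "finite S" "\<iota> \<in> S \<rightarrow> {1..m}"
  shows "0 \<le> (\<Sum>n<N. \<Sum>n'<N. b n * b n' * (\<Prod>l\<in>S. \<integral>x. step_fun (h n) (\<iota> l) x * step_fun (h n') (\<iota> l) x \<partial>L))"
    "(\<Sum>n<N. \<Sum>n'<N. b n * b n' * (\<Prod>l\<in>S. \<integral>x. step_fun (h n) (\<iota> l) x * step_fun (h n') (\<iota> l) x \<partial>L))
      \<le> (\<Sum>n<N. \<Sum>n'<N. b n * b n' * covariance t (h n) (h n') ^ card S)"
    "0 \<le> (\<Sum>n<N. \<Sum>n'<N. b n * b n' * covariance t (h n) (h n') ^ card S)"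
proof -
  define q where "q \<kappa> = (\<Sum>n<N. \<Sum>n'<N. b n * b n' * (\<Prod>l\<in>S. \<integral>x. step_fun (h n) (\<kappa> l) x * step_fun (h n') (\<kappa> l) x \<partial>L))" for \<kappa> :: "nat \<Rightarrow> nat"
  have q: "0 \<le> q \<kappa>" for \<kappa>
  proof -
    have "q \<kappa> = (\<integral>x. (\<Sum>n<N. b n * (\<Prod>l\<in>S. step_fun (h n) (\<kappa> l) (x l)))\<^sup>2 \<partial>Pi\<^sub>M S (\<lambda>_. L))"
      unfolding q_def
      by (rule square_integrable_product_form(2)[OF S(1), where g = "\<lambda>n l. step_fun (h n) (\<kappa> l)", symmetric])
        (rule square_integrable_step_fun)
    then show ?thesis by simp
  qed
  have fin: "finite (PiE S (\<lambda>_. {1..m}))" using S(1) by (intro finite_PiE) auto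
  have expand: "(\<Sum>n<N. \<Sum>n'<N. b n * b n' * covariance t (h n) (h n') ^ card S) = (\<Sum>\<kappa>\<in>PiE S (\<lambda>_. {1..m}). q \<kappa>)"
  proof -
    have "covariance t (h n) (h n') ^ card S =
      (\<Sum>\<kappa>\<in>PiE S (\<lambda>_. {1..m}). \<Prod>l\<in>S. \<integral>x. step_fun (h n) (\<kappa> l) x * step_fun (h n') (\<kappa> l) x \<partial>L)"
      if "n < N" "n' < N" for n n'
    proof -
      have "covariance t (h n) (h n') ^ card S = (\<Prod>l\<in>S. \<Sum>i\<in>{1..m}. \<integral>x. step_fun (h n) i x * step_fun (h n') i x \<partial>L)"
        using covariance_eq_inner[OF h[OF that(1)] h[OF that(2)]] by (simp add: inner_K_def)
      also have "\<dots> = (\<Sum>\<kappa>\<in>PiE S (\<lambda>_. {1..m}). \<Prod>l\<in>S. \<integral>x. step_fun (h n) (\<kappa> l) x * step_fun (h n') (\<kappa> l) x \<partial>L)"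
        by (rule prod_sum_PiE) (use S(1) in auto)
      finally show ?thesis .
    qed
    then have "(\<Sum>n<N. \<Sum>n'<N. b n * b n' * covariance t (h n) (h n') ^ card S) =
      (\<Sum>n<N. \<Sum>n'<N. \<Sum>\<kappa>\<in>PiE S (\<lambda>_. {1..m}). b n * b n' * (\<Prod>l\<in>S. \<integral>x. step_fun (h n) (\<kappa> l) x * step_fun (h n') (\<kappa> l) x \<partial>L))"
      by (intro sum.cong refl) (simp add: sum_distrib_left)
    also have "\<dots> = (\<Sum>n<N. \<Sum>\<kappa>\<in>PiE S (\<lambda>_. {1..m}). \<Sum>n'<N. b n * b n' * (\<Prod>l\<in>S. \<integral>x. step_fun (h n) (\<kappa> l) x * step_fun (h n') (\<kappa> l) x \<partial>L))"
      by (intro sum.cong refl sum.swap)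
    also have "\<dots> = (\<Sum>\<kappa>\<in>PiE S (\<lambda>_. {1..m}). q \<kappa>)"
      unfolding q_def by (rule sum.swap)
    finally show ?thesis .
  qed
  show "0 \<le> (\<Sum>n<N. \<Sum>n'<N. b n * b n' * covariance t (h n) (h n') ^ card S)"
    unfolding expand by (intro sum_nonneg q)
  have res: "q \<iota> = q (restrict \<iota> S)"
    unfolding q_def by (intro sum.cong refl arg_cong2[where f = "(*)"] prod.cong) simp
  show "0 \<le> (\<Sum>n<N. \<Sum>n'<N. b n * b n' * (\<Prod>l\<in>S. \<integral>x. step_fun (h n) (\<iota> l) x * step_fun (h n') (\<iota> l) x \<partial>L))"
    using q[of \<iota>] by (simp add: q_def)
  have "q (restrict \<iota> S) \<le> (\<Sum>\<kappa>\<in>PiE S (\<lambda>_. {1..m}). q \<kappa>)"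
    by (rule member_le_sum) (use S(2) q fin in auto)
  then show "(\<Sum>n<N. \<Sum>n'<N. b n * b n' * (\<Prod>l\<in>S. \<integral>x. step_fun (h n) (\<iota> l) x * step_fun (h n') (\<iota> l) x \<partial>L))
      \<le> (\<Sum>n<N. \<Sum>n'<N. b n * b n' * covariance t (h n) (h n') ^ card S)"
    unfolding expand res[symmetric] by (simp add: q_def)
qed

text \<open>The transform determines the second moment: a finite sum \<open>Y = \<Sum> b\<^sub>n exp (G h\<^sub>n - |h\<^sub>n|\<^sup>2/2)\<close> satisfies
  \<open>E Y\<^sup>2 = \<Sum> b\<^sub>n b\<^sub>n' exp \<langle>h\<^sub>n, h\<^sub>n'\<rangle>\<close>, which is at least \<open>1/r!\<close> times the form of order \<open>r\<close>, while
  \<open>E (X Y)\<close> is the inner product of \<open>\<Phi>\<close> with \<open>\<Sum> b\<^sub>n h\<^sub>n \<otimes> \<dots> \<otimes> h\<^sub>n\<close>.\<close>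

lemma transform_bound_exp_sum:
  assumes X: "square_integrable M X" and \<Phi>: "square_integrable (cube t T k) \<Phi>"
    and i: "\<And>l. l \<in> {1..k} \<Longrightarrow> i l \<in> {0..m}"
    and short: "(\<forall>l\<in>{1..k}. i l \<noteq> 0) \<or> T - t < 1"
    and transform: "\<And>h. valid h \<Longrightarrow> expectation (\<lambda>\<omega>. X \<omega> * exp (G h \<omega>)) =
      exp (covariance t h h / 2) * (\<integral>x. \<Phi> x * (\<Prod>l=1..k. kernel h (i l) (x l)) \<partial>cube t T k)"
    and l: "\<forall>(a, h)\<in>set l. valid h"
  shows "(expectation (\<lambda>\<omega>. X \<omega> * exp_sum l \<omega>))\<^sup>2
    \<le> fact k * (\<integral>x. (\<Phi> x)\<^sup>2 \<partial>cube t T k) * expectation (\<lambda>\<omega>. (exp_sum l \<omega>)\<^sup>2)"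
proof -
  define N where "N = length l"
  define a where "a n = fst (l ! n)" for n
  define h where "h n = snd (l ! n)" for n
  have h: "valid (h n)" if "n < N" for n
  proof -
    have "l ! n \<in> set l" using that by (simp add: N_def)
    then show ?thesis using l unfolding h_def by (auto simp: case_prod_unfold)
  qed
  define b where "b n = a n * exp (covariance t (h n) (h n) / 2)" for n
  define \<Psi> where "\<Psi> x = (\<Sum>n<N. b n * (\<Prod>l\<in>{1..k}. kernel (h n) (i l) (x l)))" for x :: "nat \<Rightarrow> real"
  have Y: "exp_sum l \<omega> = (\<Sum>n<N. a n * exp (G (h n) \<omega>))" for \<omega>
    unfolding exp_sum_def case_prod_unfold sum_list_map_nth N_def a_def h_def ..
  have \<Psi>: "square_integrable (cube t T k) \<Psi>"
    and \<Psi>_sq: "(\<integral>x. (\<Psi> x)\<^sup>2 \<partial>cube t T k) = (\<Sum>n<N. \<Sum>n'<N. b n * b n' * (\<Prod>l\<in>{1..k}. \<integral>x. kernel (h n) (i l) x * kernel (h n') (i l) x \<partial>L))"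
    unfolding \<Psi>_def[abs_def]
    using square_integrable_product_form[of "{1..k}" N "\<lambda>n l. kernel (h n) (i l)" b] square_integrable_kernel by auto
  have prodsi: "square_integrable (cube t T k) (\<lambda>x. \<Prod>l\<in>{1..k}. kernel g (i l) (x l))" for g
    using square_integrable_product_form(1)[of "{1..k}" "Suc 0" "\<lambda>n l. kernel g (i l)" "\<lambda>_. 1"] square_integrable_kernel by simp
  have EXY: "expectation (\<lambda>\<omega>. X \<omega> * exp_sum l \<omega>) = (\<integral>x. \<Phi> x * \<Psi> x \<partial>cube t T k)"
  proof -
    have "expectation (\<lambda>\<omega>. X \<omega> * exp_sum l \<omega>) = expectation (\<lambda>\<omega>. \<Sum>n<N. a n * (X \<omega> * exp (G (h n) \<omega>)))"
      unfolding Y sum_distrib_left by (simp only: mult.left_commute)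
    also have "\<dots> = (\<Sum>n<N. a n * expectation (\<lambda>\<omega>. X \<omega> * exp (G (h n) \<omega>)))"
      by (subst Bochner_Integration.integral_sum)
        (auto intro!: integrable_mult_right square_integrable_mult X exp_G_square_integrable h)
    also have "\<dots> = (\<Sum>n<N. \<integral>x. b n * (\<Phi> x * (\<Prod>l\<in>{1..k}. kernel (h n) (i l) (x l))) \<partial>cube t T k)"
      by (intro sum.cong refl) (simp add: transform[OF h] b_def)
    also have "\<dots> = (\<integral>x. (\<Sum>n<N. b n * (\<Phi> x * (\<Prod>l\<in>{1..k}. kernel (h n) (i l) (x l)))) \<partial>cube t T k)"
      by (rule Bochner_Integration.integral_sum[symmetric])
        (intro integrable_mult_right square_integrable_mult \<Phi> prodsi)
    also have "\<dots> = (\<integral>x. \<Phi> x * \<Psi> x \<partial>cube t T k)"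
      unfolding \<Psi>_def sum_distrib_left by (simp only: mult.left_commute)
    finally show ?thesis .
  qed
  have EYY: "expectation (\<lambda>\<omega>. (exp_sum l \<omega>)\<^sup>2) = (\<Sum>n<N. \<Sum>n'<N. b n * b n' * exp (covariance t (h n) (h n')))"
  proof -
    have "expectation (\<lambda>\<omega>. (exp_sum l \<omega>)\<^sup>2) = expectation (\<lambda>\<omega>. \<Sum>n<N. \<Sum>n'<N. a n * a n' * exp (G (h n @ h n') \<omega>))"
      unfolding Y power2_eq_square sum_product gsum_simps exp_add by (simp only: mult_ac)
    also have "\<dots> = (\<Sum>n<N. \<Sum>n'<N. a n * a n' * expectation (\<lambda>\<omega>. exp (G (h n @ h n') \<omega>)))"
      by (rule integral_double_sum[where b = "\<lambda>n n'. a n * a n'" and g = "\<lambda>n n'. \<lambda>\<omega>. exp (G (h n @ h n') \<omega>)"])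
        (rule exp_G_expectation(1), use h in simp)
    also have "\<dots> = (\<Sum>n<N. \<Sum>n'<N. b n * b n' * exp (covariance t (h n) (h n')))"
    proof (intro sum.cong refl)
      fix n n' assume n: "n \<in> {..<N}" "n' \<in> {..<N}"
      have "covariance t (h n @ h n') (h n @ h n') / 2 =
        covariance t (h n) (h n) / 2 + covariance t (h n') (h n') / 2 + covariance t (h n) (h n')"
        by (simp add: covariance_commute[of t "h n'" "h n"] add_divide_distrib)
      then have "expectation (\<lambda>\<omega>. exp (G (h n @ h n') \<omega>)) =
        exp (covariance t (h n) (h n) / 2) * exp (covariance t (h n') (h n') / 2) * exp (covariance t (h n) (h n'))"
        using exp_G_expectation(2)[of "h n @ h n'"] h n by (simp only: exp_add valid_simps lessThan_iff simp_thms)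
      then show "a n * a n' * expectation (\<lambda>\<omega>. exp (G (h n @ h n') \<omega>)) = b n * b n' * exp (covariance t (h n) (h n'))"
        by (simp only: b_def mult_ac)
    qed
    finally show ?thesis .
  qed
  define S where "S = {1..k} \<inter> - {l. i l = 0}"
  have S: "finite S" "card S \<le> k" "i \<in> S \<rightarrow> {1..m}"
  proof -
    show "finite S" by (simp add: S_def)
    have "card S \<le> card {1..k}" by (rule card_mono) (auto simp: S_def)
    then show "card S \<le> k" by simp
    show "i \<in> S \<rightarrow> {1..m}" using i unfolding S_def by fastforce
  qed
  define p where "p = (\<Sum>n<N. \<Sum>n'<N. b n * b n' * covariance t (h n) (h n') ^ card S)"
  define q where "q = (\<Sum>n<N. \<Sum>n'<N. b n * b n' * (\<Prod>l\<in>S. \<integral>x. step_fun (h n) (i l) x * step_fun (h n') (i l) x \<partial>L))"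
  have q: "0 \<le> q" "q \<le> p"
    unfolding q_def p_def by (rule covariance_power_form[OF h S(1,3)], assumption)+
  have p: "p \<le> fact (card S) * expectation (\<lambda>\<omega>. (exp_sum l \<omega>)\<^sup>2)"
    unfolding p_def EYY
  proof (rule positive_exponential_form)
    fix r :: nat
    show "0 \<le> (\<Sum>n<N. \<Sum>n'<N. b n * b n' * covariance t (h n) (h n') ^ r)"
    proof (cases "m = 0")
      case False
      then show ?thesis using covariance_power_form(3)[where N = N and h = h and S = "{..<r}" and \<iota> = "\<lambda>_. 1" and b = b] h by simp
    next
      case True
      have "h n = []" if "n < N" for n
      proof (cases "h n")
        case (Cons a g)
        then have "fst (snd a) \<in> {1..m}" using h[OF that] by simp
        then show ?thesis using True by simp
      qed
      then have eq: "(\<Sum>n<N. \<Sum>n'<N. b n * b n' * covariance t (h n) (h n') ^ r) = (\<Sum>n<N. b n) * (\<Sum>n<N. b n) * 0 ^ r"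
        by (subst sum_product) (simp add: sum_distrib_right)
      show ?thesis unfolding eq by simp
    qed
  qed
  have \<Psi>_q: "(\<integral>x. (\<Psi> x)\<^sup>2 \<partial>cube t T k) = (T - t) ^ card ({1..k} \<inter> {l. i l = 0}) * q"
  proof -
    have "(\<Prod>l\<in>{1..k}. \<integral>x. kernel (h n) (i l) x * kernel (h n') (i l) x \<partial>L) =
      (T - t) ^ card ({1..k} \<inter> {l. i l = 0}) * (\<Prod>l\<in>S. \<integral>x. step_fun (h n) (i l) x * step_fun (h n') (i l) x \<partial>L)" for n n'
    proof -
      have "(\<Prod>l\<in>{1..k}. \<integral>x. kernel (h n) (i l) x * kernel (h n') (i l) x \<partial>L) =
        (\<Prod>l\<in>{1..k}. if i l = 0 then T - t else \<integral>x. step_fun (h n) (i l) x * step_fun (h n') (i l) x \<partial>L)"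
        by (intro prod.cong refl) (simp add: kernel_def measure_L)
      also have "\<dots> = (T - t) ^ card ({1..k} \<inter> {l. i l = 0}) * (\<Prod>l\<in>S. \<integral>x. step_fun (h n) (i l) x * step_fun (h n') (i l) x \<partial>L)"
        unfolding S_def by (subst prod.If_cases) simp_all
      finally show ?thesis .
    qed
    then show ?thesis unfolding \<Psi>_sq q_def by (simp add: sum_distrib_left mult_ac)
  qed
  have "(T - t) ^ card ({1..k} \<inter> {l. i l = 0}) \<le> 1"
  proof (rule disjE[OF short])
    assume "\<forall>l\<in>{1..k}. i l \<noteq> 0"
    then have "{1..k} \<inter> {l. i l = 0} = {}" by auto
    then show ?thesis by simp
  next
    assume "T - t < 1"
    then show ?thesis using t_less by (intro power_le_one) auto
  qed
  then have "(\<integral>x. (\<Psi> x)\<^sup>2 \<partial>cube t T k) \<le> q" unfolding \<Psi>_q using q(1) mult_right_mono by fastforce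
  also have "q \<le> fact (card S) * expectation (\<lambda>\<omega>. (exp_sum l \<omega>)\<^sup>2)" using q p by linarith
  also have "\<dots> \<le> fact k * expectation (\<lambda>\<omega>. (exp_sum l \<omega>)\<^sup>2)"
    using S(2) by (intro mult_right_mono fact_mono) auto
  finally have \<Psi>_le: "(\<integral>x. (\<Psi> x)\<^sup>2 \<partial>cube t T k) \<le> fact k * expectation (\<lambda>\<omega>. (exp_sum l \<omega>)\<^sup>2)" .
  have "(expectation (\<lambda>\<omega>. X \<omega> * exp_sum l \<omega>))\<^sup>2 \<le> (\<integral>x. (\<Phi> x)\<^sup>2 \<partial>cube t T k) * (\<integral>x. (\<Psi> x)\<^sup>2 \<partial>cube t T k)"
    unfolding EXY by (rule integral_Cauchy_Schwarz[OF \<Phi> \<Psi>])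
  also have "\<dots> \<le> (\<integral>x. (\<Phi> x)\<^sup>2 \<partial>cube t T k) * (fact k * expectation (\<lambda>\<omega>. (exp_sum l \<omega>)\<^sup>2))"
    by (intro mult_left_mono \<Psi>_le) simp
  finally show ?thesis by (simp only: mult_ac)
qed

theorem transform_bound:
  assumes X: "exp_span X" and \<Phi>: "square_integrable (cube t T k) \<Phi>"
    and i: "\<And>l. l \<in> {1..k} \<Longrightarrow> i l \<in> {0..m}"
    and short: "(\<forall>l\<in>{1..k}. i l \<noteq> 0) \<or> T - t < 1"
    and transform: "\<And>h. valid h \<Longrightarrow> expectation (\<lambda>\<omega>. X \<omega> * exp (G h \<omega>)) =
      exp (covariance t h h / 2) * (\<integral>x. \<Phi> x * (\<Prod>l=1..k. kernel h (i l) (x l)) \<partial>cube t T k)"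
  shows "square_integrable M X"
    "expectation (\<lambda>\<omega>. (X \<omega>)\<^sup>2) \<le> fact k * (\<integral>x. (\<Phi> x)\<^sup>2 \<partial>cube t T k)"
proof -
  note mX = exp_span_measurable[OF X]
  have "\<exists>l. (\<forall>(a, h)\<in>set l. valid h) \<and> nsq M (\<lambda>\<omega>. exp_sum l \<omega> - X \<omega>) \<le> ennreal (inverse (real (Suc n)))" for n
    using X unfolding exp_span_def by (metis inverse_positive_iff_positive of_nat_0_less_iff zero_less_Suc)
  then obtain l where l: "\<And>n. \<forall>(a, h)\<in>set (l n). valid h"
    "\<And>n. nsq M (\<lambda>\<omega>. exp_sum (l n) \<omega> - X \<omega>) \<le> ennreal (inverse (real (Suc n)))" by metis
  note si = exp_sum_square_integrable[OF l(1)]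
  have "(\<lambda>n. ennreal (inverse (real (Suc n)))) \<longlonglongrightarrow> ennreal 0"
    by (intro tendsto_ennrealI LIMSEQ_inverse_real_of_nat)
  then have lim: "(\<lambda>n. nsq M (\<lambda>\<omega>. exp_sum (l n) \<omega> - X \<omega>)) \<longlonglongrightarrow> 0"
    by (intro ennreal_squeeze[OF l(2)]) simp
  show sX: "square_integrable M X" by (rule square_integrable_limit[OF si mX lim])
  define A where "A = expectation (\<lambda>\<omega>. (X \<omega>)\<^sup>2)"
  define B where "B = fact k * (\<integral>x. (\<Phi> x)\<^sup>2 \<partial>cube t T k)"
  have "(\<lambda>n. expectation (\<lambda>\<omega>. X \<omega> * exp_sum (l n) \<omega>)) \<longlonglongrightarrow> A"
  proof -
    have "expectation (\<lambda>\<omega>. X \<omega> * exp_sum (l n) \<omega>) = expectation (\<lambda>\<omega>. exp_sum (l n) \<omega> * X \<omega>)" for n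
      by (simp add: mult.commute)
    then show ?thesis
      using integral_mult_limit[OF si mX lim sX] by (simp only: A_def power2_eq_square)
  qed
  then have l1: "(\<lambda>n. (expectation (\<lambda>\<omega>. X \<omega> * exp_sum (l n) \<omega>))\<^sup>2) \<longlonglongrightarrow> A\<^sup>2" by (rule tendsto_power)
  have l2: "(\<lambda>n. B * expectation (\<lambda>\<omega>. (exp_sum (l n) \<omega>)\<^sup>2)) \<longlonglongrightarrow> B * A"
    unfolding A_def by (intro tendsto_mult_left integral_sq_limit[OF si mX lim])
  have l3: "(expectation (\<lambda>\<omega>. X \<omega> * exp_sum (l n) \<omega>))\<^sup>2 \<le> B * expectation (\<lambda>\<omega>. (exp_sum (l n) \<omega>)\<^sup>2)" for n
    unfolding B_def by (rule transform_bound_exp_sum[OF sX \<Phi> i short transform l(1)])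
  have "A\<^sup>2 \<le> B * A" by (rule LIMSEQ_le[OF l1 l2]) (use l3 in blast)
  moreover have "0 \<le> A" "0 \<le> B" by (simp_all add: A_def B_def)
  ultimately have "A \<le> B" by (cases "A = 0") (auto simp: power2_eq_square)
  then show "expectation (\<lambda>\<omega>. (X \<omega>)\<^sup>2) \<le> fact k * (\<integral>x. (\<Phi> x)\<^sup>2 \<partial>cube t T k)"
    by (simp only: A_def B_def)
qed

subsection \<open>The transform of an increment\<close>

text \<open>The restriction of a step function to the times before \<open>u\<close>, and to those after \<open>u\<close>.\<close>

definition before :: "real \<Rightarrow> (real \<times> nat \<times> real) list \<Rightarrow> (real \<times> nat \<times> real) list" where
  "before u h = map (\<lambda>(c, i, v). (c, i, min v u)) h"

definition after :: "real \<Rightarrow> (real \<times> nat \<times> real) list \<Rightarrow> (real \<times> nat \<times> real) list" where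
  "after u h = map (\<lambda>(c, i, v). (c, i, max v u)) h"

lemma gsum_before_after: "gsum t (before u h) \<omega> + gsum u (after u h) \<omega> = gsum t h \<omega>"
proof (induction h)
  case Nil
  show ?case by (simp add: before_def after_def)
next
  case (Cons a h)
  obtain c i v where a: "a = (c, i, v)" by (cases a) auto
  have "before u (a # h) = (c, i, min v u) # before u h" "after u (a # h) = (c, i, max v u) # after u h"
    by (simp_all add: before_def after_def a)
  moreover have "c * (f i (min v u) \<omega> - f i t \<omega>) + c * (f i (max v u) \<omega> - f i u \<omega>) = c * (f i v \<omega> - f i t \<omega>)"
    by (cases "v \<le> u") (simp_all add: min_def max_def right_diff_distrib)
  ultimately show ?case using Cons by (simp only: gsum_simps a)
qed

lemma valid_before: "valid h \<Longrightarrow> t \<le> u \<Longrightarrow> valid (before u h)"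
  by (induction h) (auto simp: before_def)

lemma valid_after: "valid h \<Longrightarrow> u \<le> T \<Longrightarrow> valid_from u (after u h)"
  by (induction h) (auto simp: after_def)

lemma G_before_adapted:
  assumes "valid h" "t \<le> u" "u \<le> T"
  shows "G (before u h) \<in> borel_measurable (F u)"
  using assms(1)
proof (induction h)
  case Nil
  have "G (before u []) = (\<lambda>_. 0)" by (simp add: before_def fun_eq_iff)
  then show ?case by simp
next
  case (Cons a h)
  obtain c i v where a: "a = (c, i, v)" by (cases a) auto
  have "G (before u (a # h)) = (\<lambda>\<omega>. c * (f i (min v u) \<omega> - f i t \<omega>) + G (before u h) \<omega>)"
    by (simp add: before_def a fun_eq_iff)
  moreover have "f i (min v u) \<in> borel_measurable (F u)" "f i t \<in> borel_measurable (F u)" "G (before u h) \<in> borel_measurable (F u)"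
    using Cons assms t_nonneg by (auto simp: a intro!: f_adapted)
  ultimately show ?case by simp
qed

lemma covariance_after:
  assumes "t \<le> u" "u \<le> v" "v \<le> T"
  shows "covariance u (after u h) [(1, i, v)] = (\<integral>x. indicator {u..<v} x * step_fun h i x \<partial>L)"
proof (induction h)
  case Nil
  then show ?case by (simp add: after_def)
next
  case (Cons a h)
  interpret finite_measure L by (rule finite_measure_L)
  obtain c k w where a: "a = (c, k, w)" by (cases a) auto
  have mI: "(indicator A :: real \<Rightarrow> real) \<in> borel_measurable L" if "A \<in> sets borel" for A
    using that by (intro measurable_restrict_space1 borel_measurable_indicator) simp
  have sI: "square_integrable L (indicator A)" if "A \<in> sets borel" for A
    unfolding square_integrable_def
    by (intro conjI mI that integrable_const_bound[where B = 1] AE_I2 borel_measurable_power)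
       (simp_all split: split_indicator)
  have "(\<integral>x. indicator {u..<v} x * indicator {..<w} x \<partial>L) = (\<integral>x. (indicator {t..T} x * (indicator {u..<v} x * indicator {..<w} x) :: real) \<partial>lebesgue)"
    by (subst integral_restrict_space) auto
  also have "\<dots> = (\<integral>x. indicator {u..<min v w} x \<partial>lebesgue)"
    using assms by (intro Bochner_Integration.integral_cong refl) (auto split: split_indicator)
  also have "\<dots> = min (max w u) v - u"
    using assms by (cases "u \<le> w") (auto simp: min_def max_def)
  finally have base: "(\<integral>x. indicator {u..<v} x * indicator {..<w} x \<partial>L) = min (max w u) v - u" .
  have int: "integrable L (\<lambda>x. indicator {u..<v} x * indicator {..<w} x :: real)"
    "integrable L (\<lambda>x. indicator {u..<v} x * step_fun h i x)"
    by (intro square_integrable_mult sI square_integrable_step_fun; simp)+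
  have "(\<integral>x. indicator {u..<v} x * step_fun (a # h) i x \<partial>L) =
    (\<integral>x. (c * of_bool (k = i)) * (indicator {u..<v} x * indicator {..<w} x) + indicator {u..<v} x * step_fun h i x \<partial>L)"
    by (simp add: a distrib_left mult_ac)
  also have "\<dots> = (c * of_bool (k = i)) * (min (max w u) v - u) + covariance u (after u h) [(1, i, v)]"
    using int by (simp add: base Cons)
  also have "\<dots> = covariance u (after u (a # h)) [(1, i, v)]"
    using covariance_Cons(1)[of u "(c, k, max w u)" "after u h" "[(1, i, v)]"]
    by (simp add: after_def a) (simp add: covariance_def)
  finally show ?case ..
qed

lemma gauss_increment:
  assumes "i \<in> {1..m}" "t \<le> u" "u \<le> T" "t \<le> v" "v \<le> T"
  shows "gauss (\<lambda>\<omega>. f i v \<omega> - f i u \<omega>) (step_fun [(1, i, v), (-1, i, u)])"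
proof -
  have "gauss (G [(1, i, v), (-1, i, u)]) (step_fun [(1, i, v), (-1, i, u)])"
    by (rule gauss_G) (use assms in simp)
  moreover have "G [(1, i, v), (-1, i, u)] = (\<lambda>\<omega>. f i v \<omega> - f i u \<omega>)" by (simp add: fun_eq_iff)
  ultimately show ?thesis by simp
qed

text \<open>The exponential factorizes at time \<open>u\<close>; its future part, tilted by the increment, has an explicit
  expectation, which is differentiated with respect to the tilt.\<close>

lemma increment_transform:
  assumes i: "i \<in> {1..m}" and uv: "t \<le> u" "u \<le> v" "v \<le> T"
    and \<eta>: "\<eta> \<in> borel_measurable (F u)" "square_integrable M \<eta>" and h: "valid h"
  shows "expectation (\<lambda>\<omega>. \<eta> \<omega> * (f i v \<omega> - f i u \<omega>) * exp (G h \<omega>)) =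
    (\<integral>x. indicator {u..<v} x * step_fun h i x \<partial>L) * expectation (\<lambda>\<omega>. \<eta> \<omega> * exp (G h \<omega>))"
proof -
  have u0: "0 \<le> u" "u \<le> T" using t_nonneg uv by auto
  define \<eta>' where "\<eta>' \<omega> = \<eta> \<omega> * exp (G (before u h) \<omega>)" for \<omega>
  have \<eta>'_F: "\<eta>' \<in> borel_measurable (F u)"
    unfolding \<eta>'_def[abs_def]
    by (intro borel_measurable_times \<eta>(1) measurable_compose[OF G_before_adapted[OF h uv(1) u0(2)] borel_measurable_exp])
  have \<eta>'_int: "integrable M \<eta>'"
    unfolding \<eta>'_def[abs_def] by (intro square_integrable_mult \<eta> exp_G_square_integrable valid_before h uv)
  define c where "c = covariance u (after u h) [(1, i, v)]"
  define E0 where "E0 = expectation (\<lambda>\<omega>. \<eta> \<omega> * exp (G h \<omega>))"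
  have tilt: "expectation (\<lambda>\<omega>. \<eta> \<omega> * exp (G h \<omega> + e * (f i v \<omega> - f i u \<omega>))) =
    expectation \<eta>' * exp ((covariance u (after u h) (after u h) + 2 * e * c + e\<^sup>2 * (v - u)) / 2)" for e
  proof -
    have val: "valid_from u (after u h @ [(e, i, v)])" using valid_after[OF h u0(2)] i uv by simp
    have cov: "covariance u (after u h @ [(e, i, v)]) (after u h @ [(e, i, v)]) =
      covariance u (after u h) (after u h) + 2 * e * c + e\<^sup>2 * (v - u)"
    proof -
      have "covariance u h' [(e, i, v)] = e * covariance u h' [(1, i, v)]" for h'
        by (induction h') (auto simp: covariance_def algebra_simps)
      moreover have "covariance u [(e, i, v)] h' = covariance u h' [(e, i, v)]" for h' by (rule covariance_commute)
      moreover have "covariance u [(e, i, v)] [(e, i, v)] = e\<^sup>2 * (v - u)" by (simp add: covariance_def power2_eq_square)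
      ultimately show ?thesis unfolding covariance_simps c_def by simp
    qed
    have "\<eta> \<omega> * exp (G h \<omega> + e * (f i v \<omega> - f i u \<omega>)) = \<eta>' \<omega> * exp (gsum u (after u h @ [(e, i, v)]) \<omega>)" for \<omega>
      unfolding \<eta>'_def gsum_simps gsum_before_after[of u h \<omega>, symmetric] by (simp add: exp_add)
    then show ?thesis
      using moment_generating(2)[OF u0 val \<eta>'_F \<eta>'_int] unfolding cov by simp
  qed
  have E0: "E0 = expectation \<eta>' * exp (covariance u (after u h) (after u h) / 2)"
    using tilt[of 0] by (simp add: E0_def)
  have "((\<lambda>e. expectation \<eta>' * exp ((covariance u (after u h) (after u h) + 2 * e * c + e\<^sup>2 * (v - u)) / 2)) has_real_derivative
      c * E0) (at 0)"
    unfolding E0 by (auto intro!: derivative_eq_intros)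
  from sequential_derivative[OF this]
  have "(\<lambda>n. real (Suc n) * (expectation (\<lambda>\<omega>. \<eta> \<omega> * exp (G h \<omega> + 1 / real (Suc n) * (f i v \<omega> - f i u \<omega>)))
      - expectation (\<lambda>\<omega>. \<eta> \<omega> * exp (G h \<omega> + 0 * (f i v \<omega> - f i u \<omega>))))) \<longlonglongrightarrow> c * E0"
    unfolding tilt .
  moreover have "(\<lambda>n. real (Suc n) * (expectation (\<lambda>\<omega>. \<eta> \<omega> * exp (G h \<omega> + 1 / real (Suc n) * (f i v \<omega> - f i u \<omega>)))
      - expectation (\<lambda>\<omega>. \<eta> \<omega> * exp (G h \<omega> + 0 * (f i v \<omega> - f i u \<omega>))))) \<longlonglongrightarrow>
      expectation (\<lambda>\<omega>. \<eta> \<omega> * ((f i v \<omega> - f i u \<omega>) * exp (G h \<omega>)))"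
    using multiplier_derivative[OF exp_multiplier_const[of 1] gauss_G[OF h] gauss_increment[OF i] \<eta>(2), of u v] uv
    by simp
  ultimately have "c * E0 = expectation (\<lambda>\<omega>. \<eta> \<omega> * ((f i v \<omega> - f i u \<omega>) * exp (G h \<omega>)))"
    by (rule LIMSEQ_unique)
  then show ?thesis unfolding c_def covariance_after[OF uv] E0_def by (simp only: mult.assoc)
qed

end

section \<open>Elementary processes and the Ito isometry\<close>

context wiener_setting
begin

lemma square_integrable_increment:
  assumes i: "i \<in> {1..m}" and su: "0 \<le> s" "s \<le> u" "u \<le> T"
    and \<eta>: "\<eta> \<in> borel_measurable (F s)" "square_integrable M \<eta>"
  shows "square_integrable M (\<lambda>\<omega>. \<eta> \<omega> * (f i u \<omega> - f i s \<omega>))"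
    "expectation (\<lambda>\<omega>. (\<eta> \<omega> * (f i u \<omega> - f i s \<omega>))\<^sup>2) = expectation (\<lambda>\<omega>. (\<eta> \<omega>)\<^sup>2) * (u - s)"
proof -
  note mp = increment_moments_past(3,4)[OF i su borel_measurable_power[OF \<eta>(1)] square_integrable_sq[OF \<eta>(2)]]
  have "f i u \<in> borel_measurable M" "f i s \<in> borel_measurable M" "\<eta> \<in> borel_measurable M"
    using f_measurable[OF i, of u] f_measurable[OF i, of s] su \<eta>(2) by (auto simp: square_integrable_def)
  then show "square_integrable M (\<lambda>\<omega>. \<eta> \<omega> * (f i u \<omega> - f i s \<omega>))"
    using mp(1) by (simp add: square_integrable_def power_mult_distrib)
  show "expectation (\<lambda>\<omega>. (\<eta> \<omega> * (f i u \<omega> - f i s \<omega>))\<^sup>2) = expectation (\<lambda>\<omega>. (\<eta> \<omega>)\<^sup>2) * (u - s)"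
    using mp(2) by (simp add: power_mult_distrib)
qed

text \<open>The part of the earlier interval before \<open>c\<close> is uncorrelated with the later increment.  On the
  common part \<open>[c,e]\<close> the squared increment has mean \<open>e - c\<close>.\<close>

lemma increment_inner_ordered:
  assumes i: "i \<in> {1..m}" and ab: "0 \<le> a" "a \<le> b" "b \<le> T" and cd: "a \<le> c" "c \<le> d" "d \<le> T"
    and \<eta>: "\<eta> \<in> borel_measurable (F a)" "square_integrable M \<eta>"
    and \<eta>': "\<eta>' \<in> borel_measurable (F c)" "square_integrable M \<eta>'"
  shows "expectation (\<lambda>\<omega>. (\<eta> \<omega> * (f i b \<omega> - f i a \<omega>)) * (\<eta>' \<omega> * (f i d \<omega> - f i c \<omega>))) =
    expectation (\<lambda>\<omega>. \<eta> \<omega> * \<eta>' \<omega>) * max 0 (min b d - c)"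
proof -
  have c0: "0 \<le> c" "c \<le> T" "a \<le> T" using ab cd by auto
  have \<eta>c: "\<eta> \<in> borel_measurable (F c)" by (rule F_mono[OF ab(1) cd(1) c0(2) \<eta>(1)])
  define D where "D x y \<omega> = f i y \<omega> - f i x \<omega>" for x y \<omega>
  have D_meas: "D x y \<in> borel_measurable (F z)" if "0 \<le> x" "x \<le> z" "0 \<le> y" "y \<le> z" "z \<le> T" for x y z
    unfolding D_def[abs_def] by (intro borel_measurable_diff f_adapted i that)
  show ?thesis
  proof (cases "b \<le> c")
    case True
    define \<theta> where "\<theta> \<omega> = (\<eta> \<omega> * D a b \<omega>) * \<eta>' \<omega>" for \<omega>
    have "\<theta> \<in> borel_measurable (F c)"
      unfolding \<theta>_def[abs_def] using ab True c0 by (intro borel_measurable_times \<eta>c \<eta>'(1) D_meas) auto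
    moreover have "integrable M \<theta>"
      unfolding \<theta>_def[abs_def] D_def
      by (rule square_integrable_mult[OF square_integrable_increment(1)[OF i ab \<eta>] \<eta>'(2)])
    ultimately have "expectation (\<lambda>\<omega>. \<theta> \<omega> * (f i d \<omega> - f i c \<omega>)) = 0"
      by (rule increment_moments_past(2)[OF i c0(1) cd(2,3)])
    moreover have "max 0 (min b d - c) = 0" using True by (simp add: max_def min_def)
    ultimately show ?thesis by (simp add: \<theta>_def D_def mult.assoc)
  next
    case False
    define e where "e = min b d"
    have e: "c \<le> e" "e \<le> b" "e \<le> d" "e \<le> T" "0 \<le> e" using False cd ab c0 by (auto simp: e_def)
    define \<theta>1 where "\<theta>1 \<omega> = (\<eta> \<omega> * D a c \<omega>) * \<eta>' \<omega>" for \<omega>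
    define \<theta>2 where "\<theta>2 \<omega> = \<eta> \<omega> * \<eta>' \<omega>" for \<omega>
    define \<theta>3 where "\<theta>3 \<omega> = \<theta>2 \<omega> * D c e \<omega>" for \<omega>
    have \<theta>1: "\<theta>1 \<in> borel_measurable (F c)" "integrable M \<theta>1"
      unfolding \<theta>1_def[abs_def] D_def
      using square_integrable_mult[OF square_integrable_increment(1)[OF i ab(1) cd(1) c0(2) \<eta>] \<eta>'(2)]
        D_meas[of a c c] ab cd c0
      by (auto intro!: borel_measurable_times \<eta>c \<eta>'(1) simp: D_def[abs_def])
    have \<theta>1e: "\<theta>1 \<in> borel_measurable (F e)" by (rule F_mono[OF c0(1) e(1,4) \<theta>1(1)])
    have \<theta>2: "\<theta>2 \<in> borel_measurable (F c)" "integrable M \<theta>2"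
      unfolding \<theta>2_def[abs_def] by (intro borel_measurable_times \<eta>c \<eta>'(1) square_integrable_mult \<eta>(2) \<eta>'(2))+
    note m1 = increment_moments_past[OF i c0(1) e(1,4) \<theta>1] increment_moments_past[OF i e(5,3) cd(3) \<theta>1e \<theta>1(2)]
    note m2 = increment_moments_past[OF i c0(1) e(1,4) \<theta>2]
    have \<theta>3: "\<theta>3 \<in> borel_measurable (F e)" "integrable M \<theta>3"
    proof -
      have "\<theta>2 \<in> borel_measurable (F e)" by (rule F_mono[OF c0(1) e(1,4) \<theta>2(1)])
      then show "\<theta>3 \<in> borel_measurable (F e)"
        unfolding \<theta>3_def[abs_def] using D_meas[of c e e] c0 e by (intro borel_measurable_times) auto
      show "integrable M \<theta>3" unfolding \<theta>3_def[abs_def] D_def by (rule m2(1))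
    qed
    note m3 = increment_moments_past[OF i e(5,3) cd(3) \<theta>3] increment_moments_past[OF i e(5,2) ab(3) \<theta>3]
    have zero: "D e b \<omega> * D e d \<omega> = 0" for \<omega> by (auto simp: e_def D_def min_def)
    have "(\<eta> \<omega> * D a b \<omega>) * (\<eta>' \<omega> * D c d \<omega>) =
      \<theta>1 \<omega> * D c e \<omega> + \<theta>1 \<omega> * D e d \<omega> + \<theta>2 \<omega> * (D c e \<omega>)\<^sup>2 + \<theta>3 \<omega> * D e d \<omega> + \<theta>3 \<omega> * D e b \<omega>" for \<omega>
    proof -
      have "(\<eta> \<omega> * D a b \<omega>) * (\<eta>' \<omega> * D c d \<omega>) = \<theta>1 \<omega> * D c e \<omega> + \<theta>1 \<omega> * D e d \<omega> + \<theta>2 \<omega> * (D c e \<omega>)\<^sup>2 + \<theta>3 \<omega> * D e d \<omega> + \<theta>3 \<omega> * D e b \<omega>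
        + \<theta>2 \<omega> * (D e b \<omega> * D e d \<omega>)"
        unfolding \<theta>1_def \<theta>2_def \<theta>3_def D_def power2_eq_square by (simp add: algebra_simps)
      then show ?thesis using zero[of \<omega>] by simp
    qed
    then have "expectation (\<lambda>\<omega>. (\<eta> \<omega> * D a b \<omega>) * (\<eta>' \<omega> * D c d \<omega>)) =
      expectation (\<lambda>\<omega>. \<theta>1 \<omega> * D c e \<omega> + \<theta>1 \<omega> * D e d \<omega> + \<theta>2 \<omega> * (D c e \<omega>)\<^sup>2 + \<theta>3 \<omega> * D e d \<omega> + \<theta>3 \<omega> * D e b \<omega>)"
      by simp
    also have "\<dots> = expectation \<theta>2 * (e - c)"
      unfolding D_def using m1 m2 m3 by simp
    finally show ?thesis using e(1) unfolding D_def \<theta>2_def e_def by (simp add: max_absorb2)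
  qed
qed

lemma increment_inner:
  assumes i: "i \<in> {1..m}" and ab: "0 \<le> a" "a \<le> b" "b \<le> T" and cd: "0 \<le> c" "c \<le> d" "d \<le> T"
    and \<eta>: "\<eta> \<in> borel_measurable (F a)" "square_integrable M \<eta>"
    and \<eta>': "\<eta>' \<in> borel_measurable (F c)" "square_integrable M \<eta>'"
  shows "expectation (\<lambda>\<omega>. (\<eta> \<omega> * (f i b \<omega> - f i a \<omega>)) * (\<eta>' \<omega> * (f i d \<omega> - f i c \<omega>))) =
    expectation (\<lambda>\<omega>. \<eta> \<omega> * \<eta>' \<omega>) * max 0 (min b d - max a c)"
proof (cases "a \<le> c")
  case True
  then show ?thesis using increment_inner_ordered[OF i ab True cd(2,3) \<eta> \<eta>'] by (simp add: max_absorb2)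
next
  case False
  then have ca: "c \<le> a" by simp
  show ?thesis
    using increment_inner_ordered[OF i cd ca ab(2,3) \<eta>' \<eta>] ca
    by (simp add: max_absorb1 mult_ac min.commute)
qed

definition w :: "nat \<Rightarrow> real \<Rightarrow> 'a \<Rightarrow> real" where
  "w i s \<omega> = (if i = 0 then s else f i s \<omega>)"

text \<open>A triple \<open>(a, b, \<eta>)\<close> stands for the process \<open>\<eta> 1\<^bsub>[a,b)\<^esub>\<close>; the intervals of a list may overlap,
  so that concatenation of lists is addition of processes.\<close>

definition elementary :: "(real \<times> real \<times> ('a \<Rightarrow> real)) list \<Rightarrow> bool" where
  "elementary el \<longleftrightarrow> (\<forall>(a, b, \<eta>)\<in>set el. t \<le> a \<and> a \<le> b \<and> b \<le> T \<and> \<eta> \<in> borel_measurable (F a) \<and> square_integrable M \<eta>)"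

definition el_proc :: "(real \<times> real \<times> ('a \<Rightarrow> real)) list \<Rightarrow> real \<Rightarrow> 'a \<Rightarrow> real" where
  "el_proc el u \<omega> = (\<Sum>(a, b, \<eta>)\<leftarrow>el. \<eta> \<omega> * indicator {a..<b} u)"

definition el_int :: "nat \<Rightarrow> (real \<times> real \<times> ('a \<Rightarrow> real)) list \<Rightarrow> real \<Rightarrow> 'a \<Rightarrow> real" where
  "el_int i el s \<omega> = (\<Sum>(a, b, \<eta>)\<leftarrow>el. \<eta> \<omega> * (w i (max a (min b s)) \<omega> - w i a \<omega>))"

definition el_uminus :: "(real \<times> real \<times> ('a \<Rightarrow> real)) list \<Rightarrow> (real \<times> real \<times> ('a \<Rightarrow> real)) list" where
  "el_uminus el = map (\<lambda>(a, b, \<eta>). (a, b, \<lambda>\<omega>. - \<eta> \<omega>)) el"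

lemma elementary_simps:
  "elementary []" "elementary ((a, b, \<eta>) # el) \<longleftrightarrow> t \<le> a \<and> a \<le> b \<and> b \<le> T \<and> \<eta> \<in> borel_measurable (F a) \<and> square_integrable M \<eta> \<and> elementary el"
  "elementary (el @ el') \<longleftrightarrow> elementary el \<and> elementary el'"
  unfolding elementary_def set_append ball_Un by simp_all

lemma el_proc_simps:
  "el_proc [] u \<omega> = 0" "el_proc ((a, b, \<eta>) # el) u \<omega> = \<eta> \<omega> * indicator {a..<b} u + el_proc el u \<omega>"
  "el_proc (el @ el') u \<omega> = el_proc el u \<omega> + el_proc el' u \<omega>"
  by (simp_all add: el_proc_def)

lemma el_int_simps:
  "el_int i [] s \<omega> = 0" "el_int i ((a, b, \<eta>) # el) s \<omega> = \<eta> \<omega> * (w i (max a (min b s)) \<omega> - w i a \<omega>) + el_int i el s \<omega>"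
  "el_int i (el @ el') s \<omega> = el_int i el s \<omega> + el_int i el' s \<omega>"
  by (simp_all add: el_int_def)

lemma el_uminus:
  "elementary el \<Longrightarrow> elementary (el_uminus el)" "el_proc (el_uminus el) u \<omega> = - el_proc el u \<omega>"
  "el_int i (el_uminus el) s \<omega> = - el_int i el s \<omega>"
proof -
  have Cons: "el_uminus ((a, b, \<eta>) # el) = (a, b, \<lambda>\<omega>. - \<eta> \<omega>) # el_uminus el" for a b \<eta> el
    by (simp add: el_uminus_def)
  have Nil: "el_uminus [] = []" by (simp add: el_uminus_def)
  show "el_proc (el_uminus el) u \<omega> = - el_proc el u \<omega>"
    by (induction el) (auto simp: Nil Cons el_proc_simps)
  show "el_int i (el_uminus el) s \<omega> = - el_int i el s \<omega>"
    by (induction el) (auto simp: Nil Cons el_int_simps)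
  show "elementary el \<Longrightarrow> elementary (el_uminus el)"
  proof (induction el)
    case (Cons x el)
    obtain a b \<eta> where x: "x = (a, b, \<eta>)" by (cases x) auto
    have "square_integrable M (\<lambda>\<omega>. - \<eta> \<omega>)"
      using Cons.prems square_integrable_cmult[of M \<eta> "-1"] by (simp add: x elementary_simps)
    then show ?case using Cons by (simp add: x elementary_simps \<open>\<And>el b a \<eta>. el_uminus ((a, b, \<eta>) # el) = (a, b, \<lambda>\<omega>. - \<eta> \<omega>) # el_uminus el\<close>)
  qed (simp add: Nil elementary_simps)
qed

definition pnsq :: "real \<Rightarrow> (real \<Rightarrow> 'a \<Rightarrow> real) \<Rightarrow> ennreal" where
  "pnsq s Y = (\<integral>\<^sup>+u. nsq M (Y u) \<partial>lebesgue_on {t..s})"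

lemma integral_indicator_overlap:
  assumes "t \<le> a" "a \<le> b" "t \<le> c" "c \<le> d"
  shows "(\<integral>u. indicator {a..<b} u * indicator {c..<d} u \<partial>lebesgue_on {t..s}) =
    max 0 (min (max a (min b s)) (max c (min d s)) - max a c)"
proof -
  have "(\<integral>u. indicator {a..<b} u * indicator {c..<d} u \<partial>lebesgue_on {t..s}) =
    (\<integral>u. (indicator {t..s} u * (indicator {a..<b} u * indicator {c..<d} u) :: real) \<partial>lebesgue)"
    by (subst integral_restrict_space) auto
  also have "\<dots> = (\<integral>u. indicator ({max a c..<min b d} \<inter> {..s}) u \<partial>lebesgue)"
    using assms by (intro Bochner_Integration.integral_cong refl) (auto split: split_indicator)
  also have "\<dots> = measure lebesgue ({max a c..<min b d} \<inter> {..s})"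
    by simp
  also have "\<dots> = max 0 (min (max a (min b s)) (max c (min d s)) - max a c)"
  proof (cases "s < min b d")
    case True
    then have "{max a c..<min b d} \<inter> {..s} = {max a c..s}" by auto
    moreover have "min (max a (min b s)) (max c (min d s)) = min (max a s) (max c s)" using True by (simp add: min_absorb2)
    moreover have "measure lebesgue {max a c..s} = max 0 (s - max a c)" by (cases "max a c \<le> s") auto
    moreover have "max 0 (s - max a c) = max 0 (min (max a s) (max c s) - max a c)"
    proof (cases "max a c \<le> s")
      case True
      then show ?thesis by (simp add: max_absorb2)
    next
      case sm: False
      have "min (max a s) (max c s) \<le> max a c"
      proof (cases "a \<le> c")
        case True
        then have "max c s = c" "max a c = c" using sm by (simp_all add: max_absorb1 max_absorb2)
        then show ?thesis by (simp only: min.cobounded2)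
      next
        case False
        then have "max a s = a" "max a c = a" using sm by (simp_all add: max_absorb1 max_absorb2)
        then show ?thesis by (simp only: min.cobounded1)
      qed
      then show ?thesis using sm by (simp add: max_absorb1)
    qed
    ultimately show ?thesis by (simp only:)
  next
    case False
    then have "min b d \<le> s" by linarith
    then have "{max a c..<min b d} \<inter> {..s} = {max a c..<min b d}"
      by (intro Int_absorb2 subsetI) (simp only: atLeastLessThan_iff atMost_iff, linarith)
    moreover have "measure lebesgue {max a c..<min b d} = max 0 (min b d - max a c)" by (cases "max a c \<le> min b d") auto
    moreover have "min (max a (min b s)) (max c (min d s)) = min b d"
    proof (cases "b \<le> d")
      case True
      then have "min b s = b" "b \<le> min d s" using False by auto
      then show ?thesis using True assms(2) by (simp add: max_absorb2 min_absorb1 le_max_iff_disj)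
    next
      case bd: False
      then have "min d s = d" "d \<le> min b s" using False by auto
      then show ?thesis using bd assms(4) by (simp add: max_absorb2 min_absorb2 le_max_iff_disj)
    qed
    ultimately show ?thesis by (simp only:)
  qed
  finally show ?thesis .
qed

lemma indicator_measurable_lebesgue_on: "(indicator {a..<b} :: real \<Rightarrow> real) \<in> borel_measurable (lebesgue_on {c..d})"
  by (intro measurable_restrict_space1 borel_measurable_indicator) simp

lemma ito_isometry:
  assumes i: "i \<in> {1..m}" and el: "elementary el" and s: "t \<le> s" "s \<le> T"
  shows "square_integrable M (el_int i el s)" "nsq M (el_int i el s) = pnsq s (el_proc el)"
proof -
  define N where "N = length el"
  define a where "a n = fst (el ! n)" for n
  define b where "b n = fst (snd (el ! n))" for n
  define \<eta> where "\<eta> n = snd (snd (el ! n))" for n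
  define c where "c n = max (a n) (min (b n) s)" for n
  have val: "t \<le> a n \<and> a n \<le> b n \<and> b n \<le> T \<and> \<eta> n \<in> borel_measurable (F (a n)) \<and> square_integrable M (\<eta> n)" if "n < N" for n
  proof -
    have "el ! n \<in> set el" using that by (simp add: N_def)
    then show ?thesis using el unfolding elementary_def a_def b_def \<eta>_def by (auto simp: case_prod_unfold)
  qed
  have ac: "0 \<le> a n" "a n \<le> c n" "c n \<le> T" if "n < N" for n
    using val[OF that] t_nonneg s by (auto simp: c_def)
  define X where "X n \<omega> = \<eta> n \<omega> * (f i (c n) \<omega> - f i (a n) \<omega>)" for n \<omega>
  have X: "square_integrable M (X n)" if "n < N" for n
    unfolding X_def[abs_def] using val[OF that] ac[OF that] by (intro square_integrable_increment(1)[OF i]) auto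
  have int_eq: "el_int i el s = (\<lambda>\<omega>. \<Sum>n<N. X n \<omega>)"
    unfolding el_int_def[abs_def] case_prod_unfold sum_list_map_nth N_def X_def a_def b_def c_def \<eta>_def
    using i by (simp add: w_def)
  have proc_eq: "el_proc el u = (\<lambda>\<omega>. \<Sum>n<N. \<eta> n \<omega> * indicator {a n..<b n} u)" for u
    unfolding el_proc_def[abs_def] case_prod_unfold sum_list_map_nth N_def a_def b_def \<eta>_def ..
  show si: "square_integrable M (el_int i el s)"
    unfolding int_eq by (intro square_integrable_sum X) simp
  define v where "v n n' = expectation (\<lambda>\<omega>. \<eta> n \<omega> * \<eta> n' \<omega>)" for n n'
  have "expectation (\<lambda>\<omega>. (el_int i el s \<omega>)\<^sup>2) = expectation (\<lambda>\<omega>. \<Sum>n<N. \<Sum>n'<N. 1 * (X n \<omega> * X n' \<omega>))"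
    unfolding int_eq power2_eq_square sum_product by simp
  also have "\<dots> = (\<Sum>n<N. \<Sum>n'<N. 1 * expectation (\<lambda>\<omega>. X n \<omega> * X n' \<omega>))"
    by (rule integral_double_sum[where b = "\<lambda>_ _. 1" and g = "\<lambda>n n' \<omega>. X n \<omega> * X n' \<omega>"]) (intro square_integrable_mult X)
  also have "\<dots> = (\<Sum>n<N. \<Sum>n'<N. v n n' * (\<integral>u. indicator {a n..<b n} u * indicator {a n'..<b n'} u \<partial>lebesgue_on {t..s}))"
  proof (intro sum.cong refl)
    fix n n' assume "n \<in> {..<N}" "n' \<in> {..<N}"
    then have n: "n < N" "n' < N" by simp_all
    have "expectation (\<lambda>\<omega>. X n \<omega> * X n' \<omega>) = v n n' * max 0 (min (c n) (c n') - max (a n) (a n'))"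
      unfolding X_def v_def using val[OF n(1)] val[OF n(2)] ac[OF n(1)] ac[OF n(2)]
      by (intro increment_inner[OF i]) auto
    moreover have "(\<integral>u. indicator {a n..<b n} u * indicator {a n'..<b n'} u \<partial>lebesgue_on {t..s}) =
        max 0 (min (c n) (c n') - max (a n) (a n'))"
      unfolding c_def by (rule integral_indicator_overlap) (use val[OF n(1)] val[OF n(2)] in blast)+
    ultimately show "1 * expectation (\<lambda>\<omega>. X n \<omega> * X n' \<omega>) = v n n' * (\<integral>u. indicator {a n..<b n} u * indicator {a n'..<b n'} u \<partial>lebesgue_on {t..s})"
      by (simp only: mult_1)
  qed
  finally have lhs: "expectation (\<lambda>\<omega>. (el_int i el s \<omega>)\<^sup>2) =
    (\<Sum>n<N. \<Sum>n'<N. v n n' * (\<integral>u. indicator {a n..<b n} u * indicator {a n'..<b n'} u \<partial>lebesgue_on {t..s}))" .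
  define g where "g u = (\<Sum>n<N. \<Sum>n'<N. v n n' * (indicator {a n..<b n} u * indicator {a n'..<b n'} u))" for u
  have gE: "g u = expectation (\<lambda>\<omega>. (el_proc el u \<omega>)\<^sup>2)" and proc_si: "square_integrable M (el_proc el u)" for u
  proof -
    show "square_integrable M (el_proc el u)"
    proof -
      have "square_integrable M (\<lambda>\<omega>. \<eta> n \<omega> * indicator {a n..<b n} u)" if "n \<in> {..<N}" for n
      proof -
        have "square_integrable M (\<eta> n)" using val[OF that[unfolded lessThan_iff]] by blast
        then have "square_integrable M (\<lambda>\<omega>. indicator {a n..<b n} u * \<eta> n \<omega>)" by (rule square_integrable_cmult)
        then show ?thesis by (simp only: mult.commute)
      qed
      then show ?thesis unfolding proc_eq by (rule square_integrable_sum)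
    qed
    have "expectation (\<lambda>\<omega>. (el_proc el u \<omega>)\<^sup>2) =
      expectation (\<lambda>\<omega>. \<Sum>n<N. \<Sum>n'<N. (indicator {a n..<b n} u * indicator {a n'..<b n'} u) * (\<eta> n \<omega> * \<eta> n' \<omega>))"
      unfolding proc_eq power2_eq_square sum_product by (simp only: mult_ac)
    also have "\<dots> = (\<Sum>n<N. \<Sum>n'<N. (indicator {a n..<b n} u * indicator {a n'..<b n'} u) * v n n')"
      unfolding v_def
      by (rule integral_double_sum[where b = "\<lambda>n n'. indicator {a n..<b n} u * indicator {a n'..<b n'} u" and g = "\<lambda>n n' \<omega>. \<eta> n \<omega> * \<eta> n' \<omega>"])
         (intro square_integrable_mult; use val in blast)
    finally show "g u = expectation (\<lambda>\<omega>. (el_proc el u \<omega>)\<^sup>2)" unfolding g_def by (simp only: mult.commute)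
  qed
  interpret Q: finite_measure "lebesgue_on {t..s}" by (rule finite_measure_lebesgue_on_Icc)
  have int: "integrable (lebesgue_on {t..s}) (\<lambda>u. indicator {a n..<b n} u * indicator {a n'..<b n'} u :: real)" for n n'
    by (rule Q.integrable_const_bound[where B = 1])
       (auto intro!: AE_I2 borel_measurable_times indicator_measurable_lebesgue_on split: split_indicator)
  have g_int: "integrable (lebesgue_on {t..s}) g"
    unfolding g_def[abs_def] by (intro Bochner_Integration.integrable_sum integrable_mult_right int)
  have "pnsq s (el_proc el) = (\<integral>\<^sup>+u. ennreal (g u) \<partial>lebesgue_on {t..s})"
    unfolding pnsq_def nsq_eq_integral[OF proc_si] gE ..
  also have "\<dots> = ennreal (\<integral>u. g u \<partial>lebesgue_on {t..s})"
    by (rule nn_integral_eq_integral[OF g_int]) (simp add: gE)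
  also have "(\<integral>u. g u \<partial>lebesgue_on {t..s}) = expectation (\<lambda>\<omega>. (el_int i el s \<omega>)\<^sup>2)"
    unfolding lhs g_def by (rule integral_double_sum[where b = v and g = "\<lambda>n n' u. indicator {a n..<b n} u * indicator {a n'..<b n'} u"]) (rule int)
  finally show "nsq M (el_int i el s) = pnsq s (el_proc el)" using nsq_eq_integral[OF si] by simp
qed

lemma ito_isometry_diff:
  assumes i: "i \<in> {1..m}" and el: "elementary el" "elementary el'" and s: "t \<le> s" "s \<le> T"
  shows "nsq M (\<lambda>\<omega>. el_int i el s \<omega> - el_int i el' s \<omega>) = pnsq s (\<lambda>u \<omega>. el_proc el u \<omega> - el_proc el' u \<omega>)"
proof -
  have "elementary (el @ el_uminus el')" using el el_uminus(1) by (simp add: elementary_simps)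
  from ito_isometry(2)[OF i this s] show ?thesis
    by (simp add: el_int_simps el_proc_simps el_uminus nsq_def pnsq_def)
qed

subsection \<open>Distances between processes\<close>

abbreviation joint :: "real \<Rightarrow> (real \<Rightarrow> 'a \<Rightarrow> real) \<Rightarrow> bool" where
  "joint s Y \<equiv> (\<lambda>(u, \<omega>). Y u \<omega>) \<in> borel_measurable (lebesgue_on {t..s} \<Otimes>\<^sub>M M)"

lemma joint_section: "joint s Y \<Longrightarrow> u \<in> {t..s} \<Longrightarrow> Y u \<in> borel_measurable M"
  using measurable_Pair2[of "\<lambda>(u, \<omega>). Y u \<omega>" "lebesgue_on {t..s}" M borel u] by (simp add: space_restrict_space)

lemma joint_nsq: "joint s Y \<Longrightarrow> joint s Z \<Longrightarrow> (\<lambda>u. nsq M (\<lambda>\<omega>. Y u \<omega> - Z u \<omega>)) \<in> borel_measurable (lebesgue_on {t..s})"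
  unfolding nsq_def by (intro borel_measurable_nn_integral) (auto simp: case_prod_unfold)

lemma joint_mono:
  assumes "joint s' Y" "s \<le> s'"
  shows "joint s Y"
proof -
  have id: "(\<lambda>u. u) \<in> lebesgue_on {t..s} \<rightarrow>\<^sub>M lebesgue_on {t..s'}"
    using assms(2) by (intro measurable_restrict_space3) auto
  have "(\<lambda>x. (fst x, snd x)) \<in> lebesgue_on {t..s} \<Otimes>\<^sub>M M \<rightarrow>\<^sub>M lebesgue_on {t..s'} \<Otimes>\<^sub>M M"
    by (intro measurable_Pair measurable_compose[OF measurable_fst id] measurable_snd)
  from measurable_compose[OF this assms(1)] show ?thesis by (simp add: case_prod_unfold)
qed

lemma pnsq_mono: "s \<le> s' \<Longrightarrow> pnsq s Y \<le> pnsq s' Y"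
  unfolding pnsq_def by (simp add: nn_integral_restrict_space) (intro nn_integral_mono, auto split: split_indicator)

lemma pnsq_diff_le:
  assumes "joint s X" "joint s Y" "joint s Z"
  shows "pnsq s (\<lambda>u \<omega>. X u \<omega> - Z u \<omega>) \<le> 2 * pnsq s (\<lambda>u \<omega>. X u \<omega> - Y u \<omega>) + 2 * pnsq s (\<lambda>u \<omega>. Y u \<omega> - Z u \<omega>)"
proof -
  have "pnsq s (\<lambda>u \<omega>. X u \<omega> - Z u \<omega>) \<le> (\<integral>\<^sup>+u. 2 * nsq M (\<lambda>\<omega>. X u \<omega> - Y u \<omega>) + 2 * nsq M (\<lambda>\<omega>. Y u \<omega> - Z u \<omega>) \<partial>lebesgue_on {t..s})"
    unfolding pnsq_def
  proof (rule nn_integral_mono)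
    fix u assume "u \<in> space (lebesgue_on {t..s})"
    then have "u \<in> {t..s}" by (simp add: space_restrict_space)
    then show "nsq M (\<lambda>\<omega>. X u \<omega> - Z u \<omega>) \<le> 2 * nsq M (\<lambda>\<omega>. X u \<omega> - Y u \<omega>) + 2 * nsq M (\<lambda>\<omega>. Y u \<omega> - Z u \<omega>)"
      by (intro nsq_diff_le joint_section[OF assms(1)] joint_section[OF assms(2)] joint_section[OF assms(3)])
  qed
  also have "\<dots> = 2 * pnsq s (\<lambda>u \<omega>. X u \<omega> - Y u \<omega>) + 2 * pnsq s (\<lambda>u \<omega>. Y u \<omega> - Z u \<omega>)"
    unfolding pnsq_def
    using joint_nsq[OF assms(1,2)] joint_nsq[OF assms(2,3)]
    by (subst nn_integral_add) (simp_all add: nn_integral_cmult)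
  finally show ?thesis .
qed

lemma pnsq_commute: "pnsq s (\<lambda>u \<omega>. X u \<omega> - Y u \<omega>) = pnsq s (\<lambda>u \<omega>. Y u \<omega> - X u \<omega>)"
  unfolding pnsq_def by (intro nn_integral_cong nsq_commute)

lemma joint_el_proc: "elementary el \<Longrightarrow> joint s (el_proc el)"
proof (induction el)
  case Nil
  then show ?case by (simp add: el_proc_simps case_prod_unfold)
next
  case (Cons x el)
  obtain a b \<eta> where x: "x = (a, b, \<eta>)" by (cases x) auto
  have "\<eta> \<in> borel_measurable M" using Cons.prems square_integrable_measurable by (auto simp: x elementary_simps)
  then have "(\<lambda>z. \<eta> (snd z) * indicator {a..<b} (fst z) + el_proc el (fst z) (snd z)) \<in> borel_measurable (lebesgue_on {t..s} \<Otimes>\<^sub>M M)"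
    using Cons by (intro borel_measurable_add borel_measurable_times measurable_compose[OF measurable_snd]
        measurable_compose[OF measurable_fst indicator_measurable_lebesgue_on]) (auto simp: x elementary_simps case_prod_unfold)
  then show ?case by (simp add: x el_proc_simps case_prod_unfold)
qed

definition list_of_steps :: "nat \<Rightarrow> (nat \<Rightarrow> real) \<Rightarrow> (nat \<Rightarrow> 'a \<Rightarrow> real) \<Rightarrow> (real \<times> real \<times> ('a \<Rightarrow> real)) list" where
  "list_of_steps N \<tau> \<eta> = map (\<lambda>j. (\<tau> j, \<tau> (Suc j), \<eta> j)) [0..<N]"

lemma adapted_step_partition:
  assumes "adapted_step M F t s N \<tau> \<eta>" "j \<le> N"
  shows "t \<le> \<tau> j" "\<tau> j \<le> s"
proof -
  have le: "\<tau> p \<le> \<tau> q" if "p \<le> q" "q \<le> N" for p q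
    using that
  proof (induction q rule: dec_induct)
    case (step n)
    then have "\<tau> n < \<tau> (Suc n)" using assms(1) by (simp add: adapted_step_def)
    with step show ?case by simp
  qed simp
  show "t \<le> \<tau> j" "\<tau> j \<le> s"
    using le[of 0 j] le[of j N] assms by (auto simp: adapted_step_def)
qed

lemma list_of_steps:
  assumes st: "adapted_step M F t s N \<tau> \<eta>" and s: "t \<le> s" "s \<le> T"
  shows "elementary (list_of_steps N \<tau> \<eta>)" "el_proc (list_of_steps N \<tau> \<eta>) = step_process N \<tau> \<eta>"
    "i \<noteq> 0 \<Longrightarrow> el_int i (list_of_steps N \<tau> \<eta>) s = step_integral (f i) N \<tau> \<eta>"
proof -
  have sum_upt: "(\<Sum>j\<leftarrow>[0..<N]. g j) = (\<Sum>j<N. g j)" for g :: "nat \<Rightarrow> real"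
    by (simp add: interv_sum_list_conv_sum_set_nat atLeast0LessThan)
  show "elementary (list_of_steps N \<tau> \<eta>)"
    unfolding elementary_def
  proof (intro ballI)
    fix x assume "x \<in> set (list_of_steps N \<tau> \<eta>)"
    then obtain j where j: "j < N" "x = (\<tau> j, \<tau> (Suc j), \<eta> j)" by (auto simp: list_of_steps_def)
    have "\<eta> j \<in> borel_measurable (F (\<tau> j))" "integrable M (\<lambda>\<omega>. (\<eta> j \<omega>)\<^sup>2)" "\<tau> j \<le> \<tau> (Suc j)"
      using st j(1) by (auto simp: adapted_step_def intro: less_imp_le)
    moreover have "t \<le> \<tau> j" "\<tau> (Suc j) \<le> T"
      using adapted_step_partition[OF st, of j] adapted_step_partition[OF st, of "Suc j"] j(1) s by auto
    moreover have "\<eta> j \<in> borel_measurable M"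
      using calculation t_nonneg by (intro F_measurable[of "\<tau> j"]) auto
    ultimately show "case x of (a, b, \<eta>) \<Rightarrow> t \<le> a \<and> a \<le> b \<and> b \<le> T \<and> \<eta> \<in> borel_measurable (F a) \<and> square_integrable M \<eta>"
      by (simp add: j(2) square_integrable_def)
  qed
  show "el_proc (list_of_steps N \<tau> \<eta>) = step_process N \<tau> \<eta>"
    unfolding el_proc_def[abs_def] step_process_def[abs_def] list_of_steps_def by (simp add: comp_def sum_upt)
  show "el_int i (list_of_steps N \<tau> \<eta>) s = step_integral (f i) N \<tau> \<eta>" if "i \<noteq> 0"
  proof -
    have "max (\<tau> j) (min (\<tau> (Suc j)) s) = \<tau> (Suc j)" if "j < N" for j
    proof -
      have "\<tau> j \<le> \<tau> (Suc j)" using st that by (auto simp: adapted_step_def intro: less_imp_le)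
      then show ?thesis using adapted_step_partition(2)[OF st, of "Suc j"] that by auto
    qed
    then show ?thesis
      unfolding el_int_def[abs_def] step_integral_def[abs_def] list_of_steps_def
      using \<open>i \<noteq> 0\<close> by (simp add: comp_def sum_upt w_def)
  qed
qed

end

section \<open>Approximation of the integrands\<close>

lemma clamp_lipschitz: "\<bar>max a (min b s) - max a (min b s')\<bar> \<le> \<bar>s - s' :: real\<bar>"
proof -
  have "\<bar>max a x - max a y\<bar> \<le> \<bar>x - y\<bar>" for x y :: real by (simp add: max_def)
  moreover have "\<bar>min b s - min b s'\<bar> \<le> \<bar>s - s'\<bar>" by (simp add: min_def)
  ultimately show ?thesis using order_trans by blast
qed

context wiener_setting
begin

text \<open>Polynomials in the increments up to time \<open>u\<close>.  They are adapted, and their products with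
  exponentials are limits of exponentials.\<close>

inductive past_poly :: "real \<Rightarrow> ('a \<Rightarrow> real) \<Rightarrow> bool" for u where
  const: "past_poly u (\<lambda>_. c)"
| add: "past_poly u P \<Longrightarrow> past_poly u Q \<Longrightarrow> past_poly u (\<lambda>\<omega>. P \<omega> + Q \<omega>)"
| cmult: "past_poly u P \<Longrightarrow> past_poly u (\<lambda>\<omega>. c * P \<omega>)"
| increment: "past_poly u P \<Longrightarrow> i \<in> {1..m} \<Longrightarrow> t \<le> a \<Longrightarrow> a \<le> b \<Longrightarrow> b \<le> u \<Longrightarrow>
    past_poly u (\<lambda>\<omega>. P \<omega> * (f i b \<omega> - f i a \<omega>))"

lemma past_poly_mono: "past_poly u P \<Longrightarrow> u \<le> v \<Longrightarrow> past_poly v P"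
proof (induction rule: past_poly.induct)
  case (increment P i a b)
  then show ?case by (intro past_poly.increment) linarith+
qed (simp_all add: past_poly.const past_poly.add past_poly.cmult)

lemma past_poly_adapted:
  assumes "past_poly u P" "u \<le> T"
  shows "P \<in> borel_measurable (F u)"
  using assms(1)
proof (induction rule: past_poly.induct)
  case (increment P i a b)
  have "f i b \<in> borel_measurable (F u)" "f i a \<in> borel_measurable (F u)"
    using increment t_nonneg assms(2) by (intro f_adapted; linarith?)+
  then show ?case using increment.IH by (intro borel_measurable_times borel_measurable_diff)
qed auto

lemma past_poly_multiplier:
  assumes "past_poly u P" "u \<le> T"
  shows "exp_multiplier P"
  using assms(1)
proof (induction rule: past_poly.induct)
  case (increment P i a b)
  have "gauss (\<lambda>\<omega>. f i b \<omega> - f i a \<omega>) (step_fun [(1, i, b), (-1, i, a)])"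
    using increment.hyps assms(2) by (intro gauss_increment) linarith+
  then show ?case by (rule exp_multiplier_mult[OF increment.IH])
qed (rule exp_multiplier_const exp_multiplier_add exp_multiplier_cmult; assumption?)+

lemma past_poly_square_integrable: "past_poly u P \<Longrightarrow> u \<le> T \<Longrightarrow> square_integrable M P"
  using exp_multiplier_base(1) past_poly_multiplier by blast

text \<open>Uniform continuity in mean square lets such a process be sampled at the points of a partition, and
  the resulting step process is adapted with polynomial values.\<close>

definition regular_process :: "(real \<Rightarrow> 'a \<Rightarrow> real) \<Rightarrow> bool" where
  "regular_process Y \<longleftrightarrow> (\<forall>u\<in>{t..T}. past_poly u (Y u)) \<and>
     (\<exists>C\<ge>0. \<forall>u\<in>{t..T}. nsq M (Y u) \<le> ennreal C) \<and>
     (\<forall>e>0. \<exists>d>0. \<forall>u\<in>{t..T}. \<forall>v\<in>{t..T}. \<bar>u - v\<bar> < d \<longrightarrow> nsq M (\<lambda>\<omega>. Y u \<omega> - Y v \<omega>) \<le> ennreal e)"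

lemma regular_process_measurable: "regular_process Y \<Longrightarrow> u \<in> {t..T} \<Longrightarrow> square_integrable M (Y u)"
  unfolding regular_process_def by (meson atLeastAtMost_iff past_poly_square_integrable)

lemma regular_process_const: "regular_process (\<lambda>_ _. c)"
  unfolding regular_process_def
proof (intro conjI)
  show "\<exists>C\<ge>0. \<forall>u\<in>{t..T}. nsq M (\<lambda>_. c) \<le> ennreal C"
    by (intro exI[of _ "c\<^sup>2"] conjI ballI) (simp_all add: nsq_def emeasure_space_1)
  show "\<forall>u\<in>{t..T}. past_poly u (\<lambda>_. c)" by (intro ballI past_poly.const)
  show "\<forall>e>0. \<exists>d>0. \<forall>u\<in>{t..T}. \<forall>v\<in>{t..T}. \<bar>u - v\<bar> < d \<longrightarrow> nsq M (\<lambda>\<omega>. c - c) \<le> ennreal e"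
    by (intro allI impI exI[of _ 1] conjI ballI) (simp_all add: nsq_def)
qed

lemma regular_process_add:
  assumes X: "regular_process X" and Y: "regular_process Y"
  shows "regular_process (\<lambda>u \<omega>. X u \<omega> + Y u \<omega>)"
  unfolding regular_process_def
proof (intro conjI ballI allI impI)
  note mX = square_integrable_measurable[OF regular_process_measurable[OF X]]
    and mY = square_integrable_measurable[OF regular_process_measurable[OF Y]]
  show "past_poly u (\<lambda>\<omega>. X u \<omega> + Y u \<omega>)" if "u \<in> {t..T}" for u
    using X Y that unfolding regular_process_def by (intro past_poly.add) blast+
  obtain C where C: "0 \<le> C" "\<And>u. u \<in> {t..T} \<Longrightarrow> nsq M (X u) \<le> ennreal C"
    using X unfolding regular_process_def by blast
  obtain D where D: "0 \<le> D" "\<And>u. u \<in> {t..T} \<Longrightarrow> nsq M (Y u) \<le> ennreal D"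
    using Y unfolding regular_process_def by blast
  show "\<exists>C\<ge>0. \<forall>u\<in>{t..T}. nsq M (\<lambda>\<omega>. X u \<omega> + Y u \<omega>) \<le> ennreal C"
  proof (intro exI[of _ "2 * C + 2 * D"] conjI ballI)
    fix u assume u: "u \<in> {t..T}"
    have "nsq M (\<lambda>\<omega>. X u \<omega> + Y u \<omega>) \<le> 2 * nsq M (X u) + 2 * nsq M (Y u)"
      by (rule nsq_add_le[OF mX[OF u] mY[OF u]])
    also have "\<dots> \<le> 2 * ennreal C + 2 * ennreal D" by (intro add_mono mult_left_mono C(2) D(2) u) auto
    also have "\<dots> = ennreal (2 * C + 2 * D)" using C(1) D(1) by (simp add: ennreal_plus ennreal_mult)
    finally show "nsq M (\<lambda>\<omega>. X u \<omega> + Y u \<omega>) \<le> ennreal (2 * C + 2 * D)" .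
  qed (use C D in simp)
  fix e :: real assume e: "0 < e"
  then have "0 < e / 4" by simp
  then obtain d where d: "d > 0" "\<And>u v. u \<in> {t..T} \<Longrightarrow> v \<in> {t..T} \<Longrightarrow> \<bar>u - v\<bar> < d \<Longrightarrow> nsq M (\<lambda>\<omega>. X u \<omega> - X v \<omega>) \<le> ennreal (e / 4)"
    using X unfolding regular_process_def by meson
  obtain d' where d': "d' > 0" "\<And>u v. u \<in> {t..T} \<Longrightarrow> v \<in> {t..T} \<Longrightarrow> \<bar>u - v\<bar> < d' \<Longrightarrow> nsq M (\<lambda>\<omega>. Y u \<omega> - Y v \<omega>) \<le> ennreal (e / 4)"
    using Y \<open>0 < e / 4\<close> unfolding regular_process_def by meson
  show "\<exists>d>0. \<forall>u\<in>{t..T}. \<forall>v\<in>{t..T}. \<bar>u - v\<bar> < d \<longrightarrow> nsq M (\<lambda>\<omega>. (X u \<omega> + Y u \<omega>) - (X v \<omega> + Y v \<omega>)) \<le> ennreal e"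
  proof (intro exI[of _ "min d d'"] conjI ballI impI)
    fix u v assume "u \<in> {t..T}" "v \<in> {t..T}" "\<bar>u - v\<bar> < min d d'"
    then show "nsq M (\<lambda>\<omega>. (X u \<omega> + Y u \<omega>) - (X v \<omega> + Y v \<omega>)) \<le> ennreal e"
      by (intro nsq_add_diff_le[OF _ _ _ _ _ _ e] mX mY d(2) d'(2)) auto
  qed (use d d' in simp)
qed

lemma regular_process_cont_mult:
  assumes Y: "regular_process Y" and \<gamma>: "continuous_on UNIV \<gamma>"
  shows "regular_process (\<lambda>u \<omega>. \<gamma> u * Y u \<omega>)"
  unfolding regular_process_def
proof (intro conjI ballI allI impI)
  note mY = square_integrable_measurable[OF regular_process_measurable[OF Y]]
  show "past_poly u (\<lambda>\<omega>. \<gamma> u * Y u \<omega>)" if "u \<in> {t..T}" for u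
    using Y that unfolding regular_process_def by (intro past_poly.cmult) blast
  have \<gamma>c: "continuous_on {t..T} \<gamma>" using \<gamma> by (rule continuous_on_subset) simp
  obtain B where "\<forall>u\<in>{t..T}. \<bar>\<gamma> u\<bar> \<le> B"
    using compact_imp_bounded[OF compact_continuous_image[OF \<gamma>c compact_Icc]] unfolding bounded_iff by auto
  then have B: "\<And>u. u \<in> {t..T} \<Longrightarrow> \<bar>\<gamma> u\<bar> \<le> B" by blast
  have Bsq: "(\<gamma> u)\<^sup>2 \<le> B\<^sup>2" if "u \<in> {t..T}" for u
    using B[OF that] by (metis abs_ge_zero power2_abs power_mono)
  obtain C where C: "0 \<le> C" "\<And>u. u \<in> {t..T} \<Longrightarrow> nsq M (Y u) \<le> ennreal C"
    using Y unfolding regular_process_def by blast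
  have scaled: "nsq M (\<lambda>\<omega>. c * Z \<omega>) \<le> ennreal (q * r)"
    if "nsq M Z \<le> ennreal r" "c\<^sup>2 \<le> q" "0 \<le> r" "Z \<in> borel_measurable M" for c q r Z
  proof -
    have q0: "0 \<le> q" using that(2) zero_le_power2[of c] by linarith
    have "nsq M (\<lambda>\<omega>. c * Z \<omega>) = ennreal (c\<^sup>2) * nsq M Z" by (rule nsq_cmult[OF that(4)])
    also have "\<dots> \<le> ennreal q * ennreal r" by (intro mult_mono ennreal_leI that(1,2)) auto
    also have "\<dots> = ennreal (q * r)" by (rule ennreal_mult[OF q0 that(3), symmetric])
    finally show ?thesis .
  qed
  show "\<exists>C\<ge>0. \<forall>u\<in>{t..T}. nsq M (\<lambda>\<omega>. \<gamma> u * Y u \<omega>) \<le> ennreal C"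
    using scaled[OF C(2) Bsq C(1) mY] C(1) by (intro exI[of _ "B\<^sup>2 * C"]) simp
  fix e :: real assume e: "0 < e"
  define e1 where "e1 = e / (4 * (B\<^sup>2 + 1))"
  define q where "q = e / (4 * (C + 1))"
  have B1: "0 < 4 * (B\<^sup>2 + 1)" by (intro mult_pos_pos add_nonneg_pos) auto
  have e1: "0 < e1" unfolding e1_def using e B1 by (rule divide_pos_pos)
  have q: "0 < q" unfolding q_def using e C(1) by (intro divide_pos_pos) auto
  obtain d where d: "d > 0" "\<And>u v. u \<in> {t..T} \<Longrightarrow> v \<in> {t..T} \<Longrightarrow> \<bar>u - v\<bar> < d \<Longrightarrow> nsq M (\<lambda>\<omega>. Y u \<omega> - Y v \<omega>) \<le> ennreal e1"
    using Y e1 unfolding regular_process_def by meson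
  have "uniformly_continuous_on {t..T} \<gamma>" by (rule compact_uniformly_continuous[OF \<gamma>c compact_Icc])
  then obtain d' where d': "d' > 0" "\<And>u v. u \<in> {t..T} \<Longrightarrow> v \<in> {t..T} \<Longrightarrow> dist v u < d' \<Longrightarrow> dist (\<gamma> v) (\<gamma> u) < sqrt q"
    using q unfolding uniformly_continuous_on_def by (metis real_sqrt_gt_zero)
  show "\<exists>d>0. \<forall>u\<in>{t..T}. \<forall>v\<in>{t..T}. \<bar>u - v\<bar> < d \<longrightarrow> nsq M (\<lambda>\<omega>. \<gamma> u * Y u \<omega> - \<gamma> v * Y v \<omega>) \<le> ennreal e"
  proof (intro exI[of _ "min d d'"] conjI ballI impI)
    fix u v assume u: "u \<in> {t..T}" and v: "v \<in> {t..T}" and uv: "\<bar>u - v\<bar> < min d d'"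
    have "\<bar>\<gamma> u - \<gamma> v\<bar> < sqrt q" using d'(2)[OF v u] uv by (simp add: dist_real_def)
    then have "\<bar>\<gamma> u - \<gamma> v\<bar>\<^sup>2 \<le> (sqrt q)\<^sup>2" by (intro power_mono) auto
    then have qq: "(\<gamma> u - \<gamma> v)\<^sup>2 \<le> q" using q by simp
    have "nsq M (\<lambda>\<omega>. \<gamma> u * Y u \<omega> - \<gamma> v * Y v \<omega>) = nsq M (\<lambda>\<omega>. \<gamma> u * (Y u \<omega> - Y v \<omega>) + (\<gamma> u - \<gamma> v) * Y v \<omega>)"
      by (simp add: algebra_simps)
    also have "\<dots> \<le> 2 * nsq M (\<lambda>\<omega>. \<gamma> u * (Y u \<omega> - Y v \<omega>)) + 2 * nsq M (\<lambda>\<omega>. (\<gamma> u - \<gamma> v) * Y v \<omega>)"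
      by (rule nsq_add_le) (use mY[OF u] mY[OF v] in auto)
    also have "\<dots> \<le> 2 * ennreal (B\<^sup>2 * e1) + 2 * ennreal (q * C)"
      using uv e1 mY[OF u] mY[OF v]
      by (intro add_mono mult_left_mono scaled[OF d(2)[OF u v] Bsq[OF u]] scaled[OF C(2)[OF v] qq C(1)]) auto
    also have "\<dots> = ennreal (2 * (B\<^sup>2 * e1) + 2 * (q * C))"
      using e1 q C(1) by (simp add: ennreal_plus ennreal_mult)
    also have "2 * (B\<^sup>2 * e1) + 2 * (q * C) \<le> e"
    proof -
      have "B\<^sup>2 * e1 \<le> (B\<^sup>2 + 1) * e1" using e1 by (intro mult_right_mono) auto
      also have "\<dots> = e / 4"
      proof -
        have "b * (e / (4 * b)) = e / 4" if "b \<noteq> 0" for b :: real using that by (simp add: field_simps)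
        moreover have "B\<^sup>2 + 1 \<noteq> 0" using B1 by auto
        ultimately show ?thesis unfolding e1_def by blast
      qed
      finally have "B\<^sup>2 * e1 \<le> e / 4" .
      moreover have "q * C \<le> q * (C + 1)" using q by (intro mult_left_mono) auto
      moreover have "q * (C + 1) = e / 4"
      proof -
        have "e / (4 * b) * b = e / 4" if "b \<noteq> 0" for b :: real using that by (simp add: field_simps)
        moreover have "C + 1 \<noteq> 0" using C(1) by auto
        ultimately show ?thesis unfolding q_def by blast
      qed
      ultimately show ?thesis by linarith
    qed
    finally show "nsq M (\<lambda>\<omega>. \<gamma> u * Y u \<omega> - \<gamma> v * Y v \<omega>) \<le> ennreal e" by (simp add: ennreal_leI)
  qed (use d d' in simp)
qed

lemma w_increment_bound:
  assumes i: "i \<in> {0..m}" and xy: "t \<le> a" "a \<le> x" "x \<le> y" "y \<le> T"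
    and \<eta>: "\<eta> \<in> borel_measurable (F a)" "square_integrable M \<eta>"
  shows "nsq M (\<lambda>\<omega>. \<eta> \<omega> * (w i y \<omega> - w i x \<omega>)) \<le> ennreal (expectation (\<lambda>\<omega>. (\<eta> \<omega>)\<^sup>2) * (1 + (T - t)) * (y - x))"
proof (cases "i = 0")
  case True
  have "nsq M (\<lambda>\<omega>. \<eta> \<omega> * (w i y \<omega> - w i x \<omega>)) = nsq M (\<lambda>\<omega>. (y - x) * \<eta> \<omega>)" by (simp add: w_def True mult.commute)
  also have "\<dots> = ennreal ((y - x)\<^sup>2) * nsq M \<eta>" by (rule nsq_cmult[OF square_integrable_measurable[OF \<eta>(2)]])
  also have "\<dots> = ennreal ((y - x)\<^sup>2 * expectation (\<lambda>\<omega>. (\<eta> \<omega>)\<^sup>2))" by (simp add: nsq_eq_integral[OF \<eta>(2)] ennreal_mult)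
  also have "\<dots> \<le> ennreal (expectation (\<lambda>\<omega>. (\<eta> \<omega>)\<^sup>2) * (1 + (T - t)) * (y - x))"
  proof (rule ennreal_leI)
    have "(y - x)\<^sup>2 \<le> (1 + (T - t)) * (y - x)"
      unfolding power2_eq_square using xy by (intro mult_right_mono) auto
    then have "(y - x)\<^sup>2 * expectation (\<lambda>\<omega>. (\<eta> \<omega>)\<^sup>2) \<le> ((1 + (T - t)) * (y - x)) * expectation (\<lambda>\<omega>. (\<eta> \<omega>)\<^sup>2)"
      by (intro mult_right_mono) auto
    then show "(y - x)\<^sup>2 * expectation (\<lambda>\<omega>. (\<eta> \<omega>)\<^sup>2) \<le> expectation (\<lambda>\<omega>. (\<eta> \<omega>)\<^sup>2) * (1 + (T - t)) * (y - x)"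
      by (simp only: mult_ac)
  qed
  finally show ?thesis .
next
  case False
  then have i1: "i \<in> {1..m}" using i by auto
  have x0: "0 \<le> x" "0 \<le> a" "x \<le> T" using xy t_nonneg by linarith+
  have \<eta>x: "\<eta> \<in> borel_measurable (F x)" by (rule F_mono[OF x0(2) xy(2) x0(3) \<eta>(1)])
  note si = square_integrable_increment[OF i1 x0(1) xy(3,4) \<eta>x \<eta>(2)]
  have "nsq M (\<lambda>\<omega>. \<eta> \<omega> * (w i y \<omega> - w i x \<omega>)) = ennreal (expectation (\<lambda>\<omega>. (\<eta> \<omega>)\<^sup>2) * (y - x))"
    using nsq_eq_integral[OF si(1)] si(2) False by (simp add: w_def)
  also have "\<dots> \<le> ennreal (expectation (\<lambda>\<omega>. (\<eta> \<omega>)\<^sup>2) * (1 + (T - t)) * (y - x))"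
  proof (rule ennreal_leI)
    have "1 * (y - x) \<le> (1 + (T - t)) * (y - x)" using xy t_less by (intro mult_right_mono) auto
    then have "expectation (\<lambda>\<omega>. (\<eta> \<omega>)\<^sup>2) * (y - x) \<le> expectation (\<lambda>\<omega>. (\<eta> \<omega>)\<^sup>2) * ((1 + (T - t)) * (y - x))"
      by (intro mult_left_mono) auto
    then show "expectation (\<lambda>\<omega>. (\<eta> \<omega>)\<^sup>2) * (y - x) \<le> expectation (\<lambda>\<omega>. (\<eta> \<omega>)\<^sup>2) * (1 + (T - t)) * (y - x)"
      by (simp only: mult_ac)
  qed
  finally show ?thesis .
qed

lemma regular_process_increment:
  assumes i: "i \<in> {0..m}" and ab: "t \<le> a" "a \<le> b" "b \<le> T" and \<eta>: "past_poly a \<eta>"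
  shows "regular_process (\<lambda>s \<omega>. \<eta> \<omega> * (w i (max a (min b s)) \<omega> - w i a \<omega>))"
proof -
  define c where "c s = max a (min b s)" for s
  have c: "a \<le> c s" "c s \<le> T" for s using ab by (auto simp: c_def)
  have aT: "a \<le> T" using ab by linarith
  have \<eta>m: "\<eta> \<in> borel_measurable (F a)" "square_integrable M \<eta>"
    using past_poly_adapted[OF \<eta> aT] past_poly_square_integrable[OF \<eta> aT] by auto
  define K where "K = expectation (\<lambda>\<omega>. (\<eta> \<omega>)\<^sup>2) * (1 + (T - t))"
  have K: "0 \<le> K" unfolding K_def using t_less by (intro mult_nonneg_nonneg) auto
  have le: "nsq M (\<lambda>\<omega>. \<eta> \<omega> * (w i (c u) \<omega> - w i (c v) \<omega>)) \<le> ennreal (K * \<bar>c u - c v\<bar>)" for u v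
  proof (cases "c v \<le> c u")
    case True
    then show ?thesis using w_increment_bound[OF i ab(1) c(1) True c(2) \<eta>m] by (simp add: K_def)
  next
    case False
    then have vu: "c u \<le> c v" by simp
    have "nsq M (\<lambda>\<omega>. \<eta> \<omega> * (w i (c u) \<omega> - w i (c v) \<omega>)) = nsq M (\<lambda>\<omega>. \<eta> \<omega> * (w i (c v) \<omega> - w i (c u) \<omega>))"
      unfolding nsq_def by (simp add: power_mult_distrib power2_commute)
    then show ?thesis using w_increment_bound[OF i ab(1) c(1) vu c(2) \<eta>m] vu by (simp add: K_def abs_minus_commute)
  qed
  have "regular_process (\<lambda>s \<omega>. \<eta> \<omega> * (w i (c s) \<omega> - w i a \<omega>))"
    unfolding regular_process_def
  proof (intro conjI ballI allI impI)
    fix s assume s: "s \<in> {t..T}"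
    show "past_poly s (\<lambda>\<omega>. \<eta> \<omega> * (w i (c s) \<omega> - w i a \<omega>))"
    proof (cases "s \<le> a")
      case True
      then have "c s = a" using ab by (auto simp: c_def max_def min_def)
      then show ?thesis using past_poly.const[of s 0] by simp
    next
      case False
      then have as: "a \<le> s" "c s \<le> s" by (auto simp: c_def)
      have \<eta>s: "past_poly s \<eta>" by (rule past_poly_mono[OF \<eta> as(1)])
      show ?thesis
      proof (cases "i = 0")
        case True
        then show ?thesis using past_poly.cmult[OF \<eta>s, of "c s - a"] by (simp add: w_def mult.commute)
      next
        case False
        then have "i \<in> {1..m}" using i by auto
        from past_poly.increment[OF \<eta>s this ab(1) c(1) as(2)] show ?thesis using False by (simp add: w_def)
      qed
    qed
  next
    show "\<exists>C\<ge>0. \<forall>u\<in>{t..T}. nsq M (\<lambda>\<omega>. \<eta> \<omega> * (w i (c u) \<omega> - w i a \<omega>)) \<le> ennreal C"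
    proof (intro exI[of _ "K * (T - t)"] conjI ballI)
      show "0 \<le> K * (T - t)" using K t_less by simp
      fix u assume "u \<in> {t..T}"
      have ct: "c t = a" using ab by (auto simp: c_def max_def min_def)
      have "nsq M (\<lambda>\<omega>. \<eta> \<omega> * (w i (c u) \<omega> - w i a \<omega>)) \<le> ennreal (K * \<bar>c u - a\<bar>)" using le[of u t] ct by simp
      also have "\<dots> \<le> ennreal (K * (T - t))"
        using c[of u] ab K by (intro ennreal_leI mult_left_mono) auto
      finally show "nsq M (\<lambda>\<omega>. \<eta> \<omega> * (w i (c u) \<omega> - w i a \<omega>)) \<le> ennreal (K * (T - t))" .
    qed
  next
    fix e :: real assume e: "0 < e"
    show "\<exists>d>0. \<forall>u\<in>{t..T}. \<forall>v\<in>{t..T}. \<bar>u - v\<bar> < d \<longrightarrow>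
      nsq M (\<lambda>\<omega>. \<eta> \<omega> * (w i (c u) \<omega> - w i a \<omega>) - \<eta> \<omega> * (w i (c v) \<omega> - w i a \<omega>)) \<le> ennreal e"
    proof (intro exI[of _ "e / (K + 1)"] conjI ballI impI)
      show "0 < e / (K + 1)" using e K by (intro divide_pos_pos) auto
      fix u v assume uv: "\<bar>u - v\<bar> < e / (K + 1)"
      have "nsq M (\<lambda>\<omega>. \<eta> \<omega> * (w i (c u) \<omega> - w i a \<omega>) - \<eta> \<omega> * (w i (c v) \<omega> - w i a \<omega>)) =
        nsq M (\<lambda>\<omega>. \<eta> \<omega> * (w i (c u) \<omega> - w i (c v) \<omega>))"
        by (simp add: right_diff_distrib)
      also have "\<dots> \<le> ennreal (K * \<bar>c u - c v\<bar>)" by (rule le)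
      also have "\<dots> \<le> ennreal e"
      proof (rule ennreal_leI)
        have "\<bar>c u - c v\<bar> \<le> e / (K + 1)" using clamp_lipschitz[of a b u v] uv unfolding c_def by linarith
        then have "K * \<bar>c u - c v\<bar> \<le> (K + 1) * (e / (K + 1))" using K by (intro mult_mono) auto
        then show "K * \<bar>c u - c v\<bar> \<le> e" using K by simp
      qed
      finally show "nsq M (\<lambda>\<omega>. \<eta> \<omega> * (w i (c u) \<omega> - w i a \<omega>) - \<eta> \<omega> * (w i (c v) \<omega> - w i a \<omega>)) \<le> ennreal e" .
    qed
  qed
  then show ?thesis by (simp only: c_def)
qed

definition poly_elementary :: "(real \<times> real \<times> ('a \<Rightarrow> real)) list \<Rightarrow> bool" where
  "poly_elementary el \<longleftrightarrow> (\<forall>(a, b, \<eta>)\<in>set el. t \<le> a \<and> a \<le> b \<and> b \<le> T \<and> past_poly a \<eta>)"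

lemma poly_elementary_imp_elementary:
  assumes "poly_elementary el" shows "elementary el"
  unfolding elementary_def
proof (intro ballI)
  fix x assume x: "x \<in> set el"
  obtain a b \<eta> where abe: "x = (a, b, \<eta>)" by (cases x) auto
  then have *: "t \<le> a" "a \<le> b" "b \<le> T" "past_poly a \<eta>" using assms x unfolding poly_elementary_def by blast+
  then have "a \<le> T" by linarith
  then show "case x of (a, b, \<eta>) \<Rightarrow> t \<le> a \<and> a \<le> b \<and> b \<le> T \<and> \<eta> \<in> borel_measurable (F a) \<and> square_integrable M \<eta>"
    using * past_poly_adapted past_poly_square_integrable unfolding abe by blast
qed

lemma regular_process_el_int:
  assumes i: "i \<in> {0..m}" and el: "poly_elementary el"
  shows "regular_process (el_int i el)"
  using el
proof (induction el)
  case Nil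
  have "el_int i [] = (\<lambda>_ _. 0)" by (simp add: el_int_simps fun_eq_iff)
  then show ?case using regular_process_const[of 0] by simp
next
  case (Cons x el)
  obtain a b \<eta> where x: "x = (a, b, \<eta>)" by (cases x) auto
  have *: "t \<le> a" "a \<le> b" "b \<le> T" "past_poly a \<eta>" "poly_elementary el"
    using Cons.prems unfolding poly_elementary_def x by simp_all
  have "el_int i (x # el) = (\<lambda>s \<omega>. \<eta> \<omega> * (w i (max a (min b s)) \<omega> - w i a \<omega>) + el_int i el s \<omega>)"
    by (simp add: x el_int_simps fun_eq_iff)
  then show ?case
    using regular_process_add[OF regular_process_increment[OF i *(1-4)] Cons.IH[OF *(5)]] by simp
qed

text \<open>Sampling at the left end points of a fine uniform partition.\<close>

lemma sampled_approximation:
  assumes Y: "regular_process Y" and s: "t < s" "s \<le> T" and e: "0 < e"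
  shows "\<exists>N \<tau>. adapted_step M F t s N \<tau> (\<lambda>j. Y (\<tau> j)) \<and> (\<forall>j<N. past_poly (\<tau> j) (Y (\<tau> j))) \<and>
    (\<forall>u\<in>{t..<s}. \<exists>v\<in>{t..s}. (\<forall>\<omega>. step_process N \<tau> (\<lambda>j. Y (\<tau> j)) u \<omega> = Y v \<omega>) \<and> nsq M (\<lambda>\<omega>. Y v \<omega> - Y u \<omega>) \<le> ennreal e)"
proof -
  obtain d where d: "d > 0" "\<And>u v. u \<in> {t..T} \<Longrightarrow> v \<in> {t..T} \<Longrightarrow> \<bar>u - v\<bar> < d \<Longrightarrow> nsq M (\<lambda>\<omega>. Y u \<omega> - Y v \<omega>) \<le> ennreal e"
    using Y e unfolding regular_process_def by meson
  obtain n where n: "(s - t) / d < real n" using reals_Archimedean2 by blast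
  define N where "N = Suc n"
  define \<delta> where "\<delta> = (s - t) / real N"
  have \<delta>: "0 < \<delta>" unfolding \<delta>_def N_def using s by (intro divide_pos_pos) auto
  have N\<delta>: "real N * \<delta> = s - t" by (simp add: \<delta>_def N_def)
  have "s - t < real N * d" using n d(1) by (simp add: N_def divide_less_eq distrib_right)
  then have \<delta>d: "\<delta> < d" unfolding \<delta>_def N_def using d(1) by (simp add: divide_less_eq mult.commute)
  define \<tau> where "\<tau> j = t + real j * \<delta>" for j
  have \<tau>_range: "\<tau> j \<in> {t..s}" if "j \<le> N" for j
  proof -
    have "real j * \<delta> \<le> real N * \<delta>" using that \<delta> by (intro mult_right_mono) auto
    then show ?thesis using \<delta> N\<delta> unfolding \<tau>_def by simp
  qed
  have poly: "past_poly (\<tau> j) (Y (\<tau> j))" if "j < N" for j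
  proof -
    have "\<tau> j \<in> {t..T}" using \<tau>_range[of j] that s by auto
    then show ?thesis using Y unfolding regular_process_def by blast
  qed
  have step: "adapted_step M F t s N \<tau> (\<lambda>j. Y (\<tau> j))"
    unfolding adapted_step_def
  proof (intro conjI allI impI)
    show "\<tau> 0 = t" by (simp add: \<tau>_def)
    show "\<tau> N = s" using N\<delta> by (simp add: \<tau>_def)
    show "\<tau> j < \<tau> (Suc j)" for j using \<delta> by (simp add: \<tau>_def distrib_right)
    fix j assume j: "j < N"
    have "\<tau> j \<le> T" using \<tau>_range[of j] j s by auto
    then show "Y (\<tau> j) \<in> borel_measurable (F (\<tau> j))" "integrable M (\<lambda>\<omega>. (Y (\<tau> j) \<omega>)\<^sup>2)"
      using past_poly_adapted[OF poly[OF j]] square_integrable_sq[OF past_poly_square_integrable[OF poly[OF j]]] by auto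
  qed
  have "\<exists>v\<in>{t..s}. (\<forall>\<omega>. step_process N \<tau> (\<lambda>j. Y (\<tau> j)) u \<omega> = Y v \<omega>) \<and> nsq M (\<lambda>\<omega>. Y v \<omega> - Y u \<omega>) \<le> ennreal e"
    if u: "u \<in> {t..<s}" for u
  proof -
    define k where "k = nat \<lfloor>(u - t) / \<delta>\<rfloor>"
    have x0: "0 \<le> (u - t) / \<delta>" using u \<delta> by simp
    have k1: "real k \<le> (u - t) / \<delta>" "(u - t) / \<delta> < real k + 1" using x0 unfolding k_def by linarith+
    have k2: "\<tau> k \<le> u" "u < \<tau> (Suc k)"
      using k1 \<delta> unfolding \<tau>_def by (simp_all add: le_divide_eq divide_less_eq algebra_simps)
    have "real k * \<delta> < real N * \<delta>" using k2(1) u N\<delta> unfolding \<tau>_def by auto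
    then have kN: "k < N" using \<delta> by simp
    have uniq: "indicator {\<tau> j..<\<tau> (Suc j)} u = (of_bool (j = k) :: real)" for j
    proof (cases j k rule: linorder_cases)
      case less
      then have "real (Suc j) * \<delta> \<le> real k * \<delta>" using \<delta> by (intro mult_right_mono) auto
      then have "\<tau> (Suc j) \<le> u" using k2(1) unfolding \<tau>_def by linarith
      then show ?thesis using less by simp
    next
      case equal
      then show ?thesis using k2 by simp
    next
      case greater
      then have "real (Suc k) * \<delta> \<le> real j * \<delta>" using \<delta> by (intro mult_right_mono) auto
      then have "u < \<tau> j" using k2(2) unfolding \<tau>_def by linarith
      then show ?thesis using greater by simp
    qed
    have "step_process N \<tau> (\<lambda>j. Y (\<tau> j)) u \<omega> = Y (\<tau> k) \<omega>" for \<omega>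
      unfolding step_process_def uniq using kN by (simp add: of_bool_def if_distrib cong: if_cong)
    moreover have "nsq M (\<lambda>\<omega>. Y (\<tau> k) \<omega> - Y u \<omega>) \<le> ennreal e"
    proof (rule d(2))
      show "\<tau> k \<in> {t..T}" "u \<in> {t..T}" using \<tau>_range[of k] kN s u by auto
      have "\<tau> (Suc k) = \<tau> k + \<delta>" by (simp add: \<tau>_def distrib_right)
      then show "\<bar>\<tau> k - u\<bar> < d" using k2 \<delta>d by linarith
    qed
    ultimately show ?thesis using \<tau>_range[of k] kN by (intro bexI[of _ "\<tau> k"]) auto
  qed
  then show ?thesis using step poly by blast
qed

text \<open>The integrands that arise when integrals are iterated.  Uniform approximation by polynomial
  processes is inherited by the integral as a function of its upper limit, and it places every value
  of the process in the closed span of the exponentials.\<close>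

definition approximable :: "(real \<Rightarrow> 'a \<Rightarrow> real) \<Rightarrow> bool" where
  "approximable J \<longleftrightarrow> joint T J \<and>
     (\<forall>e>0. \<exists>Y. regular_process Y \<and> (\<forall>u\<in>{t..T}. nsq M (\<lambda>\<omega>. Y u \<omega> - J u \<omega>) \<le> ennreal e))"

lemma approximable_bounded:
  assumes J: "approximable J"
  obtains C where "0 \<le> C" "\<And>u. u \<in> {t..T} \<Longrightarrow> nsq M (J u) \<le> ennreal C"
proof -
  obtain Y where Y: "regular_process Y" "\<And>u. u \<in> {t..T} \<Longrightarrow> nsq M (\<lambda>\<omega>. Y u \<omega> - J u \<omega>) \<le> ennreal 1"
    using J unfolding approximable_def by (meson zero_less_one)
  obtain C where C: "0 \<le> C" "\<And>u. u \<in> {t..T} \<Longrightarrow> nsq M (Y u) \<le> ennreal C"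
    using Y(1) unfolding regular_process_def by blast
  have "nsq M (J u) \<le> ennreal (2 * 1 + 2 * C)" if u: "u \<in> {t..T}" for u
  proof -
    have mJ: "J u \<in> borel_measurable M" using J u joint_section unfolding approximable_def by blast
    have mY: "Y u \<in> borel_measurable M" by (rule square_integrable_measurable[OF regular_process_measurable[OF Y(1) u]])
    have "nsq M (\<lambda>\<omega>. J u \<omega> - 0) \<le> 2 * nsq M (\<lambda>\<omega>. J u \<omega> - Y u \<omega>) + 2 * nsq M (\<lambda>\<omega>. Y u \<omega> - 0)"
      by (rule nsq_diff_le) (use mJ mY in auto)
    also have "\<dots> \<le> 2 * ennreal 1 + 2 * ennreal C"
      using Y(2)[OF u] C(2)[OF u] nsq_commute[of M "J u" "Y u"] by (intro add_mono mult_left_mono) auto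
    also have "\<dots> = ennreal (2 * 1 + 2 * C)" using C(1) by (subst ennreal_plus) (auto simp: ennreal_mult)
    finally show ?thesis by simp
  qed
  then show thesis using that[of "2 * 1 + 2 * C"] C(1) by simp
qed

lemma approximable_const: "approximable (\<lambda>_ _. c)"
  unfolding approximable_def
proof (intro conjI allI impI)
  show "\<exists>Y. regular_process Y \<and> (\<forall>u\<in>{t..T}. nsq M (\<lambda>\<omega>. Y u \<omega> - c) \<le> ennreal e)" for e
    by (intro exI[of _ "\<lambda>_ _. c"] conjI ballI regular_process_const) (simp add: nsq_def)
qed simp

lemma joint_mult:
  assumes "L2_on t T \<psi>" "joint T J" shows "joint T (\<lambda>u \<omega>. \<psi> u * J u \<omega>)"
proof -
  have "\<psi> \<in> borel_measurable L" using assms(1) by (simp add: L2_on_def)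
  then have "(\<lambda>z. \<psi> (fst z)) \<in> borel_measurable (L \<Otimes>\<^sub>M M)" by (rule measurable_compose[OF measurable_fst])
  from borel_measurable_times[OF this assms(2)] show ?thesis by (simp add: case_prod_unfold)
qed

lemma pnsq_degenerate: "pnsq t Y = 0"
proof -
  have "emeasure (lebesgue_on {t..t}) (space (lebesgue_on {t..t})) = 0"
    by (simp add: emeasure_restrict_space space_restrict_space)
  then have "AE u in lebesgue_on {t..t}. False"
    by (intro AE_I[of _ _ "space (lebesgue_on {t..t})"]) auto
  then have "pnsq t Y = (\<integral>\<^sup>+u. 0 \<partial>lebesgue_on {t..t})"
    unfolding pnsq_def by (intro nn_integral_cong_AE) (auto elim: AE_mp)
  then show ?thesis by simp
qed

text \<open>The factor \<open>\<psi>\<close> is replaced by a continuous function and \<open>J\<close> by a regular process; their product is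
  then sampled.\<close>

lemma step_approximation:
  assumes J: "approximable J" and \<psi>: "L2_on t T \<psi>" and s: "t \<le> s" "s \<le> T" and e: "0 < e"
  shows "\<exists>N \<tau> \<eta>. adapted_step M F t s N \<tau> \<eta> \<and> (\<forall>j<N. past_poly (\<tau> j) (\<eta> j)) \<and>
    pnsq s (\<lambda>u \<omega>. step_process N \<tau> \<eta> u \<omega> - \<psi> u * J u \<omega>) \<le> ennreal e"
proof (cases "s = t")
  case True
  show ?thesis
    by (rule exI[of _ 0], rule exI[of _ "\<lambda>_. t"], rule exI[of _ "\<lambda>_ _. 0"])
       (simp add: True pnsq_degenerate adapted_step_def)
next
  case False
  then have ts: "t < s" using s by simp
  obtain C where C: "0 \<le> C" "\<And>u. u \<in> {t..T} \<Longrightarrow> nsq M (J u) \<le> ennreal C"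
    using approximable_bounded[OF J] by blast
  define e1 where "e1 = e / (8 * (C + 1))"
  have e1: "0 < e1" unfolding e1_def using e C(1) by (intro divide_pos_pos) auto
  obtain \<gamma> where \<gamma>: "continuous_on UNIV \<gamma>" "nsq L (\<lambda>x. \<gamma> x - \<psi> x) \<le> ennreal e1"
    using continuous_dense_L2[OF \<psi> e1] by blast
  have \<gamma>c: "continuous_on {t..T} \<gamma>" using \<gamma>(1) by (rule continuous_on_subset) simp
  obtain B where "\<forall>u\<in>{t..T}. \<bar>\<gamma> u\<bar> \<le> B"
    using compact_imp_bounded[OF compact_continuous_image[OF \<gamma>c compact_Icc]] unfolding bounded_iff by auto
  then have B: "\<And>u. u \<in> {t..T} \<Longrightarrow> \<bar>\<gamma> u\<bar> \<le> B" by blast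
  have Bsq: "(\<gamma> u)\<^sup>2 \<le> B\<^sup>2" if "u \<in> {t..T}" for u
    using B[OF that] by (metis abs_ge_zero power2_abs power_mono)
  define D where "D = T - t"
  have D: "0 < D" "s - t \<le> D" using t_less s by (auto simp: D_def)
  define e2 where "e2 = e / (16 * (B\<^sup>2 + 1) * D)"
  have B1: "0 < B\<^sup>2 + 1" using zero_le_power2[of B] by linarith
  have e2: "0 < e2" unfolding e2_def using e B1 D by (intro divide_pos_pos mult_pos_pos) auto
  obtain Y where Y: "regular_process Y" "\<And>u. u \<in> {t..T} \<Longrightarrow> nsq M (\<lambda>\<omega>. Y u \<omega> - J u \<omega>) \<le> ennreal e2"
    using J e2 unfolding approximable_def by meson
  define R where "R u \<omega> = \<gamma> u * Y u \<omega>" for u \<omega>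
  have R: "regular_process R" unfolding R_def[abs_def] by (rule regular_process_cont_mult[OF Y(1) \<gamma>(1)])
  define e3 where "e3 = e / (8 * D)"
  have e3: "0 < e3" unfolding e3_def using e D by simp
  obtain N \<tau> where st: "adapted_step M F t s N \<tau> (\<lambda>j. R (\<tau> j))" "\<forall>j<N. past_poly (\<tau> j) (R (\<tau> j))"
    "\<And>u. u \<in> {t..<s} \<Longrightarrow> \<exists>v\<in>{t..s}. (\<forall>\<omega>. step_process N \<tau> (\<lambda>j. R (\<tau> j)) u \<omega> = R v \<omega>) \<and> nsq M (\<lambda>\<omega>. R v \<omega> - R u \<omega>) \<le> ennreal e3"
    using sampled_approximation[OF R ts s(2) e3] by blast
  have jJ: "joint T J" using J unfolding approximable_def by blast
  define K where "K = 2 * e3 + 4 * (B\<^sup>2 * e2)"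
  have K: "0 \<le> K" unfolding K_def using e3 e2 by simp
  have inner: "nsq M (\<lambda>\<omega>. step_process N \<tau> (\<lambda>j. R (\<tau> j)) u \<omega> - \<psi> u * J u \<omega>)
      \<le> ennreal K + ennreal (4 * C) * ennreal ((\<gamma> u - \<psi> u)\<^sup>2)" if us: "u \<in> {t..<s}" for u
  proof -
    have u: "u \<in> {t..T}" using us s by auto
    have mJ [measurable]: "J u \<in> borel_measurable M" by (rule joint_section[OF jJ u])
    have mY [measurable]: "Y u \<in> borel_measurable M" by (rule square_integrable_measurable[OF regular_process_measurable[OF Y(1) u]])
    have mR [measurable]: "R u \<in> borel_measurable M" by (rule square_integrable_measurable[OF regular_process_measurable[OF R u]])
    obtain v where v: "v \<in> {t..s}" "\<And>\<omega>. step_process N \<tau> (\<lambda>j. R (\<tau> j)) u \<omega> = R v \<omega>" "nsq M (\<lambda>\<omega>. R v \<omega> - R u \<omega>) \<le> ennreal e3"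
      using st(3)[OF us] by blast
    have vT: "v \<in> {t..T}" using v(1) s by auto
    have mRv: "R v \<in> borel_measurable M" by (rule square_integrable_measurable[OF regular_process_measurable[OF R vT]])
    have 1: "nsq M (\<lambda>\<omega>. R u \<omega> - \<gamma> u * J u \<omega>) \<le> ennreal (B\<^sup>2 * e2)"
    proof -
      have "nsq M (\<lambda>\<omega>. R u \<omega> - \<gamma> u * J u \<omega>) = ennreal ((\<gamma> u)\<^sup>2) * nsq M (\<lambda>\<omega>. Y u \<omega> - J u \<omega>)"
        unfolding R_def right_diff_distrib[symmetric] by (rule nsq_cmult) simp
      also have "\<dots> \<le> ennreal (B\<^sup>2) * ennreal e2" by (intro mult_mono ennreal_leI Bsq Y(2) u) auto
      also have "\<dots> = ennreal (B\<^sup>2 * e2)" using e2 by (intro ennreal_mult[symmetric]) auto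
      finally show ?thesis .
    qed
    have 2: "nsq M (\<lambda>\<omega>. \<gamma> u * J u \<omega> - \<psi> u * J u \<omega>) \<le> ennreal ((\<gamma> u - \<psi> u)\<^sup>2) * ennreal C"
    proof -
      have "nsq M (\<lambda>\<omega>. \<gamma> u * J u \<omega> - \<psi> u * J u \<omega>) = ennreal ((\<gamma> u - \<psi> u)\<^sup>2) * nsq M (J u)"
        unfolding left_diff_distrib[symmetric] by (rule nsq_cmult[OF mJ])
      also have "\<dots> \<le> ennreal ((\<gamma> u - \<psi> u)\<^sup>2) * ennreal C" by (intro mult_left_mono C(2) u) auto
      finally show ?thesis .
    qed
    have "nsq M (\<lambda>\<omega>. R u \<omega> - \<psi> u * J u \<omega>) \<le> 2 * nsq M (\<lambda>\<omega>. R u \<omega> - \<gamma> u * J u \<omega>) + 2 * nsq M (\<lambda>\<omega>. \<gamma> u * J u \<omega> - \<psi> u * J u \<omega>)"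
      by (rule nsq_diff_le) simp_all
    also have "\<dots> \<le> 2 * ennreal (B\<^sup>2 * e2) + 2 * (ennreal ((\<gamma> u - \<psi> u)\<^sup>2) * ennreal C)"
      by (intro add_mono mult_left_mono 1 2) auto
    also have "\<dots> = ennreal (2 * (B\<^sup>2 * e2) + 2 * ((\<gamma> u - \<psi> u)\<^sup>2 * C))"
      using e2 C(1) by (simp add: ennreal_plus ennreal_mult)
    finally have 3: "nsq M (\<lambda>\<omega>. R u \<omega> - \<psi> u * J u \<omega>) \<le> ennreal (2 * (B\<^sup>2 * e2) + 2 * ((\<gamma> u - \<psi> u)\<^sup>2 * C))" .
    have "nsq M (\<lambda>\<omega>. R v \<omega> - \<psi> u * J u \<omega>) \<le> 2 * nsq M (\<lambda>\<omega>. R v \<omega> - R u \<omega>) + 2 * nsq M (\<lambda>\<omega>. R u \<omega> - \<psi> u * J u \<omega>)"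
      by (rule nsq_diff_le) (use mRv in simp_all)
    also have "\<dots> \<le> 2 * ennreal e3 + 2 * ennreal (2 * (B\<^sup>2 * e2) + 2 * ((\<gamma> u - \<psi> u)\<^sup>2 * C))"
      by (intro add_mono mult_left_mono v(3) 3) auto
    also have "\<dots> = ennreal (2 * e3 + 2 * (2 * (B\<^sup>2 * e2) + 2 * ((\<gamma> u - \<psi> u)\<^sup>2 * C)))"
      using e3 e2 C(1) by (simp add: ennreal_plus ennreal_mult)
    also have "2 * e3 + 2 * (2 * (B\<^sup>2 * e2) + 2 * ((\<gamma> u - \<psi> u)\<^sup>2 * C)) = K + (4 * C) * (\<gamma> u - \<psi> u)\<^sup>2"
      by (simp add: K_def algebra_simps)
    also have "ennreal \<dots> = ennreal K + ennreal (4 * C) * ennreal ((\<gamma> u - \<psi> u)\<^sup>2)"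
      using K C(1) by (subst ennreal_plus) (simp_all add: ennreal_mult)
    finally show ?thesis by (simp only: v(2))
  qed
  have m\<psi>: "(\<lambda>u. ennreal ((\<gamma> u - \<psi> u)\<^sup>2)) \<in> borel_measurable (lebesgue_on {t..s})"
  proof -
    have "\<psi> \<in> borel_measurable L" using \<psi> by (simp add: L2_on_def)
    then have "\<psi> \<in> borel_measurable (lebesgue_on {t..s})" by (rule measurable_restrict_mono) (use s(2) in auto)
    moreover have "\<gamma> \<in> borel_measurable (lebesgue_on {t..s})"
      using borel_measurable_continuous_onI[OF \<gamma>(1)] by (intro measurable_restrict_space1 measurable_completion) simp
    ultimately show ?thesis by measurable
  qed
  have "AE u in lebesgue_on {t..s}. u \<noteq> s"
  proof -
    have "AE u in lebesgue. u \<noteq> s" by (rule AE_completion) (rule AE_lborel_singleton)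
    then show ?thesis by (subst AE_restrict_space_iff) auto
  qed
  then have "pnsq s (\<lambda>u \<omega>. step_process N \<tau> (\<lambda>j. R (\<tau> j)) u \<omega> - \<psi> u * J u \<omega>) \<le>
    (\<integral>\<^sup>+u. ennreal K + ennreal (4 * C) * ennreal ((\<gamma> u - \<psi> u)\<^sup>2) \<partial>lebesgue_on {t..s})"
    unfolding pnsq_def
  proof (intro nn_integral_mono_AE, elim AE_mp, intro AE_I2 impI)
    fix u assume "u \<in> space (lebesgue_on {t..s})" "u \<noteq> s"
    then have "u \<in> {t..<s}" by (auto simp: space_restrict_space)
    then show "nsq M (\<lambda>\<omega>. step_process N \<tau> (\<lambda>j. R (\<tau> j)) u \<omega> - \<psi> u * J u \<omega>)
      \<le> ennreal K + ennreal (4 * C) * ennreal ((\<gamma> u - \<psi> u)\<^sup>2)" by (rule inner)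
  qed
  also have "\<dots> = ennreal K * ennreal (s - t) + ennreal (4 * C) * (\<integral>\<^sup>+u. ennreal ((\<gamma> u - \<psi> u)\<^sup>2) \<partial>lebesgue_on {t..s})"
    using m\<psi> s(1) by (subst nn_integral_add) (simp_all add: nn_integral_cmult emeasure_restrict_space space_restrict_space)
  also have "\<dots> \<le> ennreal K * ennreal D + ennreal (4 * C) * ennreal e1"
  proof (intro add_mono mult_left_mono)
    have "(\<integral>\<^sup>+u. ennreal ((\<gamma> u - \<psi> u)\<^sup>2) \<partial>lebesgue_on {t..s}) \<le> nsq L (\<lambda>x. \<gamma> x - \<psi> x)"
      unfolding nsq_def using s by (simp add: nn_integral_restrict_space) (intro nn_integral_mono, auto split: split_indicator)
    then show "(\<integral>\<^sup>+u. ennreal ((\<gamma> u - \<psi> u)\<^sup>2) \<partial>lebesgue_on {t..s}) \<le> ennreal e1" using \<gamma>(2) by (rule order_trans)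
    show "ennreal (s - t) \<le> ennreal D" by (rule ennreal_leI[OF D(2)])
  qed auto
  also have "\<dots> = ennreal (K * D + (4 * C) * e1)"
    using K D C(1) e1 by (subst ennreal_plus) (simp_all add: ennreal_mult)
  also have "K * D + (4 * C) * e1 \<le> e"
  proof -
    have 1: "e3 * D = e / 8" using D by (simp add: e3_def)
    have "(B\<^sup>2 + 1) * e2 * D = e / 16"
    proof -
      have "b * (e / (16 * b * D)) * D = e / 16" if "b \<noteq> 0" for b :: real using that D(1) by (simp add: field_simps)
      moreover have "B\<^sup>2 + 1 \<noteq> 0" using B1 by simp
      ultimately show ?thesis unfolding e2_def by blast
    qed
    moreover have "B\<^sup>2 * e2 * D \<le> (B\<^sup>2 + 1) * e2 * D" using e2 D by (intro mult_right_mono) auto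
    ultimately have 2: "B\<^sup>2 * e2 * D \<le> e / 16" by linarith
    have "(C + 1) * e1 = e / 8"
    proof -
      have "b * (e / (8 * b)) = e / 8" if "b \<noteq> 0" for b :: real using that by (simp add: field_simps)
      moreover have "C + 1 \<noteq> 0" using C(1) by auto
      ultimately show ?thesis unfolding e1_def by blast
    qed
    moreover have "C * e1 \<le> (C + 1) * e1" using e1 by (intro mult_right_mono) auto
    ultimately have 3: "C * e1 \<le> e / 8" by linarith
    have "K * D + (4 * C) * e1 = 2 * (e3 * D) + 4 * (B\<^sup>2 * e2 * D) + 4 * (C * e1)"
      by (simp add: K_def algebra_simps)
    then show ?thesis using 1 2 3 e by linarith
  qed
  finally have "pnsq s (\<lambda>u \<omega>. step_process N \<tau> (\<lambda>j. R (\<tau> j)) u \<omega> - \<psi> u * J u \<omega>) \<le> ennreal e"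
    by (simp add: ennreal_leI)
  then show ?thesis using st(1,2) by blast
qed

lemma list_of_steps_poly:
  assumes st: "adapted_step M F t s N \<tau> \<eta>" and s: "t \<le> s" "s \<le> T" and "\<forall>j<N. past_poly (\<tau> j) (\<eta> j)"
  shows "poly_elementary (list_of_steps N \<tau> \<eta>)"
  unfolding poly_elementary_def
proof (intro ballI)
  fix x assume "x \<in> set (list_of_steps N \<tau> \<eta>)"
  then obtain j where j: "j < N" "x = (\<tau> j, \<tau> (Suc j), \<eta> j)" by (auto simp: list_of_steps_def)
  have "\<tau> j \<le> \<tau> (Suc j)" using st j(1) by (auto simp: adapted_step_def intro: less_imp_le)
  moreover have "t \<le> \<tau> j" "\<tau> (Suc j) \<le> T"
    using adapted_step_partition[OF st, of j] adapted_step_partition[OF st, of "Suc j"] j(1) s by auto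
  ultimately show "case x of (a, b, \<eta>) \<Rightarrow> t \<le> a \<and> a \<le> b \<and> b \<le> T \<and> past_poly a \<eta>"
    using assms(4) j by simp
qed

lemma poly_approximation:
  assumes J: "approximable J" and \<psi>: "L2_on t T \<psi>" and e: "0 < e"
  obtains el where "poly_elementary el" "pnsq T (\<lambda>u \<omega>. el_proc el u \<omega> - \<psi> u * J u \<omega>) \<le> ennreal e"
proof -
  have tT: "t \<le> T" using t_less by simp
  obtain N \<tau> \<eta> where st: "adapted_step M F t T N \<tau> \<eta>" "\<forall>j<N. past_poly (\<tau> j) (\<eta> j)"
    "pnsq T (\<lambda>u \<omega>. step_process N \<tau> \<eta> u \<omega> - \<psi> u * J u \<omega>) \<le> ennreal e"
    using step_approximation[OF J \<psi> tT order_refl e] by blast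
  show thesis
    using that[OF list_of_steps_poly[OF st(1) tT order_refl st(2)]] st(3) list_of_steps(2)[OF st(1) tT order_refl] by simp
qed

end

section \<open>The Ito integral as a process\<close>

context wiener_setting
begin

text \<open>Off a null set the paths are continuous, hence jointly measurable as limits of their values at
  discretized times.\<close>

lemma jointly_measurable_version:
  assumes i: "i \<in> {1..m}"
  obtains g where "AE \<omega> in M. \<forall>s. g s \<omega> = f i s \<omega>"
    "\<And>c. c \<in> borel_measurable L \<Longrightarrow> (\<And>s. s \<in> {t..T} \<Longrightarrow> c s \<in> {t..T}) \<Longrightarrow> joint T (\<lambda>s. g (c s))"
proof -
  have "AE \<omega> in M. continuous_on {0..T} (\<lambda>s. f i s \<omega>)" using wiener i by (simp add: wiener_process_def)
  then obtain N where N: "{\<omega> \<in> space M. \<not> continuous_on {0..T} (\<lambda>s. f i s \<omega>)} \<subseteq> N" "emeasure M N = 0" "N \<in> sets M"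
    by (rule AE_E)
  define g where "g s \<omega> = (if \<omega> \<in> N then 0 else f i s \<omega>)" for s \<omega>
  have gm: "g s \<in> borel_measurable M" if "0 \<le> s" "s \<le> T" for s
    unfolding g_def[abs_def] using N(3) f_measurable[OF i that] by (intro measurable_If_set) auto
  have cont: "continuous_on {0..T} (\<lambda>s. g s \<omega>)" if "\<omega> \<in> space M" for \<omega>
  proof (cases "\<omega> \<in> N")
    case False
    then have "continuous_on {0..T} (\<lambda>s. f i s \<omega>)" using N(1) that by blast
    then show ?thesis using False by (simp add: g_def)
  qed (simp add: g_def)
  have AE: "AE \<omega> in M. \<forall>s. g s \<omega> = f i s \<omega>"
    using AE_not_in[of N M] N(2,3) by (auto simp: g_def null_sets_def elim!: AE_mp)
  have "joint T (\<lambda>s. g (c s))" if c: "c \<in> borel_measurable L" "\<And>s. s \<in> {t..T} \<Longrightarrow> c s \<in> {t..T}" for c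
  proof (rule borel_measurable_LIMSEQ_real)
    define r where "r n k = max t (min T (real_of_int k / real (Suc n)))" for n :: nat and k :: int
    have r: "r n k \<in> {0..T}" for n k using t_nonneg t_less by (auto simp: r_def)
    show "(\<lambda>z. g (r n \<lfloor>c (fst z) * real (Suc n)\<rfloor>) (snd z)) \<in> borel_measurable (L \<Otimes>\<^sub>M M)" for n
    proof (rule measurable_compose_countable[where f = "\<lambda>k z. g (r n k) (snd z)"])
      show "(\<lambda>z. g (r n k) (snd z)) \<in> borel_measurable (L \<Otimes>\<^sub>M M)" for k
        using r[of n k] by (intro measurable_compose[OF measurable_snd gm]) auto
      have "(\<lambda>z. c (fst z) * real (Suc n)) \<in> borel_measurable (L \<Otimes>\<^sub>M M)"
        by (intro borel_measurable_times measurable_compose[OF measurable_fst c(1)] borel_measurable_const)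
      then show "(\<lambda>z. \<lfloor>c (fst z) * real (Suc n)\<rfloor>) \<in> L \<Otimes>\<^sub>M M \<rightarrow>\<^sub>M count_space UNIV"
        by (rule measurable_compose) (rule measurable_real_floor)
    qed
    fix z assume "z \<in> space (L \<Otimes>\<^sub>M M)"
    then obtain s \<omega> where z: "z = (s, \<omega>)" "s \<in> {t..T}" "\<omega> \<in> space M"
      by (auto simp: space_pair_measure space_restrict_space)
    have x: "c s \<in> {t..T}" by (rule c(2)[OF z(2)])
    have "(\<lambda>n. r n \<lfloor>c s * real (Suc n)\<rfloor>) \<longlonglongrightarrow> c s"
    proof (rule LIMSEQ_I)
      fix e :: real assume e: "0 < e"
      obtain n0 where n0: "inverse (real (Suc n0)) < e" using reals_Archimedean[OF e] by blast
      have "norm (r n \<lfloor>c s * real (Suc n)\<rfloor> - c s) < e" if "n \<ge> n0" for n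
      proof -
        have "\<bar>real_of_int \<lfloor>c s * real (Suc n)\<rfloor> - c s * real (Suc n)\<bar> \<le> 1" by linarith
        then have "\<bar>real_of_int \<lfloor>c s * real (Suc n)\<rfloor> - c s * real (Suc n)\<bar> / real (Suc n) \<le> 1 / real (Suc n)"
          by (intro divide_right_mono) auto
        moreover have "\<bar>real_of_int \<lfloor>c s * real (Suc n)\<rfloor> - c s * real (Suc n)\<bar> / real (Suc n) =
          \<bar>real_of_int \<lfloor>c s * real (Suc n)\<rfloor> / real (Suc n) - c s\<bar>"
        proof -
          have "real_of_int \<lfloor>c s * real (Suc n)\<rfloor> / real (Suc n) - c s = (real_of_int \<lfloor>c s * real (Suc n)\<rfloor> - c s * real (Suc n)) / real (Suc n)"
            by (simp add: diff_divide_distrib)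
          then show ?thesis by (simp only: abs_divide abs_of_nat)
        qed
        moreover have "r n \<lfloor>c s * real (Suc n)\<rfloor> - c s =
          max t (min T (real_of_int \<lfloor>c s * real (Suc n)\<rfloor> / real (Suc n))) - max t (min T (c s))"
          using x by (simp add: r_def)
        ultimately have "\<bar>r n \<lfloor>c s * real (Suc n)\<rfloor> - c s\<bar> \<le> 1 / real (Suc n)"
          using clamp_lipschitz[of t T "real_of_int \<lfloor>c s * real (Suc n)\<rfloor> / real (Suc n)" "c s"] by linarith
        also have "\<dots> \<le> 1 / real (Suc n0)" using that by (intro divide_left_mono) auto
        finally show ?thesis using n0 by (simp add: inverse_eq_divide)
      qed
      then show "\<exists>n0. \<forall>n\<ge>n0. norm (r n \<lfloor>c s * real (Suc n)\<rfloor> - c s) < e" by blast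
    qed
    then have "(\<lambda>n. g (r n \<lfloor>c s * real (Suc n)\<rfloor>) \<omega>) \<longlonglongrightarrow> g (c s) \<omega>"
      by (rule continuous_on_tendsto_compose[OF cont[OF z(3)]]) (use x t_nonneg r in auto)
    then show "(\<lambda>n. g (r n \<lfloor>c (fst z) * real (Suc n)\<rfloor>) (snd z)) \<longlonglongrightarrow> (case z of (s, \<omega>) \<Rightarrow> g (c s) \<omega>)"
      by (simp only: z fst_conv snd_conv case_prod_conv)
  qed
  then show thesis using that AE by blast
qed

lemma joint_el_int:
  assumes i: "i \<in> {1..m}" and el: "elementary el"
  obtains S where "joint T S" "\<And>s. AE \<omega> in M. S s \<omega> = el_int i el s \<omega>"
proof -
  obtain g where g: "AE \<omega> in M. \<forall>s. g s \<omega> = f i s \<omega>"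
    "\<And>c. c \<in> borel_measurable L \<Longrightarrow> (\<And>s. s \<in> {t..T} \<Longrightarrow> c s \<in> {t..T}) \<Longrightarrow> joint T (\<lambda>s. g (c s))"
    using jointly_measurable_version[OF i] by blast
  define S where "S s \<omega> = (\<Sum>(a, b, \<eta>)\<leftarrow>el. \<eta> \<omega> * (g (max a (min b s)) \<omega> - g a \<omega>))" for s \<omega>
  have "AE \<omega> in M. S s \<omega> = el_int i el s \<omega>" for s
    using g(1)
  proof eventually_elim
    case (elim \<omega>)
    show ?case using i unfolding S_def el_int_def w_def by (simp add: elim)
  qed
  moreover have "joint T S"
    unfolding S_def[abs_def] using el
  proof (induction el)
    case (Cons x el)
    obtain a b \<eta> where x: "x = (a, b, \<eta>)" by (cases x) auto
    have v: "t \<le> a" "a \<le> b" "b \<le> T" "\<eta> \<in> borel_measurable M" "elementary el"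
      using Cons.prems square_integrable_measurable unfolding x elementary_simps by blast+
    have id: "(\<lambda>s. s) \<in> borel_measurable L" by (intro measurable_restrict_space1 measurable_completion) simp
    have "joint T (\<lambda>s. g (max a (min b s)))"
      by (rule g(2)) (use v id in \<open>auto intro!: borel_measurable_max borel_measurable_min\<close>)
    moreover have "joint T (\<lambda>s. g a)" by (rule g(2)) (use v in auto)
    moreover have "(\<lambda>z. \<eta> (snd z)) \<in> borel_measurable (L \<Otimes>\<^sub>M M)" by (rule measurable_compose[OF measurable_snd v(4)])
    ultimately have "(\<lambda>z. \<eta> (snd z) * ((case z of (s, \<omega>) \<Rightarrow> g (max a (min b s)) \<omega>) - (case z of (s, \<omega>) \<Rightarrow> g a \<omega>)) +
      (case z of (s, \<omega>) \<Rightarrow> \<Sum>(a, b, \<eta>)\<leftarrow>el. \<eta> \<omega> * (g (max a (min b s)) \<omega> - g a \<omega>))) \<in> borel_measurable (L \<Otimes>\<^sub>M M)"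
      by (intro borel_measurable_add borel_measurable_times borel_measurable_diff Cons.IH[OF v(5)])
    then show ?case by (simp add: x case_prod_unfold)
  qed simp
  ultimately show thesis using that by blast
qed

lemma quarter_powers: "0 \<le> a \<Longrightarrow> 0 \<le> b \<Longrightarrow> 2 * ennreal (a * (1/4)^n) + 2 * ennreal (b * (1/4)^n) = ennreal ((2 * a + 2 * b) * (1/4)^n)"
proof -
  assume ab: "0 \<le> a" "0 \<le> b"
  have "2 * ennreal (a * (1/4)^n) + 2 * ennreal (b * (1/4)^n) = ennreal (2 * (a * (1/4)^n)) + ennreal (2 * (b * (1/4)^n))"
    using ab by (simp add: ennreal_mult)
  also have "\<dots> = ennreal (2 * (a * (1/4)^n) + 2 * (b * (1/4)^n))" using ab by (intro ennreal_plus[symmetric]) auto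
  also have "2 * (a * (1/4)^n) + 2 * (b * (1/4)^n) = (2 * a + 2 * b) * (1/4)^n" by (simp add: algebra_simps)
  finally show ?thesis .
qed

lemma quarter_powers_lim: "(\<lambda>n. ennreal (c * (1/4)^n)) \<longlonglongrightarrow> 0"
proof -
  have "(\<lambda>n. c * (1/4::real)^n) \<longlonglongrightarrow> c * 0" by (intro tendsto_mult_left LIMSEQ_realpow_zero) auto
  from tendsto_ennrealI[OF this] show ?thesis by simp
qed

text \<open>For each \<open>s\<close> the integrals of a rapidly converging sequence of elementary processes converge almost
  surely; their pointwise limit, where it exists, is a jointly measurable version.\<close>

lemma ito_integral_exists:
  assumes i: "i \<in> {1..m}" and J: "approximable J" and \<psi>: "L2_on t T \<psi>"
  shows "\<exists>X. joint T X \<and> (\<forall>s\<in>{t..T}. is_ito_integral M F (f i) t s (\<lambda>u \<omega>. \<psi> u * J u \<omega>) (X s))"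
proof -
  define \<xi> where "\<xi> u \<omega> = \<psi> u * J u \<omega>" for u \<omega>
  have j\<xi>: "joint T \<xi>" unfolding \<xi>_def[abs_def] using J \<psi> joint_mult unfolding approximable_def by blast
  have pos: "0 < (1/4::real)^n" for n by simp
  have "\<exists>el. poly_elementary el \<and> pnsq T (\<lambda>u \<omega>. el_proc el u \<omega> - \<xi> u \<omega>) \<le> ennreal (1 * (1/4)^n)" for n
    unfolding \<xi>_def mult_1 using poly_approximation[OF J \<psi> pos[of n]] by blast
  then obtain el where el': "\<And>n. poly_elementary (el n)" "\<And>n. pnsq T (\<lambda>u \<omega>. el_proc (el n) u \<omega> - \<xi> u \<omega>) \<le> ennreal (1 * (1/4)^n)"
    by metis
  note el = poly_elementary_imp_elementary[OF el'(1)]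
  have "\<exists>S. joint T S \<and> (\<forall>s. AE \<omega> in M. S s \<omega> = el_int i (el n) s \<omega>)" for n
    using joint_el_int[OF i el[of n]] by metis
  then obtain S where S: "\<And>n. joint T (S n)" "\<And>n s. AE \<omega> in M. S n s \<omega> = el_int i (el n) s \<omega>" by metis
  define X where "X s \<omega> = lim (\<lambda>n. S n s \<omega>)" for s \<omega>
  have jX: "joint T X"
    unfolding X_def[abs_def] case_prod_unfold
    by (rule borel_measurable_lim_metric) (use S(1) in \<open>simp add: case_prod_unfold\<close>)
  have dist: "nsq M (\<lambda>\<omega>. S k s \<omega> - S n s \<omega>) \<le> ennreal (4 * (1/4)^n)" if "n \<le> k" "s \<in> {t..T}" for k n s
  proof -
    have s: "t \<le> s" "s \<le> T" using that(2) by auto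
    have "nsq M (\<lambda>\<omega>. S k s \<omega> - S n s \<omega>) = nsq M (\<lambda>\<omega>. el_int i (el k) s \<omega> - el_int i (el n) s \<omega>)"
      by (rule nsq_cong_AE) (use S(2)[of k s] S(2)[of n s] in \<open>eventually_elim, simp\<close>)
    also have "\<dots> = pnsq s (\<lambda>u \<omega>. el_proc (el k) u \<omega> - el_proc (el n) u \<omega>)" by (rule ito_isometry_diff[OF i el el s])
    also have "\<dots> \<le> pnsq T (\<lambda>u \<omega>. el_proc (el k) u \<omega> - el_proc (el n) u \<omega>)" by (rule pnsq_mono[OF s(2)])
    also have "\<dots> \<le> 2 * pnsq T (\<lambda>u \<omega>. el_proc (el k) u \<omega> - \<xi> u \<omega>) + 2 * pnsq T (\<lambda>u \<omega>. \<xi> u \<omega> - el_proc (el n) u \<omega>)"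
      by (rule pnsq_diff_le[OF joint_el_proc[OF el] j\<xi> joint_el_proc[OF el]])
    also have "\<dots> \<le> 2 * ennreal (1 * (1/4)^n) + 2 * ennreal (1 * (1/4)^n)"
    proof (intro add_mono mult_left_mono)
      have "(1/4::real)^k \<le> (1/4)^n" using that(1) by (intro power_decreasing) auto
      then show "pnsq T (\<lambda>u \<omega>. el_proc (el k) u \<omega> - \<xi> u \<omega>) \<le> ennreal (1 * (1/4)^n)"
        by (intro order_trans[OF el'(2)] ennreal_leI) simp
      show "pnsq T (\<lambda>u \<omega>. \<xi> u \<omega> - el_proc (el n) u \<omega>) \<le> ennreal (1 * (1/4)^n)"
        unfolding pnsq_commute[of T \<xi>] by (rule el'(2))
    qed auto
    also have "\<dots> = ennreal (4 * (1/4)^n)" using quarter_powers[of 1 1 n] by simp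
    finally show ?thesis .
  qed
  have mS: "S n s \<in> borel_measurable M" if "s \<in> {t..T}" for n s by (rule joint_section[OF S(1) that])
  have mX: "X s \<in> borel_measurable M" if "s \<in> {t..T}" for s by (rule joint_section[OF jX that])
  have close: "nsq M (\<lambda>\<omega>. X s \<omega> - el_int i (el n) s \<omega>) \<le> ennreal (4 * (1/4)^n)" if s: "s \<in> {t..T}" for n s
  proof -
    have "AE \<omega> in M. convergent (\<lambda>n. S n s \<omega>)"
      by (rule AE_convergent_fast[OF mS[OF s] dist[OF _ s]]) auto
    then have "AE \<omega> in M. (\<lambda>k. S k s \<omega> - S n s \<omega>) \<longlonglongrightarrow> X s \<omega> - S n s \<omega>"
      unfolding X_def by eventually_elim (intro tendsto_diff tendsto_const, simp add: convergent_LIMSEQ_iff)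
    then have "nsq M (\<lambda>\<omega>. X s \<omega> - S n s \<omega>) \<le> ennreal (4 * (1/4)^n)"
      by (rule nsq_Fatou[where ?n0.0 = n, rotated 2]) (use mS[OF s] mX[OF s] dist[OF _ s] in auto)
    moreover have "nsq M (\<lambda>\<omega>. X s \<omega> - S n s \<omega>) = nsq M (\<lambda>\<omega>. X s \<omega> - el_int i (el n) s \<omega>)"
      by (rule nsq_cong_AE) (use S(2)[of n s] in \<open>eventually_elim, simp\<close>)
    ultimately show ?thesis by simp
  qed
  have "is_ito_integral M F (f i) t s \<xi> (X s)" if sT: "s \<in> {t..T}" for s
  proof -
    have s: "t \<le> s" "s \<le> T" using sT by auto
    have "\<exists>N \<tau> \<eta>. adapted_step M F t s N \<tau> \<eta> \<and> pnsq s (\<lambda>u \<omega>. step_process N \<tau> \<eta> u \<omega> - \<xi> u \<omega>) \<le> ennreal (1 * (1/4)^n)" for n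
      unfolding \<xi>_def mult_1 using step_approximation[OF J \<psi> s pos[of n]] by blast
    then obtain N \<tau> \<eta> where st: "\<And>n. adapted_step M F t s (N n) (\<tau> n) (\<eta> n)"
      "\<And>n. pnsq s (\<lambda>u \<omega>. step_process (N n) (\<tau> n) (\<eta> n) u \<omega> - \<xi> u \<omega>) \<le> ennreal (1 * (1/4)^n)"
      by metis
    have i0: "i \<noteq> 0" using i by auto
    note ls = list_of_steps[OF st(1) s]
    have "nsq M (\<lambda>\<omega>. step_integral (f i) (N n) (\<tau> n) (\<eta> n) \<omega> - X s \<omega>) \<le> ennreal (16 * (1/4)^n)" for n
    proof -
      let ?l = "list_of_steps (N n) (\<tau> n) (\<eta> n)"
      have si: "square_integrable M (el_int i ?l s)" "square_integrable M (el_int i (el n) s)"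
        by (rule ito_isometry(1)[OF i ls(1) s], rule ito_isometry(1)[OF i el s])
      have "nsq M (\<lambda>\<omega>. el_int i ?l s \<omega> - el_int i (el n) s \<omega>) = pnsq s (\<lambda>u \<omega>. el_proc ?l u \<omega> - el_proc (el n) u \<omega>)"
        by (rule ito_isometry_diff[OF i ls(1) el s])
      also have "\<dots> \<le> 2 * pnsq s (\<lambda>u \<omega>. el_proc ?l u \<omega> - \<xi> u \<omega>) + 2 * pnsq s (\<lambda>u \<omega>. \<xi> u \<omega> - el_proc (el n) u \<omega>)"
        by (rule pnsq_diff_le[OF joint_el_proc[OF ls(1)] joint_mono[OF j\<xi> s(2)] joint_el_proc[OF el]])
      also have "\<dots> \<le> 2 * ennreal (1 * (1/4)^n) + 2 * ennreal (1 * (1/4)^n)"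
      proof (intro add_mono mult_left_mono)
        show "pnsq s (\<lambda>u \<omega>. el_proc ?l u \<omega> - \<xi> u \<omega>) \<le> ennreal (1 * (1/4)^n)" unfolding ls(2) by (rule st(2))
        show "pnsq s (\<lambda>u \<omega>. \<xi> u \<omega> - el_proc (el n) u \<omega>) \<le> ennreal (1 * (1/4)^n)"
          unfolding pnsq_commute[of s \<xi>] by (rule order_trans[OF pnsq_mono[OF s(2)] el'(2)])
      qed auto
      also have "\<dots> = ennreal (4 * (1/4)^n)" using quarter_powers[of 1 1 n] by simp
      finally have 1: "nsq M (\<lambda>\<omega>. el_int i ?l s \<omega> - el_int i (el n) s \<omega>) \<le> ennreal (4 * (1/4)^n)" .
      have 2: "nsq M (\<lambda>\<omega>. el_int i (el n) s \<omega> - X s \<omega>) \<le> ennreal (4 * (1/4)^n)"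
        unfolding nsq_commute[of M "el_int i (el n) s"] by (rule close[OF sT])
      have "nsq M (\<lambda>\<omega>. el_int i ?l s \<omega> - X s \<omega>) \<le>
          2 * nsq M (\<lambda>\<omega>. el_int i ?l s \<omega> - el_int i (el n) s \<omega>) + 2 * nsq M (\<lambda>\<omega>. el_int i (el n) s \<omega> - X s \<omega>)"
        by (rule nsq_diff_le[OF square_integrable_measurable[OF si(1)] square_integrable_measurable[OF si(2)] mX[OF sT]])
      also have "\<dots> \<le> 2 * ennreal (4 * (1/4)^n) + 2 * ennreal (4 * (1/4)^n)"
        by (intro add_mono mult_left_mono 1 2) auto
      also have "\<dots> = ennreal (16 * (1/4)^n)" using quarter_powers[of 4 4 n] by simp
      finally show ?thesis unfolding ls(3)[OF i0] .
    qed
    then have "(\<lambda>n. nsq M (\<lambda>\<omega>. step_integral (f i) (N n) (\<tau> n) (\<eta> n) \<omega> - X s \<omega>)) \<longlonglongrightarrow> 0"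
      by (rule ennreal_squeeze) (rule quarter_powers_lim)
    moreover have "(\<lambda>n. pnsq s (\<lambda>u \<omega>. step_process (N n) (\<tau> n) (\<eta> n) u \<omega> - \<xi> u \<omega>)) \<longlonglongrightarrow> 0"
      by (rule ennreal_squeeze[OF st(2)]) (rule quarter_powers_lim)
    ultimately show ?thesis
      unfolding is_ito_integral_def
      using joint_mono[OF j\<xi> s(2)] mX[OF sT] st(1)
      by (intro conjI exI[of _ N] exI[of _ \<tau>] exI[of _ \<eta>] allI) (simp_all only: pnsq_def nsq_def)
  qed
  then show ?thesis using jX unfolding \<xi>_def[abs_def] by blast
qed

text \<open>Two approximating sequences give the same limit, by the isometry; so an Ito integral is
  close to the integral of every elementary process that is close to the integrand.\<close>

lemma is_ito_integral_close:
  assumes i: "i \<in> {1..m}" and s: "t \<le> s" "s \<le> T" and X: "is_ito_integral M F (f i) t s \<xi> X"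
    and el: "elementary el"
  shows "nsq M (\<lambda>\<omega>. X \<omega> - el_int i el s \<omega>) \<le> 4 * pnsq s (\<lambda>u \<omega>. \<xi> u \<omega> - el_proc el u \<omega>)"
proof -
  obtain N \<tau> \<eta> where st: "\<And>n. adapted_step M F t s (N n) (\<tau> n) (\<eta> n)"
    and lim: "(\<lambda>n. pnsq s (\<lambda>u \<omega>. step_process (N n) (\<tau> n) (\<eta> n) u \<omega> - \<xi> u \<omega>)) \<longlonglongrightarrow> 0"
      "(\<lambda>n. nsq M (\<lambda>\<omega>. step_integral (f i) (N n) (\<tau> n) (\<eta> n) \<omega> - X \<omega>)) \<longlonglongrightarrow> 0"
    using X unfolding is_ito_integral_def pnsq_def nsq_def by blast
  have j\<xi>: "joint s \<xi>" and mX: "X \<in> borel_measurable M" using X unfolding is_ito_integral_def by blast+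
  have i0: "i \<noteq> 0" using i by auto
  define p where "p = pnsq s (\<lambda>u \<omega>. \<xi> u \<omega> - el_proc el u \<omega>)"
  define a where "a n = nsq M (\<lambda>\<omega>. step_integral (f i) (N n) (\<tau> n) (\<eta> n) \<omega> - X \<omega>)" for n
  define b where "b n = pnsq s (\<lambda>u \<omega>. step_process (N n) (\<tau> n) (\<eta> n) u \<omega> - \<xi> u \<omega>)" for n
  have le: "nsq M (\<lambda>\<omega>. X \<omega> - el_int i el s \<omega>) \<le> 2 * a n + 2 * (2 * b n + 2 * p)" for n
  proof -
    let ?l = "list_of_steps (N n) (\<tau> n) (\<eta> n)"
    note ls = list_of_steps[OF st s]
    have si: "square_integrable M (el_int i ?l s)" "square_integrable M (el_int i el s)"
      by (rule ito_isometry(1)[OF i ls(1) s], rule ito_isometry(1)[OF i el s])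
    have "nsq M (\<lambda>\<omega>. X \<omega> - el_int i el s \<omega>) \<le> 2 * nsq M (\<lambda>\<omega>. X \<omega> - el_int i ?l s \<omega>) + 2 * nsq M (\<lambda>\<omega>. el_int i ?l s \<omega> - el_int i el s \<omega>)"
      by (rule nsq_diff_le[OF mX square_integrable_measurable[OF si(1)] square_integrable_measurable[OF si(2)]])
    also have "nsq M (\<lambda>\<omega>. X \<omega> - el_int i ?l s \<omega>) = a n"
      unfolding a_def ls(3)[OF i0] by (rule nsq_commute)
    also have "nsq M (\<lambda>\<omega>. el_int i ?l s \<omega> - el_int i el s \<omega>) = pnsq s (\<lambda>u \<omega>. el_proc ?l u \<omega> - el_proc el u \<omega>)"
      by (rule ito_isometry_diff[OF i ls(1) el s])
    also have "2 * a n + 2 * pnsq s (\<lambda>u \<omega>. el_proc ?l u \<omega> - el_proc el u \<omega>) \<le> 2 * a n + 2 * (2 * b n + 2 * p)"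
      unfolding b_def p_def
    proof (intro add_left_mono mult_left_mono)
      show "pnsq s (\<lambda>u \<omega>. el_proc ?l u \<omega> - el_proc el u \<omega>) \<le>
        2 * pnsq s (\<lambda>u \<omega>. step_process (N n) (\<tau> n) (\<eta> n) u \<omega> - \<xi> u \<omega>) + 2 * pnsq s (\<lambda>u \<omega>. \<xi> u \<omega> - el_proc el u \<omega>)"
        using pnsq_diff_le[OF joint_el_proc[OF ls(1)] j\<xi> joint_el_proc[OF el]] by (simp only: ls(2))
    qed simp
    finally show ?thesis .
  qed
  have "(\<lambda>n. 2 * a n + 2 * (2 * b n + 2 * p)) \<longlonglongrightarrow> 2 * 0 + 2 * (2 * 0 + 2 * p)"
    unfolding a_def b_def by (intro tendsto_add ennreal_tendsto_cmult lim tendsto_const) simp_all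
  then have "nsq M (\<lambda>\<omega>. X \<omega> - el_int i el s \<omega>) \<le> 2 * 0 + 2 * (2 * 0 + 2 * p)"
    by (rule LIMSEQ_le_const) (use le in blast)
  also have "\<dots> = 4 * p" by (simp flip: mult.assoc)
  finally show ?thesis unfolding p_def .
qed

lemma time_integral_joint:
  assumes \<xi>: "joint T \<xi>"
  shows "joint T (\<lambda>s \<omega>. LINT u|lebesgue_on {t..s}. \<xi> u \<omega>)"
proof -
  interpret Lf: finite_measure L by (rule finite_measure_L)
  have id: "(\<lambda>s. s) \<in> borel_measurable L" by (intro measurable_restrict_space1 measurable_completion) simp
  define g where "g z u = (if u \<le> fst z then \<xi> u (snd z) else 0)" for z :: "real \<times> 'a" and u
  have "(\<lambda>(z, u). g z u) \<in> borel_measurable ((L \<Otimes>\<^sub>M M) \<Otimes>\<^sub>M L)"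
  proof -
    have u: "(\<lambda>p. snd p) \<in> borel_measurable ((L \<Otimes>\<^sub>M M) \<Otimes>\<^sub>M L)" by (rule measurable_compose[OF measurable_snd id])
    have s: "(\<lambda>p. fst (fst p)) \<in> borel_measurable ((L \<Otimes>\<^sub>M M) \<Otimes>\<^sub>M L)"
      by (rule measurable_compose[OF measurable_fst measurable_compose[OF measurable_fst id]])
    have "(\<lambda>p. (snd p, snd (fst p))) \<in> (L \<Otimes>\<^sub>M M) \<Otimes>\<^sub>M L \<rightarrow>\<^sub>M L \<Otimes>\<^sub>M M"
      by (intro measurable_Pair measurable_snd measurable_compose[OF measurable_fst measurable_snd])
    from measurable_compose[OF this \<xi>] have x: "(\<lambda>p. \<xi> (snd p) (snd (fst p))) \<in> borel_measurable ((L \<Otimes>\<^sub>M M) \<Otimes>\<^sub>M L)"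
      by (simp add: case_prod_unfold)
    have "(\<lambda>p. if snd p \<le> fst (fst p) then \<xi> (snd p) (snd (fst p)) else 0) \<in> borel_measurable ((L \<Otimes>\<^sub>M M) \<Otimes>\<^sub>M L)"
      by (rule measurable_If[OF x borel_measurable_const borel_measurable_le[OF u s]])
    then show ?thesis by (simp add: g_def case_prod_unfold)
  qed
  from Lf.borel_measurable_lebesgue_integral[OF this]
  have m: "(\<lambda>z. LINT u|L. g z u) \<in> borel_measurable (L \<Otimes>\<^sub>M M)" .
  have eq: "(LINT u|L. g z u) = (case z of (s, \<omega>) \<Rightarrow> LINT u|lebesgue_on {t..s}. \<xi> u \<omega>)" if "z \<in> space (L \<Otimes>\<^sub>M M)" for z
  proof -
    obtain s \<omega> where z1: "z = (s, \<omega>)" by (cases z)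
    have z: "z = (s, \<omega>)" "s \<in> {t..T}" using that by (simp_all add: z1 space_pair_measure space_restrict_space)
    have "(LINT u|L. g z u) = (LINT u|lebesgue. indicator {t..T} u *\<^sub>R g z u)"
      by (rule integral_restrict_space) simp
    also have "\<dots> = (LINT u|lebesgue. indicator {t..s} u *\<^sub>R \<xi> u \<omega>)"
      using z by (intro Bochner_Integration.integral_cong refl) (auto simp: g_def split: split_indicator)
    also have "\<dots> = (LINT u|lebesgue_on {t..s}. \<xi> u \<omega>)"
      by (rule integral_restrict_space[symmetric]) simp
    finally show ?thesis by (simp add: z)
  qed
  show ?thesis using m by (subst measurable_cong[OF eq[symmetric]])
qed

text \<open>The Cauchy-Schwarz inequality in time, applied to almost every path.\<close>

lemma time_integral_close:
  assumes s: "t \<le> s" "s \<le> T" and \<xi>: "joint T \<xi>" and fin: "pnsq T (\<lambda>u \<omega>. \<xi> u \<omega> - el_proc el u \<omega>) < \<infinity>"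
    and el: "elementary el"
  shows "nsq M (\<lambda>\<omega>. (LINT u|lebesgue_on {t..s}. \<xi> u \<omega>) - el_int 0 el s \<omega>) \<le> ennreal (T - t) * pnsq s (\<lambda>u \<omega>. \<xi> u \<omega> - el_proc el u \<omega>)"
proof -
  let ?Q = "lebesgue_on {t..s}"
  interpret Q: finite_measure ?Q by (rule finite_measure_lebesgue_on_Icc)
  interpret QM: pair_sigma_finite ?Q M by standard
  define d where "d u \<omega> = \<xi> u \<omega> - el_proc el u \<omega>" for u \<omega>
  have jd: "joint s d"
    unfolding d_def[abs_def] using joint_mono[OF \<xi> s(2)] joint_el_proc[OF el, of s]
    by (simp add: case_prod_unfold)
  have sect: "(\<lambda>u. d u \<omega>) \<in> borel_measurable ?Q" if "\<omega> \<in> space M" for \<omega>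
    using measurable_Pair1[OF jd that] by simp
  have m2: "(\<lambda>(u, \<omega>). ennreal ((d u \<omega>)\<^sup>2)) \<in> borel_measurable (?Q \<Otimes>\<^sub>M M)"
    using jd by (simp add: case_prod_unfold)
  have swap: "(\<integral>\<^sup>+\<omega>. nsq ?Q (\<lambda>u. d u \<omega>) \<partial>M) = pnsq s d"
    unfolding pnsq_def nsq_def by (rule QM.Fubini') (use m2 in simp)
  have nq: "(\<lambda>\<omega>. nsq ?Q (\<lambda>u. d u \<omega>)) \<in> borel_measurable M"
  proof -
    have "(\<lambda>(\<omega>, u). ennreal ((d u \<omega>)\<^sup>2)) \<in> borel_measurable (M \<Otimes>\<^sub>M ?Q)"
      using measurable_compose[OF measurable_pair_swap' m2] by (simp add: case_prod_unfold)
    from Q.borel_measurable_nn_integral[OF this] show ?thesis by (simp only: nsq_def)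
  qed
  have "pnsq s d < \<infinity>" using pnsq_mono[OF s(2), of d] fin unfolding d_def by (rule le_less_trans)
  then have AEfin: "AE \<omega> in M. nsq ?Q (\<lambda>u. d u \<omega>) \<noteq> \<infinity>"
    using swap by (intro nn_integral_noteq_infinite nq) auto
  have el_eq: "el_int 0 el s \<omega> = (LINT u|?Q. el_proc el u \<omega>) \<and> integrable ?Q (\<lambda>u. el_proc el u \<omega>)" for \<omega>
    using el
  proof (induction el)
    case Nil
    then show ?case by (simp add: el_int_simps el_proc_simps)
  next
    case (Cons x el)
    obtain a b \<eta> where x: "x = (a, b, \<eta>)" by (cases x) auto
    have v: "t \<le> a" "a \<le> b" "elementary el" using Cons.prems unfolding x elementary_simps by blast+
    have int: "integrable ?Q (\<lambda>u. indicator {a..<b} u :: real)"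
      by (rule Q.integrable_const_bound[where B = 1]) (auto intro!: AE_I2 indicator_measurable_lebesgue_on split: split_indicator)
    have "(LINT u|?Q. indicator {a..<b} u :: real) = (LINT u|?Q. indicator {a..<b} u * indicator {a..<b} u)"
      by (intro Bochner_Integration.integral_cong refl) (simp split: split_indicator)
    also have "\<dots> = max a (min b s) - a"
      using integral_indicator_overlap[OF v(1,2) v(1,2), of s] by (simp add: max_absorb2)
    finally have "(LINT u|?Q. indicator {a..<b} u :: real) = max a (min b s) - a" .
    then show ?case using Cons.IH[OF v(3)] int by (simp add: x el_int_simps el_proc_simps w_def)
  qed
  have pointwise: "AE \<omega> in M. ennreal (((LINT u|?Q. \<xi> u \<omega>) - el_int 0 el s \<omega>)\<^sup>2) \<le> ennreal (T - t) * nsq ?Q (\<lambda>u. d u \<omega>)"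
  proof (rule AE_mp[OF AEfin], intro AE_I2 impI)
    fix \<omega> assume \<omega>: "\<omega> \<in> space M" "nsq ?Q (\<lambda>u. d u \<omega>) \<noteq> \<infinity>"
    have sd: "square_integrable ?Q (\<lambda>u. d u \<omega>)"
      using \<omega> sect by (simp add: square_integrable_iff_nsq less_top)
    have s1: "square_integrable ?Q (\<lambda>_. 1)" by (simp add: square_integrable_def)
    have intd: "integrable ?Q (\<lambda>u. d u \<omega>)" using square_integrable_mult[OF sd s1] by simp
    have "(LINT u|?Q. \<xi> u \<omega>) = (LINT u|?Q. d u \<omega> + el_proc el u \<omega>)" by (simp add: d_def)
    also have "\<dots> = (LINT u|?Q. d u \<omega>) + el_int 0 el s \<omega>" using el_eq[of \<omega>] intd by simp
    finally have "(LINT u|?Q. \<xi> u \<omega>) - el_int 0 el s \<omega> = (LINT u|?Q. d u \<omega> * 1)" by simp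
    then have "((LINT u|?Q. \<xi> u \<omega>) - el_int 0 el s \<omega>)\<^sup>2 \<le> (LINT u|?Q. (d u \<omega>)\<^sup>2) * (LINT u|?Q. 1\<^sup>2)"
      using integral_Cauchy_Schwarz[OF sd s1] by simp
    also have "(LINT u|?Q. 1\<^sup>2) = s - t" using s(1) by (simp add: measure_restrict_space space_restrict_space)
    also have "(LINT u|?Q. (d u \<omega>)\<^sup>2) * (s - t) \<le> (LINT u|?Q. (d u \<omega>)\<^sup>2) * (T - t)"
      using s by (intro mult_left_mono) auto
    finally have "ennreal (((LINT u|?Q. \<xi> u \<omega>) - el_int 0 el s \<omega>)\<^sup>2) \<le> ennreal ((T - t) * (LINT u|?Q. (d u \<omega>)\<^sup>2))"
      by (intro ennreal_leI) (simp add: mult.commute)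
    also have "\<dots> = ennreal (T - t) * nsq ?Q (\<lambda>u. d u \<omega>)"
      using less_imp_le[OF t_less] by (simp add: nsq_eq_integral[OF sd] ennreal_mult)
    finally show "ennreal (((LINT u|?Q. \<xi> u \<omega>) - el_int 0 el s \<omega>)\<^sup>2) \<le> ennreal (T - t) * nsq ?Q (\<lambda>u. d u \<omega>)" .
  qed
  have "nsq M (\<lambda>\<omega>. (LINT u|?Q. \<xi> u \<omega>) - el_int 0 el s \<omega>) \<le> (\<integral>\<^sup>+\<omega>. ennreal (T - t) * nsq ?Q (\<lambda>u. d u \<omega>) \<partial>M)"
    unfolding nsq_def[of M] by (rule nn_integral_mono_AE[OF pointwise])
  also have "\<dots> = ennreal (T - t) * pnsq s d"
    unfolding swap[symmetric] by (rule nn_integral_cmult[OF nq])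
  finally show ?thesis unfolding d_def .
qed

text \<open>Both kinds of integrals are approximated, uniformly in the upper limit, by the integrals of
  elementary processes.\<close>

lemma w_integral_close:
  assumes i: "i \<in> {0..m}" and J: "approximable J" and \<psi>: "L2_on t T \<psi>"
  defines "X \<equiv> w_integral M F f t T i (\<lambda>u \<omega>. \<psi> u * J u \<omega>)"
  shows "joint T X"
    "\<exists>C\<ge>0. \<forall>el. elementary el \<longrightarrow> pnsq T (\<lambda>u \<omega>. el_proc el u \<omega> - \<psi> u * J u \<omega>) < \<infinity> \<longrightarrow>
      (\<forall>s\<in>{t..T}. nsq M (\<lambda>\<omega>. el_int i el s \<omega> - X s \<omega>) \<le> ennreal C * pnsq T (\<lambda>u \<omega>. el_proc el u \<omega> - \<psi> u * J u \<omega>))"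
proof -
  define \<xi> where "\<xi> u \<omega> = \<psi> u * J u \<omega>" for u \<omega>
  have j\<xi>: "joint T \<xi>" unfolding \<xi>_def[abs_def] using J \<psi> joint_mult unfolding approximable_def by blast
  have "joint T X \<and> (\<exists>C\<ge>0. \<forall>el. elementary el \<longrightarrow> pnsq T (\<lambda>u \<omega>. el_proc el u \<omega> - \<xi> u \<omega>) < \<infinity> \<longrightarrow>
      (\<forall>s\<in>{t..T}. nsq M (\<lambda>\<omega>. el_int i el s \<omega> - X s \<omega>) \<le> ennreal C * pnsq T (\<lambda>u \<omega>. el_proc el u \<omega> - \<xi> u \<omega>)))"
  proof (cases "i = 0")
    case True
    have X: "X = (\<lambda>s \<omega>. LINT u|lebesgue_on {t..s}. \<xi> u \<omega>)"
      unfolding X_def w_integral_def \<xi>_def using True by simp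
    have "nsq M (\<lambda>\<omega>. el_int i el s \<omega> - X s \<omega>) \<le> ennreal (T - t) * pnsq T (\<lambda>u \<omega>. el_proc el u \<omega> - \<xi> u \<omega>)"
      if el: "elementary el" "pnsq T (\<lambda>u \<omega>. el_proc el u \<omega> - \<xi> u \<omega>) < \<infinity>" and s: "s \<in> {t..T}" for el s
    proof -
      have s': "t \<le> s" "s \<le> T" using s by auto
      have fin: "pnsq T (\<lambda>u \<omega>. \<xi> u \<omega> - el_proc el u \<omega>) < \<infinity>" using el(2) unfolding pnsq_commute[of T \<xi>] .
      have "nsq M (\<lambda>\<omega>. el_int i el s \<omega> - X s \<omega>) = nsq M (\<lambda>\<omega>. (LINT u|lebesgue_on {t..s}. \<xi> u \<omega>) - el_int 0 el s \<omega>)"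
        unfolding X True by (rule nsq_commute)
      also have "\<dots> \<le> ennreal (T - t) * pnsq s (\<lambda>u \<omega>. \<xi> u \<omega> - el_proc el u \<omega>)"
        by (rule time_integral_close[OF s' j\<xi> fin el(1)])
      also have "\<dots> \<le> ennreal (T - t) * pnsq T (\<lambda>u \<omega>. el_proc el u \<omega> - \<xi> u \<omega>)"
        unfolding pnsq_commute[of s \<xi>] by (intro mult_left_mono pnsq_mono s') simp
      finally show ?thesis .
    qed
    moreover have "0 \<le> T - t" using t_less by simp
    moreover have "joint T X" unfolding X by (rule time_integral_joint[OF j\<xi>])
    ultimately show ?thesis by blast
  next
    case False
    then have i1: "i \<in> {1..m}" using i by auto
    define P where "P X \<longleftrightarrow> joint T X \<and> (\<forall>s\<in>{t..T}. is_ito_integral M F (f i) t s \<xi> (X s))" for X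
    have "Ex P" using ito_integral_exists[OF i1 J \<psi>] unfolding P_def \<xi>_def[abs_def] by blast
    moreover have "Eps P = X"
      unfolding X_def w_integral_def ito_integral_def P_def[abs_def] \<xi>_def[abs_def] using False by simp
    ultimately have "P X" using someI_ex[of P] by simp
    then have X: "joint T X \<and> (\<forall>s\<in>{t..T}. is_ito_integral M F (f i) t s \<xi> (X s))"
      unfolding P_def .
    have "nsq M (\<lambda>\<omega>. el_int i el s \<omega> - X s \<omega>) \<le> ennreal 4 * pnsq T (\<lambda>u \<omega>. el_proc el u \<omega> - \<xi> u \<omega>)"
      if el: "elementary el" and s: "s \<in> {t..T}" for el s
    proof -
      have s': "t \<le> s" "s \<le> T" using s by auto
      have "nsq M (\<lambda>\<omega>. el_int i el s \<omega> - X s \<omega>) = nsq M (\<lambda>\<omega>. X s \<omega> - el_int i el s \<omega>)" by (rule nsq_commute)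
      also have "\<dots> \<le> 4 * pnsq s (\<lambda>u \<omega>. \<xi> u \<omega> - el_proc el u \<omega>)"
        by (rule is_ito_integral_close[OF i1 s' _ el]) (use X s in blast)
      also have "\<dots> \<le> ennreal 4 * pnsq T (\<lambda>u \<omega>. el_proc el u \<omega> - \<xi> u \<omega>)"
        unfolding pnsq_commute[of s \<xi>] by (simp add: mult_left_mono pnsq_mono s')
      finally show ?thesis .
    qed
    then show ?thesis using X by (intro conjI exI[of _ 4]) auto
  qed
  then show "joint T X"
    "\<exists>C\<ge>0. \<forall>el. elementary el \<longrightarrow> pnsq T (\<lambda>u \<omega>. el_proc el u \<omega> - \<psi> u * J u \<omega>) < \<infinity> \<longrightarrow>
      (\<forall>s\<in>{t..T}. nsq M (\<lambda>\<omega>. el_int i el s \<omega> - X s \<omega>) \<le> ennreal C * pnsq T (\<lambda>u \<omega>. el_proc el u \<omega> - \<psi> u * J u \<omega>))"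
    unfolding \<xi>_def by blast+
qed

lemma w_integral_sequence:
  assumes i: "i \<in> {0..m}" and J: "approximable J" and \<psi>: "L2_on t T \<psi>"
  obtains C where "0 \<le> C" "\<And>e. 0 < e \<Longrightarrow> \<exists>el. poly_elementary el \<and> pnsq T (\<lambda>u \<omega>. el_proc el u \<omega> - \<psi> u * J u \<omega>) \<le> ennreal e \<and>
      (\<forall>s\<in>{t..T}. nsq M (\<lambda>\<omega>. el_int i el s \<omega> - w_integral M F f t T i (\<lambda>u \<omega>. \<psi> u * J u \<omega>) s \<omega>) \<le> ennreal (C * e))"
proof -
  obtain C where C: "0 \<le> C" "\<And>el s. elementary el \<Longrightarrow> pnsq T (\<lambda>u \<omega>. el_proc el u \<omega> - \<psi> u * J u \<omega>) < \<infinity> \<Longrightarrow> s \<in> {t..T} \<Longrightarrow>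
      nsq M (\<lambda>\<omega>. el_int i el s \<omega> - w_integral M F f t T i (\<lambda>u \<omega>. \<psi> u * J u \<omega>) s \<omega>) \<le> ennreal C * pnsq T (\<lambda>u \<omega>. el_proc el u \<omega> - \<psi> u * J u \<omega>)"
    using w_integral_close(2)[OF i J \<psi>] by blast
  show thesis
  proof (rule that[OF C(1)])
    fix e :: real assume e: "0 < e"
    obtain el where el: "poly_elementary el" "pnsq T (\<lambda>u \<omega>. el_proc el u \<omega> - \<psi> u * J u \<omega>) \<le> ennreal e"
      using poly_approximation[OF J \<psi> e] by blast
    have fin: "pnsq T (\<lambda>u \<omega>. el_proc el u \<omega> - \<psi> u * J u \<omega>) < \<infinity>" using el(2) by (rule le_less_trans) simp
    have "nsq M (\<lambda>\<omega>. el_int i el s \<omega> - w_integral M F f t T i (\<lambda>u \<omega>. \<psi> u * J u \<omega>) s \<omega>) \<le> ennreal (C * e)" if "s \<in> {t..T}" for s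
    proof -
      have "nsq M (\<lambda>\<omega>. el_int i el s \<omega> - w_integral M F f t T i (\<lambda>u \<omega>. \<psi> u * J u \<omega>) s \<omega>) \<le> ennreal C * pnsq T (\<lambda>u \<omega>. el_proc el u \<omega> - \<psi> u * J u \<omega>)"
        by (rule C(2)[OF poly_elementary_imp_elementary[OF el(1)] fin that])
      also have "\<dots> \<le> ennreal C * ennreal e" by (intro mult_left_mono el(2)) simp
      also have "\<dots> = ennreal (C * e)" using C(1) e by (intro ennreal_mult[symmetric]) auto
      finally show ?thesis .
    qed
    then show "\<exists>el. poly_elementary el \<and> pnsq T (\<lambda>u \<omega>. el_proc el u \<omega> - \<psi> u * J u \<omega>) \<le> ennreal e \<and>
      (\<forall>s\<in>{t..T}. nsq M (\<lambda>\<omega>. el_int i el s \<omega> - w_integral M F f t T i (\<lambda>u \<omega>. \<psi> u * J u \<omega>) s \<omega>) \<le> ennreal (C * e))"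
      using el by blast
  qed
qed

lemma approximable_w_integral:
  assumes i: "i \<in> {0..m}" and J: "approximable J" and \<psi>: "L2_on t T \<psi>"
  shows "approximable (w_integral M F f t T i (\<lambda>u \<omega>. \<psi> u * J u \<omega>))"
  unfolding approximable_def
proof (intro conjI allI impI w_integral_close(1)[OF assms])
  fix e :: real assume e: "0 < e"
  obtain C where C: "0 \<le> C" "\<And>e. 0 < e \<Longrightarrow> \<exists>el. poly_elementary el \<and> pnsq T (\<lambda>u \<omega>. el_proc el u \<omega> - \<psi> u * J u \<omega>) \<le> ennreal e \<and>
      (\<forall>s\<in>{t..T}. nsq M (\<lambda>\<omega>. el_int i el s \<omega> - w_integral M F f t T i (\<lambda>u \<omega>. \<psi> u * J u \<omega>) s \<omega>) \<le> ennreal (C * e))"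
    using w_integral_sequence[OF assms] by blast
  have C1: "0 < C + 1" using C(1) by simp
  have "0 < e / (C + 1)" using e C1 by (rule divide_pos_pos)
  from C(2)[OF this] obtain el where el: "poly_elementary el"
    "\<And>s. s \<in> {t..T} \<Longrightarrow> nsq M (\<lambda>\<omega>. el_int i el s \<omega> - w_integral M F f t T i (\<lambda>u \<omega>. \<psi> u * J u \<omega>) s \<omega>) \<le> ennreal (C * (e / (C + 1)))"
    by blast
  have "C * (e / (C + 1)) \<le> (C + 1) * (e / (C + 1))" using \<open>0 < e / (C + 1)\<close> by (intro mult_right_mono) auto
  also have "\<dots> = e" using C1 by simp
  finally have le: "ennreal (C * (e / (C + 1))) \<le> ennreal e" by (rule ennreal_leI)
  show "\<exists>Y. regular_process Y \<and> (\<forall>u\<in>{t..T}. nsq M (\<lambda>\<omega>. Y u \<omega> - w_integral M F f t T i (\<lambda>u \<omega>. \<psi> u * J u \<omega>) u \<omega>) \<le> ennreal e)"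
    by (intro exI[of _ "el_int i el"] conjI ballI regular_process_el_int[OF i el(1)] order_trans[OF el(2) le])
qed

lemma approximable_exp_span:
  assumes J: "approximable J" and s: "s \<in> {t..T}"
  shows "exp_span (J s)"
proof -
  have "\<exists>Y. exp_span Y \<and> nsq M (\<lambda>\<omega>. Y \<omega> - J s \<omega>) \<le> ennreal (1 * (1/4)^n)" for n
  proof -
    have "0 < 1 * (1/4::real)^n" by simp
    then obtain Y where Y: "regular_process Y" "nsq M (\<lambda>\<omega>. Y s \<omega> - J s \<omega>) \<le> ennreal (1 * (1/4)^n)"
      using J s unfolding approximable_def by meson
    have "past_poly s (Y s)" using Y(1) s unfolding regular_process_def by blast
    then have "exp_span (Y s)" using s by (intro exp_multiplier_base(2) past_poly_multiplier) auto
    then show ?thesis using Y(2) by blast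
  qed
  then obtain Y where Y: "\<And>n. exp_span (Y n)" "\<And>n. nsq M (\<lambda>\<omega>. Y n \<omega> - J s \<omega>) \<le> ennreal (1 * (1/4)^n)" by metis
  have "J s \<in> borel_measurable M" using J s joint_section unfolding approximable_def by blast
  then show ?thesis by (rule exp_span_limit[OF Y(1)]) (rule ennreal_squeeze[OF Y(2) quarter_powers_lim])
qed

end

section \<open>The transform of the iterated integral\<close>

context wiener_setting
begin

lemma square_integrable_indicator_L: "square_integrable L (indicator {a..<b})"
proof -
  interpret Lf: finite_measure L by (rule finite_measure_L)
  show ?thesis
    unfolding square_integrable_def
    by (intro conjI indicator_measurable_lebesgue_on Lf.integrable_const_bound[where B = 1] AE_I2 borel_measurable_power)
       (simp_all split: split_indicator)
qed

lemma indicator_lessThan_measurable: "(indicator {..<s} :: real \<Rightarrow> real) \<in> borel_measurable L"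
  by (intro measurable_restrict_space1 borel_measurable_indicator) simp

lemma square_integrable_bounded_mult:
  assumes g: "square_integrable N g" and \<theta>: "\<theta> \<in> borel_measurable N" "\<And>x. \<bar>\<theta> x\<bar> \<le> 1"
  shows "square_integrable N (\<lambda>x. \<theta> x * g x)"
  unfolding square_integrable_def
proof
  show m: "(\<lambda>x. \<theta> x * g x) \<in> borel_measurable N"
    by (intro borel_measurable_times \<theta>(1) square_integrable_measurable[OF g])
  show "integrable N (\<lambda>x. (\<theta> x * g x)\<^sup>2)"
  proof (rule Bochner_Integration.integrable_bound[OF square_integrable_sq[OF g] borel_measurable_power[OF m]], rule AE_I2)
    fix x
    have "(\<theta> x)\<^sup>2 \<le> 1" using \<theta>(2)[of x] by (simp add: abs_square_le_1)
    then have "(\<theta> x)\<^sup>2 * (g x)\<^sup>2 \<le> 1 * (g x)\<^sup>2" by (intro mult_right_mono) auto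
    then show "norm ((\<theta> x * g x)\<^sup>2) \<le> norm ((g x)\<^sup>2)" by (simp add: power_mult_distrib)
  qed
qed

lemma indicator_abs_le: "\<bar>indicator A x :: real\<bar> \<le> 1"
  by (simp split: split_indicator)

text \<open>An increment is integrated against the part of its interval that precedes \<open>s\<close>.\<close>

lemma el_int_transform:
  assumes i: "i \<in> {0..m}" and el: "elementary el" and h: "valid h" and s: "s \<in> {t..T}"
  shows "square_integrable L (\<lambda>x. expectation (\<lambda>\<omega>. el_proc el x \<omega> * exp (G h \<omega>))) \<and>
    expectation (\<lambda>\<omega>. el_int i el s \<omega> * exp (G h \<omega>)) =
      (\<integral>x. (indicator {..<s} x * kernel h i x) * expectation (\<lambda>\<omega>. el_proc el x \<omega> * exp (G h \<omega>)) \<partial>L) \<and>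
    square_integrable M (el_int i el s) \<and> (\<forall>x. square_integrable M (el_proc el x))"
  using el
proof (induction el)
  case Nil
  then show ?case by (simp add: el_proc_simps el_int_simps cong: measurable_cong)
next
  case (Cons z el)
  obtain a b \<eta> where z: "z = (a, b, \<eta>)" by (cases z) auto
  have v: "t \<le> a" "a \<le> b" "b \<le> T" "\<eta> \<in> borel_measurable (F a)" "square_integrable M \<eta>" "elementary el"
    using Cons.prems unfolding z elementary_simps by blast+
  note IH = Cons.IH[OF v(6)]
  define c where "c = max a (min b s)"
  have c: "a \<le> c" "c \<le> T" using v by (auto simp: c_def)
  define E0 where "E0 = expectation (\<lambda>\<omega>. \<eta> \<omega> * exp (G h \<omega>))"
  define A where "A x = expectation (\<lambda>\<omega>. el_proc el x \<omega> * exp (G h \<omega>))" for x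
  note eG = exp_G_square_integrable[OF h]
  have si_proc: "square_integrable M (\<lambda>\<omega>. indicator {a..<b} x * \<eta> \<omega>)" for x :: real
    by (rule square_integrable_cmult[OF v(5)])
  have proc: "el_proc (z # el) x = (\<lambda>\<omega>. indicator {a..<b} x * \<eta> \<omega> + el_proc el x \<omega>)" for x
    by (simp add: z el_proc_simps fun_eq_iff mult.commute)
  have A: "expectation (\<lambda>\<omega>. el_proc (z # el) x \<omega> * exp (G h \<omega>)) = E0 * indicator {a..<b} x + A x" for x
  proof -
    have "expectation (\<lambda>\<omega>. el_proc (z # el) x \<omega> * exp (G h \<omega>)) =
      expectation (\<lambda>\<omega>. indicator {a..<b} x * (\<eta> \<omega> * exp (G h \<omega>)) + el_proc el x \<omega> * exp (G h \<omega>))"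
      unfolding proc by (simp only: distrib_right mult.assoc)
    also have "\<dots> = indicator {a..<b} x * E0 + A x"
      unfolding E0_def A_def using IH square_integrable_mult[OF v(5) eG] square_integrable_mult[OF _ eG, of "el_proc el x"]
      by (subst Bochner_Integration.integral_add) auto
    finally show ?thesis by (simp only: mult.commute)
  qed
  have "square_integrable L (\<lambda>x. E0 * indicator {a..<b} x + A x)"
    using IH unfolding A_def by (intro square_integrable_add square_integrable_cmult square_integrable_indicator_L) blast
  then have 1: "square_integrable L (\<lambda>x. expectation (\<lambda>\<omega>. el_proc (z # el) x \<omega> * exp (G h \<omega>)))" unfolding A .
  have w_si: "square_integrable M (\<lambda>\<omega>. \<eta> \<omega> * (w i c \<omega> - w i a \<omega>))"
  proof -
    have m: "(\<lambda>\<omega>. \<eta> \<omega> * (w i c \<omega> - w i a \<omega>)) \<in> borel_measurable M"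
    proof -
      have "w i y \<in> borel_measurable M" if "t \<le> y" "y \<le> T" for y
        using i that t_nonneg f_measurable[of i y] unfolding w_def[abs_def] by (cases "i = 0") auto
      then show ?thesis using v c by (intro borel_measurable_times borel_measurable_diff square_integrable_measurable[OF v(5)]) auto
    qed
    have "nsq M (\<lambda>\<omega>. \<eta> \<omega> * (w i c \<omega> - w i a \<omega>)) < \<infinity>"
      by (rule le_less_trans[OF w_increment_bound[OF i v(1) order_refl c v(4,5)]]) simp
    then show ?thesis by (simp only: square_integrable_iff_nsq[OF m])
  qed
  have overlap: "(indicator {..<s} x * indicator {a..<b} x :: real) = indicator {a..<c} x" for x
    unfolding c_def by (auto split: split_indicator)
  have w_transform: "expectation (\<lambda>\<omega>. \<eta> \<omega> * (w i c \<omega> - w i a \<omega>) * exp (G h \<omega>)) = (\<integral>x. indicator {a..<c} x * kernel h i x \<partial>L) * E0"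
  proof (cases "i = 0")
    case True
    have "(\<integral>x. indicator {a..<c} x \<partial>L) = (\<integral>x. indicator {a..<c} x * indicator {a..<c} x \<partial>L :: real)"
      by (intro Bochner_Integration.integral_cong refl) (simp split: split_indicator)
    also have "\<dots> = c - a"
      using integral_indicator_overlap[OF v(1) c(1) v(1) c(1), of T] c by (simp add: max_absorb2 min_absorb1)
    finally have "(\<integral>x. indicator {a..<c} x * kernel h i x \<partial>L) = c - a" by (simp add: kernel_def True)
    moreover have "expectation (\<lambda>\<omega>. \<eta> \<omega> * (w i c \<omega> - w i a \<omega>) * exp (G h \<omega>)) = expectation (\<lambda>\<omega>. (c - a) * (\<eta> \<omega> * exp (G h \<omega>)))"
      by (simp add: w_def True mult_ac)
    ultimately show ?thesis by (simp add: E0_def)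
  next
    case False
    then have i1: "i \<in> {1..m}" using i by auto
    show ?thesis
      using increment_transform[OF i1 v(1) c v(4,5) h] False by (simp add: w_def kernel_def E0_def)
  qed
  have int_eq: "el_int i (z # el) s = (\<lambda>\<omega>. \<eta> \<omega> * (w i c \<omega> - w i a \<omega>) + el_int i el s \<omega>)"
    by (simp add: z el_int_simps c_def fun_eq_iff)
  have kL: "square_integrable L (\<lambda>x. indicator {..<s} x * kernel h i x)"
    by (rule square_integrable_bounded_mult[OF square_integrable_kernel indicator_lessThan_measurable indicator_abs_le])
  have "expectation (\<lambda>\<omega>. el_int i (z # el) s \<omega> * exp (G h \<omega>)) =
    expectation (\<lambda>\<omega>. \<eta> \<omega> * (w i c \<omega> - w i a \<omega>) * exp (G h \<omega>)) + expectation (\<lambda>\<omega>. el_int i el s \<omega> * exp (G h \<omega>))"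
    unfolding int_eq distrib_right
    by (rule Bochner_Integration.integral_add[OF square_integrable_mult[OF w_si eG]]) (use IH square_integrable_mult[OF _ eG] in blast)
  also have "\<dots> = (\<integral>x. indicator {a..<c} x * kernel h i x \<partial>L) * E0 + (\<integral>x. (indicator {..<s} x * kernel h i x) * A x \<partial>L)"
    unfolding w_transform A_def using IH by simp
  also have "(\<integral>x. indicator {a..<c} x * kernel h i x \<partial>L) * E0 = (\<integral>x. (indicator {..<s} x * kernel h i x) * (E0 * indicator {a..<b} x) \<partial>L)"
  proof -
    have e: "(indicator {..<s} x * kernel h i x) * (E0 * indicator {a..<b} x) = (indicator {a..<c} x * kernel h i x) * E0" for x
      unfolding overlap[symmetric] by (simp only: mult_ac)
    show ?thesis unfolding e by (rule integral_mult_left_zero[symmetric])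
  qed
  also have "(\<integral>x. (indicator {..<s} x * kernel h i x) * (E0 * indicator {a..<b} x) \<partial>L) + (\<integral>x. (indicator {..<s} x * kernel h i x) * A x \<partial>L) =
    (\<integral>x. (indicator {..<s} x * kernel h i x) * (E0 * indicator {a..<b} x + A x) \<partial>L)"
    unfolding distrib_left
    by (rule Bochner_Integration.integral_add[symmetric])
      (use IH kL in \<open>auto simp: A_def intro!: square_integrable_mult square_integrable_cmult square_integrable_indicator_L\<close>)
  finally have 2: "expectation (\<lambda>\<omega>. el_int i (z # el) s \<omega> * exp (G h \<omega>)) =
      (\<integral>x. (indicator {..<s} x * kernel h i x) * expectation (\<lambda>\<omega>. el_proc (z # el) x \<omega> * exp (G h \<omega>)) \<partial>L)"
    unfolding A .
  have IH': "square_integrable M (el_int i el s)" "square_integrable M (el_proc el x)" for x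
    using IH by simp_all
  have 3: "square_integrable M (el_int i (z # el) s)" unfolding int_eq by (rule square_integrable_add[OF w_si IH'(1)])
  have 4: "square_integrable M (el_proc (z # el) x)" for x unfolding proc by (rule square_integrable_add[OF si_proc IH'(2)])
  show ?case using 1 2 3 4 by blast
qed

text \<open>Elementary processes converge to the integrand, their integrals to the integral, and the transform
  is continuous in mean square.\<close>

lemma w_integral_transform:
  assumes i: "i \<in> {0..m}" and J: "approximable J" and \<psi>: "L2_on t T \<psi>" and h: "valid h" and s: "s \<in> {t..T}"
  shows "square_integrable L (\<lambda>x. \<psi> x * expectation (\<lambda>\<omega>. J x \<omega> * exp (G h \<omega>)))"
    "expectation (\<lambda>\<omega>. w_integral M F f t T i (\<lambda>u \<omega>. \<psi> u * J u \<omega>) s \<omega> * exp (G h \<omega>)) =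
      (\<integral>x. (indicator {..<s} x * kernel h i x) * (\<psi> x * expectation (\<lambda>\<omega>. J x \<omega> * exp (G h \<omega>))) \<partial>L)"
proof -
  define X where "X = w_integral M F f t T i (\<lambda>u \<omega>. \<psi> u * J u \<omega>) s"
  define g where "g x = \<psi> x * expectation (\<lambda>\<omega>. J x \<omega> * exp (G h \<omega>))" for x
  note eG = exp_G_square_integrable[OF h]
  obtain C where C: "0 \<le> C" "\<And>e. 0 < e \<Longrightarrow> \<exists>el. poly_elementary el \<and> pnsq T (\<lambda>u \<omega>. el_proc el u \<omega> - \<psi> u * J u \<omega>) \<le> ennreal e \<and>
      (\<forall>s\<in>{t..T}. nsq M (\<lambda>\<omega>. el_int i el s \<omega> - w_integral M F f t T i (\<lambda>u \<omega>. \<psi> u * J u \<omega>) s \<omega>) \<le> ennreal (C * e))"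
    using w_integral_sequence[OF i J \<psi>] by blast
  have pos: "0 < (1/4::real)^n" for n by simp
  define Q where "Q n el \<longleftrightarrow> elementary el \<and> pnsq T (\<lambda>u \<omega>. el_proc el u \<omega> - \<psi> u * J u \<omega>) \<le> ennreal ((1/4)^n) \<and>
      nsq M (\<lambda>\<omega>. el_int i el s \<omega> - X \<omega>) \<le> ennreal (C * (1/4)^n)" for n el
  have "\<exists>el. Q n el" for n
  proof -
    obtain el where "poly_elementary el" "pnsq T (\<lambda>u \<omega>. el_proc el u \<omega> - \<psi> u * J u \<omega>) \<le> ennreal ((1/4)^n)"
      "\<forall>s\<in>{t..T}. nsq M (\<lambda>\<omega>. el_int i el s \<omega> - w_integral M F f t T i (\<lambda>u \<omega>. \<psi> u * J u \<omega>) s \<omega>) \<le> ennreal (C * (1/4)^n)"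
      using C(2)[OF pos[of n]] by (elim exE conjE)
    then show ?thesis using s poly_elementary_imp_elementary unfolding Q_def X_def by blast
  qed
  then have "\<forall>n. \<exists>el. Q n el" by (rule allI)
  from choice[OF this] obtain el where "\<forall>n. Q n (el n)" by (elim exE)
  then have Q: "Q n (el n)" for n by (rule spec)
  have el: "\<And>n. elementary (el n)" "\<And>n. pnsq T (\<lambda>u \<omega>. el_proc (el n) u \<omega> - \<psi> u * J u \<omega>) \<le> ennreal ((1/4)^n)"
      "\<And>n. nsq M (\<lambda>\<omega>. el_int i (el n) s \<omega> - X \<omega>) \<le> ennreal (C * (1/4)^n)"
    using Q unfolding Q_def by simp_all
  note tr = el_int_transform[OF i el(1) h s]
  define fn where "fn n x = expectation (\<lambda>\<omega>. el_proc (el n) x \<omega> * exp (G h \<omega>))" for n x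
  have fn: "square_integrable L (fn n)" for n using tr[of n] unfolding fn_def[abs_def] by blast
  have jJ: "joint T J" using J unfolding approximable_def by blast
  have gm: "g \<in> borel_measurable L"
  proof -
    have "(\<lambda>z. (case z of (x, \<omega>) \<Rightarrow> J x \<omega>) * exp (G h (snd z))) \<in> borel_measurable (L \<Otimes>\<^sub>M M)"
      by (intro borel_measurable_times jJ measurable_compose[OF measurable_snd square_integrable_measurable[OF eG]])
    then have "(\<lambda>(x, \<omega>). J x \<omega> * exp (G h \<omega>)) \<in> borel_measurable (L \<Otimes>\<^sub>M M)" by (simp add: case_prod_unfold)
    from borel_measurable_lebesgue_integral[OF this] show ?thesis
      using \<psi> unfolding g_def[abs_def] L2_on_def by (intro borel_measurable_times) auto
  qed
  define K where "K = expectation (\<lambda>\<omega>. (exp (G h \<omega>))\<^sup>2)"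
  have K: "0 \<le> K" by (simp add: K_def)
  obtain B where B: "0 \<le> B" "\<And>u. u \<in> {t..T} \<Longrightarrow> nsq M (J u) \<le> ennreal B" using approximable_bounded[OF J] by blast
  have diff: "ennreal ((fn n x - g x)\<^sup>2) \<le> ennreal K * nsq M (\<lambda>\<omega>. el_proc (el n) x \<omega> - \<psi> x * J x \<omega>)" if x: "x \<in> {t..T}" for n x
  proof -
    have mJ: "J x \<in> borel_measurable M" by (rule joint_section[OF jJ x])
    have sJ: "square_integrable M (J x)"
      unfolding square_integrable_iff_nsq[OF mJ] by (rule le_less_trans[OF B(2)[OF x]]) simp
    have sd: "square_integrable M (\<lambda>\<omega>. el_proc (el n) x \<omega> - \<psi> x * J x \<omega>)"
      using tr[of n] sJ by (intro square_integrable_diff square_integrable_cmult) blast+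
    have "expectation (\<lambda>\<omega>. (el_proc (el n) x \<omega> - \<psi> x * J x \<omega>) * exp (G h \<omega>)) =
      expectation (\<lambda>\<omega>. el_proc (el n) x \<omega> * exp (G h \<omega>) - \<psi> x * (J x \<omega> * exp (G h \<omega>)))"
      by (simp only: left_diff_distrib mult.assoc)
    also have "\<dots> = fn n x - g x"
      unfolding fn_def g_def using tr[of n] sJ square_integrable_mult[OF _ eG]
      by (subst Bochner_Integration.integral_diff) auto
    finally have "(fn n x - g x)\<^sup>2 \<le> expectation (\<lambda>\<omega>. (el_proc (el n) x \<omega> - \<psi> x * J x \<omega>)\<^sup>2) * K"
      unfolding K_def using integral_Cauchy_Schwarz[OF sd eG] by simp
    then have "ennreal ((fn n x - g x)\<^sup>2) \<le> ennreal (K * expectation (\<lambda>\<omega>. (el_proc (el n) x \<omega> - \<psi> x * J x \<omega>)\<^sup>2))"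
      by (intro ennreal_leI) (simp only: mult.commute)
    also have "\<dots> = ennreal K * nsq M (\<lambda>\<omega>. el_proc (el n) x \<omega> - \<psi> x * J x \<omega>)"
      unfolding nsq_eq_integral[OF sd] using K by (intro ennreal_mult) auto
    finally show ?thesis .
  qed
  have dist: "nsq L (\<lambda>x. fn n x - g x) \<le> ennreal (K * (1/4)^n)" for n
  proof -
    have "nsq L (\<lambda>x. fn n x - g x) \<le> (\<integral>\<^sup>+x. ennreal K * nsq M (\<lambda>\<omega>. el_proc (el n) x \<omega> - \<psi> x * J x \<omega>) \<partial>L)"
      unfolding nsq_def[of L] by (rule nn_integral_mono) (use diff in \<open>simp add: space_restrict_space\<close>)
    also have "\<dots> = ennreal K * pnsq T (\<lambda>u \<omega>. el_proc (el n) u \<omega> - \<psi> u * J u \<omega>)"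
      unfolding pnsq_def by (rule nn_integral_cmult[OF joint_nsq[OF joint_el_proc[OF el(1)] joint_mult[OF \<psi> jJ]]])
    also have "\<dots> \<le> ennreal K * ennreal ((1/4)^n)" by (intro mult_left_mono el(2)) simp
    also have "\<dots> = ennreal (K * (1/4)^n)" using K by (intro ennreal_mult[symmetric]) auto
    finally show ?thesis .
  qed
  have lim: "(\<lambda>n. nsq L (\<lambda>x. fn n x - g x)) \<longlonglongrightarrow> 0" by (rule ennreal_squeeze[OF dist quarter_powers_lim])
  show "square_integrable L (\<lambda>x. \<psi> x * expectation (\<lambda>\<omega>. J x \<omega> * exp (G h \<omega>)))"
    using square_integrable_limit[OF fn gm lim] unfolding g_def[abs_def] .
  have kL: "square_integrable L (\<lambda>x. indicator {..<s} x * kernel h i x)"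
    by (rule square_integrable_bounded_mult[OF square_integrable_kernel indicator_lessThan_measurable indicator_abs_le])
  have mX: "X \<in> borel_measurable M"
    unfolding X_def by (rule joint_section[OF w_integral_close(1)[OF i J \<psi>] s])
  have sint: "square_integrable M (el_int i (el n) s)" for n using tr[of n] by blast
  have "(\<lambda>n. expectation (\<lambda>\<omega>. el_int i (el n) s \<omega> * exp (G h \<omega>))) \<longlonglongrightarrow> expectation (\<lambda>\<omega>. X \<omega> * exp (G h \<omega>))"
    by (rule integral_mult_limit[OF sint mX ennreal_squeeze[OF el(3) quarter_powers_lim] eG])
  moreover have "expectation (\<lambda>\<omega>. el_int i (el n) s \<omega> * exp (G h \<omega>)) = (\<integral>x. fn n x * (indicator {..<s} x * kernel h i x) \<partial>L)" for n
    using tr[of n] unfolding fn_def by (simp only: mult.commute)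
  moreover have "(\<lambda>n. \<integral>x. fn n x * (indicator {..<s} x * kernel h i x) \<partial>L) \<longlonglongrightarrow> (\<integral>x. g x * (indicator {..<s} x * kernel h i x) \<partial>L)"
    by (rule integral_mult_limit[OF fn gm lim kL])
  ultimately have "expectation (\<lambda>\<omega>. X \<omega> * exp (G h \<omega>)) = (\<integral>x. g x * (indicator {..<s} x * kernel h i x) \<partial>L)"
    using LIMSEQ_unique by simp
  then show "expectation (\<lambda>\<omega>. w_integral M F f t T i (\<lambda>u \<omega>. \<psi> u * J u \<omega>) s \<omega> * exp (G h \<omega>)) =
      (\<integral>x. (indicator {..<s} x * kernel h i x) * (\<psi> x * expectation (\<lambda>\<omega>. J x \<omega> * exp (G h \<omega>))) \<partial>L)"
    unfolding X_def g_def by (simp only: mult.commute)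
qed

lemma approximable_iterated_integral:
  assumes "\<And>l. l \<in> {1..k} \<Longrightarrow> i l \<in> {0..m}" "\<And>l. l \<in> {1..k} \<Longrightarrow> L2_on t T (\<psi> l)"
  shows "approximable (iterated_integral M F f t T \<psi> i k)"
  using assms
proof (induction k)
  case 0
  then show ?case using approximable_const[of 1] by simp
next
  case (Suc k)
  have "approximable (iterated_integral M F f t T \<psi> i k)" by (rule Suc.IH) (use Suc.prems in auto)
  then show ?case unfolding iterated_integral.simps by (rule approximable_w_integral[rotated]) (use Suc.prems in auto)
qed

subsection \<open>Integrals over the simplex\<close>

lemma coordinate_measurable:
  assumes "l \<in> I" shows "(\<lambda>x. x l) \<in> borel_measurable (Pi\<^sub>M I (\<lambda>_. L))"
proof -
  have "(\<lambda>s. s) \<in> borel_measurable L" by (intro measurable_restrict_space1 measurable_completion) simp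
  from measurable_compose[OF measurable_component_singleton[of l I "\<lambda>_. L", OF assms] this] show ?thesis .
qed

lemma simplex_kernel_measurable:
  assumes "\<And>l. l \<in> {1..k} \<Longrightarrow> \<chi>' l \<in> borel_measurable L"
  shows "simplex_kernel k \<chi>' \<in> borel_measurable (cube t T k)"
proof -
  have order: "{x \<in> space (cube t T k). \<forall>l\<in>{1..<k}. x l < x (Suc l)} \<in> sets (cube t T k)"
    by (rule sets.sets_Collect_finite_All) (auto intro!: borel_measurable_less coordinate_measurable)
  have "(\<lambda>x. \<chi>' l (x l)) \<in> borel_measurable (cube t T k)" if l: "l \<in> {1..k}" for l
    by (rule measurable_compose[OF measurable_component_singleton[of l "{1..k}" "\<lambda>_. L", OF l] assms[OF l]])
  then have "(\<lambda>x. \<Prod>l=1..k. \<chi>' l (x l)) \<in> borel_measurable (cube t T k)"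
    by (rule borel_measurable_prod)
  then show ?thesis unfolding simplex_kernel_def[abs_def] by (intro measurable_If borel_measurable_const order)
qed

lemma simplex_kernel_abs_le: "\<bar>simplex_kernel k \<chi>' x\<bar> \<le> \<bar>\<Prod>l=1..k. \<chi>' l (x l)\<bar>"
  by (simp add: simplex_kernel_def)

lemma simplex_kernel_mult:
  "simplex_kernel k (\<lambda>l x. \<psi> l x * \<kappa> l x) x = simplex_kernel k \<psi> x * (\<Prod>l=1..k. \<kappa> l (x l))"
  by (simp add: simplex_kernel_def prod.distrib)

lemma simplex_section_measurable:
  assumes "\<And>l. l \<in> {1..k} \<Longrightarrow> \<chi>' l \<in> borel_measurable L"
  shows "(\<lambda>u. \<integral>y. simplex_kernel k \<chi>' y * (if k = 0 then 1 else indicator {..<u} (y k)) \<partial>cube t T k) \<in> borel_measurable L"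
proof -
  interpret product_sigma_finite "\<lambda>_::nat. L" by (rule product_sigma_finite_L)
  have "(\<lambda>(u, y). simplex_kernel k \<chi>' y * (if k = 0 then 1 else indicator {..<u} (y k))) \<in> borel_measurable (L \<Otimes>\<^sub>M cube t T k)"
  proof -
    have K: "(\<lambda>p. simplex_kernel k \<chi>' (snd p)) \<in> borel_measurable (L \<Otimes>\<^sub>M cube t T k)"
      by (rule measurable_compose[OF measurable_snd simplex_kernel_measurable[OF assms]])
    have "(\<lambda>p. if k = 0 then 1 else indicator {..<fst p} (snd p k) :: real) \<in> borel_measurable (L \<Otimes>\<^sub>M cube t T k)"
    proof (cases "k = 0")
      case False
      have id: "(\<lambda>s. s) \<in> borel_measurable L" by (intro measurable_restrict_space1 measurable_completion) simp
      have "(\<lambda>p. if snd p k < fst p then 1 else 0 :: real) \<in> borel_measurable (L \<Otimes>\<^sub>M cube t T k)"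
        using False
        by (intro measurable_If borel_measurable_const borel_measurable_less
            measurable_compose[OF measurable_snd coordinate_measurable] measurable_compose[OF measurable_fst id]) auto
      moreover have "(\<lambda>p. if k = 0 then 1 else indicator {..<fst p} (snd p k) :: real) = (\<lambda>p. if snd p k < fst p then 1 else 0)"
        using False by (auto simp: fun_eq_iff split: split_indicator)
      ultimately show ?thesis by (rule back_subst[where P = "\<lambda>g. g \<in> borel_measurable (L \<Otimes>\<^sub>M cube t T k)", OF _ sym])
    qed simp
    from borel_measurable_times[OF K this] show ?thesis by (simp add: case_prod_unfold)
  qed
  moreover have "sigma_finite_measure (cube t T k)" by (rule sigma_finite) simp
  ultimately show ?thesis by (rule sigma_finite_measure.borel_measurable_lebesgue_integral[rotated])
qed

text \<open>The section of the simplex over its last coordinate \<open>u\<close> is a simplex of one dimension less, whose own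
  last coordinate is bounded by \<open>u\<close>; in dimension \<open>0\<close> nothing is left to be bounded.\<close>

lemma simplex_integral_last:
  assumes \<chi>: "\<And>l. l \<in> {1..Suc k} \<Longrightarrow> integrable L (\<chi>' l)"
    and \<theta>: "\<theta> \<in> borel_measurable L" "\<And>x. \<bar>\<theta> x\<bar> \<le> 1"
  shows "(\<integral>x. simplex_kernel (Suc k) \<chi>' x * \<theta> (x (Suc k)) \<partial>cube t T (Suc k)) =
    (\<integral>u. \<theta> u * (\<chi>' (Suc k) u * (\<integral>y. simplex_kernel k \<chi>' y * (if k = 0 then 1 else indicator {..<u} (y k)) \<partial>cube t T k)) \<partial>L)"
proof -
  interpret product_sigma_finite "\<lambda>_::nat. L" by (rule product_sigma_finite_L)
  let ?f = "\<lambda>x. simplex_kernel (Suc k) \<chi>' x * \<theta> (x (Suc k))"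
  have set_eq: "{Suc k} \<union> {1..k} = {1..Suc k}" by auto
  have mf: "?f \<in> borel_measurable (cube t T (Suc k))"
    by (intro borel_measurable_times simplex_kernel_measurable borel_measurable_integrable[OF \<chi>]
        measurable_compose[OF measurable_component_singleton[of "Suc k" "{1..Suc k}" "\<lambda>_. L"] \<theta>(1)]) auto
  have int: "integrable (cube t T (Suc k)) ?f"
  proof (rule Bochner_Integration.integrable_bound[OF _ mf])
    show "integrable (cube t T (Suc k)) (\<lambda>x. \<Prod>l=1..Suc k. \<chi>' l (x l))"
      by (rule product_integrable_prod) (use \<chi> in auto)
    show "AE x in cube t T (Suc k). norm (?f x) \<le> norm (\<Prod>l=1..Suc k. \<chi>' l (x l))"
    proof (rule AE_I2)
      fix x
      have "\<bar>simplex_kernel (Suc k) \<chi>' x\<bar> * \<bar>\<theta> (x (Suc k))\<bar> \<le> \<bar>\<Prod>l=1..Suc k. \<chi>' l (x l)\<bar> * 1"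
        by (rule mult_mono[OF simplex_kernel_abs_le \<theta>(2)]) auto
      then show "norm (?f x) \<le> norm (\<Prod>l=1..Suc k. \<chi>' l (x l))" by (simp only: real_norm_def abs_mult mult_1_right)
    qed
  qed
  define N where "N u = (\<integral>y. simplex_kernel k \<chi>' y * (if k = 0 then 1 else indicator {..<u} (y k)) \<partial>cube t T k)" for u
  define \<Phi> where "\<Phi> u = \<theta> u * (\<chi>' (Suc k) u * N u)" for u
  have split: "?f (merge {Suc k} {1..k} (x, y)) =
    (\<theta> (x (Suc k)) * \<chi>' (Suc k) (x (Suc k))) * (simplex_kernel k \<chi>' y * (if k = 0 then 1 else indicator {..<x (Suc k)} (y k)))" for x y
  proof -
    define z where "z = merge {Suc k} {1..k} (x, y)"
    have z: "z (Suc k) = x (Suc k)" "\<And>l. l \<in> {1..k} \<Longrightarrow> z l = y l" by (auto simp: z_def merge_def)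
    have prod: "(\<Prod>l=1..Suc k. \<chi>' l (z l)) = (\<Prod>l=1..k. \<chi>' l (y l)) * \<chi>' (Suc k) (x (Suc k))"
      using z by simp
    have cond: "(\<forall>l\<in>{1..<Suc k}. z l < z (Suc l)) \<longleftrightarrow> (\<forall>l\<in>{1..<k}. y l < y (Suc l)) \<and> (k = 0 \<or> y k < x (Suc k))"
    proof (cases "k = 0")
      case False
      then have "{1..<Suc k} = insert k {1..<k}" by auto
      moreover have "(\<forall>l\<in>{1..<k}. z l < z (Suc l)) \<longleftrightarrow> (\<forall>l\<in>{1..<k}. y l < y (Suc l))"
        by (intro ball_cong refl) (simp add: z(2))
      moreover have "z k = y k" using False by (intro z(2)) auto
      ultimately show ?thesis using False z(1) by auto
    qed simp
    show ?thesis
      unfolding z_def[symmetric] simplex_kernel_def cond prod z(1) by (auto split: split_indicator)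
  qed
  have "(\<integral>x. ?f x \<partial>cube t T (Suc k)) = (\<integral>x. (\<integral>y. ?f (merge {Suc k} {1..k} (x, y)) \<partial>cube t T k) \<partial>Pi\<^sub>M {Suc k} (\<lambda>_. L))"
  proof -
    have "integral\<^sup>L (Pi\<^sub>M ({Suc k} \<union> {1..k}) (\<lambda>_. L)) ?f =
      (\<integral>x. (\<integral>y. ?f (merge {Suc k} {1..k} (x, y)) \<partial>cube t T k) \<partial>Pi\<^sub>M {Suc k} (\<lambda>_. L))"
    proof (rule product_integral_fold)
      show "integrable (Pi\<^sub>M ({Suc k} \<union> {1..k}) (\<lambda>_. L)) ?f" unfolding set_eq by (rule int)
    qed auto
    then show ?thesis unfolding set_eq .
  qed
  also have "\<dots> = (\<integral>x. \<Phi> (x (Suc k)) \<partial>Pi\<^sub>M {Suc k} (\<lambda>_. L))"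
    unfolding split \<Phi>_def N_def by (simp only: integral_mult_right_zero mult.assoc)
  also have "\<dots> = (\<integral>u. \<Phi> u \<partial>L)"
  proof (rule product_integral_singleton)
    have "N \<in> borel_measurable L"
      unfolding N_def[abs_def] by (rule simplex_section_measurable) (auto intro: borel_measurable_integrable[OF \<chi>])
    then show "\<Phi> \<in> borel_measurable L"
      unfolding \<Phi>_def[abs_def] by (intro borel_measurable_times \<theta>(1) borel_measurable_integrable[OF \<chi>]) auto
  qed
  finally show ?thesis unfolding \<Phi>_def N_def .
qed

text \<open>Under the transform, integration with respect to the \<open>i\<close>-th component becomes integration with
  density \<open>kernel h i\<close>; iteration produces an integral over the simplex below \<open>s\<close>.\<close>

lemma iterated_integral_transform_upto:
  assumes "\<And>l. l \<in> {1..k} \<Longrightarrow> i l \<in> {0..m}" "\<And>l. l \<in> {1..k} \<Longrightarrow> L2_on t T (\<psi> l)" and h: "valid h"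
    and "s \<in> {t..T}"
  shows "expectation (\<lambda>\<omega>. iterated_integral M F f t T \<psi> i k s \<omega> * exp (G h \<omega>)) =
    exp (covariance t h h / 2) *
      (\<integral>x. simplex_kernel k (\<lambda>l x. \<psi> l x * kernel h (i l) x) x * (if k = 0 then 1 else indicator {..<s} (x k)) \<partial>cube t T k)"
  using assms(1,2,4)
proof (induction k arbitrary: s)
  case 0
  interpret product_sigma_finite "\<lambda>_::nat. L" by (rule product_sigma_finite_L)
  have "(\<integral>x. simplex_kernel 0 (\<lambda>l x. \<psi> l x * kernel h (i l) x) x \<partial>Pi\<^sub>M {} (\<lambda>_::nat. L)) = 1"
    using product_integral_prod[of "{}" "\<lambda>l x. x"] by (simp add: simplex_kernel_def)
  then show ?case using exp_G_expectation(2)[OF h] by simp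
next
  case (Suc k)
  define \<chi>' where "\<chi>' l x = \<psi> l x * kernel h (i l) x" for l x
  have \<chi>: "integrable L (\<chi>' l)" if "l \<in> {1..Suc k}" for l
    unfolding \<chi>'_def[abs_def] using Suc.prems(2)[OF that]
    by (intro square_integrable_mult square_integrable_kernel) (simp add: L2_on_iff)
  have J: "approximable (iterated_integral M F f t T \<psi> i k)"
    by (rule approximable_iterated_integral) (use Suc.prems in auto)
  have k1: "i (Suc k) \<in> {0..m}" "L2_on t T (\<psi> (Suc k))" using Suc.prems by auto
  define N where "N u = (\<integral>y. simplex_kernel k \<chi>' y * (if k = 0 then 1 else indicator {..<u} (y k)) \<partial>cube t T k)" for u
  have IH: "expectation (\<lambda>\<omega>. iterated_integral M F f t T \<psi> i k u \<omega> * exp (G h \<omega>)) = exp (covariance t h h / 2) * N u"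
    if "u \<in> {t..T}" for u
    unfolding N_def \<chi>'_def[abs_def] by (rule Suc.IH[OF _ _ that]) (use Suc.prems in auto)
  have "expectation (\<lambda>\<omega>. iterated_integral M F f t T \<psi> i (Suc k) s \<omega> * exp (G h \<omega>)) =
    (\<integral>x. (indicator {..<s} x * kernel h (i (Suc k)) x) * (\<psi> (Suc k) x * expectation (\<lambda>\<omega>. iterated_integral M F f t T \<psi> i k x \<omega> * exp (G h \<omega>))) \<partial>L)"
    unfolding iterated_integral.simps by (rule w_integral_transform(2)[OF k1(1) J k1(2) h Suc.prems(3)])
  also have "\<dots> = (\<integral>x. exp (covariance t h h / 2) * (indicator {..<s} x * (\<chi>' (Suc k) x * N x)) \<partial>L)"
  proof (intro Bochner_Integration.integral_cong refl)
    fix x assume "x \<in> space L"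
    then have "x \<in> {t..T}" by (simp add: space_restrict_space)
    then show "(indicator {..<s} x * kernel h (i (Suc k)) x) * (\<psi> (Suc k) x * expectation (\<lambda>\<omega>. iterated_integral M F f t T \<psi> i k x \<omega> * exp (G h \<omega>))) =
      exp (covariance t h h / 2) * (indicator {..<s} x * (\<chi>' (Suc k) x * N x))"
      unfolding IH[OF \<open>x \<in> {t..T}\<close>] \<chi>'_def by (simp only: mult_ac)
  qed
  also have "\<dots> = exp (covariance t h h / 2) * (\<integral>x. indicator {..<s} x * (\<chi>' (Suc k) x * N x) \<partial>L)"
    by (rule integral_mult_right_zero)
  also have "(\<integral>x. indicator {..<s} x * (\<chi>' (Suc k) x * N x) \<partial>L) =
    (\<integral>x. simplex_kernel (Suc k) \<chi>' x * indicator {..<s} (x (Suc k)) \<partial>cube t T (Suc k))"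
    unfolding N_def by (rule simplex_integral_last[OF \<chi> indicator_lessThan_measurable indicator_abs_le, symmetric])
  finally show ?case unfolding \<chi>'_def[abs_def] by simp
qed

text \<open>At the final time the constraint \<open>x k < T\<close> only excludes a null set.\<close>

lemma iterated_integral_transform:
  assumes k: "1 \<le> k" and "\<And>l. l \<in> {1..k} \<Longrightarrow> i l \<in> {0..m}" "\<And>l. l \<in> {1..k} \<Longrightarrow> L2_on t T (\<psi> l)" and h: "valid h"
  shows "expectation (\<lambda>\<omega>. iterated_integral M F f t T \<psi> i k T \<omega> * exp (G h \<omega>)) =
    exp (covariance t h h / 2) * (\<integral>x. simplex_kernel k \<psi> x * (\<Prod>l=1..k. kernel h (i l) (x l)) \<partial>cube t T k)"
proof -
  obtain k' where k': "k = Suc k'" using k by (cases k) auto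
  define \<chi>' where "\<chi>' l x = \<psi> l x * kernel h (i l) x" for l x
  have \<chi>: "integrable L (\<chi>' l)" if "l \<in> {1..Suc k'}" for l
    unfolding \<chi>'_def[abs_def] using assms(3)[of l] that k'
    by (intro square_integrable_mult square_integrable_kernel) (simp add: L2_on_iff)
  have TT: "T \<in> {t..T}" using t_less by simp
  have neT: "AE u in L. indicator {..<T} u = (1::real)"
  proof -
    have "AE u in lebesgue. u \<noteq> T" by (rule AE_completion) (rule AE_lborel_singleton)
    then have "AE u in L. u \<noteq> T" by (subst AE_restrict_space_iff) auto
    then show ?thesis by (rule AE_mp) (auto intro!: AE_I2 simp: space_restrict_space split: split_indicator)
  qed
  have last: "(\<integral>x. simplex_kernel k \<chi>' x * indicator {..<T} (x k) \<partial>cube t T k) = (\<integral>x. simplex_kernel k \<chi>' x * 1 \<partial>cube t T k)"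
  proof -
    define N where "N u = (\<integral>y. simplex_kernel k' \<chi>' y * (if k' = 0 then 1 else indicator {..<u} (y k')) \<partial>cube t T k')" for u
    have "N \<in> borel_measurable L"
      unfolding N_def[abs_def] by (rule simplex_section_measurable) (auto intro: borel_measurable_integrable[OF \<chi>])
    then have N: "(\<lambda>u. \<chi>' (Suc k') u * N u) \<in> borel_measurable L"
      by (intro borel_measurable_times borel_measurable_integrable[OF \<chi>]) auto
    have one: "(\<lambda>_. 1::real) \<in> borel_measurable L" by simp
    have "(\<integral>x. simplex_kernel k \<chi>' x * indicator {..<T} (x k) \<partial>cube t T k) = (\<integral>u. indicator {..<T} u * (\<chi>' (Suc k') u * N u) \<partial>L)"
      unfolding k' N_def by (rule simplex_integral_last[OF \<chi> indicator_lessThan_measurable indicator_abs_le])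
    also have "\<dots> = (\<integral>u. 1 * (\<chi>' (Suc k') u * N u) \<partial>L)"
    proof (rule integral_cong_AE)
      show "AE u in L. indicator {..<T} u * (\<chi>' (Suc k') u * N u) = 1 * (\<chi>' (Suc k') u * N u)"
        using neT by eventually_elim simp
    qed (rule borel_measurable_times[OF indicator_lessThan_measurable N] borel_measurable_times[OF one N])+
    also have "\<dots> = (\<integral>x. simplex_kernel k \<chi>' x * 1 \<partial>cube t T k)"
      unfolding k' N_def by (rule simplex_integral_last[where \<theta> = "\<lambda>_. 1", OF \<chi> one, symmetric]) auto
    finally show ?thesis .
  qed
  have "expectation (\<lambda>\<omega>. iterated_integral M F f t T \<psi> i k T \<omega> * exp (G h \<omega>)) =
    exp (covariance t h h / 2) * (\<integral>x. simplex_kernel k \<chi>' x * (if k = 0 then 1 else indicator {..<T} (x k)) \<partial>cube t T k)"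
    unfolding \<chi>'_def[abs_def] by (rule iterated_integral_transform_upto[OF assms(2,3) h TT])
  also have "(\<integral>x. simplex_kernel k \<chi>' x * (if k = 0 then 1 else indicator {..<T} (x k)) \<partial>cube t T k) =
    (\<integral>x. simplex_kernel k \<chi>' x * indicator {..<T} (x k) \<partial>cube t T k)"
    using k by (simp only: not_one_le_zero if_False k' nat.distinct(2))
  also note last
  also have "(\<integral>x. simplex_kernel k \<chi>' x * 1 \<partial>cube t T k) = (\<integral>x. simplex_kernel k \<psi> x * (\<Prod>l=1..k. kernel h (i l) (x l)) \<partial>cube t T k)"
    unfolding \<chi>'_def[abs_def] simplex_kernel_mult by (simp only: mult_1_right)
  finally show ?thesis .
qed

end

section \<open>The transform of the approximation\<close>

text \<open>A pairing of \<open>k\<close> points has at most \<open>k div 2\<close> pairs; the empty one contributes the product without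
  contractions.\<close>

lemma pairing_sum_by_card:
  fixes g :: "nat set set \<Rightarrow> real"
  shows "(\<Sum>P\<in>pairings {1..k}. g P) = g {} + (\<Sum>r=1..k div 2. \<Sum>P\<in>pair_partitions k r. g P)"
proof -
  have fin: "finite P" if "P \<in> pairings {1..k}" for P using finite_pairing[OF _ that] by simp
  have part: "{P \<in> pairings {1..k}. card P = r} = pair_partitions k r" for r
    by (auto simp: pairings_def pair_partitions_def)
  have card: "card P \<le> k div 2" if P: "P \<in> pairings {1..k}" for P
  proof -
    have two: "\<And>B. B \<in> P \<Longrightarrow> card B = 2" "\<And>B. B \<in> P \<Longrightarrow> B \<subseteq> {1..k}" "disjoint P"
      using P by (auto simp: pairings_def)
    have "card (\<Union>P) = (\<Sum>B\<in>P. card B)"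
      by (rule card_Union_disjoint[OF two(3)]) (use two(2) finite_subset in blast)
    also have "\<dots> = 2 * card P" using two(1) by simp
    finally have "2 * card P \<le> card {1..k}" using card_mono[of "{1..k}" "\<Union>P"] two(2) by (simp add: Union_least)
    then show ?thesis by simp
  qed
  have "(\<Sum>P\<in>pairings {1..k}. g P) = (\<Sum>r\<in>{0..k div 2}. \<Sum>P\<in>{P \<in> pairings {1..k}. card P = r}. g P)"
    by (rule sum.group[symmetric]) (use card finite_pairings in auto)
  also have "\<dots> = (\<Sum>P\<in>{P \<in> pairings {1..k}. card P = 0}. g P) + (\<Sum>r=1..k div 2. \<Sum>P\<in>pair_partitions k r. g P)"
    unfolding part by (simp add: sum.atLeast_Suc_atMost)
  also have "{P \<in> pairings {1..k}. card P = 0} = {{}}"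
    using fin by (auto simp: pairings_def)
  finally show ?thesis by simp
qed

text \<open>The contraction of two of the variables \<open>zeta\<close>, that is, their covariance.\<close>

definition pair_weight :: "(nat \<Rightarrow> nat) \<Rightarrow> (nat \<Rightarrow> nat) \<Rightarrow> nat set \<Rightarrow> real" where
  "pair_weight i j A = of_bool (i (Min A) = i (Max A) \<and> i (Min A) \<noteq> 0) * of_bool (j (Min A) = j (Max A))"

lemma pair_weight_doubleton:
  "pair_weight i j {x, q} = of_bool (i x = i q \<and> i x \<noteq> 0) * of_bool (j x = j q)"
proof (cases "x \<le> q")
  case True
  then have "Min {x, q} = x" "Max {x, q} = q" by (simp_all add: min_absorb1 max_absorb2)
  then show ?thesis by (simp only: pair_weight_def)
next
  case False
  then have "Min {x, q} = q" "Max {x, q} = x" by (simp_all add: min_absorb2 max_absorb1)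
  moreover have "(i q = i x \<and> i q \<noteq> 0) = (i x = i q \<and> i x \<noteq> 0)" "(j q = j x) = (j x = j q)" by metis+
  ultimately show ?thesis by (simp only: pair_weight_def)
qed

lemma approximation_sum_eq:
  "approximation_sum M F f t T k \<psi> \<phi> i p \<omega> =
    (\<Sum>j\<in>(\<Pi>\<^sub>E l\<in>{1..k}. {0..p l}). fourier_coeff t T k \<psi> \<phi> j *
      (\<Sum>P\<in>pairings {1..k}. ((-1) ^ card P * (\<Prod>A\<in>P. pair_weight i j A)) * (\<Prod>q\<in>{1..k} - \<Union>P. zeta M F f t T \<phi> (i q) (j q) \<omega>)))"
  unfolding pairing_sum_by_card approximation_sum_def pair_weight_def[symmetric]
proof (intro sum.cong refl arg_cong2[where f = "(*)"] arg_cong2[where f = "(+)"])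
  fix j r
  show "(-1) ^ r * (\<Sum>P\<in>pair_partitions k r. (\<Prod>A\<in>P. pair_weight i j A) * (\<Prod>q\<in>{1..k} - \<Union>P. zeta M F f t T \<phi> (i q) (j q) \<omega>)) =
    (\<Sum>P\<in>pair_partitions k r. ((-1) ^ card P * (\<Prod>A\<in>P. pair_weight i j A)) * (\<Prod>q\<in>{1..k} - \<Union>P. zeta M F f t T \<phi> (i q) (j q) \<omega>))"
    unfolding sum_distrib_left by (rule sum.cong) (auto simp: pair_partitions_def mult.assoc)
qed simp

lemma integral_expansion_mult:
  fixes c :: "'i \<Rightarrow> real"
  assumes "\<And>j. j \<in> I \<Longrightarrow> square_integrable N (B j)" "square_integrable N g"
  shows "(\<integral>x. (\<Sum>j\<in>I. c j * B j x) * g x \<partial>N) = (\<Sum>j\<in>I. c j * (\<integral>x. B j x * g x \<partial>N))"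
proof -
  have e: "(\<Sum>j\<in>I. c j * B j x) * g x = (\<Sum>j\<in>I. c j * (B j x * g x))" for x
    by (simp only: sum_distrib_right mult.assoc)
  have "(\<integral>x. (\<Sum>j\<in>I. c j * (B j x * g x)) \<partial>N) = (\<Sum>j\<in>I. \<integral>x. c j * (B j x * g x) \<partial>N)"
    by (rule Bochner_Integration.integral_sum) (intro integrable_mult_right square_integrable_mult assms)
  then show ?thesis unfolding e by (simp only: integral_mult_right_zero)
qed

text \<open>Pythagoras: the residual of a partial Fourier expansion.\<close>

lemma orthonormal_residual:
  assumes K: "square_integrable N K" and I: "finite I" and B: "\<And>j. j \<in> I \<Longrightarrow> square_integrable N (B j)"
    and orth: "\<And>j j'. j \<in> I \<Longrightarrow> j' \<in> I \<Longrightarrow> (\<integral>x. B j x * B j' x \<partial>N) = of_bool (j = j')"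
  shows "(\<integral>x. (K x - (\<Sum>j\<in>I. (\<integral>x. K x * B j x \<partial>N) * B j x))\<^sup>2 \<partial>N) =
    (\<integral>x. (K x)\<^sup>2 \<partial>N) - (\<Sum>j\<in>I. (\<integral>x. K x * B j x \<partial>N)\<^sup>2)"
proof -
  define c where "c j = (\<integral>x. K x * B j x \<partial>N)" for j
  define S where "S x = (\<Sum>j\<in>I. c j * B j x)" for x
  have S: "square_integrable N S"
    unfolding S_def[abs_def] using B by (intro square_integrable_sum square_integrable_cmult)
  have SK: "(\<integral>x. S x * K x \<partial>N) = (\<Sum>j\<in>I. (c j)\<^sup>2)"
  proof -
    have "(\<integral>x. S x * K x \<partial>N) = (\<Sum>j\<in>I. c j * (\<integral>x. B j x * K x \<partial>N))"
      unfolding S_def by (rule integral_expansion_mult[OF B K])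
    then show ?thesis by (simp only: c_def power2_eq_square mult.commute)
  qed
  have BS: "(\<integral>x. B j x * S x \<partial>N) = c j" if j: "j \<in> I" for j
  proof -
    have "(\<integral>x. B j x * S x \<partial>N) = (\<integral>x. S x * B j x \<partial>N)" by (simp only: mult.commute)
    also have "\<dots> = (\<Sum>j'\<in>I. c j' * (\<integral>x. B j' x * B j x \<partial>N))"
      unfolding S_def by (rule integral_expansion_mult[OF B B[OF j]])
    also have "\<dots> = (\<Sum>j'\<in>I. if j' = j then c j' else 0)"
      by (rule sum.cong) (auto simp: orth j)
    finally show ?thesis using I j by simp
  qed
  have SS: "(\<integral>x. S x * S x \<partial>N) = (\<Sum>j\<in>I. (c j)\<^sup>2)"
  proof -
    have "(\<integral>x. S x * S x \<partial>N) = (\<integral>x. (\<Sum>j\<in>I. c j * B j x) * S x \<partial>N)" by (simp only: S_def)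
    also have "\<dots> = (\<Sum>j\<in>I. c j * (\<integral>x. B j x * S x \<partial>N))" by (rule integral_expansion_mult[OF B S])
    also have "\<dots> = (\<Sum>j\<in>I. (c j)\<^sup>2)" by (rule sum.cong) (simp_all add: BS power2_eq_square)
    finally show ?thesis .
  qed
  have "(\<integral>x. (K x - S x)\<^sup>2 \<partial>N) = (\<integral>x. (K x)\<^sup>2 - 2 * (S x * K x) + S x * S x \<partial>N)"
    by (rule Bochner_Integration.integral_cong) (simp_all add: power2_eq_square algebra_simps)
  also have "\<dots> = (\<integral>x. (K x)\<^sup>2 - 2 * (S x * K x) \<partial>N) + (\<integral>x. S x * S x \<partial>N)"
    by (rule Bochner_Integration.integral_add)
       (intro Bochner_Integration.integrable_diff integrable_mult_right square_integrable_mult square_integrable_sq K S)+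
  also have "(\<integral>x. (K x)\<^sup>2 - 2 * (S x * K x) \<partial>N) = (\<integral>x. (K x)\<^sup>2 \<partial>N) - (\<integral>x. 2 * (S x * K x) \<partial>N)"
    by (rule Bochner_Integration.integral_diff) (intro integrable_mult_right square_integrable_mult square_integrable_sq K S)+
  also have "(\<integral>x. 2 * (S x * K x) \<partial>N) = 2 * (\<Sum>j\<in>I. (c j)\<^sup>2)" unfolding SK[symmetric] by (rule integral_mult_right_zero)
  finally have "(\<integral>x. (K x - S x)\<^sup>2 \<partial>N) = (\<integral>x. (K x)\<^sup>2 \<partial>N) - (\<Sum>j\<in>I. (c j)\<^sup>2)" unfolding SS by linarith
  then show ?thesis unfolding S_def c_def .
qed

context wiener_setting
begin

lemma gauss_limit:
  assumes X: "X \<in> borel_measurable M" and H: "\<And>i. i \<in> {1..m} \<Longrightarrow> square_integrable L (H i)"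
    and approx: "\<And>e. 0 < e \<Longrightarrow> \<exists>Y K. gauss Y K \<and> nsq M (\<lambda>\<omega>. Y \<omega> - X \<omega>) \<le> ennreal e \<and>
      (\<forall>i\<in>{1..m}. nsq L (\<lambda>x. K i x - H i x) \<le> ennreal e)"
  shows "gauss X H"
  unfolding gauss_def
proof (intro conjI ballI allI impI X H)
  fix e :: real assume e: "0 < e"
  then have e4: "0 < e / 4" by simp
  have q: "2 * ennreal (e / 4) + 2 * ennreal (e / 4) = ennreal e" using e by (intro ennreal_quarters) simp
  obtain Y K where Y: "gauss Y K" "nsq M (\<lambda>\<omega>. Y \<omega> - X \<omega>) \<le> ennreal (e / 4)"
    "\<forall>i\<in>{1..m}. nsq L (\<lambda>x. K i x - H i x) \<le> ennreal (e / 4)"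
    using approx[OF e4] by (elim exE conjE)
  obtain h where h: "valid h" "nsq M (\<lambda>\<omega>. G h \<omega> - Y \<omega>) \<le> ennreal (e / 4)"
    "\<forall>i\<in>{1..m}. nsq L (\<lambda>x. step_fun h i x - K i x) \<le> ennreal (e / 4)"
    using Y(1) e4 unfolding gauss_def by blast
  have 1: "nsq M (\<lambda>\<omega>. G h \<omega> - X \<omega>) \<le> ennreal e"
  proof -
    have "nsq M (\<lambda>\<omega>. G h \<omega> - X \<omega>) \<le> 2 * nsq M (\<lambda>\<omega>. G h \<omega> - Y \<omega>) + 2 * nsq M (\<lambda>\<omega>. Y \<omega> - X \<omega>)"
      by (rule nsq_diff_le[OF G_measurable[OF h(1)] gauss_measurable[OF Y(1)] X])
    also have "\<dots> \<le> 2 * ennreal (e / 4) + 2 * ennreal (e / 4)"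
      by (intro add_mono mult_left_mono h(2) Y(2)) simp_all
    finally show ?thesis unfolding q .
  qed
  have 2: "nsq L (\<lambda>x. step_fun h i x - H i x) \<le> ennreal e" if i: "i \<in> {1..m}" for i
  proof -
    have "nsq L (\<lambda>x. step_fun h i x - H i x) \<le> 2 * nsq L (\<lambda>x. step_fun h i x - K i x) + 2 * nsq L (\<lambda>x. K i x - H i x)"
      by (rule nsq_diff_le[OF square_integrable_measurable[OF square_integrable_step_fun]
          square_integrable_measurable[OF gauss_kernel[OF Y(1) i]] square_integrable_measurable[OF H[OF i]]])
    also have "\<dots> \<le> 2 * ennreal (e / 4) + 2 * ennreal (e / 4)"
      by (intro add_mono mult_left_mono bspec[OF h(3) i] bspec[OF Y(3) i]) simp_all
    finally show ?thesis unfolding q .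
  qed
  show "\<exists>h. valid h \<and> nsq M (\<lambda>\<omega>. G h \<omega> - X \<omega>) \<le> ennreal e \<and>
        (\<forall>i\<in>{1..m}. nsq L (\<lambda>x. step_fun h i x - H i x) \<le> ennreal e)"
    using h(1) 1 2 by (intro exI[of _ h] conjI ballI)
qed

lemma gauss_step_integral:
  assumes i: "i \<in> {1..m}" and "\<And>j. j < N \<Longrightarrow> t \<le> \<tau> j \<and> \<tau> j \<le> \<tau> (Suc j) \<and> \<tau> (Suc j) \<le> T"
  shows "gauss (step_integral (f i) N \<tau> (\<lambda>j \<omega>. c j))
    (\<lambda>i' x. of_bool (i' = i) * (\<Sum>j<N. c j * indicator {\<tau> j..<\<tau> (Suc j)} x))"
  using assms(2)
proof (induction N)
  case 0
  then show ?case using gauss_zero by (simp add: step_integral_def[abs_def])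
next
  case (Suc N)
  define S where "S x = (\<Sum>j<N. c j * indicator {\<tau> j..<\<tau> (Suc j)} x)" for x
  have IH: "gauss (step_integral (f i) N \<tau> (\<lambda>j \<omega>. c j)) (\<lambda>i' x. of_bool (i' = i) * S x)"
    unfolding S_def by (rule Suc.IH) (use Suc.prems in auto)
  have \<tau>: "t \<le> \<tau> N" "\<tau> N \<le> \<tau> (Suc N)" "\<tau> (Suc N) \<le> T" using Suc.prems[of N] by auto
  have inc: "gauss (\<lambda>\<omega>. f i (\<tau> (Suc N)) \<omega> - f i (\<tau> N) \<omega>) (step_fun [(1, i, \<tau> (Suc N)), (-1, i, \<tau> N)])"
    by (rule gauss_increment[OF i]) (use \<tau> in auto)
  have ind: "step_fun [(1, i, \<tau> (Suc N)), (-1, i, \<tau> N)] i' x = of_bool (i' = i) * indicator {\<tau> N..<\<tau> (Suc N)} x" for i' x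
    using \<tau>(2) by (auto split: split_indicator)
  have "(\<lambda>\<omega>. step_integral (f i) N \<tau> (\<lambda>j \<omega>. c j) \<omega> + c N * (f i (\<tau> (Suc N)) \<omega> - f i (\<tau> N) \<omega>)) =
      step_integral (f i) (Suc N) \<tau> (\<lambda>j \<omega>. c j)"
    by (simp add: step_integral_def fun_eq_iff)
  moreover have "of_bool (i' = i) * S x + c N * step_fun [(1, i, \<tau> (Suc N)), (-1, i, \<tau> N)] i' x =
      of_bool (i' = i) * (\<Sum>j<Suc N. c j * indicator {\<tau> j..<\<tau> (Suc j)} x)" for i' x
    unfolding ind sum.lessThan_Suc S_def by (simp add: algebra_simps)
  ultimately show ?case using gauss_add[OF IH gauss_cmult[OF inc, of "c N"]] by (simp only:)
qed

text \<open>A Wiener integral is Gaussian. Steps with random heights approximate its integrand by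
  construction; by Jensen's inequality the expected heights do at least as well.\<close>

lemma gauss_w_integral:
  assumes i: "i \<in> {1..m}" and g: "L2_on t T g"
  shows "gauss (w_integral M F f t T i (\<lambda>u \<omega>. g u) T) (\<lambda>i' x. of_bool (i' = i) * g x)"
proof -
  define X where "X = w_integral M F f t T i (\<lambda>u \<omega>. g u) T"
  have i0: "i \<in> {0..m}" using i by simp
  have TT: "T \<in> {t..T}" "t \<le> T" using t_less by auto
  note cl = w_integral_close[OF i0 approximable_const[of 1] g, unfolded mult_1_right]
  obtain C where C: "0 \<le> C" "\<And>el. elementary el \<Longrightarrow> pnsq T (\<lambda>u \<omega>. el_proc el u \<omega> - g u) < \<infinity> \<Longrightarrow>
      nsq M (\<lambda>\<omega>. el_int i el T \<omega> - X \<omega>) \<le> ennreal C * pnsq T (\<lambda>u \<omega>. el_proc el u \<omega> - g u)"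
    using cl(2) TT(1) unfolding X_def by blast
  have gL: "square_integrable L g" using g by (simp add: L2_on_iff)
  show ?thesis unfolding X_def[symmetric]
  proof (rule gauss_limit)
    show "X \<in> borel_measurable M" unfolding X_def by (rule joint_section[OF cl(1) TT(1)])
    show "square_integrable L (\<lambda>x. of_bool (i' = i) * g x)" for i' by (rule square_integrable_cmult[OF gL])
    fix e :: real assume e: "0 < e"
    define e1 where "e1 = e / (C + 1)"
    have e1: "0 < e1" "e1 \<le> e" "C * e1 \<le> e" using e C(1) by (auto simp: e1_def divide_simps mult_left_mono)
    obtain N \<tau> \<eta> where st: "adapted_step M F t T N \<tau> \<eta>"
      and close: "pnsq T (\<lambda>u \<omega>. step_process N \<tau> \<eta> u \<omega> - g u) \<le> ennreal e1"
      using step_approximation[OF approximable_const[of 1] g TT(2) order_refl e1(1)] unfolding mult_1_right by blast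
    have steps: "t \<le> \<tau> j \<and> \<tau> j \<le> \<tau> (Suc j) \<and> \<tau> (Suc j) \<le> T" "square_integrable M (\<eta> j)" if "j < N" for j
      using list_of_steps(1)[OF st TT(2) order_refl] that unfolding elementary_def list_of_steps_def by auto
    define c where "c j = expectation (\<eta> j)" for j
    define D where "D x = (\<Sum>j<N. c j * indicator {\<tau> j..<\<tau> (Suc j)} x)" for x
    have int_\<eta>: "integrable M (\<eta> j)" if "j < N" for j
      using square_integrable_mult[OF steps(2)[OF that] square_integrable_const[of 1]] by simp
    have "square_integrable M (\<lambda>\<omega>. \<eta> j \<omega> * r)" if "j < N" for j r
      using square_integrable_cmult[OF steps(2)[OF that], of r] by (simp only: mult.commute)
    then have Z: "square_integrable M (\<lambda>\<omega>. step_process N \<tau> \<eta> u \<omega> - g u)" for u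
      unfolding step_process_def
      by (intro square_integrable_diff square_integrable_sum square_integrable_const) simp_all
    have mean: "expectation (\<lambda>\<omega>. step_process N \<tau> \<eta> u \<omega> - g u) = D u - g u" for u
    proof -
      have "expectation (\<lambda>\<omega>. \<Sum>j<N. \<eta> j \<omega> * indicator {\<tau> j..<\<tau> (Suc j)} u) =
        (\<Sum>j<N. expectation (\<lambda>\<omega>. \<eta> j \<omega> * indicator {\<tau> j..<\<tau> (Suc j)} u))"
        by (rule Bochner_Integration.integral_sum) (use int_\<eta> in auto)
      also have "\<dots> = D u" unfolding D_def c_def by (simp only: integral_mult_left_zero)
      finally have 1: "expectation (step_process N \<tau> \<eta> u) = D u" unfolding step_process_def[abs_def] .
      have 2: "integrable M (step_process N \<tau> \<eta> u)"
        unfolding step_process_def[abs_def] by (rule Bochner_Integration.integrable_sum) (use int_\<eta> in auto)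
      have "expectation (\<lambda>\<omega>. step_process N \<tau> \<eta> u \<omega> - g u) = expectation (step_process N \<tau> \<eta> u) - expectation (\<lambda>_. g u)"
        by (rule Bochner_Integration.integral_diff[OF 2]) simp
      then show ?thesis unfolding 1 by (simp add: prob_space)
    qed
    have jensen: "ennreal ((D u - g u)\<^sup>2) \<le> nsq M (\<lambda>\<omega>. step_process N \<tau> \<eta> u \<omega> - g u)" for u
      using integral_Cauchy_Schwarz[OF Z[of u] square_integrable_const[of 1]]
      unfolding nsq_eq_integral[OF Z] by (simp add: mean prob_space)
    have Dg: "nsq L (\<lambda>x. D x - g x) \<le> ennreal e1"
    proof -
      have "nsq L (\<lambda>x. D x - g x) \<le> pnsq T (\<lambda>u \<omega>. step_process N \<tau> \<eta> u \<omega> - g u)"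
        unfolding pnsq_def nsq_def[of L] by (rule nn_integral_mono) (rule jensen)
      then show ?thesis using close by (rule order_trans)
    qed
    define el where "el = list_of_steps N \<tau> (\<lambda>j (_::'a). c j)"
    have st': "adapted_step M F t T N \<tau> (\<lambda>j (_::'a). c j)" using st by (simp add: adapted_step_def)
    note el = list_of_steps[OF st' TT(2) order_refl, folded el_def]
    have pn: "pnsq T (\<lambda>u \<omega>. el_proc el u \<omega> - g u) = nsq L (\<lambda>x. D x - g x)"
      unfolding pnsq_def el(2) step_process_def D_def[symmetric]
      by (simp add: nsq_def emeasure_space_1)
    have fin: "pnsq T (\<lambda>u \<omega>. el_proc el u \<omega> - g u) < \<infinity>"
      unfolding pn by (rule le_less_trans[OF Dg]) simp
    define Y where "Y = step_integral (f i) N \<tau> (\<lambda>j (_::'a). c j)"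
    have Y: "gauss Y (\<lambda>i' x. of_bool (i' = i) * D x)"
      unfolding Y_def D_def by (rule gauss_step_integral[OF i]) (rule steps(1))
    have "i \<noteq> 0" using i by simp
    from el(3)[OF this] have elY: "el_int i el T = Y" unfolding Y_def .
    have "nsq M (\<lambda>\<omega>. Y \<omega> - X \<omega>) \<le> ennreal C * nsq L (\<lambda>x. D x - g x)"
      using C(2)[OF el(1) fin] unfolding pn elY .
    also have "\<dots> \<le> ennreal C * ennreal e1" by (rule mult_left_mono[OF Dg]) simp
    also have "\<dots> = ennreal (C * e1)" using C(1) e1 by (intro ennreal_mult[symmetric]) auto
    also have "\<dots> \<le> ennreal e" by (rule ennreal_leI[OF e1(3)])
    finally have 1: "nsq M (\<lambda>\<omega>. Y \<omega> - X \<omega>) \<le> ennreal e" .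
    have 2: "nsq L (\<lambda>x. of_bool (i' = i) * D x - of_bool (i' = i) * g x) \<le> ennreal e" for i'
    proof (cases "i' = i")
      case True
      then have "of_bool (i' = i) = (1::real)" by simp
      then show ?thesis using order_trans[OF Dg ennreal_leI[OF e1(2)]] by (simp only: mult_1_left)
    next
      case False
      then have "of_bool (i' = i) = (0::real)" by simp
      then show ?thesis by (simp only: mult_zero_left diff_0_right nsq_def) simp
    qed
    show "\<exists>Y K. gauss Y K \<and> nsq M (\<lambda>\<omega>. Y \<omega> - X \<omega>) \<le> ennreal e \<and>
      (\<forall>i'\<in>{1..m}. nsq L (\<lambda>x. K i' x - of_bool (i' = i) * g x) \<le> ennreal e)"
      using Y 1 2 by (intro exI[of _ Y] exI[of _ "\<lambda>i' x. of_bool (i' = i) * D x"] conjI ballI)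
  qed
qed

lemma inner_K_single:
  assumes "i \<in> {1..m}"
  shows "inner_K (\<lambda>i' x. of_bool (i' = i) * g x) K = (\<integral>x. g x * K i x \<partial>L)"
proof -
  have "inner_K (\<lambda>i' x. of_bool (i' = i) * g x) K = (\<Sum>i'\<in>{1..m}. if i' = i then (\<integral>x. g x * K i' x \<partial>L) else 0)"
    unfolding inner_K_def by (rule sum.cong) auto
  then show ?thesis using assms by simp
qed

context
  fixes \<phi> :: "nat \<Rightarrow> real \<Rightarrow> real" and i j :: "nat \<Rightarrow> nat" and A :: "nat set"
  assumes \<phi>: "\<And>a. L2_on t T (\<phi> a)"
    and orthonormal: "\<And>a b. (\<integral>x. \<phi> a x * \<phi> b x \<partial>L) = (if a = b then 1 else 0)"
    and A: "finite A" and i: "\<And>q. q \<in> A \<Longrightarrow> i q \<in> {0..m}"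
begin

abbreviation Z :: "nat \<Rightarrow> 'a \<Rightarrow> real" where "Z q \<equiv> zeta M F f t T \<phi> (i q) (j q)"

lemma zeta_time: "i q = 0 \<Longrightarrow> Z q \<omega> = (\<integral>x. \<phi> (j q) x \<partial>L)"
  by (simp add: zeta_def w_integral_def)

lemma zeta_gauss: "q \<in> A \<Longrightarrow> i q \<noteq> 0 \<Longrightarrow> gauss (Z q) (\<lambda>i' x. of_bool (i' = i q) * \<phi> (j q) x)"
  unfolding zeta_def by (rule gauss_w_integral[OF _ \<phi>]) (use i[of q] in auto)

lemma zeta_prod_split:
  assumes "S \<subseteq> A"
  shows "(\<Prod>q\<in>S. Z q \<omega>) = (\<Prod>q\<in>{q \<in> S. i q = 0}. \<integral>x. \<phi> (j q) x \<partial>L) * (\<Prod>q\<in>{q \<in> S. i q \<noteq> 0}. Z q \<omega>)"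
proof -
  have S: "finite S" using assms A finite_subset by blast
  have "(\<Prod>q\<in>S. Z q \<omega>) = (\<Prod>q\<in>{q \<in> S. i q = 0} \<union> {q \<in> S. i q \<noteq> 0}. Z q \<omega>)" by (rule prod.cong) auto
  also have "\<dots> = (\<Prod>q\<in>{q \<in> S. i q = 0}. Z q \<omega>) * (\<Prod>q\<in>{q \<in> S. i q \<noteq> 0}. Z q \<omega>)"
    by (rule prod.union_disjoint) (use S in auto)
  also have "(\<Prod>q\<in>{q \<in> S. i q = 0}. Z q \<omega>) = (\<Prod>q\<in>{q \<in> S. i q = 0}. \<integral>x. \<phi> (j q) x \<partial>L)"
  proof (rule prod.cong[OF refl])
    fix q assume "q \<in> {q \<in> S. i q = 0}"
    then show "Z q \<omega> = (\<integral>x. \<phi> (j q) x \<partial>L)" by (intro zeta_time) simp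
  qed
  finally show ?thesis .
qed

lemma zeta_prod_multiplier:
  assumes "S \<subseteq> A"
  shows "exp_multiplier (\<lambda>\<omega>. \<Prod>q\<in>S. Z q \<omega>)"
  unfolding zeta_prod_split[OF assms]
proof (rule exp_multiplier_cmult[OF exp_multiplier_prod])
  show "finite {q \<in> S. i q \<noteq> 0}" by (rule finite_subset[OF _ A]) (use assms in blast)
  show "gauss (Z q) (\<lambda>i' x. of_bool (i' = i q) * \<phi> (j q) x)" if "q \<in> {q \<in> S. i q \<noteq> 0}" for q
    using that assms by (intro zeta_gauss) auto
qed

text \<open>The variables with index \<open>0\<close> are constants and are never contracted.  The others are Gaussian, so
  that integration by parts applies, and orthonormality reduces the inner products to indicators.\<close>

lemma zeta_recursion:
  assumes h: "valid h" and x: "x \<in> A" and S: "S \<subseteq> A - {x}"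
  shows "expectation (\<lambda>\<omega>. (\<Prod>q\<in>insert x S. Z q \<omega>) * exp (G h \<omega>)) =
    (\<integral>y. \<phi> (j x) y * kernel h (i x) y \<partial>L) * expectation (\<lambda>\<omega>. (\<Prod>q\<in>S. Z q \<omega>) * exp (G h \<omega>)) +
    (\<Sum>q\<in>S. pair_weight i j {x, q} * expectation (\<lambda>\<omega>. (\<Prod>q\<in>S - {q}. Z q \<omega>) * exp (G h \<omega>)))"
proof -
  have fin: "finite S" "x \<notin> S" "S \<subseteq> A" using S A finite_subset by blast+
  define \<Phi> where "\<Phi> S = expectation (\<lambda>\<omega>. (\<Prod>q\<in>S. Z q \<omega>) * exp (G h \<omega>))" for S
  have ins: "(\<Prod>q\<in>insert x S. Z q \<omega>) = Z x \<omega> * (\<Prod>q\<in>S. Z q \<omega>)" for \<omega> using fin by simp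
  show ?thesis unfolding \<Phi>_def[symmetric]
  proof (cases "i x = 0")
    case True
    have "\<Phi> (insert x S) = (\<integral>y. \<phi> (j x) y \<partial>L) * \<Phi> S"
      unfolding \<Phi>_def ins zeta_time[OF True] mult.assoc by (rule integral_mult_right_zero)
    then show "\<Phi> (insert x S) = (\<integral>y. \<phi> (j x) y * kernel h (i x) y \<partial>L) * \<Phi> S + (\<Sum>q\<in>S. pair_weight i j {x, q} * \<Phi> (S - {q}))"
      by (simp add: kernel_def True pair_weight_doubleton)
  next
    case False
    define S1 where "S1 = {q \<in> S. i q \<noteq> 0}"
    define \<kappa> where "\<kappa> = (\<Prod>q\<in>{q \<in> S. i q = 0}. \<integral>x. \<phi> (j q) x \<partial>L)"
    define E where "E S = expectation (\<lambda>\<omega>. (\<Prod>q\<in>S. Z q \<omega>) * exp (G h \<omega>))" for S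
    define K where "K q = (\<lambda>i' x. of_bool (i' = i q) * \<phi> (j q) x)" for q
    have ix: "i x \<in> {1..m}" using i[OF x] False by simp
    have \<kappa>S: "\<Phi> S = \<kappa> * E S1"
      unfolding \<Phi>_def E_def zeta_prod_split[OF fin(3)] \<kappa>_def S1_def mult.assoc by (rule integral_mult_right_zero)
    have \<kappa>q: "\<Phi> (S - {q}) = \<kappa> * E (S1 - {q})" if q: "q \<in> S1" for q
    proof -
      have e: "{r \<in> S - {q}. i r = 0} = {r \<in> S. i r = 0}" "{r \<in> S - {q}. i r \<noteq> 0} = S1 - {q}"
        using q by (auto simp: S1_def)
      have sub: "S - {q} \<subseteq> A" using fin(3) by blast
      show ?thesis
        unfolding \<Phi>_def E_def zeta_prod_split[OF sub] e \<kappa>_def mult.assoc by (rule integral_mult_right_zero)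
    qed
    have "\<Phi> (insert x S) = expectation (\<lambda>\<omega>. \<kappa> * ((\<Prod>q\<in>S1. Z q \<omega>) * Z x \<omega> * exp (G h \<omega>)))"
      unfolding \<Phi>_def ins zeta_prod_split[OF fin(3)] \<kappa>_def S1_def by (simp only: mult_ac)
    also have "\<dots> = \<kappa> * expectation (\<lambda>\<omega>. (\<Prod>q\<in>S1. Z q \<omega>) * Z x \<omega> * exp (G h \<omega>))" by (rule integral_mult_right_zero)
    also have "expectation (\<lambda>\<omega>. (\<Prod>q\<in>S1. Z q \<omega>) * Z x \<omega> * exp (G h \<omega>)) =
      inner_K (K x) (step_fun h) * E S1 + (\<Sum>q\<in>S1. inner_K (K x) (K q) * E (S1 - {q}))"
      unfolding E_def
    proof (rule gauss_integration_by_parts)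
      show "finite S1" using fin by (simp add: S1_def)
      show "gauss (Z q) (K q)" if "q \<in> S1" for q
        unfolding K_def by (rule zeta_gauss) (use that fin in \<open>auto simp: S1_def\<close>)
      show "gauss (Z x) (K x)" unfolding K_def by (rule zeta_gauss[OF x False])
      show "gauss (G h) (step_fun h)" by (rule gauss_G[OF h])
    qed
    also have "inner_K (K x) (step_fun h) = (\<integral>y. \<phi> (j x) y * kernel h (i x) y \<partial>L)"
      unfolding K_def inner_K_single[OF ix] using False by (simp add: kernel_def)
    also have "(\<Sum>q\<in>S1. inner_K (K x) (K q) * E (S1 - {q})) = (\<Sum>q\<in>S1. pair_weight i j {x, q} * E (S1 - {q}))"
    proof (rule sum.cong[OF refl])
      fix q assume "q \<in> S1"
      have "inner_K (K x) (K q) = of_bool (i x = i q) * (\<integral>y. \<phi> (j x) y * \<phi> (j q) y \<partial>L)"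
        unfolding K_def inner_K_single[OF ix] by simp
      then show "inner_K (K x) (K q) * E (S1 - {q}) = pair_weight i j {x, q} * E (S1 - {q})"
        using False by (simp add: orthonormal pair_weight_doubleton)
    qed
    finally have "\<Phi> (insert x S) = (\<integral>y. \<phi> (j x) y * kernel h (i x) y \<partial>L) * (\<kappa> * E S1) +
      (\<Sum>q\<in>S1. pair_weight i j {x, q} * (\<kappa> * E (S1 - {q})))"
      by (simp add: algebra_simps sum_distrib_left)
    also have "(\<Sum>q\<in>S1. pair_weight i j {x, q} * (\<kappa> * E (S1 - {q}))) = (\<Sum>q\<in>S1. pair_weight i j {x, q} * \<Phi> (S - {q}))"
      by (rule sum.cong) (simp_all add: \<kappa>q)
    also have "\<dots> = (\<Sum>q\<in>S. pair_weight i j {x, q} * \<Phi> (S - {q}))"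
      by (rule sum.mono_neutral_left) (use fin False in \<open>auto simp: S1_def pair_weight_doubleton\<close>)
    finally show "\<Phi> (insert x S) = (\<integral>y. \<phi> (j x) y * kernel h (i x) y \<partial>L) * \<Phi> S + (\<Sum>q\<in>S. pair_weight i j {x, q} * \<Phi> (S - {q}))"
      unfolding \<kappa>S .
  qed
qed

text \<open>The alternating sum over pairings is a Wick product: it removes all contractions, so
  that its transform factorises.\<close>

lemma wick_transform:
  assumes h: "valid h"
  shows "(\<Sum>P\<in>pairings A. ((-1) ^ card P * (\<Prod>B\<in>P. pair_weight i j B)) *
      expectation (\<lambda>\<omega>. (\<Prod>q\<in>A - \<Union>P. Z q \<omega>) * exp (G h \<omega>))) =
    (\<Prod>l\<in>A. \<integral>y. \<phi> (j l) y * kernel h (i l) y \<partial>L) * exp (covariance t h h / 2)"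
proof -
  have "(\<Sum>P\<in>pairings A. ((-1) ^ card P * (\<Prod>B\<in>P. pair_weight i j B)) *
      expectation (\<lambda>\<omega>. (\<Prod>q\<in>A - \<Union>P. Z q \<omega>) * exp (G h \<omega>))) =
    (\<Prod>l\<in>A. \<integral>y. \<phi> (j l) y * kernel h (i l) y \<partial>L) * expectation (\<lambda>\<omega>. (\<Prod>q\<in>{}. Z q \<omega>) * exp (G h \<omega>))"
    by (rule alternating_pairing_sum[where \<Phi> = "\<lambda>S. expectation (\<lambda>\<omega>. (\<Prod>q\<in>S. Z q \<omega>) * exp (G h \<omega>))", OF A zeta_recursion[OF h]])
  also have "expectation (\<lambda>\<omega>. (\<Prod>q\<in>{}. Z q \<omega>) * exp (G h \<omega>)) = exp (covariance t h h / 2)"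
    using exp_G_expectation(2)[OF h] by (simp only: prod.empty mult_1_left)
  finally show ?thesis .
qed

end

end

section \<open>The mean-square estimate\<close>

context wiener_setting
begin

lemma exp_multiplier_sum:
  assumes "finite I" "\<And>j. j \<in> I \<Longrightarrow> exp_multiplier (Y j)"
  shows "exp_multiplier (\<lambda>\<omega>. \<Sum>j\<in>I. c j * Y j \<omega>)"
  using assms
proof (induction I)
  case empty
  then show ?case using exp_multiplier_const[of 0] by simp
next
  case (insert j I)
  have "exp_multiplier (\<lambda>\<omega>. c j * Y j \<omega> + (\<Sum>j\<in>I. c j * Y j \<omega>))"
    by (intro exp_multiplier_add exp_multiplier_cmult) (use insert in auto)
  then show ?case using insert.hyps by simp
qed

lemma square_integrable_product:
  assumes "\<And>l. l \<in> {1..k} \<Longrightarrow> square_integrable L (g l)"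
  shows "square_integrable (cube t T k) (\<lambda>x. \<Prod>l=1..k. g l (x l))"
proof -
  have "square_integrable (cube t T k) (\<lambda>x. \<Sum>n<1::nat. 1 * (\<Prod>l=1..k. g l (x l)))"
    by (rule square_integrable_product_form(1)[where S = "{1..k}" and N = 1 and g = "\<lambda>_. g" and b = "\<lambda>_. 1"])
       (use assms in auto)
  then show ?thesis by simp
qed

lemma product_integral:
  assumes "\<And>l. l \<in> {1..k} \<Longrightarrow> square_integrable L (g l)" "\<And>l. l \<in> {1..k} \<Longrightarrow> square_integrable L (g' l)"
  shows "(\<integral>x. (\<Prod>l=1..k. g l (x l)) * (\<Prod>l=1..k. g' l (x l)) \<partial>cube t T k) = (\<Prod>l=1..k. \<integral>x. g l x * g' l x \<partial>L)"
proof -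
  interpret product_sigma_finite "\<lambda>_::nat. L" by (rule product_sigma_finite_L)
  show ?thesis
    unfolding prod.distrib[symmetric]
    by (rule product_integral_prod[where f = "\<lambda>l x. g l x * g' l x"]) (use assms in \<open>auto intro!: square_integrable_mult\<close>)
qed

lemma square_integrable_simplex_kernel:
  assumes "\<And>l. l \<in> {1..k} \<Longrightarrow> L2_on t T (\<psi> l)"
  shows "square_integrable (cube t T k) (simplex_kernel k \<psi>)"
  unfolding square_integrable_def
proof
  have \<psi>: "square_integrable L (\<psi> l)" if "l \<in> {1..k}" for l using assms[OF that] by (simp add: L2_on_iff)
  show m: "simplex_kernel k \<psi> \<in> borel_measurable (cube t T k)"
    by (rule simplex_kernel_measurable) (rule square_integrable_measurable[OF \<psi>])
  have "\<bar>simplex_kernel k \<psi> x\<bar> \<le> \<bar>\<Prod>l=1..k. \<psi> l (x l)\<bar>" for x by (rule simplex_kernel_abs_le)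
  then have le: "(simplex_kernel k \<psi> x)\<^sup>2 \<le> (\<Prod>l=1..k. \<psi> l (x l))\<^sup>2" for x by (simp only: abs_le_square_iff)
  show "integrable (cube t T k) (\<lambda>x. (simplex_kernel k \<psi> x)\<^sup>2)"
  proof (rule Bochner_Integration.integrable_bound)
    show "integrable (cube t T k) (\<lambda>x. (\<Prod>l=1..k. \<psi> l (x l))\<^sup>2)"
      by (rule square_integrable_sq[OF square_integrable_product[OF \<psi>]])
    show "(\<lambda>x. (simplex_kernel k \<psi> x)\<^sup>2) \<in> borel_measurable (cube t T k)" using m by (rule borel_measurable_power)
    show "AE x in cube t T k. norm ((simplex_kernel k \<psi> x)\<^sup>2) \<le> norm ((\<Prod>l=1..k. \<psi> l (x l))\<^sup>2)"
      by (rule AE_I2) (simp only: real_norm_def abs_power2 le)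
  qed
qed

text \<open>The transforms of the integral and of its approximation differ by the residual of the Fourier
  expansion of the kernel, and the difference lies in the closed span of the exponentials.\<close>

theorem mean_square_estimate:
  fixes \<psi> \<phi> :: "nat \<Rightarrow> real \<Rightarrow> real" and i p :: "nat \<Rightarrow> nat"
  assumes k: "1 \<le> k" and \<psi>: "\<And>l. l \<in> {1..k} \<Longrightarrow> L2_on t T (\<psi> l)"
    and \<phi>: "\<And>a. L2_on t T (\<phi> a)"
    and orthonormal: "\<And>a b. (\<integral>x. \<phi> a x * \<phi> b x \<partial>L) = (if a = b then 1 else 0)"
    and i: "\<And>l. l \<in> {1..k} \<Longrightarrow> i l \<in> {0..m}"
    and short: "(\<forall>l\<in>{1..k}. i l \<noteq> 0) \<or> T - t < 1"
  defines "X \<equiv> \<lambda>\<omega>. iterated_integral M F f t T \<psi> i k T \<omega> - approximation_sum M F f t T k \<psi> \<phi> i p \<omega>"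
  shows "square_integrable M X"
    "expectation (\<lambda>\<omega>. (X \<omega>)\<^sup>2) \<le> fact k * ((\<integral>x. (simplex_kernel k \<psi> x)\<^sup>2 \<partial>cube t T k) -
        (\<Sum>j\<in>(\<Pi>\<^sub>E l\<in>{1..k}. {0..p l}). (fourier_coeff t T k \<psi> \<phi> j)\<^sup>2))"
proof -
  define I where "I = (\<Pi>\<^sub>E l\<in>{1..k}. {0..p l})"
  define K where "K = simplex_kernel k \<psi>"
  define B where "B j x = (\<Prod>l=1..k. \<phi> (j l) (x l))" for j :: "nat \<Rightarrow> nat" and x :: "nat \<Rightarrow> real"
  define C where "C j = fourier_coeff t T k \<psi> \<phi> j" for j
  define S where "S x = (\<Sum>j\<in>I. C j * B j x)" for x
  define J where "J = iterated_integral M F f t T \<psi> i k T"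
  define e where "e j P = (-1) ^ card P * (\<Prod>A\<in>P. pair_weight i j A)" for j P
  define V where "V j P \<omega> = (\<Prod>q\<in>{1..k} - \<Union>P. zeta M F f t T \<phi> (i q) (j q) \<omega>)" for j P \<omega>
  define W where "W j \<omega> = (\<Sum>P\<in>pairings {1..k}. e j P * V j P \<omega>)" for j \<omega>
  define Jp where "Jp \<omega> = (\<Sum>j\<in>I. C j * W j \<omega>)" for \<omega>
  have TT: "T \<in> {t..T}" using t_less by simp
  have fin: "finite I" "finite (pairings {1..k})" by (auto simp: I_def finite_PiE finite_pairings)
  have Jp_eq: "approximation_sum M F f t T k \<psi> \<phi> i p \<omega> = Jp \<omega>" for \<omega>
    unfolding approximation_sum_eq Jp_def W_def V_def e_def C_def I_def ..
  have X_eq: "X = (\<lambda>\<omega>. J \<omega> - Jp \<omega>)" unfolding X_def J_def Jp_eq ..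
  have \<phi>L: "square_integrable L (\<phi> a)" for a using \<phi>[of a] by (simp add: L2_on_iff)
  have K: "square_integrable (cube t T k) K" unfolding K_def by (rule square_integrable_simplex_kernel[OF \<psi>])
  have B: "square_integrable (cube t T k) (B j)" for j
    unfolding B_def[abs_def] by (rule square_integrable_product[OF \<phi>L])
  have S: "square_integrable (cube t T k) S"
    unfolding S_def[abs_def] by (intro square_integrable_sum square_integrable_cmult B)
  have C: "(\<integral>x. K x * B j x \<partial>cube t T k) = C j" for j by (simp only: C_def fourier_coeff_def K_def B_def)
  have residual: "(\<integral>x. (K x - S x)\<^sup>2 \<partial>cube t T k) = (\<integral>x. (K x)\<^sup>2 \<partial>cube t T k) - (\<Sum>j\<in>I. (C j)\<^sup>2)"
  proof -
    have "(\<integral>x. B j x * B j' x \<partial>cube t T k) = of_bool (j = j')" if j: "j \<in> I" "j' \<in> I" for j j'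
    proof -
      have "(\<integral>x. B j x * B j' x \<partial>cube t T k) = (\<Prod>l=1..k. \<integral>x. \<phi> (j l) x * \<phi> (j' l) x \<partial>L)"
        unfolding B_def by (rule product_integral[OF \<phi>L \<phi>L])
      also have "\<dots> = (\<Prod>l=1..k. if j l = j' l then 1 else 0)" unfolding orthonormal ..
      also have "\<dots> = of_bool (j = j')"
      proof (cases "j = j'")
        case False
        then obtain l where "l \<in> {1..k}" "j l \<noteq> j' l" using j PiE_ext unfolding I_def by metis
        then show ?thesis using False by (auto intro!: prod_zero)
      qed simp
      finally show ?thesis .
    qed
    from orthonormal_residual[OF K fin(1) B this] show ?thesis unfolding C S_def .
  qed
  have app: "approximable (iterated_integral M F f t T \<psi> i k)"
    by (rule approximable_iterated_integral) (fact i \<psi>)+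
  have J_span: "exp_span J" unfolding J_def by (rule approximable_exp_span[OF app TT])
  have J: "square_integrable M J"
  proof -
    obtain c where c: "0 \<le> c" "\<And>u. u \<in> {t..T} \<Longrightarrow> nsq M (iterated_integral M F f t T \<psi> i k u) \<le> ennreal c"
      using approximable_bounded[OF app] by blast
    have "nsq M J < \<infinity>" unfolding J_def by (rule le_less_trans[OF c(2)[OF TT]]) simp
    then show ?thesis by (simp only: square_integrable_iff_nsq[OF exp_span_measurable[OF J_span]])
  qed
  have V: "exp_multiplier (V j P)" for j P
    unfolding V_def[abs_def]
    by (rule zeta_prod_multiplier[where \<phi> = \<phi> and i = i and j = j and A = "{1..k}", OF \<phi> orthonormal _ i]) auto
  have W: "exp_multiplier (W j)" for j
    unfolding W_def[abs_def] by (rule exp_multiplier_sum[OF fin(2) V])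
  have Jp: "exp_multiplier Jp" unfolding Jp_def[abs_def] by (rule exp_multiplier_sum[OF fin(1) W])
  note Jp_base = exp_multiplier_base[OF Jp]
  have span: "exp_span X"
    using exp_span_add[OF J_span exp_span_cmult[OF Jp_base(2), of "-1"]] unfolding X_eq by simp
  have transform: "expectation (\<lambda>\<omega>. X \<omega> * exp (G h \<omega>)) =
      exp (covariance t h h / 2) * (\<integral>x. (K x - S x) * (\<Prod>l=1..k. kernel h (i l) (x l)) \<partial>cube t T k)" if h: "valid h" for h
  proof -
    define Q where "Q x = (\<Prod>l=1..k. kernel h (i l) (x l))" for x
    have Q: "square_integrable (cube t T k) Q"
      unfolding Q_def[abs_def] by (rule square_integrable_product[OF square_integrable_kernel])
    note eG = exp_G_square_integrable[OF h]
    have "expectation (\<lambda>\<omega>. W j \<omega> * exp (G h \<omega>)) = (\<integral>x. B j x * Q x \<partial>cube t T k) * exp (covariance t h h / 2)" for j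
    proof -
      have "expectation (\<lambda>\<omega>. W j \<omega> * exp (G h \<omega>)) =
        (\<Sum>P\<in>pairings {1..k}. e j P * expectation (\<lambda>\<omega>. V j P \<omega> * exp (G h \<omega>)))"
        unfolding W_def by (rule integral_expansion_mult[OF exp_multiplier_base(1)[OF V] eG])
      also have "\<dots> = (\<Prod>l=1..k. \<integral>y. \<phi> (j l) y * kernel h (i l) y \<partial>L) * exp (covariance t h h / 2)"
        unfolding e_def V_def
        by (rule wick_transform[where \<phi> = \<phi> and i = i and j = j and A = "{1..k}", OF \<phi> orthonormal _ i h]) auto
      also have "(\<Prod>l=1..k. \<integral>y. \<phi> (j l) y * kernel h (i l) y \<partial>L) = (\<integral>x. B j x * Q x \<partial>cube t T k)"
        unfolding B_def Q_def by (rule product_integral[OF \<phi>L square_integrable_kernel, symmetric])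
      finally show ?thesis .
    qed
    note W_transform = this
    have "expectation (\<lambda>\<omega>. Jp \<omega> * exp (G h \<omega>)) = (\<Sum>j\<in>I. C j * expectation (\<lambda>\<omega>. W j \<omega> * exp (G h \<omega>)))"
      unfolding Jp_def by (rule integral_expansion_mult[OF exp_multiplier_base(1)[OF W] eG])
    also have "\<dots> = exp (covariance t h h / 2) * (\<Sum>j\<in>I. C j * (\<integral>x. B j x * Q x \<partial>cube t T k))"
      unfolding W_transform sum_distrib_left by (rule sum.cong) (simp_all only: mult_ac)
    also have "(\<Sum>j\<in>I. C j * (\<integral>x. B j x * Q x \<partial>cube t T k)) = (\<integral>x. S x * Q x \<partial>cube t T k)"
      unfolding S_def by (rule integral_expansion_mult[OF B Q, symmetric])
    finally have 1: "expectation (\<lambda>\<omega>. Jp \<omega> * exp (G h \<omega>)) = exp (covariance t h h / 2) * (\<integral>x. S x * Q x \<partial>cube t T k)" .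
    have 2: "expectation (\<lambda>\<omega>. J \<omega> * exp (G h \<omega>)) = exp (covariance t h h / 2) * (\<integral>x. K x * Q x \<partial>cube t T k)"
      unfolding J_def K_def Q_def by (rule iterated_integral_transform[OF k i \<psi> h])
    have "expectation (\<lambda>\<omega>. X \<omega> * exp (G h \<omega>)) = expectation (\<lambda>\<omega>. J \<omega> * exp (G h \<omega>) - Jp \<omega> * exp (G h \<omega>))"
      unfolding X_eq by (simp only: left_diff_distrib)
    also have "\<dots> = expectation (\<lambda>\<omega>. J \<omega> * exp (G h \<omega>)) - expectation (\<lambda>\<omega>. Jp \<omega> * exp (G h \<omega>))"
      by (rule Bochner_Integration.integral_diff[OF square_integrable_mult[OF J eG] square_integrable_mult[OF Jp_base(1) eG]])
    also have "\<dots> = exp (covariance t h h / 2) * ((\<integral>x. K x * Q x \<partial>cube t T k) - (\<integral>x. S x * Q x \<partial>cube t T k))"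
      unfolding 1 2 by (simp only: right_diff_distrib)
    also have "(\<integral>x. K x * Q x \<partial>cube t T k) - (\<integral>x. S x * Q x \<partial>cube t T k) = (\<integral>x. (K x - S x) * Q x \<partial>cube t T k)"
      unfolding left_diff_distrib
      by (rule Bochner_Integration.integral_diff[OF square_integrable_mult[OF K Q] square_integrable_mult[OF S Q], symmetric])
    finally show ?thesis unfolding Q_def .
  qed
  note bound = transform_bound[OF span square_integrable_diff[OF K S] i short transform]
  show "square_integrable M X" by (rule bound(1))
  have "expectation (\<lambda>\<omega>. (X \<omega>)\<^sup>2) \<le> fact k * (\<integral>x. (K x - S x)\<^sup>2 \<partial>cube t T k)" by (rule bound(2))
  then have "expectation (\<lambda>\<omega>. (X \<omega>)\<^sup>2) \<le> fact k * ((\<integral>x. (K x)\<^sup>2 \<partial>cube t T k) - (\<Sum>j\<in>I. (C j)\<^sup>2))"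
    unfolding residual .
  then show "expectation (\<lambda>\<omega>. (X \<omega>)\<^sup>2) \<le> fact k * ((\<integral>x. (simplex_kernel k \<psi> x)\<^sup>2 \<partial>cube t T k) -
        (\<Sum>j\<in>(\<Pi>\<^sub>E l\<in>{1..k}. {0..p l}). (fourier_coeff t T k \<psi> \<phi> j)\<^sup>2))"
    unfolding K_def C_def I_def .
qed

end

theorem theorem5:
  fixes M :: "'a measure" and F :: "real \<Rightarrow> 'a measure"
    and f :: "nat \<Rightarrow> real \<Rightarrow> 'a \<Rightarrow> real"
    and t T :: real and m k :: nat
    and \<psi> \<phi> :: "nat \<Rightarrow> real \<Rightarrow> real" and i p :: "nat \<Rightarrow> nat"
  assumes "prob_space M" and "complete_measure M"
    and "right_continuous_filtration M T F"
    and "wiener_process M F T m f"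
    and "0 \<le> t" and "t < T"
    and "k \<ge> 1"
    and "\<And>l. l \<in> {1..k} \<Longrightarrow> L2_on t T (\<psi> l)"
    and "complete_orthonormal_system t T \<phi>"
    and "(\<forall>l\<in>{1..k}. i l \<in> {1..m}) \<or>
         ((\<forall>l\<in>{1..k}. i l \<in> {0..m}) \<and> (\<Sum>l=1..k. (i l)\<^sup>2) > 0 \<and> T - t < 1)"
  defines "J \<equiv> iterated_integral M F f t T \<psi> i k T"
    and "Jp \<equiv> approximation_sum M F f t T k \<psi> \<phi> i p"
  shows "integrable M (\<lambda>\<omega>. (J \<omega> - Jp \<omega>)\<^sup>2) \<and>
    prob_space.expectation M (\<lambda>\<omega>. (J \<omega> - Jp \<omega>)\<^sup>2) \<le>
      fact k * ((LINT x|cube t T k. (simplex_kernel k \<psi> x)\<^sup>2) -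
        (\<Sum>j\<in>(\<Pi>\<^sub>E l\<in>{1..k}. {0..p l}). (fourier_coeff t T k \<psi> \<phi> j)\<^sup>2))"
proof -
  interpret wiener_setting M F f t T m
    by (intro wiener_setting.intro wiener_setting_axioms.intro assms)
  have i: "i l \<in> {0..m}" if "l \<in> {1..k}" for l using assms(10) that by auto
  have short: "(\<forall>l\<in>{1..k}. i l \<noteq> 0) \<or> T - t < 1" using assms(10) by auto
  have \<phi>: "L2_on t T (\<phi> a)" "(LINT x|lebesgue_on {t..T}. \<phi> a x * \<phi> b x) = (if a = b then 1 else 0)" for a b
    using assms(9) unfolding complete_orthonormal_system_def by blast+
  note estimate = mean_square_estimate[OF assms(7,8) \<phi> i short]
  show ?thesis
    unfolding J_def Jp_def by (intro conjI square_integrable_sq estimate)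
qed

end
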